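(* Let $G$ be a compact nilpotent (linear) $\ell$-adic Lie group of dimension $d$. Let $0<\alpha\le1$ and $f\in L^2(\mu_G)$. Then $f\in Lip_G(\alpha;2)$ if and only if $$\sum_{[\xi]\in\widehat G:\ \langle\xi\rangle_G>\ell^k}d_\xi\|\widehat f(\xi)\|_{HS}^2=\mathcal{O}(\ell^{-2k\alpha})\quad\text{as }k\to\infty.$$
   Context: **Setting.** $\ell>2$ is a fixed prime and $\mathbb{Z}_\ell$ is the ring of $\ell$-adic integers. $G$ is a compact $d$-dimensional $\ell$-adic Lie subgroup of $GL_m(\mathbb{Z}_\ell)$, nilpotent, regarded as the exponential image $G=\exp(\mathfrak g)$ of a nilpotent $\mathbb{Z}_\ell$-Lie algebra $\mathfrak g=\mathbb{Z}_\ell X_1+\dots+\mathbb{Z}_\ell X_d$ with $\mathbb{Z}_\ell$-basis $X_1,\dots,X_d$. Points $x=(x_1,\dots,x_d)\in\mathbb{Z}_\ell^d$ are identified with $\exp(x_1X_1+\dots+x_dX_d)\in G$, and $\|x\|_\ell=\max_j|x_j|_\ell$. Put $G_n=\exp(\ell^n\mathfrak g)$, $n\in\mathbb{N}_0$, a strictly decreasing sequence of compact open subgroups. $\mu_G$ is the normalized Haar measure. **Representations.** $\widehat G$ is the set of classes of continuous irreducible finite-dimensional unitary representations; $d_\xi$ is the dimension of $\xi$. For $n\ge1$, $\widehat G_n$ is the set of $[\xi]\in\widehat G$ that are trivial on $G_n$ but not on $G_{n-1}$. The Fourier coefficient is $\widehat f(\xi)=\int_Gf(x)\xi(x)^*\,d\mu_G(x)$;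 $\|\cdot\|_{HS}$ is the Hilbert–Schmidt norm. $\langle\xi\rangle_G$ denotes the eigenvalue, on the matrix entries of $\xi$, of the operator $\frac{1-\ell^{-d}}{1-\ell^{-(1+d)}}I+\mathscr{D}^1$, where $\mathscr{D}^1f(x)=\frac{1-\ell}{1-\ell^{-(1+d)}}\int_G\frac{f(xy^{-1})-f(x)}{\|y\|_\ell^{1+d}}\,d\mu_G(y)$; explicitly, $\langle\xi\rangle_G=\ell^n$ for $[\xi]\in\widehat G_n$, $n\ge1$, and $\langle\xi\rangle_G=\frac{1-\ell^{-d}}{1-\ell^{-(1+d)}}$ for the trivial representation. **Lipschitz space.** $Lip_G(\alpha;2)=\{f\in L^2(\mu_G):\|f(h\,\cdot)-f(\cdot)\|_{L^2(\mu_G)}=\mathcal{O}(\|h\|_\ell^\alpha)\text{ as }\|h\|_\ell\to0\}$. *)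

theory Defs
  imports
    "HOL-Analysis.Analysis"
    "HOL-Library.Landau_Symbols"
    "HOL-Algebra.Generated_Groups"
    "Jordan_Normal_Form.Schur_Decomposition"
    "Berlekamp_Zassenhaus.Finite_Field"
begin

hide_type (open) Matrix.vec
hide_const (open) Matrix.vec Matrix.mat Matrix.row Matrix.transpose_mat Determinant.det
  Coset.order Fraction_Field.Fract
no_notation Matrix.vec_index (infixl "$" 100)

section \<open>The field of \<open>\<ell>\<close>-adic numbers\<close>

subsection \<open>The \<open>p\<close>-adic absolute value on the rationals\<close>

definition rat_padic_abs :: "nat \<Rightarrow> rat \<Rightarrow> real" where
  "rat_padic_abs p q = (case quotient_of q of (a, b) \<Rightarrow>
     if a = 0 then 0
     else real p powi (int (multiplicity (int p) b) - int (multiplicity (int p) a)))"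

definition padic_vanishes :: "nat \<Rightarrow> (nat \<Rightarrow> rat) \<Rightarrow> bool" where
  "padic_vanishes p X \<longleftrightarrow> (\<forall>r>0. \<exists>k. \<forall>n\<ge>k. rat_padic_abs p (X n) < r)"

definition padic_cauchy :: "nat \<Rightarrow> (nat \<Rightarrow> rat) \<Rightarrow> bool" where
  "padic_cauchy p X \<longleftrightarrow> (\<forall>r>0. \<exists>k. \<forall>m\<ge>k. \<forall>n\<ge>k. rat_padic_abs p (X m - X n) < r)"

context
  fixes p :: nat
  assumes p: "Factorial_Ring.prime p"
begin

lemma rat_padic_abs_0 [simp]: "rat_padic_abs p 0 = 0"
  by (simp add: rat_padic_abs_def)

lemma rat_padic_abs_Fract:
  assumes "a \<noteq> 0" "b \<noteq> 0"
  shows "rat_padic_abs p (Fract a b) =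
    real p powi (int (multiplicity (int p) b) - int (multiplicity (int p) a))"
proof -
  obtain c e where q: "quotient_of (Fract a b) = (c, e)" by (cases "quotient_of (Fract a b)")
  have e: "e > 0" using quotient_of_denom_pos[OF q] .
  have F: "Fract a b = Fract c e"
    using quotient_of_div[OF q] by (simp add: Fract_of_int_quotient)
  then have ae: "a * e = c * b" using assms e by (simp add: eq_rat)
  then have c: "c \<noteq> 0" using assms e by auto
  have pp: "prime_elem (int p)" using p by simp
  have "multiplicity (int p) a + multiplicity (int p) e =
        multiplicity (int p) c + multiplicity (int p) b"
    using ae prime_elem_multiplicity_mult_distrib[OF pp, of a e]
      prime_elem_multiplicity_mult_distrib[OF pp, of c b] assms e c by simp
  then have "int (multiplicity (int p) b) - int (multiplicity (int p) a)
     = int (multiplicity (int p) e) - int (multiplicity (int p) c)" by linarith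
  then show ?thesis using q c by (simp add: rat_padic_abs_def)
qed

lemma rat_nonzero_cases:
  fixes q :: rat
  assumes "q \<noteq> 0"
  obtains a b where "q = Fract a b" "a \<noteq> 0" "b \<noteq> 0"
  using assms by (metis Rat_cases_nonzero less_irrefl)

lemma rat_padic_abs_nonneg: "rat_padic_abs p q \<ge> 0"
  by (auto simp: rat_padic_abs_def split: prod.splits)

lemma rat_padic_abs_pos: "q \<noteq> 0 \<Longrightarrow> rat_padic_abs p q > 0"
  using p by (elim rat_nonzero_cases) (simp add: rat_padic_abs_Fract prime_gt_0_nat)

lemma rat_padic_abs_eq_0 [simp]: "rat_padic_abs p q = 0 \<longleftrightarrow> q = 0"
  using rat_padic_abs_pos[of q] by (cases "q = 0") auto

lemma rat_padic_abs_mult: "rat_padic_abs p (q * r) = rat_padic_abs p q * rat_padic_abs p r"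
proof (cases "q = 0 \<or> r = 0")
  case False
  obtain a b where q: "q = Fract a b" "a \<noteq> 0" "b \<noteq> 0" using False rat_nonzero_cases by metis
  obtain c e where r: "r = Fract c e" "c \<noteq> 0" "e \<noteq> 0" using False rat_nonzero_cases by metis
  have pp: "prime_elem (int p)" using p by simp
  have p0: "real p \<noteq> 0" using p by auto
  show ?thesis
    using q r p0
    by (simp add: rat_padic_abs_Fract prime_elem_multiplicity_mult_distrib[OF pp]
        power_int_add[symmetric] algebra_simps)
qed auto

lemma rat_padic_abs_1 [simp]: "rat_padic_abs p 1 = 1"
  by (simp add: rat_padic_abs_def)

lemma rat_padic_abs_minus [simp]: "rat_padic_abs p (- q) = rat_padic_abs p q"
proof (cases "q = 0")
  case False
  then obtain a b where "q = Fract a b" "a \<noteq> 0" "b \<noteq> 0" using rat_nonzero_cases by metis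
  then show ?thesis by (simp add: rat_padic_abs_Fract multiplicity_def)
qed simp

lemma rat_padic_abs_minus_commute: "rat_padic_abs p (q - r) = rat_padic_abs p (r - q)"
  using rat_padic_abs_minus[of "q - r"] by simp

lemma rat_padic_abs_inverse: "rat_padic_abs p (inverse q) = inverse (rat_padic_abs p q)"
proof (cases "q = 0")
  case False
  then have "rat_padic_abs p q * rat_padic_abs p (inverse q) = 1"
    by (simp flip: rat_padic_abs_mult)
  then show ?thesis by (metis inverse_unique)
qed simp

lemma rat_padic_abs_add: "rat_padic_abs p (q + r) \<le> max (rat_padic_abs p q) (rat_padic_abs p r)"
proof (cases "q = 0 \<or> r = 0 \<or> q + r = 0")
  case True
  then show ?thesis using rat_padic_abs_nonneg[of q] rat_padic_abs_nonneg[of r] by auto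
next
  case False
  obtain a b where q: "q = Fract a b" "a \<noteq> 0" "b \<noteq> 0" using False rat_nonzero_cases by metis
  obtain c e where r: "r = Fract c e" "c \<noteq> 0" "e \<noteq> 0" using False rat_nonzero_cases by metis
  have s: "q + r = Fract (a * e + c * b) (b * e)" using q r by simp
  then have nz: "a * e + c * b \<noteq> 0" using False q r by (auto simp: rat_number_collapse)
  have pp: "prime_elem (int p)" using p by simp
  define M where "M = min (multiplicity (int p) (a * e)) (multiplicity (int p) (c * b))"
  have "int p ^ M dvd a * e" "int p ^ M dvd c * b"
    by (auto simp: M_def intro!: multiplicity_dvd')
  then have "int p ^ M dvd a * e + c * b" by simp
  then have M: "M \<le> multiplicity (int p) (a * e + c * b)"
    using nz p by (intro multiplicity_geI) auto
  have p1: "real p \<ge> 1" using prime_ge_1_nat[OF p] by simp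
  have me: "multiplicity (int p) (a * e) = multiplicity (int p) a + multiplicity (int p) e"
    "multiplicity (int p) (c * b) = multiplicity (int p) c + multiplicity (int p) b"
    "multiplicity (int p) (b * e) = multiplicity (int p) b + multiplicity (int p) e"
    using q r by (auto simp: prime_elem_multiplicity_mult_distrib[OF pp])
  have A: "rat_padic_abs p (q + r) =
     real p powi (int (multiplicity (int p) (b * e)) - int (multiplicity (int p) (a * e + c * b)))"
    unfolding s using nz q r by (subst rat_padic_abs_Fract) auto
  have B: "rat_padic_abs p q = real p powi (int (multiplicity (int p) b) - int (multiplicity (int p) a))"
    "rat_padic_abs p r = real p powi (int (multiplicity (int p) e) - int (multiplicity (int p) c))"
    using q r by (auto simp: rat_padic_abs_Fract)
  show ?thesis
  proof (cases "multiplicity (int p) (a * e) \<le> multiplicity (int p) (c * b)")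
    case True
    then have "rat_padic_abs p (q + r) \<le> rat_padic_abs p q"
      unfolding A B using M me by (intro power_int_increasing p1) (auto simp: M_def)
    then show ?thesis by simp
  next
    case False
    then have "rat_padic_abs p (q + r) \<le> rat_padic_abs p r"
      unfolding A B using M me by (intro power_int_increasing p1) (auto simp: M_def)
    then show ?thesis by simp
  qed
qed

lemma rat_padic_abs_add_less:
  "rat_padic_abs p q < s \<Longrightarrow> rat_padic_abs p r < s \<Longrightarrow> rat_padic_abs p (q + r) < s"
  using rat_padic_abs_add[of q r] by auto

lemma rat_padic_abs_diff_less:
  "rat_padic_abs p q < s \<Longrightarrow> rat_padic_abs p r < s \<Longrightarrow> rat_padic_abs p (q - r) < s"
  using rat_padic_abs_add_less[of q s "- r"] by auto

subsection \<open>Cauchy sequences of rationals\<close>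

lemma padic_cauchy_const [simp]: "padic_cauchy p (\<lambda>n. c)"
  by (simp add: padic_cauchy_def)

lemma padic_vanishes_const [simp]: "padic_vanishes p (\<lambda>n. c) \<longleftrightarrow> c = 0"
  using rat_padic_abs_pos[of c] by (auto simp: padic_vanishes_def)

lemma padic_vanishes_minus: "padic_vanishes p X \<Longrightarrow> padic_vanishes p (\<lambda>n. - X n)"
  by (simp add: padic_vanishes_def)

lemma padic_vanishes_minus_commute:
  "padic_vanishes p (\<lambda>n. X n - Y n) \<longleftrightarrow> padic_vanishes p (\<lambda>n. Y n - X n)"
  unfolding padic_vanishes_def by (simp add: rat_padic_abs_minus_commute)

lemma padic_vanishes_add:
  assumes "padic_vanishes p X" "padic_vanishes p Y"
  shows "padic_vanishes p (\<lambda>n. X n + Y n)"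
  unfolding padic_vanishes_def
proof (intro allI impI)
  fix r :: real assume "r > 0"
  then obtain i j where "\<forall>n\<ge>i. rat_padic_abs p (X n) < r" "\<forall>n\<ge>j. rat_padic_abs p (Y n) < r"
    using assms unfolding padic_vanishes_def by meson
  then have "\<forall>n\<ge>max i j. rat_padic_abs p (X n + Y n) < r"
    by (auto intro: rat_padic_abs_add_less)
  then show "\<exists>k. \<forall>n\<ge>k. rat_padic_abs p (X n + Y n) < r" ..
qed

lemma padic_cauchy_minus: "padic_cauchy p X \<Longrightarrow> padic_cauchy p (\<lambda>n. - X n)"
  unfolding padic_cauchy_def minus_diff_minus rat_padic_abs_minus .

lemma padic_cauchy_add:
  assumes "padic_cauchy p X" "padic_cauchy p Y"
  shows "padic_cauchy p (\<lambda>n. X n + Y n)"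
  unfolding padic_cauchy_def
proof (intro allI impI)
  fix r :: real assume "r > 0"
  then obtain i j where "\<forall>m\<ge>i. \<forall>n\<ge>i. rat_padic_abs p (X m - X n) < r"
    "\<forall>m\<ge>j. \<forall>n\<ge>j. rat_padic_abs p (Y m - Y n) < r"
    using assms unfolding padic_cauchy_def by meson
  then have "\<forall>m\<ge>max i j. \<forall>n\<ge>max i j. rat_padic_abs p ((X m + Y m) - (X n + Y n)) < r"
    unfolding add_diff_add by (auto intro: rat_padic_abs_add_less)
  then show "\<exists>k. \<forall>m\<ge>k. \<forall>n\<ge>k. rat_padic_abs p ((X m + Y m) - (X n + Y n)) < r" ..
qed

lemma padic_cauchy_bounded:
  assumes "padic_cauchy p X"
  obtains b where "b > 0" "\<And>n. rat_padic_abs p (X n) < b"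
proof -
  obtain k where k: "\<forall>m\<ge>k. \<forall>n\<ge>k. rat_padic_abs p (X m - X n) < 1"
    using assms[unfolded padic_cauchy_def, THEN spec, of 1] by auto
  define B where "B = Max ((\<lambda>n. rat_padic_abs p (X n)) ` {..k}) + 1"
  have le: "rat_padic_abs p (X n) < B" if "n \<le> k" for n
  proof -
    have "rat_padic_abs p (X n) \<le> Max ((\<lambda>n. rat_padic_abs p (X n)) ` {..k})"
      using that by (intro Max_ge) auto
    then show ?thesis by (simp add: B_def)
  qed
  have B1: "B \<ge> 1"
  proof -
    have "0 \<le> rat_padic_abs p (X 0)" by (rule rat_padic_abs_nonneg)
    also have "\<dots> \<le> Max ((\<lambda>n. rat_padic_abs p (X n)) ` {..k})" by (intro Max_ge) auto
    finally show ?thesis by (simp add: B_def)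
  qed
  have "rat_padic_abs p (X n) < B" for n
  proof (cases "n \<le> k")
    case False
    then have "rat_padic_abs p (X n - X k) < B" using k B1 by (smt (verit) nle_le)
    then have "rat_padic_abs p ((X n - X k) + X k) < B"
      using le[of k] by (intro rat_padic_abs_add_less) auto
    then show ?thesis by simp
  qed (use le in auto)
  then show ?thesis using that[of B] B1 by auto
qed

lemma padic_vanishes_mult_bounded:
  assumes "b > 0" "\<And>n. rat_padic_abs p (X n) < b" "padic_vanishes p Y"
  shows "padic_vanishes p (\<lambda>n. X n * Y n)"
  unfolding padic_vanishes_def
proof (intro allI impI)
  fix r :: real assume "r > 0"
  then obtain k where k: "\<forall>n\<ge>k. rat_padic_abs p (Y n) < r / b"
    using assms(1,3) unfolding padic_vanishes_def by (meson divide_pos_pos)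
  have "rat_padic_abs p (X n * Y n) < r" if "n \<ge> k" for n
  proof -
    have "rat_padic_abs p (X n) * rat_padic_abs p (Y n) < b * (r / b)"
      using that k assms by (intro mult_strict_mono' rat_padic_abs_nonneg) auto
    then show ?thesis using assms(1) by (simp add: rat_padic_abs_mult)
  qed
  then show "\<exists>k. \<forall>n\<ge>k. rat_padic_abs p (X n * Y n) < r" by blast
qed

lemma padic_cauchy_mult:
  assumes "padic_cauchy p X" "padic_cauchy p Y"
  shows "padic_cauchy p (\<lambda>n. X n * Y n)"
  unfolding padic_cauchy_def
proof (intro allI impI)
  fix r :: real assume r: "r > 0"
  obtain a where a: "a > 0" "\<And>n. rat_padic_abs p (X n) < a" using padic_cauchy_bounded assms by blast
  obtain b where b: "b > 0" "\<And>n. rat_padic_abs p (Y n) < b" using padic_cauchy_bounded assms by blast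
  obtain i where i: "\<forall>m\<ge>i. \<forall>n\<ge>i. rat_padic_abs p (X m - X n) < r / b"
    using assms r b unfolding padic_cauchy_def by (meson divide_pos_pos)
  obtain j where j: "\<forall>m\<ge>j. \<forall>n\<ge>j. rat_padic_abs p (Y m - Y n) < r / a"
    using assms r a unfolding padic_cauchy_def by (meson divide_pos_pos)
  have "rat_padic_abs p (X m * Y m - X n * Y n) < r" if "m \<ge> max i j" "n \<ge> max i j" for m n
  proof -
    have "rat_padic_abs p (X m) * rat_padic_abs p (Y m - Y n) < a * (r / a)"
      using that a j by (intro mult_strict_mono' rat_padic_abs_nonneg) auto
    then have 1: "rat_padic_abs p (X m * (Y m - Y n)) < r" using a by (simp add: rat_padic_abs_mult)
    have "rat_padic_abs p (X m - X n) * rat_padic_abs p (Y n) < (r / b) * b"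
      using that b i by (intro mult_strict_mono' rat_padic_abs_nonneg) auto
    then have 2: "rat_padic_abs p ((X m - X n) * Y n) < r" using b by (simp add: rat_padic_abs_mult)
    show ?thesis using rat_padic_abs_add_less[OF 1 2] by (simp add: algebra_simps)
  qed
  then show "\<exists>k. \<forall>m\<ge>k. \<forall>n\<ge>k. rat_padic_abs p (X m * Y m - X n * Y n) < r" by blast
qed

lemma padic_cauchy_not_vanishes:
  assumes "padic_cauchy p X" "\<not> padic_vanishes p X"
  obtains c k where "c > 0" "\<And>n. n \<ge> k \<Longrightarrow> rat_padic_abs p (X n) = c"
proof -
  obtain r where r: "r > 0" "\<And>k. \<exists>n\<ge>k. r \<le> rat_padic_abs p (X n)"
    using assms(2) unfolding padic_vanishes_def by (meson not_less)
  obtain k where k: "\<And>m n. m \<ge> k \<Longrightarrow> n \<ge> k \<Longrightarrow> rat_padic_abs p (X m - X n) < r"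
    using assms(1) r(1) unfolding padic_cauchy_def by meson
  obtain i where i: "i \<ge> k" "r \<le> rat_padic_abs p (X i)" using r(2) by blast
  have "rat_padic_abs p (X n) = rat_padic_abs p (X i)" if "n \<ge> k" for n
  proof -
    have s: "rat_padic_abs p (X n - X i) < r" "rat_padic_abs p (X i - X n) < r"
      using k that i by auto
    have 1: "rat_padic_abs p (X n) \<le> rat_padic_abs p (X i)"
      using rat_padic_abs_add[of "X n - X i" "X i"] s i by simp
    have 2: "rat_padic_abs p (X i) \<le> rat_padic_abs p (X n)"
      using rat_padic_abs_add[of "X i - X n" "X n"] s i by (auto simp: max_def split: if_splits)
    show ?thesis using 1 2 by simp
  qed
  then show ?thesis using that[of "rat_padic_abs p (X i)" k] r(1) i(2) by auto
qed

lemma padic_cauchy_inverse: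
  assumes "padic_cauchy p X" "\<not> padic_vanishes p X"
  shows "padic_cauchy p (\<lambda>n. inverse (X n))"
proof -
  obtain c k where c: "c > 0" "\<And>n. n \<ge> k \<Longrightarrow> rat_padic_abs p (X n) = c"
    using padic_cauchy_not_vanishes[OF assms] by blast
  show ?thesis unfolding padic_cauchy_def
  proof (intro allI impI)
    fix r :: real assume r: "r > 0"
    then have "r * c * c > 0" using c by simp
    then obtain j where j: "\<forall>m\<ge>j. \<forall>n\<ge>j. rat_padic_abs p (X m - X n) < r * c * c"
      using assms(1) unfolding padic_cauchy_def by meson
    have "rat_padic_abs p (inverse (X m) - inverse (X n)) < r"
      if "m \<ge> max j k" "n \<ge> max j k" for m n
    proof -
      have nz: "X m \<noteq> 0" "X n \<noteq> 0" using c(2)[of m] c(2)[of n] that c(1) by auto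
      have "rat_padic_abs p (inverse (X m) - inverse (X n)) =
          inverse c * rat_padic_abs p (X m - X n) * inverse c"
        using nz c(2)[of m] c(2)[of n] that
        by (simp add: inverse_diff_inverse rat_padic_abs_mult rat_padic_abs_inverse)
      moreover have "rat_padic_abs p (X m - X n) < r * c * c" using j that by simp
      ultimately have "rat_padic_abs p (inverse (X m) - inverse (X n)) <
          inverse c * (r * c * c) * inverse c"
        using c(1) by (simp only: mult_strict_right_mono mult_strict_left_mono positive_imp_inverse_positive)
      moreover have "inverse c * (r * c * c) * inverse c = r" using c(1) by (simp add: divide_simps)
      ultimately show ?thesis by simp
    qed
    then show "\<exists>k. \<forall>m\<ge>k. \<forall>n\<ge>k. rat_padic_abs p (inverse (X m) - inverse (X n)) < r" by blast
  qed
qed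

lemma padic_vanishes_diff_inverse:
  assumes "padic_cauchy p X" "\<not> padic_vanishes p X" "padic_cauchy p Y" "\<not> padic_vanishes p Y"
    and "padic_vanishes p (\<lambda>n. X n - Y n)"
  shows "padic_vanishes p (\<lambda>n. inverse (X n) - inverse (Y n))"
proof -
  obtain c k where c: "c > 0" "\<And>n. n \<ge> k \<Longrightarrow> rat_padic_abs p (X n) = c"
    using padic_cauchy_not_vanishes[OF assms(1,2)] by blast
  obtain c' k' where c': "c' > 0" "\<And>n. n \<ge> k' \<Longrightarrow> rat_padic_abs p (Y n) = c'"
    using padic_cauchy_not_vanishes[OF assms(3,4)] by blast
  show ?thesis unfolding padic_vanishes_def
  proof (intro allI impI)
    fix r :: real assume r: "r > 0"
    then have "r * c * c' > 0" using c c' by simp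
    then obtain j where j: "\<forall>n\<ge>j. rat_padic_abs p (X n - Y n) < r * c * c'"
      using assms(5) unfolding padic_vanishes_def by meson
    have "rat_padic_abs p (inverse (X n) - inverse (Y n)) < r"
      if "n \<ge> max j (max k k')" for n
    proof -
      have nz: "X n \<noteq> 0" "Y n \<noteq> 0" using c(2)[of n] c'(2)[of n] that c(1) c'(1) by auto
      have "rat_padic_abs p (inverse (X n) - inverse (Y n)) =
          inverse c * rat_padic_abs p (X n - Y n) * inverse c'"
        using nz c(2)[of n] c'(2)[of n] that
        by (simp add: inverse_diff_inverse rat_padic_abs_mult rat_padic_abs_inverse)
      moreover have "rat_padic_abs p (X n - Y n) < r * c * c'" using j that by simp
      ultimately have "rat_padic_abs p (inverse (X n) - inverse (Y n)) <
          inverse c * (r * c * c') * inverse c'"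
        using c(1) c'(1)
        by (simp only: mult_strict_right_mono mult_strict_left_mono positive_imp_inverse_positive)
      moreover have "inverse c * (r * c * c') * inverse c' = r"
        using c(1) c'(1) by (simp add: divide_simps)
      ultimately show ?thesis by simp
    qed
    then show "\<exists>k. \<forall>n\<ge>k. rat_padic_abs p (inverse (X n) - inverse (Y n)) < r" by blast
  qed
qed

lemma padic_vanishes_iff_tendsto: "padic_vanishes p X \<longleftrightarrow> (\<lambda>n. rat_padic_abs p (X n)) \<longlonglongrightarrow> 0"
  using rat_padic_abs_nonneg unfolding padic_vanishes_def LIMSEQ_def by auto

lemma padic_cauchy_abs_convergent:
  assumes "padic_cauchy p X"
  shows "convergent (\<lambda>n. rat_padic_abs p (X n))"
proof (cases "padic_vanishes p X")
  case True
  then show ?thesis by (auto simp: padic_vanishes_iff_tendsto convergent_def)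
next
  case False
  then obtain c k where "\<And>n. n \<ge> k \<Longrightarrow> rat_padic_abs p (X n) = c"
    using padic_cauchy_not_vanishes[OF assms] by metis
  then have "(\<lambda>n. rat_padic_abs p (X n)) \<longlonglongrightarrow> c"
    by (intro tendsto_eventually) (auto simp: eventually_sequentially)
  then show ?thesis by (auto simp: convergent_def)
qed

lemma padic_abs_lim_cong:
  assumes "padic_cauchy p X" "padic_cauchy p Y" "padic_vanishes p (\<lambda>n. X n - Y n)"
  shows "lim (\<lambda>n. rat_padic_abs p (X n)) = lim (\<lambda>n. rat_padic_abs p (Y n))"
proof -
  have le: "rat_padic_abs p a \<le> rat_padic_abs p b + rat_padic_abs p (a - b)" for a b
    using rat_padic_abs_add[of "a - b" b] rat_padic_abs_nonneg[of "a - b"]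
      rat_padic_abs_nonneg[of b] by simp
  have bd: "norm (rat_padic_abs p (X n) - rat_padic_abs p (Y n)) \<le> rat_padic_abs p (X n - Y n)" for n
    using le[of "X n" "Y n"] le[of "Y n" "X n"] rat_padic_abs_minus_commute[of "X n" "Y n"] by simp
  have "(\<lambda>n. rat_padic_abs p (X n) - rat_padic_abs p (Y n)) \<longlonglongrightarrow> 0"
    using assms(3) unfolding padic_vanishes_iff_tendsto
    by (rule Lim_null_comparison[OF always_eventually, rule_format, OF bd])
  moreover have "(\<lambda>n. rat_padic_abs p (X n) - rat_padic_abs p (Y n)) \<longlonglongrightarrow>
      lim (\<lambda>n. rat_padic_abs p (X n)) - lim (\<lambda>n. rat_padic_abs p (Y n))"
    by (intro tendsto_diff convergent_LIMSEQ_iff[THEN iffD1] padic_cauchy_abs_convergent assms)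
  ultimately have "lim (\<lambda>n. rat_padic_abs p (X n)) - lim (\<lambda>n. rat_padic_abs p (Y n)) = 0"
    by (rule LIMSEQ_unique[symmetric])
  then show ?thesis by simp
qed

end

subsection \<open>The completion\<close>

text \<open>The prime \<open>\<ell>\<close> is the cardinality of the index type \<open>'l\<close>.\<close>

typedef (overloaded) 'l padic_seq = "{X. padic_cauchy CARD('l::prime_card) X}"
  morphisms padic_nth Abs_padic_seq
  using padic_cauchy_const[OF prime_card] by blast

setup_lifting type_definition_padic_seq

lemma padic_nth_cauchy [simp]: "padic_cauchy CARD('l) (padic_nth (S :: 'l::prime_card padic_seq))"
  using padic_nth by blast

lift_definition padic_seq_const :: "rat \<Rightarrow> 'l::prime_card padic_seq" is "\<lambda>c n. c"
  by (rule padic_cauchy_const[OF prime_card])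

lift_definition padic_seq_add :: "'l::prime_card padic_seq \<Rightarrow> 'l padic_seq \<Rightarrow> 'l padic_seq"
  is "\<lambda>X Y n. X n + Y n" by (rule padic_cauchy_add[OF prime_card])

lift_definition padic_seq_minus :: "'l::prime_card padic_seq \<Rightarrow> 'l padic_seq"
  is "\<lambda>X n. - X n" by (rule padic_cauchy_minus[OF prime_card])

lift_definition padic_seq_mult :: "'l::prime_card padic_seq \<Rightarrow> 'l padic_seq \<Rightarrow> 'l padic_seq"
  is "\<lambda>X Y n. X n * Y n" by (rule padic_cauchy_mult[OF prime_card])

lift_definition padic_seq_inverse :: "'l::prime_card padic_seq \<Rightarrow> 'l padic_seq"
  is "\<lambda>X. if padic_vanishes CARD('l) X then (\<lambda>n. 0) else (\<lambda>n. inverse (X n))"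
  using padic_cauchy_const[OF prime_card] padic_cauchy_inverse[OF prime_card] by auto

lemmas padic_seq_nths = padic_seq_const.rep_eq padic_seq_add.rep_eq padic_seq_minus.rep_eq
  padic_seq_mult.rep_eq padic_seq_inverse.rep_eq

definition padic_rel :: "'l::prime_card padic_seq \<Rightarrow> 'l padic_seq \<Rightarrow> bool" where
  "padic_rel S T \<longleftrightarrow> padic_vanishes CARD('l) (\<lambda>n. padic_nth S n - padic_nth T n)"

lemma equivp_padic_rel: "equivp (padic_rel :: 'l::prime_card padic_seq \<Rightarrow> _)"
proof (rule equivpI)
  note p = prime_card[where 'a = 'l]
  show "reflp (padic_rel :: 'l padic_seq \<Rightarrow> _)"
    using p by (auto intro!: reflpI simp: padic_rel_def)
  show "symp (padic_rel :: 'l padic_seq \<Rightarrow> _)"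
    unfolding padic_rel_def by (intro sympI) (subst padic_vanishes_minus_commute[OF p])
  show "transp (padic_rel :: 'l padic_seq \<Rightarrow> _)"
  proof (rule transpI)
    fix S T U :: "'l padic_seq"
    assume "padic_rel S T" "padic_rel T U"
    then show "padic_rel S U"
      unfolding padic_rel_def by (drule_tac padic_vanishes_add[OF p]) auto
  qed
qed

quotient_type 'l padic = "'l::prime_card padic_seq" / padic_rel
  by (rule equivp_padic_rel)

instantiation padic :: (prime_card) field
begin

lift_definition zero_padic :: "'a padic" is "padic_seq_const 0" .

lift_definition one_padic :: "'a padic" is "padic_seq_const 1" .

lift_definition plus_padic :: "'a padic \<Rightarrow> 'a padic \<Rightarrow> 'a padic" is padic_seq_add
  unfolding padic_rel_def padic_seq_nths add_diff_add
  by (rule padic_vanishes_add[OF prime_card])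

lift_definition uminus_padic :: "'a padic \<Rightarrow> 'a padic" is padic_seq_minus
  unfolding padic_rel_def padic_seq_nths minus_diff_minus
  by (rule padic_vanishes_minus[OF prime_card])

lift_definition times_padic :: "'a padic \<Rightarrow> 'a padic \<Rightarrow> 'a padic" is padic_seq_mult
proof -
  note p = prime_card[where 'a = 'a]
  fix X X' Y Y' :: "'a padic_seq"
  assume X: "padic_rel X X'" and Y: "padic_rel Y Y'"
  obtain a where a: "a > 0" "\<And>n. rat_padic_abs CARD('a) (padic_nth X n) < a"
    using padic_cauchy_bounded[OF p padic_nth_cauchy] by blast
  obtain b where b: "b > 0" "\<And>n. rat_padic_abs CARD('a) (padic_nth Y' n) < b"
    using padic_cauchy_bounded[OF p padic_nth_cauchy] by blast
  have 1: "padic_vanishes CARD('a) (\<lambda>n. padic_nth X n * (padic_nth Y n - padic_nth Y' n))"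
    using padic_vanishes_mult_bounded[OF p a] Y by (auto simp: padic_rel_def)
  have 2: "padic_vanishes CARD('a) (\<lambda>n. padic_nth Y' n * (padic_nth X n - padic_nth X' n))"
    using padic_vanishes_mult_bounded[OF p b] X by (auto simp: padic_rel_def)
  show "padic_rel (padic_seq_mult X Y) (padic_seq_mult X' Y')"
    using padic_vanishes_add[OF p 1 2] by (simp add: padic_rel_def padic_seq_nths algebra_simps)
qed

lift_definition inverse_padic :: "'a padic \<Rightarrow> 'a padic" is padic_seq_inverse
proof -
  note p = prime_card[where 'a = 'a]
  fix X Y :: "'a padic_seq"
  assume XY: "padic_rel X Y"
  then have YX: "padic_rel Y X" using equivp_padic_rel by (meson equivp_symp)
  have "padic_vanishes CARD('a) (padic_nth X) \<longleftrightarrow> padic_vanishes CARD('a) (padic_nth Y)"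
    using padic_vanishes_add[OF p XY[unfolded padic_rel_def], of "padic_nth Y"]
      padic_vanishes_add[OF p YX[unfolded padic_rel_def], of "padic_nth X"] by auto
  then show "padic_rel (padic_seq_inverse X) (padic_seq_inverse Y)"
    using padic_vanishes_diff_inverse[OF p _ _ _ _ XY[unfolded padic_rel_def]] p
    by (auto simp: padic_rel_def padic_seq_nths)
qed

definition "x - y = x + - (y :: 'a padic)"

definition "x div y = x * inverse (y :: 'a padic)"

instance
proof
  note p = prime_card[where 'a = 'a]
  fix a b c :: "'a padic"
  note [simp] = padic_rel_def padic_seq_nths algebra_simps
  show "a + b + c = a + (b + c)" using p by transfer simp
  show "a + b = b + a" using p by transfer simp
  show "a * b * c = a * (b * c)" using p by transfer simp
  show "a * b = b * a" using p by transfer simp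
  show "(a + b) * c = a * c + b * c" using p by transfer simp
  show "0 + a = a" using p by transfer simp
  show "1 * a = a" using p by transfer simp
  show "- a + a = 0" using p by transfer simp
  show "a - b = a + - b" by (simp add: minus_padic_def)
  show "(0 :: 'a padic) \<noteq> 1" using p by transfer simp
  show "a div b = a * inverse b" by (simp add: divide_padic_def)
  show "inverse (0 :: 'a padic) = 0" using p by transfer simp
  show "inverse a * a = 1" if "a \<noteq> 0" using that
  proof transfer
    fix X :: "'a padic_seq"
    assume nz: "\<not> padic_rel X (padic_seq_const 0)"
    then have nv: "\<not> padic_vanishes CARD('a) (padic_nth X)" by simp
    then obtain c k where c: "c > 0" "\<And>n. n \<ge> k \<Longrightarrow> rat_padic_abs CARD('a) (padic_nth X n) = c"
      using padic_cauchy_not_vanishes[OF p padic_nth_cauchy] by metis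
    have "padic_nth X n \<noteq> 0" if "n \<ge> k" for n
      using c(2)[OF that] c(1) p by auto
    then have "inverse (padic_nth X n) * padic_nth X n - 1 = 0" if "n \<ge> k" for n
      using that by (simp del: algebra_simps)
    then have "padic_vanishes CARD('a) (\<lambda>n. inverse (padic_nth X n) * padic_nth X n - 1)"
      using p unfolding padic_vanishes_def by (metis rat_padic_abs_0)
    then show "padic_rel (padic_seq_mult (padic_seq_inverse X) X) (padic_seq_const 1)"
      using nv by simp
  qed
qed

end

text \<open>
  The type class \<open>norm\<close> is of no use here: the library constrains \<open>norm\<close> to real vector spaces.
\<close>

lift_definition padic_abs :: "'l::prime_card padic \<Rightarrow> real"
  is "\<lambda>X. lim (\<lambda>n. rat_padic_abs CARD('l) (padic_nth X n))"
  unfolding padic_rel_def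
  by (intro padic_abs_lim_cong[OF prime_card] padic_nth_cauchy)

lemma padic_nth_abs_tendsto:
  fixes X :: "'l::prime_card padic_seq"
  shows "(\<lambda>n. rat_padic_abs CARD('l) (padic_nth X n)) \<longlonglongrightarrow> padic_abs (abs_padic X)"
  using padic_cauchy_abs_convergent[OF prime_card padic_nth_cauchy[of X]]
  by (simp add: convergent_LIMSEQ_iff padic_abs.abs_eq)

lemma padic_abs_nonneg [simp]: "padic_abs (x :: 'l::prime_card padic) \<ge> 0"
proof (induction x)
  case (1 X)
  show ?case
    using rat_padic_abs_nonneg[OF prime_card[where 'a = 'l]]
    by (intro LIMSEQ_le_const[OF padic_nth_abs_tendsto]) auto
qed

lemma padic_abs_eq_0 [simp]: "padic_abs (x :: 'l::prime_card padic) = 0 \<longleftrightarrow> x = 0"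
proof (induction x)
  case (1 X)
  note p = prime_card[where 'a = 'l]
  have "padic_abs (abs_padic X) = 0 \<longleftrightarrow> padic_vanishes CARD('l) (padic_nth X)"
    using padic_nth_abs_tendsto[of X] LIMSEQ_unique
    unfolding padic_vanishes_iff_tendsto[OF p] by fastforce
  also have "\<dots> \<longleftrightarrow> abs_padic X = 0"
    by (simp add: zero_padic_def padic.abs_eq_iff padic_rel_def padic_seq_nths)
  finally show ?case .
qed

lemma padic_abs_minus [simp]: "padic_abs (- x :: 'l::prime_card padic) = padic_abs x"
  using prime_card[where 'a = 'l] by transfer (simp add: padic_seq_nths)

lemma padic_abs_1 [simp]: "padic_abs (1 :: 'l::prime_card padic) = 1"
  using prime_card[where 'a = 'l] by transfer (simp add: padic_seq_nths)

lemma padic_abs_mult: "padic_abs (x * y :: 'l::prime_card padic) = padic_abs x * padic_abs y"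
proof (induction x, induction y)
  case (1 Y X)
  have "(\<lambda>n. rat_padic_abs CARD('l) (padic_nth (padic_seq_mult X Y) n)) \<longlonglongrightarrow>
      padic_abs (abs_padic X) * padic_abs (abs_padic Y)"
    unfolding padic_seq_nths rat_padic_abs_mult[OF prime_card]
    by (intro tendsto_mult padic_nth_abs_tendsto)
  then show ?case
    using LIMSEQ_unique[OF padic_nth_abs_tendsto] by (simp add: times_padic.abs_eq)
qed

lemma padic_abs_of_rat:
  "padic_abs (abs_padic (padic_seq_const q) :: 'l::prime_card padic) = rat_padic_abs CARD('l) q"
  by (simp add: padic_abs.abs_eq padic_seq_nths)

lemma padic_abs_add: "padic_abs (x + y :: 'l::prime_card padic) \<le> max (padic_abs x) (padic_abs y)"
proof (induction x, induction y)
  case (1 Y X)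
  have "padic_abs (abs_padic (padic_seq_add X Y)) \<le> max (padic_abs (abs_padic X)) (padic_abs (abs_padic Y))"
    by (rule LIMSEQ_le[OF padic_nth_abs_tendsto
          tendsto_max[OF padic_nth_abs_tendsto padic_nth_abs_tendsto]])
       (auto simp: padic_seq_nths intro!: rat_padic_abs_add[OF prime_card])
  then show ?case by (simp add: plus_padic.abs_eq)
qed

lemma padic_of_nat: "(of_nat n :: 'l::prime_card padic) = abs_padic (padic_seq_const (of_nat n))"
proof (induction n)
  case (Suc n)
  have "padic_seq_add (padic_seq_const 1) (padic_seq_const (of_nat n) :: 'l padic_seq) =
      padic_seq_const (of_nat (Suc n))"
    by (simp add: padic_nth_inject[symmetric] padic_seq_nths)
  then show ?case by (simp add: Suc one_padic_def plus_padic.abs_eq)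
qed (simp add: zero_padic_def)

instance padic :: (prime_card) field_char_0
proof
  have "n = 0" if "(of_nat n :: 'a padic) = 0" for n
    using that padic_abs_of_rat[where 'l = 'a, of "of_nat n"] padic_abs_eq_0[of "0 :: 'a padic"]
      rat_padic_abs_pos[OF prime_card[where 'a = 'a], of "of_nat n"]
    by (cases "n = 0") (auto simp: padic_of_nat[symmetric])
  then have "of_nat m \<noteq> (of_nat n :: 'a padic)" if "m < n" for m n
    using that by (metis add_left_cancel add.right_neutral le_add_diff_inverse
        less_imp_le_nat of_nat_add zero_less_diff less_irrefl)
  then show "inj (of_nat :: nat \<Rightarrow> 'a padic)"
    by (intro injI) (metis linorder_neqE_nat)
qed

instantiation padic :: (prime_card) metric_space
begin

definition dist_padic :: "'a padic \<Rightarrow> 'a padic \<Rightarrow> real" where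
  "dist_padic x y = padic_abs (x - y)"

definition uniformity_padic :: "('a padic \<times> 'a padic) filter" where
  "uniformity_padic = (INF e\<in>{0<..}. principal {(x, y). dist x y < e})"

definition open_padic :: "'a padic set \<Rightarrow> bool" where
  "open_padic U \<longleftrightarrow> (\<forall>x\<in>U. eventually (\<lambda>(x', y). x' = x \<longrightarrow> y \<in> U) uniformity)"

instance
proof
  fix x y z :: "'a padic"
  show "dist x y = 0 \<longleftrightarrow> x = y" by (simp add: dist_padic_def)
  have "padic_abs (x - y) \<le> max (padic_abs (x - z)) (padic_abs (z - y))"
    using padic_abs_add[of "x - z" "z - y"] by simp
  moreover have "padic_abs (z - y) = padic_abs (y - z)"
    using padic_abs_minus[of "y - z"] by simp
  ultimately show "dist x y \<le> dist x z + dist y z"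
    using padic_abs_nonneg[of "x - z"] padic_abs_nonneg[of "y - z"]
    unfolding dist_padic_def by linarith
qed (simp_all add: uniformity_padic_def open_padic_def)

end

definition padic_ints :: "'l::prime_card padic set" where
  "padic_ints = {x. padic_abs x \<le> 1}"

section \<open>Nilpotent \<open>\<ell>\<close>-adic Lie groups in exponential coordinates\<close>

subsection \<open>Matrices\<close>

abbreviation mat_scale :: "'a::times \<Rightarrow> 'a ^'n ^'m \<Rightarrow> 'a ^'n ^'m" (infixr "*m" 75) where
  "c *m A \<equiv> map_matrix ((*) c) A"

definition GL_padic_ints :: "('l::prime_card padic ^'m ^'m) monoid" where
  "GL_padic_ints = \<lparr>
     carrier = {A. (\<forall>i j. A $ i $ j \<in> padic_ints) \<and>
       (\<exists>B. (\<forall>i j. B $ i $ j \<in> padic_ints) \<and> A ** B = mat 1 \<and> B ** A = mat 1)},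
     mult = (**), one = mat 1\<rparr>"

text \<open>The class-level power operation is not matrix power, since \<open>(*)\<close> on vectors is pointwise.\<close>

definition mat_pow :: "'a::semiring_1 ^'m ^'m \<Rightarrow> nat \<Rightarrow> 'a ^'m ^'m" where
  "mat_pow A k = (((**) A) ^^ k) (mat 1)"

definition mat_exp_term :: "'l::prime_card padic ^'m ^'m \<Rightarrow> nat \<Rightarrow> 'l padic ^'m ^'m" where
  "mat_exp_term A k = (1 / fact k) *m mat_pow A k"

definition mat_exp :: "'l::prime_card padic ^'m ^'m \<Rightarrow> 'l padic ^'m ^'m" where
  "mat_exp A = (\<Sum>k. mat_exp_term A k)"

definition lie_bracket :: "'a::ring_1 ^'m ^'m \<Rightarrow> 'a ^'m ^'m \<Rightarrow> 'a ^'m ^'m" where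
  "lie_bracket A B = A ** B - B ** A"

subsection \<open>\<open>\<int>\<^sub>\<ell>\<close>-Lie algebras of matrices\<close>

definition padic_ints_submodule :: "('l::prime_card padic ^'m ^'m) set \<Rightarrow> bool" where
  "padic_ints_submodule M \<longleftrightarrow> 0 \<in> M \<and> (\<forall>A\<in>M. \<forall>B\<in>M. A + B \<in> M) \<and>
     (\<forall>c\<in>padic_ints. \<forall>A\<in>M. c *m A \<in> M)"

definition padic_int_vecs :: "('l::prime_card padic ^'d) set" where
  "padic_int_vecs = {x. \<forall>j. x $ j \<in> padic_ints}"

definition lie_comb :: "('d::finite \<Rightarrow> 'l::prime_card padic ^'m ^'m) \<Rightarrow> 'l padic ^'d \<Rightarrow> 'l padic ^'m ^'m" where
  "lie_comb X x = (\<Sum>j\<in>UNIV. x $ j *m X j)"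

definition lie_lattice :: "('d::finite \<Rightarrow> 'l::prime_card padic ^'m ^'m) \<Rightarrow> ('l padic ^'m ^'m) set" where
  "lie_lattice X = lie_comb X ` padic_int_vecs"

primrec lie_lower_central :: "('l::prime_card padic ^'m ^'m) set \<Rightarrow> nat \<Rightarrow> ('l padic ^'m ^'m) set" where
  "lie_lower_central L 0 = L"
| "lie_lower_central L (Suc n) =
     padic_ints_submodule hull {lie_bracket A B | A B. A \<in> L \<and> B \<in> lie_lower_central L n}"

definition lie_nilpotent :: "('l::prime_card padic ^'m ^'m) set \<Rightarrow> bool" where
  "lie_nilpotent L \<longleftrightarrow> (\<exists>n. lie_lower_central L n = {0})"

subsection \<open>Nilpotent groups\<close>

primrec group_lower_central :: "('a, 'b) monoid_scheme \<Rightarrow> nat \<Rightarrow> 'a set" where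
  "group_lower_central H 0 = carrier H"
| "group_lower_central H (Suc n) = generate H
     {x \<otimes>\<^bsub>H\<^esub> y \<otimes>\<^bsub>H\<^esub> inv\<^bsub>H\<^esub> x \<otimes>\<^bsub>H\<^esub> inv\<^bsub>H\<^esub> y | x y. x \<in> carrier H \<and> y \<in> group_lower_central H n}"

definition group_nilpotent :: "('a, 'b) monoid_scheme \<Rightarrow> bool" where
  "group_nilpotent H \<longleftrightarrow> (\<exists>n. group_lower_central H n = {\<one>\<^bsub>H\<^esub>})"

subsection \<open>The groups under consideration\<close>

definition exp_coord :: "('d::finite \<Rightarrow> 'l::prime_card padic ^'m ^'m) \<Rightarrow> 'l padic ^'d \<Rightarrow> 'l padic ^'m ^'m" where
  "exp_coord X x = mat_exp (lie_comb X x)"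

text \<open>
  \<open>G = exp(\<int>\<^sub>\<ell> X\<^sub>1 + \<dots> + \<int>\<^sub>\<ell> X\<^sub>d)\<close>. The basis matrices may have entries in \<open>\<rat>\<^sub>\<ell>\<close>,
  as only the exponentials have to be integral.
\<close>

locale compact_nilpotent_padic_Lie_group =
  fixes X :: "'d::finite \<Rightarrow> 'l::prime_card padic ^'m::finite ^'m"
    and G :: "('l padic ^'m ^'m) set"
  assumes odd_prime: "CARD('l) > 2"
    and lie_basis: "inj_on (lie_comb X) padic_int_vecs"
    and lie_closed: "\<And>A B. A \<in> lie_lattice X \<Longrightarrow> B \<in> lie_lattice X \<Longrightarrow> lie_bracket A B \<in> lie_lattice X"
    and lie_nilpotent: "lie_nilpotent (lie_lattice X)"
    and exp_converges: "\<And>A. A \<in> lie_lattice X \<Longrightarrow> summable (mat_exp_term A)"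
    and exp_bij: "bij_betw (exp_coord X) padic_int_vecs G"
    and subgroup: "subgroup G GL_padic_ints"
    and nilpotent: "group_nilpotent (GL_padic_ints\<lparr>carrier := G\<rparr>)"
    and compact: "compact G"

text \<open>\<open>\<parallel>h\<parallel>\<^sub>\<ell> = max\<^sub>j |x\<^sub>j|\<^sub>\<ell>\<close> for \<open>h = exp(x\<^sub>1 X\<^sub>1 + \<dots> + x\<^sub>d X\<^sub>d)\<close>.\<close>

definition group_norm :: "('d::finite \<Rightarrow> 'l::prime_card padic ^'m ^'m) \<Rightarrow> 'l padic ^'m ^'m \<Rightarrow> real" where
  "group_norm X h = (MAX j. padic_abs (inv_into padic_int_vecs (exp_coord X) h $ j))"

definition normalized_Haar_measure :: "('l::prime_card padic ^'m ^'m) set \<Rightarrow> ('l padic ^'m ^'m) measure \<Rightarrow> bool" where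
  "normalized_Haar_measure G \<mu> \<longleftrightarrow>
     sets \<mu> = sets (restrict_space borel G) \<and> emeasure \<mu> G = 1 \<and>
     (\<forall>h\<in>G. \<forall>A\<in>sets \<mu>. emeasure \<mu> ((\<lambda>x. h ** x) ` A) = emeasure \<mu> A)"

section \<open>The unitary dual\<close>

definition unitary_mat :: "nat \<Rightarrow> complex Matrix.mat \<Rightarrow> bool" where
  "unitary_mat n U \<longleftrightarrow> U \<in> carrier_mat n n \<and> U * mat_adjoint U = 1\<^sub>m n"

definition rep_dim :: "('a::zero_neq_one ^'m ^'m \<Rightarrow> complex Matrix.mat) \<Rightarrow> nat" where
  "rep_dim \<xi> = dim_row (\<xi> (mat 1))"

definition unitary_rep :: "('l::prime_card padic ^'m ^'m) set \<Rightarrow>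
    ('l padic ^'m ^'m \<Rightarrow> complex Matrix.mat) \<Rightarrow> bool" where
  "unitary_rep G \<xi> \<longleftrightarrow>
     (\<forall>x\<in>G. unitary_mat (rep_dim \<xi>) (\<xi> x)) \<and>
     (\<forall>x\<in>G. \<forall>y\<in>G. \<xi> (x ** y) = \<xi> x * \<xi> y) \<and>
     (\<forall>i<rep_dim \<xi>. \<forall>j<rep_dim \<xi>. continuous_on G (\<lambda>x. \<xi> x $$ (i, j)))"

definition irreducible_rep :: "('l::prime_card padic ^'m ^'m) set \<Rightarrow>
    ('l padic ^'m ^'m \<Rightarrow> complex Matrix.mat) \<Rightarrow> bool" where
  "irreducible_rep G \<xi> \<longleftrightarrow> rep_dim \<xi> > 0 \<and>
     (\<forall>W. subspace class_ring W (module_vec TYPE(complex) (rep_dim \<xi>)) \<and>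
          (\<forall>x\<in>G. \<forall>w\<in>W. \<xi> x *\<^sub>v w \<in> W) \<longrightarrow>
        W = {0\<^sub>v (rep_dim \<xi>)} \<or> W = carrier_vec (rep_dim \<xi>))"

definition irreps :: "('l::prime_card padic ^'m ^'m) set \<Rightarrow>
    ('l padic ^'m ^'m \<Rightarrow> complex Matrix.mat) set" where
  "irreps G = {\<xi>. unitary_rep G \<xi> \<and> irreducible_rep G \<xi>}"

text \<open>Representations are total functions; their values outside \<open>G\<close> are irrelevant for the equivalence.\<close>

definition rep_equiv :: "('l::prime_card padic ^'m ^'m) set \<Rightarrow>
    (('l padic ^'m ^'m \<Rightarrow> complex Matrix.mat) \<times> ('l padic ^'m ^'m \<Rightarrow> complex Matrix.mat)) set" where
  "rep_equiv G = {(\<xi>, \<eta>). \<xi> \<in> irreps G \<and> \<eta> \<in> irreps G \<and> rep_dim \<eta> = rep_dim \<xi> \<and>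
     (\<exists>T. unitary_mat (rep_dim \<xi>) T \<and> (\<forall>x\<in>G. T * \<xi> x = \<eta> x * T))}"

definition unitary_dual :: "('l::prime_card padic ^'m ^'m) set \<Rightarrow>
    ('l padic ^'m ^'m \<Rightarrow> complex Matrix.mat) set set" where
  "unitary_dual G = irreps G // rep_equiv G"

definition class_rep :: "'a set \<Rightarrow> 'a" where
  "class_rep c = (SOME \<xi>. \<xi> \<in> c)"

section \<open>Fourier coefficients, the operator \<open>\<D>\<^sup>1\<close> and Lipschitz spaces\<close>

definition square_integrable :: "'a measure \<Rightarrow> ('a \<Rightarrow> complex) \<Rightarrow> bool" where
  "square_integrable \<mu> f \<longleftrightarrow> f \<in> borel_measurable \<mu> \<and> integrable \<mu> (\<lambda>x. (cmod (f x))\<^sup>2)"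

definition L2_norm :: "'a measure \<Rightarrow> ('a \<Rightarrow> complex) \<Rightarrow> real" where
  "L2_norm \<mu> f = sqrt (\<integral>x. (cmod (f x))\<^sup>2 \<partial>\<mu>)"

definition fourier_coeff :: "('l::prime_card padic ^'m ^'m) measure \<Rightarrow>
    ('l padic ^'m ^'m \<Rightarrow> complex) \<Rightarrow> ('l padic ^'m ^'m \<Rightarrow> complex Matrix.mat) \<Rightarrow> complex Matrix.mat" where
  "fourier_coeff \<mu> f \<xi> = Matrix.mat (rep_dim \<xi>) (rep_dim \<xi>)
     (\<lambda>(i, j). \<integral>x. f x * mat_adjoint (\<xi> x) $$ (i, j) \<partial>\<mu>)"

definition HS_norm :: "complex Matrix.mat \<Rightarrow> real" where
  "HS_norm A = sqrt (\<Sum>i<dim_row A. \<Sum>j<dim_col A. (cmod (A $$ (i, j)))\<^sup>2)"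

definition D1_op :: "('d::finite \<Rightarrow> 'l::prime_card padic ^'m ^'m) \<Rightarrow> ('l padic ^'m ^'m) measure \<Rightarrow>
    ('l padic ^'m ^'m \<Rightarrow> complex) \<Rightarrow> 'l padic ^'m ^'m \<Rightarrow> complex" where
  "D1_op X \<mu> u x =
     complex_of_real ((1 - real CARD('l)) / (1 - 1 / real CARD('l) ^ (1 + CARD('d)))) *
     (\<integral>y. (u (x ** matrix_inv y) - u x) / complex_of_real (group_norm X y ^ (1 + CARD('d))) \<partial>\<mu>)"

text \<open>
  The eigenvalue of \<open>(1 - \<ell>\<^sup>-\<^sup>d) / (1 - \<ell>\<^sup>-\<^sup>(\<^sup>1\<^sup>+\<^sup>d\<^sup>)) I + \<D>\<^sup>1\<close> on the matrix entries of \<open>\<xi>\<close>. It equals \<open>\<ell>\<^sup>n\<close> if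
  \<open>\<xi>\<close> is trivial on \<open>G\<^sub>n = exp(\<ell>\<^sup>n \<gg>)\<close> but not on \<open>G\<^bsub>n-1\<^esub>\<close>, where \<open>n \<ge> 1\<close>.
\<close>

definition rep_eigenvalue :: "('d::finite \<Rightarrow> 'l::prime_card padic ^'m ^'m) \<Rightarrow> ('l padic ^'m ^'m) set \<Rightarrow>
    ('l padic ^'m ^'m) measure \<Rightarrow> ('l padic ^'m ^'m \<Rightarrow> complex Matrix.mat) \<Rightarrow> real" where
  "rep_eigenvalue X G \<mu> \<xi> = (THE e. \<forall>i<rep_dim \<xi>. \<forall>j<rep_dim \<xi>. \<forall>x\<in>G.
     complex_of_real ((1 - 1 / real CARD('l) ^ CARD('d)) / (1 - 1 / real CARD('l) ^ (1 + CARD('d)))) *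
       \<xi> x $$ (i, j) + D1_op X \<mu> (\<lambda>y. \<xi> y $$ (i, j)) x
     = complex_of_real e * \<xi> x $$ (i, j))"

definition Lipschitz_space :: "('d::finite \<Rightarrow> 'l::prime_card padic ^'m ^'m) \<Rightarrow> ('l padic ^'m ^'m) set \<Rightarrow>
    ('l padic ^'m ^'m) measure \<Rightarrow> real \<Rightarrow> ('l padic ^'m ^'m \<Rightarrow> complex) set" where
  "Lipschitz_space X G \<mu> \<alpha> = {f. square_integrable \<mu> f \<and>
     (\<lambda>h. L2_norm \<mu> (\<lambda>x. f (h ** x) - f x))
       \<in> O[inf (filtercomap (group_norm X) (nhds 0)) (principal G)](\<lambda>h. group_norm X h powr \<alpha>)}"

end

theory Submission
  imports Defs "HOL-Computational_Algebra.Fundamental_Theorem_Algebra"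
begin

text \<open>
  Everything is compared with the congruence subgroups \<open>K n\<close> of matrices congruent to 1 modulo \<open>\<ell>\<^sup>n\<close>:
  \<open>\<parallel>h\<parallel>\<close> is comparable with the max-norm of \<open>h - 1\<close>, because a high enough power of an element of \<open>G\<close>
  lies where \<open>exp\<close> is isometric up to a constant, and taking \<open>\<ell>\<close>-th powers divides both norms by \<open>\<ell>\<close>
  there. The ball \<open>G\<^sub>n\<close> is the set of \<open>\<ell>\<^sup>n\<close>-th powers, so it is compact and invariant
  under conjugation; comparing \<open>exp a exp b\<close> with \<open>exp (a + b)\<close> modulo higher order shows that its measure is of
  order \<open>\<ell>\<^sup>-\<^sup>n\<^sup>d\<close>.

  By Schur's lemma the eigenvalue of \<open>\<D>\<^sup>1\<close> on the matrix entries of \<open>\<xi>\<close> is a scalar, namely an integral of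
  \<open>1 - Re \<xi>\<^sub>0\<^sub>0\<close> against \<open>\<parallel>y\<parallel>\<close> to the power \<open>-(1 + d)\<close>, and the measure estimate shows that it
  is of order \<open>\<ell>\<^sup>n\<close> when \<open>\<xi>\<close> is trivial on \<open>K (n+1)\<close> but not on \<open>K n\<close>. So, up to a bounded
  shift of \<open>k\<close>, the sum in the theorem runs over the classes that are not trivial on \<open>K k\<close>.

  If \<open>h \<in> K n\<close>, the translate difference \<open>f (h x) - f x\<close> has no Fourier coefficients at classes trivial on
  \<open>K n\<close>, and elsewhere its Fourier terms are at most four times those of \<open>f\<close>; Parseval's identity then gives the
  Lipschitz bound from the tail bound. Conversely, averaging the Fourier terms of the translate difference over
  \<open>h \<in> K n\<close> kills the cross terms, since a matrix entry of a representation that is nontrivial on \<open>K n\<close> has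
  integral zero over \<open>K n\<close>, and leaves twice the tail of \<open>f\<close>; Bessel's inequality concludes.
\<close>

section \<open>The p-adic absolute value and the maximum norm of matrices\<close>

text \<open>The tail condition is an O-bound along powers of l, so it does not change when k is
  shifted by a constant, and eigenvalues have to be known only up to constant factors. This leaves
  room to let the subgroups \<open>K n\<close> carry the harmonic analysis: their cosets are the
  balls of the max-norm metric, which translations on either side and inversion preserve. As all
  balls of one radius have the same measure, \<open>\<mu>\<close> is invariant under all these maps.
  Exponential coordinates enter only through two-sided estimates with constants; the basis matrices
  may have entries of large norm, so the exponential is under control only after multiplication by a
  power of l. Completeness of the matrix entries is reduced to finite-dimensional algebra: functions
  on the finite quotients G / K m are dense among the square-integrable ones, and they are
  combinations of entries of a permutation representation, which is split into irreducible
  ones.\<close>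

lemma CARD_pos [simp]: "real CARD('l::prime_card) > 0"
  using prime_gt_0_nat[OF prime_card[where 'a='l]] by simp

lemma CARD_gt_1: "real CARD('l::prime_card) > 1"
  using prime_gt_1_nat[OF prime_card[where 'a='l]] by simp

lemma padic_abs_0 [simp]: "padic_abs (0::'l::prime_card padic) = 0"
  by simp

lemma padic_ex_rep: "\<exists>X. x = abs_padic X"
  by (induction x) auto

text \<open>Along a Cauchy sequence of rationals that does not tend to 0 the absolute value is
  eventually constant, so completing the rationals adds no new values.\<close>

lemma padic_abs_value:
  fixes x :: "'l::prime_card padic"
  assumes "x \<noteq> 0"
  obtains k :: int where "padic_abs x = real CARD('l) powi k"
proof -
  note p = prime_card[where 'a = 'l]
  obtain X where X: "x = abs_padic X" using padic_ex_rep by blast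
  have nv: "\<not> padic_vanishes CARD('l) (padic_nth X)"
    using assms by (simp add: X zero_padic_def padic.abs_eq_iff padic_rel_def padic_seq_nths)
  then obtain c k where c: "c > 0" "\<And>n. n \<ge> k \<Longrightarrow> rat_padic_abs CARD('l) (padic_nth X n) = c"
    using padic_cauchy_not_vanishes[OF p padic_nth_cauchy] by metis
  have "(\<lambda>n. rat_padic_abs CARD('l) (padic_nth X n)) \<longlonglongrightarrow> c"
    using c by (intro tendsto_eventually) (auto simp: eventually_sequentially)
  then have "padic_abs x = c" using padic_nth_abs_tendsto[of X] LIMSEQ_unique X by blast
  moreover have "\<exists>k. c = real CARD('l) powi k"
    using c(2)[of k] c(1) by (auto simp: rat_padic_abs_def split: prod.splits if_splits)
  ultimately show ?thesis using that by blast
qed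

lemma padic_abs_of_nat_le_1: "padic_abs (of_nat n :: 'l::prime_card padic) \<le> 1"
proof (induction n)
  case (Suc n)
  then show ?case using padic_abs_add[of "of_nat n :: 'l padic" 1] by (auto simp: add.commute)
qed simp

lemma padic_abs_of_nat:
  "n > 0 \<Longrightarrow> padic_abs (of_nat n :: 'l::prime_card padic) = 1 / real CARD('l) ^ multiplicity (int CARD('l)) (int n)"
  using rat_padic_abs_Fract[OF prime_card[where 'a='l], of "int n" 1]
  by (simp add: padic_of_nat padic_abs_of_rat of_nat_rat[symmetric] power_int_minus field_simps)

lemma padic_abs_of_nat_coprime:
  assumes "\<not> CARD('l) dvd n"
  shows "padic_abs (of_nat n :: 'l::prime_card padic) = 1"
proof -
  have "n > 0" using assms by (cases n) auto
  moreover have "multiplicity (int CARD('l)) (int n) = 0"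
    using assms by (intro not_dvd_imp_multiplicity_0) (simp add: int_dvd_int_iff)
  ultimately show ?thesis using padic_abs_of_nat[where 'l='l, of n] by simp
qed

lemma padic_abs_prime: "padic_abs (of_nat CARD('l) :: 'l::prime_card padic) = 1 / real CARD('l)"
proof -
  have "multiplicity (int CARD('l)) (int CARD('l)) = 1"
    using prime_card[where 'a='l] by (intro multiplicity_prime) auto
  then show ?thesis using padic_abs_of_nat[where 'l='l, of "CARD('l)"] by simp
qed

lemma padic_abs_power: "padic_abs (x ^ n :: 'l::prime_card padic) = padic_abs x ^ n"
  by (induction n) (auto simp: padic_abs_mult)

lemma padic_abs_inverse: "padic_abs (inverse x :: 'l::prime_card padic) = inverse (padic_abs x)"
proof (cases "x = 0")
  case False
  then have "padic_abs x * padic_abs (inverse x) = 1" by (simp flip: padic_abs_mult)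
  then show ?thesis by (metis inverse_unique)
qed simp

lemma padic_abs_divide: "padic_abs (x / y :: 'l::prime_card padic) = padic_abs x / padic_abs y"
  by (simp add: divide_inverse padic_abs_mult padic_abs_inverse)

lemma padic_abs_diff_commute: "padic_abs (x - y :: 'l::prime_card padic) = padic_abs (y - x)"
  using padic_abs_minus[of "x - y"] by simp

lemma padic_abs_diff: "padic_abs (x - y :: 'l::prime_card padic) \<le> max (padic_abs x) (padic_abs y)"
  using padic_abs_add[of x "- y"] by simp

text \<open>Legendre's formula as a recursion: among 1, ..., n only the multiples of l have absolute
  value below 1, and dividing each of them by l leaves the factors of (n div l)!.\<close>

lemma padic_abs_fact_rec:
  "padic_abs (fact n :: 'l::prime_card padic) =
    padic_abs (fact (n div CARD('l)) :: 'l padic) / real CARD('l) ^ (n div CARD('l))"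
proof (induction n)
  case (Suc n)
  let ?p = "CARD('l)"
  have p0: "?p > 0" using prime_gt_0_nat[OF prime_card[where 'a='l]] .
  have f: "padic_abs (fact (Suc n) :: 'l padic) = padic_abs (of_nat (Suc n) :: 'l padic) * padic_abs (fact n :: 'l padic)"
    by (simp only: fact_Suc padic_abs_mult of_nat_fact)
  show ?case
  proof (cases "?p dvd Suc n")
    case True
    then obtain q where q: "Suc n = ?p * q" by blast
    then have q0: "q > 0" by (cases q) auto
    \<comment> \<open>The number \<open>n\<close> is one less than the multiple l q, so its quotient
      by l is q - 1, while that of \<open>Suc n\<close> is q.\<close>
    have "Suc n = ?p * (q - 1) + ?p" using q q0 by (cases q) simp_all
    then have "n = (?p - 1) + ?p * (q - 1)" using p0 by linarith
    then have "n div ?p = (?p - 1) div ?p + (q - 1)" using p0 by (metis add.commute div_mult_self2 less_not_refl)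
    then have nd: "n div ?p = q - 1" using p0 by simp
    have sd: "Suc n div ?p = Suc (q - 1)" using q q0 p0 by simp
    have a: "padic_abs (of_nat (Suc n) :: 'l padic) = padic_abs (of_nat (Suc (q - 1)) :: 'l padic) / real ?p"
      unfolding q using q0 by (simp add: padic_abs_mult padic_abs_prime)
    show ?thesis unfolding f Suc.IH a nd sd fact_Suc padic_abs_mult of_nat_fact by simp
  next
    case False
    then have "Suc n div ?p = n div ?p" by (simp add: div_Suc dvd_eq_mod_eq_0)
    then show ?thesis unfolding f Suc.IH padic_abs_of_nat_coprime[OF False] by simp
  qed
qed simp

text \<open>The exponent n is coarser than n / (l - 1), but it bounds the n-th term of the
  exponential series by the n-th power of l times the norm of the argument. The induction closes
  because 2 (n div l) \<le> n.\<close>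

lemma padic_abs_fact_ge: "padic_abs (fact n :: 'l::prime_card padic) \<ge> 1 / real CARD('l) ^ n"
proof (induction n rule: less_induct)
  case (less n)
  let ?p = "CARD('l)"
  have p1: "?p > 1" using prime_gt_1_nat[OF prime_card[where 'a='l]] .
  show ?case
  proof (cases "n = 0")
    case False
    define q where "q = n div ?p"
    have qn: "q < n" unfolding q_def using False p1 by simp
    have "2 * q \<le> ?p * q" using p1 by simp
    also have "\<dots> \<le> n" by (simp add: q_def)
    finally have "q + q \<le> n" by simp
    then have "real ?p ^ q * real ?p ^ q \<le> real ?p ^ n"
      unfolding power_add[symmetric] using p1 by (intro power_increasing) auto
    then have "1 / real ?p ^ n \<le> (1 / real ?p ^ q) / real ?p ^ q"
      using p1 by (simp add: field_simps)
    also have "\<dots> \<le> padic_abs (fact q :: 'l padic) / real ?p ^ q"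
      using less.IH[OF qn] by (intro divide_right_mono) auto
    also have "\<dots> = padic_abs (fact n :: 'l padic)" using padic_abs_fact_rec[where 'l='l, of n] q_def by simp
    finally show ?thesis .
  qed simp
qed

text \<open>A rational within 1 / l of x has absolute value at most 1, so its reduced denominator is
  prime to l. The numerator times an inverse of the denominator modulo l is the residue.\<close>

lemma padic_residue_ex:
  fixes x :: "'l::prime_card padic"
  assumes "padic_abs x \<le> 1"
  obtains r where "r < CARD('l)" "padic_abs (x - of_nat r) \<le> 1 / real CARD('l)"
proof -
  let ?p = "CARD('l)"
  note p = prime_card[where 'a = 'l]
  have p1: "real ?p > 1" by (rule CARD_gt_1)
  obtain X where X: "x = abs_padic X" using padic_ex_rep by blast
  obtain k where k: "\<And>m n. m \<ge> k \<Longrightarrow> n \<ge> k \<Longrightarrow> rat_padic_abs ?p (padic_nth X m - padic_nth X n) < 1 / real ?p"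
    using padic_nth_cauchy[of X, unfolded padic_cauchy_def, rule_format, of "1 / real ?p"] p1 by auto
  define q where "q = padic_nth X k"
  define y where "y = (abs_padic (padic_seq_const q) :: 'l padic)"
  have "x - y = abs_padic (padic_seq_add X (padic_seq_minus (padic_seq_const q)))"
    unfolding minus_padic_def y_def X plus_padic.abs_eq uminus_padic.abs_eq by simp
  then have "(\<lambda>n. rat_padic_abs ?p (padic_nth X n - q)) \<longlonglongrightarrow> padic_abs (x - y)"
    using padic_nth_abs_tendsto[of "padic_seq_add X (padic_seq_minus (padic_seq_const q))"]
    by (simp add: padic_seq_nths)
  then have xy: "padic_abs (x - y) \<le> 1 / real ?p"
    by (rule LIMSEQ_le_const2) (use k q_def in \<open>auto intro!: exI[of _ k] less_imp_le\<close>)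
  have "padic_abs y \<le> max (padic_abs (x - y)) (padic_abs x)"
    using padic_abs_diff[of x "x - y"] by (simp add: max.commute)
  also have "\<dots> \<le> 1" using xy assms p1 by (simp add: divide_le_eq order_trans[OF xy])
  finally have q1: "rat_padic_abs ?p q \<le> 1" by (simp add: y_def padic_abs_of_rat)
  obtain a b where ab: "quotient_of q = (a, b)" by (cases "quotient_of q")
  have b0: "b > 0" using quotient_of_denom_pos[OF ab] .
  have cop: "coprime a b" using quotient_of_coprime[OF ab] .
  have qab: "q = of_int a / of_int b" using quotient_of_div[OF ab] .
  have ndvd: "\<not> int ?p dvd b"
  proof
    assume d: "int ?p dvd b"
    have "\<not> int ?p dvd a"
    proof
      assume "int ?p dvd a"
      then have "int ?p dvd 1" using coprime_common_divisor[OF cop _ d] by blast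
      then show False using p1 by simp
    qed
    then have a0: "a \<noteq> 0" "multiplicity (int ?p) a = 0" by (auto intro: not_dvd_imp_multiplicity_0)
    have "multiplicity (int ?p) b > 0" using d b0 p by (simp add: prime_multiplicity_gt_zero_iff)
    then have "rat_padic_abs ?p q > 1"
      unfolding rat_padic_abs_def ab using a0 p1 by simp
    then show False using q1 by simp
  qed
  have "coprime b (int ?p)" using ndvd p
    by (metis coprime_commute prime_imp_coprime prime_nat_int_transfer)
  then obtain c where c: "[b * c = 1] (mod int ?p)" using cong_solve_coprime_int by blast
  define r where "r = nat ((a * c) mod int ?p)"
  have rr: "int r = (a * c) mod int ?p" using p1 by (simp add: r_def)
  have rp: "r < ?p" using rr p1 pos_mod_bound[of "int ?p" "a * c"] by linarith
  have "int ?p dvd a - b * int r"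
  proof -
    have "[b * int r = b * (a * c)] (mod int ?p)" unfolding rr by (simp add: cong_def mod_mult_right_eq)
    also have "[b * (a * c) = a * (b * c)] (mod int ?p)" by (simp add: ac_simps)
    also have "[a * (b * c) = a * 1] (mod int ?p)" using c by (rule cong_scalar_left)
    finally show ?thesis by (metis cong_iff_dvd_diff cong_sym mult.right_neutral)
  qed
  then obtain e where e: "a - b * int r = int ?p * e" by blast
  have "q - of_nat r = of_nat ?p * (of_int e / of_int b)"
  proof -
    have "(of_int a - of_int b * of_nat r :: rat) = of_nat ?p * of_int e"
      using arg_cong[OF e, of "of_int :: int \<Rightarrow> rat"] by simp
    then show ?thesis using b0 by (simp add: qab field_simps)
  qed
  then have qr0: "rat_padic_abs ?p (q - of_nat r) = rat_padic_abs ?p (of_nat ?p) * rat_padic_abs ?p (of_int e / of_int b)"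
    by (simp only: rat_padic_abs_mult[OF p])
  have pp: "rat_padic_abs ?p (of_nat ?p) = 1 / real ?p"
    using padic_abs_prime[where 'l='l] by (simp add: padic_of_nat padic_abs_of_rat)
  have "rat_padic_abs ?p (of_int e / of_int b) \<le> 1"
  proof (cases "e = 0")
    case False
    have "rat_padic_abs ?p (of_int e / of_int b) = real ?p powi (int (multiplicity (int ?p) b) - int (multiplicity (int ?p) e))"
      using False b0 by (simp add: rat_padic_abs_Fract[OF p] Fract_of_int_quotient[symmetric])
    also have "multiplicity (int ?p) b = 0" using ndvd by (rule not_dvd_imp_multiplicity_0)
    also have "real ?p powi (int 0 - int (multiplicity (int ?p) e)) \<le> 1"
      using p1 by (simp add: power_int_minus field_simps)
    finally show ?thesis .
  qed (use p in simp)
  then have qr: "rat_padic_abs ?p (q - of_nat r) \<le> 1 / real ?p"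
    unfolding qr0 pp using p1 by (simp add: divide_le_eq)
  have "y - of_nat r = abs_padic (padic_seq_const (q - of_nat r))"
  proof -
    have "padic_seq_add (padic_seq_const q) (padic_seq_minus (padic_seq_const (of_nat r))) = (padic_seq_const (q - of_nat r) :: 'l padic_seq)"
      by (simp add: padic_nth_inject[symmetric] padic_seq_nths)
    then show ?thesis unfolding minus_padic_def y_def padic_of_nat plus_padic.abs_eq uminus_padic.abs_eq by simp
  qed
  then have "padic_abs (y - of_nat r) \<le> 1 / real ?p" using qr by (simp add: padic_abs_of_rat)
  then have "padic_abs (x - of_nat r) \<le> 1 / real ?p"
    using padic_abs_add[of "x - y" "y - of_nat r"] xy by simp
  then show ?thesis using that rp by blast
qed

lemma padic_residue_unique:
  assumes "r < CARD('l)" "s < CARD('l)" "padic_abs (of_nat r - of_nat s :: 'l::prime_card padic) < 1"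
  shows "r = s"
proof -
  have *: False if "u < v" "v < CARD('l)" "padic_abs (of_nat v - of_nat u :: 'l padic) < 1" for u v
  proof -
    have "\<not> CARD('l) dvd v - u" using that by (auto dest: dvd_imp_le)
    then have "padic_abs (of_nat (v - u) :: 'l padic) = 1" by (rule padic_abs_of_nat_coprime)
    then show False using that by (simp add: of_nat_diff)
  qed
  show ?thesis
    using *[of r s] *[of s r] assms padic_abs_diff_commute[of "of_nat r :: 'l padic" "of_nat s"]
    by (metis linorder_neqE_nat)
qed

text \<open>The distance of the vector type is only equivalent to this norm, which is ultrametric
  and submultiplicative; the estimates for the exponential and for the group are made with
  it.\<close>

definition mat_norm :: "'l::prime_card padic ^'n ^'m \<Rightarrow> real" where
  "mat_norm A = Max (range (\<lambda>(i, j). padic_abs (A $ i $ j)))"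

lemma mat_norm_le_iff: "mat_norm A \<le> r \<longleftrightarrow> (\<forall>i j. padic_abs (A $ i $ j) \<le> r)"
  unfolding mat_norm_def by (subst Max_le_iff) auto

lemma mat_norm_entry: "padic_abs (A $ i $ j) \<le> mat_norm A"
  using mat_norm_le_iff by blast

lemma mat_norm_nonneg [simp]: "mat_norm A \<ge> 0"
  using mat_norm_entry[of A] padic_abs_nonneg by (meson order_trans)

lemma mat_norm_eq_0 [simp]: "mat_norm A = 0 \<longleftrightarrow> A = 0"
proof -
  have "mat_norm A = 0 \<longleftrightarrow> mat_norm A \<le> 0" using mat_norm_nonneg[of A] by linarith
  also have "\<dots> \<longleftrightarrow> (\<forall>i j. A $ i $ j = 0)"
    unfolding mat_norm_le_iff by (metis padic_abs_eq_0 padic_abs_nonneg order_antisym order_refl)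
  finally show ?thesis by (simp add: Finite_Cartesian_Product.vec_eq_iff)
qed

lemma mat_norm_0 [simp]: "mat_norm 0 = 0" by simp

lemma mat_norm_minus [simp]: "mat_norm (- A) = mat_norm A"
  unfolding mat_norm_def by simp

lemma mat_norm_diff_commute: "mat_norm (A - B) = mat_norm (B - A)"
  using mat_norm_minus[of "A - B"] by simp

lemma mat_norm_add: "mat_norm (A + B) \<le> max (mat_norm A) (mat_norm B)"
  unfolding mat_norm_le_iff
proof (intro allI)
  fix i j
  show "padic_abs ((A + B) $ i $ j) \<le> max (mat_norm A) (mat_norm B)"
    using padic_abs_add[of "A $ i $ j" "B $ i $ j"] mat_norm_entry[of A i j] mat_norm_entry[of B i j]
    by (simp add: le_max_iff_disj) linarith
qed

lemma mat_norm_add_le: "mat_norm A \<le> r \<Longrightarrow> mat_norm B \<le> r \<Longrightarrow> mat_norm (A + B) \<le> r"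
  using mat_norm_add[of A B] by linarith

lemma mat_norm_diff_le: "mat_norm A \<le> r \<Longrightarrow> mat_norm B \<le> r \<Longrightarrow> mat_norm (A - B) \<le> r"
  using mat_norm_add_le[of A r "- B"] by simp

lemma mat_norm_sum_le:
  assumes "r \<ge> 0" "\<And>x. x \<in> S \<Longrightarrow> mat_norm (f x) \<le> r"
  shows "mat_norm (sum f S) \<le> r"
  using assms by (induction S rule: infinite_finite_induct) (auto intro: mat_norm_add_le)

lemma padic_abs_sum_le:
  assumes "r \<ge> 0" "\<And>x. x \<in> S \<Longrightarrow> padic_abs (f x) \<le> r"
  shows "padic_abs (sum f S) \<le> r"
  using assms
proof (induction S rule: infinite_finite_induct)
  case (insert x S)
  then show ?case using padic_abs_add[of "f x" "sum f S"] by fastforce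
qed auto

lemma mat_norm_mult: "mat_norm (A ** B) \<le> mat_norm A * mat_norm B"
  unfolding mat_norm_le_iff matrix_matrix_mult_def
  by (auto intro!: padic_abs_sum_le mult_mono simp: padic_abs_mult mat_norm_entry)

lemma mat_norm_mult_le: "mat_norm A \<le> r \<Longrightarrow> mat_norm B \<le> s \<Longrightarrow> mat_norm (A ** B) \<le> r * s"
  using mat_norm_mult[of A B] mult_mono[of "mat_norm A" r "mat_norm B" s]
    mat_norm_nonneg[of A] by (metis mat_norm_nonneg order_trans)

lemma mat_norm_scale: "mat_norm (c *m A) = padic_abs c * mat_norm A"
proof (rule antisym)
  show "mat_norm (c *m A) \<le> padic_abs c * mat_norm A"
    unfolding mat_norm_le_iff by (auto simp: padic_abs_mult mat_norm_entry intro!: mult_left_mono)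
  show "padic_abs c * mat_norm A \<le> mat_norm (c *m A)"
  proof (cases "c = 0")
    case False
    then have c: "padic_abs c > 0" by (metis padic_abs_eq_0 padic_abs_nonneg less_eq_real_def)
    have "mat_norm A \<le> mat_norm (c *m A) / padic_abs c"
      unfolding mat_norm_le_iff
    proof (intro allI)
      fix i j show "padic_abs (A $ i $ j) \<le> mat_norm (c *m A) / padic_abs c"
        using mat_norm_entry[of "c *m A" i j] c by (simp add: padic_abs_mult field_simps)
    qed
    then show ?thesis using c by (simp add: field_simps)
  qed simp
qed

lemma mat_norm_one [simp]: "mat_norm (mat 1 :: 'l::prime_card padic ^'n ^'n) = 1"
proof (rule antisym)
  show "mat_norm (mat 1 :: 'l::prime_card padic ^'n ^'n) \<le> 1"
    unfolding mat_norm_le_iff by (auto simp: Finite_Cartesian_Product.mat_def)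
  show "1 \<le> mat_norm (mat 1 :: 'l::prime_card padic ^'n ^'n)"
  proof -
    fix k :: 'n
    have "padic_abs ((mat 1 :: 'l padic ^'n ^'n) $ k $ k) = 1" by (simp add: Finite_Cartesian_Product.mat_def)
    then show ?thesis using mat_norm_entry[of "mat 1 :: 'l padic ^'n ^'n" k k] by linarith
  qed
qed

lemma padic_abs_entry_dist: "padic_abs ((A - B) $ i $ j) \<le> dist A B"
proof -
  have "padic_abs ((A - B) $ i $ j) = dist (A $ i $ j) (B $ i $ j)" by (simp add: dist_padic_def)
  also have "\<dots> \<le> dist A B" by (rule order_trans[OF dist_vec_nth_le dist_vec_nth_le])
  finally show ?thesis .
qed

lemma mat_norm_le_dist: "mat_norm (A - B) \<le> dist A B"
  unfolding mat_norm_le_iff using padic_abs_entry_dist by blast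

lemma dist_le_mat_norm:
  "dist A (B :: 'l::prime_card padic ^'n ^'m) \<le> real (CARD('n) * CARD('m)) * mat_norm (A - B)"
proof -
  have "dist A B \<le> (\<Sum>i\<in>UNIV. dist (A $ i) (B $ i))"
    unfolding dist_vec_def by (rule L2_set_le_sum) auto
  also have "\<dots> \<le> (\<Sum>i\<in>(UNIV::'m set). \<Sum>j\<in>(UNIV::'n set). dist (A $ i $ j) (B $ i $ j))"
    by (intro sum_mono) (subst dist_vec_def, rule L2_set_le_sum, auto)
  also have "\<dots> \<le> (\<Sum>i\<in>(UNIV::'m set). \<Sum>j\<in>(UNIV::'n set). mat_norm (A - B))"
    using mat_norm_entry[of "A - B"] by (intro sum_mono) (simp add: dist_padic_def)
  finally show ?thesis by (simp add: mult_ac)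
qed

lemma tendsto_mat_norm_iff:
  fixes f :: "'a \<Rightarrow> 'l::prime_card padic ^'n ^'m"
  shows "(f \<longlongrightarrow> L) F \<longleftrightarrow> ((\<lambda>n. mat_norm (f n - L)) \<longlongrightarrow> 0) F"
proof
  assume "(f \<longlongrightarrow> L) F"
  then have d: "((\<lambda>n. dist (f n) L) \<longlongrightarrow> 0) F" by (simp add: tendsto_dist_iff[symmetric])
  show "((\<lambda>n. mat_norm (f n - L)) \<longlongrightarrow> 0) F"
    by (rule tendsto_sandwich[OF _ _ tendsto_const d]) (auto simp: mat_norm_le_dist)
next
  assume "((\<lambda>n. mat_norm (f n - L)) \<longlongrightarrow> 0) F"
  then have d: "((\<lambda>n. real (CARD('n) * CARD('m)) * mat_norm (f n - L)) \<longlongrightarrow> 0) F"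
    by (rule tendsto_mult_right_zero)
  have "((\<lambda>n. dist (f n) L) \<longlongrightarrow> 0) F"
    by (rule tendsto_sandwich[OF _ _ tendsto_const d]) (simp_all add: dist_le_mat_norm del: of_nat_mult)
  then show "(f \<longlongrightarrow> L) F" by (simp add: tendsto_dist_iff[symmetric])
qed

text \<open>Carries a uniform estimate of partial sums over to the sum of a series; this is how the
  remainder of the exponential is bounded.\<close>

lemma mat_norm_lim_le:
  assumes "f \<longlonglongrightarrow> L" "\<And>n. mat_norm (f n - A) \<le> r"
  shows "mat_norm (L - A) \<le> r"
proof (rule field_le_epsilon)
  fix e :: real assume e: "e > 0"
  have r: "r \<ge> 0" using assms(2)[of 0] mat_norm_nonneg order_trans by blast
  have "eventually (\<lambda>n. mat_norm (f n - L) < e) sequentially"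
    using assms(1) e unfolding tendsto_mat_norm_iff by (rule order_tendstoD(2))
  then obtain n where "mat_norm (f n - L) < e" using eventually_happens by fastforce
  then have "mat_norm ((L - f n) + (f n - A)) \<le> r + e"
    using assms(2)[of n] r e by (intro mat_norm_add_le) (auto simp: mat_norm_diff_commute[of L])
  then show "mat_norm (L - A) \<le> r + e" by simp
qed

section \<open>The matrix exponential\<close>

lemma scale_one [simp]: "1 *m (A :: 'a::comm_ring_1 ^'n ^'m) = A"
  and scale_zero [simp]: "0 *m (A :: 'a::comm_ring_1 ^'n ^'m) = 0"
  and scale_zero_right [simp]: "c *m (0 :: 'a::comm_ring_1 ^'n ^'m) = 0"
  and scale_scale: "c *m (d *m (A :: 'a::comm_ring_1 ^'n ^'m)) = (c * d) *m A"
  and scale_add_left: "(c + d) *m (A :: 'a::comm_ring_1 ^'n ^'m) = c *m A + d *m A"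
  and scale_add_right: "c *m (A + B :: 'a::comm_ring_1 ^'n ^'m) = c *m A + c *m B"
  and scale_diff_right: "c *m (A - B :: 'a::comm_ring_1 ^'n ^'m) = c *m A - c *m B"
  by (simp_all add: Finite_Cartesian_Product.vec_eq_iff algebra_simps)

lemma map_matrix_trivial [simp]: "map_matrix (\<lambda>a. 0) A = (0 :: 'a::zero ^'n ^'m)" "map_matrix (\<lambda>a. a) A = A"
  by (simp_all add: Finite_Cartesian_Product.vec_eq_iff)

lemma scale_sum_left: "sum f S *m (A :: 'a::comm_ring_1 ^'n ^'m) = (\<Sum>i\<in>S. f i *m A)"
  by (induction S rule: infinite_finite_induct) (auto simp: scale_add_left)

lemma scale_sum_right: "c *m (\<Sum>i\<in>S. f i) = (\<Sum>i\<in>S. c *m (f i :: 'a::comm_ring_1 ^'n ^'m))"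
  by (induction S rule: infinite_finite_induct) (auto simp: scale_add_right)

lemma scale_mult_left: "(c *m A) ** B = c *m (A ** (B :: 'a::comm_ring_1 ^'n ^'m))"
  and scale_mult_right: "A ** (c *m B) = c *m (A ** (B :: 'a::comm_ring_1 ^'n ^'m))"
  by (simp_all add: Finite_Cartesian_Product.vec_eq_iff matrix_matrix_mult_def sum_distrib_left algebra_simps)

lemma matrix_add_rdistrib: "(B + C) ** A = B ** A + C ** (A :: 'a::semiring_1 ^'n ^'m)"
  by (simp add: Finite_Cartesian_Product.vec_eq_iff matrix_matrix_mult_def sum.distrib algebra_simps)

lemma matrix_mult_sum_left: "sum f S ** B = (\<Sum>i\<in>S. f i ** (B :: 'a::comm_ring_1 ^'n ^'m))"
  by (induction S rule: infinite_finite_induct) (auto simp: matrix_add_rdistrib)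

lemma matrix_mult_sum_right: "B ** sum f S = (\<Sum>i\<in>S. B ** (f i :: 'a::comm_ring_1 ^'n ^'m))"
  by (induction S rule: infinite_finite_induct) (auto simp: matrix_add_ldistrib)

lemma matrix_diff_ldistrib: "A ** (B - C :: 'a::comm_ring_1 ^'n ^'m) = A ** B - A ** C"
  using matrix_add_ldistrib[of A "B - C" C] by (simp add: algebra_simps)

lemma matrix_diff_rdistrib: "(B - C) ** (A :: 'a::comm_ring_1 ^'n ^'m) = B ** A - C ** A"
  using matrix_add_rdistrib[of "B - C" C A] by (simp add: algebra_simps)

lemma mat_pow_0 [simp]: "mat_pow A 0 = mat 1"
  and mat_pow_Suc: "mat_pow A (Suc k) = A ** mat_pow A k"
  by (simp_all add: mat_pow_def)

lemma mat_pow_add: "mat_pow A (i + j) = mat_pow A i ** mat_pow A j"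
  by (induction i) (simp_all add: mat_pow_Suc matrix_mul_assoc)

lemma mat_pow_scale: "mat_pow (c *m (A :: 'a::comm_ring_1 ^'n ^'n)) k = c ^ k *m mat_pow A k"
proof (induction k)
  case (Suc k)
  show ?case
    by (simp only: mat_pow_Suc Suc scale_mult_left scale_mult_right scale_scale power_Suc) (simp only: mult.commute[of "c ^ k" c])
qed simp

lemma mat_norm_pow: "mat_norm (mat_pow A k) \<le> mat_norm A ^ k"
proof (induction k)
  case (Suc k)
  then show ?case using mat_norm_mult_le[OF order_refl Suc, of A] by (simp add: mat_pow_Suc)
qed simp

section \<open>Limits and series of matrices\<close>

lemma mat_norm_tendsto_0I:
  assumes "\<And>x. mat_norm (f x) \<le> g x" "(g \<longlongrightarrow> 0) F"
  shows "((\<lambda>x. mat_norm (f x)) \<longlongrightarrow> 0) F"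
  by (rule tendsto_sandwich[OF _ _ tendsto_const assms(2)]) (simp_all add: assms(1))

lemma tendsto_matrix_mult:
  fixes f :: "'a \<Rightarrow> 'l::prime_card padic ^'k ^'m" and g :: "'a \<Rightarrow> 'l padic ^'n ^'k"
  assumes "(f \<longlongrightarrow> A) F" "(g \<longlongrightarrow> B) F"
  shows "((\<lambda>x. f x ** g x) \<longlongrightarrow> A ** B) F"
proof -
  let ?a = "\<lambda>x. mat_norm (f x - A)" and ?b = "\<lambda>x. mat_norm (g x - B)"
  have ab: "(?a \<longlongrightarrow> 0) F" "(?b \<longlongrightarrow> 0) F" using assms by (simp_all add: tendsto_mat_norm_iff[symmetric])
  have lim: "((\<lambda>x. ?a x * ?b x + ?a x * mat_norm B + mat_norm A * ?b x) \<longlongrightarrow> 0 * 0 + 0 * mat_norm B + mat_norm A * 0) F"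
    by (intro tendsto_intros ab)
  have le: "mat_norm (f x ** g x - A ** B) \<le> ?a x * ?b x + ?a x * mat_norm B + mat_norm A * ?b x" for x
  proof -
    have "f x ** g x - A ** B = (f x - A) ** (g x - B) + (f x - A) ** B + A ** (g x - B)"
      by (simp add: matrix_diff_ldistrib matrix_diff_rdistrib)
    moreover have "mat_norm ((f x - A) ** (g x - B)) \<le> ?a x * ?b x" by (rule mat_norm_mult)
    moreover have "mat_norm ((f x - A) ** B) \<le> ?a x * mat_norm B" by (rule mat_norm_mult)
    moreover have "mat_norm (A ** (g x - B)) \<le> mat_norm A * ?b x" by (rule mat_norm_mult)
    moreover have "?a x * ?b x \<ge> 0" "?a x * mat_norm B \<ge> 0" "mat_norm A * ?b x \<ge> 0" by simp_all
    ultimately show ?thesis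
      using mat_norm_add[of "(f x - A) ** (g x - B) + (f x - A) ** B" "A ** (g x - B)"]
        mat_norm_add[of "(f x - A) ** (g x - B)" "(f x - A) ** B"] by (smt (verit))
  qed
  show ?thesis unfolding tendsto_mat_norm_iff
    by (rule mat_norm_tendsto_0I[OF le]) (use lim in simp)
qed

lemma continuous_on_matrix_mult:
  fixes f :: "'a::topological_space \<Rightarrow> 'l::prime_card padic ^'k ^'m" and g :: "'a \<Rightarrow> 'l padic ^'n ^'k"
  shows "continuous_on S f \<Longrightarrow> continuous_on S g \<Longrightarrow> continuous_on S (\<lambda>x. f x ** g x)"
  unfolding continuous_on_def by (auto intro: tendsto_matrix_mult)

lemma summable_mat_norm_tendsto_0:
  fixes a :: "nat \<Rightarrow> 'l::prime_card padic ^'n ^'m"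
  assumes "summable a"
  shows "(\<lambda>n. mat_norm (a n)) \<longlonglongrightarrow> 0"
proof -
  obtain L where L: "(\<lambda>n. \<Sum>i<n. a i) \<longlonglongrightarrow> L" using assms by (auto simp: summable_def sums_def)
  let ?d = "\<lambda>n. mat_norm ((\<Sum>i<n. a i) - L)"
  have d: "?d \<longlonglongrightarrow> 0" using L by (simp add: tendsto_mat_norm_iff[symmetric])
  have lim: "(\<lambda>n. max (?d (Suc n)) (?d n)) \<longlonglongrightarrow> max 0 0"
    by (intro tendsto_max d LIMSEQ_Suc[OF d])
  have le: "mat_norm (a n) \<le> max (?d (Suc n)) (?d n)" for n
  proof -
    have "a n = ((\<Sum>i<Suc n. a i) - L) + (L - (\<Sum>i<n. a i))" by simp
    then show ?thesis using mat_norm_add[of "(\<Sum>i<Suc n. a i) - L" "L - (\<Sum>i<n. a i)"]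
      by (metis mat_norm_diff_commute)
  qed
  show ?thesis
    by (rule mat_norm_tendsto_0I[OF le]) (use lim in simp)
qed

text \<open>The product of the N-th partial sums differs from the N-th partial sum of the Cauchy
  product by the terms with i, j < N \<le> i + j. In each of them one factor has a large index and
  is small, and the ultrametric inequality bounds the sum by its largest term, so plain summability
  suffices.\<close>

lemma ultrametric_Cauchy_product:
  fixes a b :: "nat \<Rightarrow> 'l::prime_card padic ^'n ^'n"
  assumes "summable a" "summable b"
  shows "(\<lambda>n. \<Sum>i\<le>n. a i ** b (n - i)) sums (suminf a ** suminf b)"
proof -
  let ?A = "\<lambda>n. \<Sum>i<n. a i" and ?B = "\<lambda>n. \<Sum>i<n. b i"
  let ?C = "\<lambda>N. \<Sum>n<N. \<Sum>i\<le>n. a i ** b (n - i)"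
  have a0: "(\<lambda>n. mat_norm (a n)) \<longlonglongrightarrow> 0" and b0: "(\<lambda>n. mat_norm (b n)) \<longlonglongrightarrow> 0"
    using assms by (auto intro: summable_mat_norm_tendsto_0)
  obtain Ma where Ma: "Ma > 0" "\<And>n. norm (mat_norm (a n)) \<le> Ma"
    using convergent_imp_Bseq[of "\<lambda>n. mat_norm (a n)"] a0 by (auto simp: convergent_def Bseq_def)
  obtain Mb where Mb: "Mb > 0" "\<And>n. norm (mat_norm (b n)) \<le> Mb"
    using convergent_imp_Bseq[of "\<lambda>n. mat_norm (b n)"] b0 by (auto simp: convergent_def Bseq_def)
  have AB: "(\<lambda>N. ?A N ** ?B N) \<longlonglongrightarrow> suminf a ** suminf b"
    using assms by (intro tendsto_matrix_mult summable_LIMSEQ)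
  have diff: "?A N ** ?B N - ?C N = (\<Sum>(i,j)\<in>{(i,j). i < N \<and> j < N \<and> N \<le> i + j}. a i ** b j)" for N
  proof -
    have "?A N ** ?B N = (\<Sum>(i,j)\<in>{..<N}\<times>{..<N}. a i ** b j)"
      unfolding matrix_mult_sum_left matrix_mult_sum_right by (subst sum.swap) (simp add: sum.cartesian_product)
    also have "\<dots> = (\<Sum>(i,j)\<in>{(i,j). i + j < N} \<union> {(i,j). i < N \<and> j < N \<and> N \<le> i + j}. a i ** b j)"
      by (rule sum.cong) auto
    also have "\<dots> = (\<Sum>(i,j)\<in>{(i,j). i + j < N}. a i ** b j) +
        (\<Sum>(i,j)\<in>{(i,j). i < N \<and> j < N \<and> N \<le> i + j}. a i ** b j)"
      by (rule sum.union_disjoint)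
         (auto intro: finite_subset[of _ "{..<N}\<times>{..<N}"])
    also have "(\<Sum>(i,j)\<in>{(i,j). i + j < N}. a i ** b j) = ?C N"
      by (rule sum.triangle_reindex)
    finally show ?thesis by simp
  qed
  have "(\<lambda>N. ?A N ** ?B N - ?C N) \<longlonglongrightarrow> 0"
    unfolding tendsto_mat_norm_iff diff_zero
  proof (rule LIMSEQ_I)
    fix r :: real assume r: "r > 0"
    \<comment> \<open>Chosen so that e (Ma + Mb) = r / 2, where Ma and Mb bound all terms of the two
      series.\<close>
    define e where "e = r / (2 * (Ma + Mb))"
    have e: "e > 0" using r Ma Mb by (simp add: e_def)
    obtain i0 where i0: "\<And>n. n \<ge> i0 \<Longrightarrow> mat_norm (a n) < e" using LIMSEQ_D[OF a0 e] by auto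
    obtain j0 where j0: "\<And>n. n \<ge> j0 \<Longrightarrow> mat_norm (b n) < e" using LIMSEQ_D[OF b0 e] by auto
    have "mat_norm (?A N ** ?B N - ?C N) \<le> e * (Ma + Mb)" if N: "N \<ge> i0 + j0" for N
      unfolding diff
    proof (rule mat_norm_sum_le, goal_cases)
      case 1
      show ?case using e Ma Mb by simp
    next
      case (2 x)
      obtain i j where x: "x = (i,j)" "i + j \<ge> N" using 2 by auto
      have "mat_norm (a i ** b j) \<le> e * (Ma + Mb)"
      proof (cases "i \<ge> i0")
        case True
        have "mat_norm (a i ** b j) \<le> e * Mb"
          using i0[OF True] Mb(2)[of j] by (intro mat_norm_mult_le) auto
        also have "\<dots> \<le> e * (Ma + Mb)" using e Ma by simp
        finally show ?thesis .
      next
        case False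
        then have "j \<ge> j0" using x N by simp
        then have "mat_norm (a i ** b j) \<le> Ma * e"
          using j0[of j] Ma(2)[of i] by (intro mat_norm_mult_le) auto
        also have "\<dots> \<le> e * (Ma + Mb)" using e Mb by simp
        finally show ?thesis .
      qed
      then show ?case by (simp add: x)
    qed
    moreover have "e * (Ma + Mb) < r" using r Ma(1) Mb(1) by (simp add: e_def field_simps add_pos_pos)
    ultimately show "\<exists>no. \<forall>n\<ge>no. norm (mat_norm (?A n ** ?B n - ?C n) - 0) < r"
      by (intro exI[of _ "i0 + j0"]) fastforce
  qed
  then have "(\<lambda>N. ?A N ** ?B N - (?A N ** ?B N - ?C N)) \<longlonglongrightarrow> suminf a ** suminf b"
  proof -
    assume l: "(\<lambda>N. ?A N ** ?B N - ?C N) \<longlonglongrightarrow> 0"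
    have l1: "(\<lambda>N. mat_norm (?A N ** ?B N - suminf a ** suminf b)) \<longlonglongrightarrow> 0" using AB by (simp add: tendsto_mat_norm_iff)
    have l2: "(\<lambda>N. mat_norm (?A N ** ?B N - ?C N)) \<longlonglongrightarrow> 0" using l by (simp add: tendsto_mat_norm_iff)
    have lim: "(\<lambda>N. max (mat_norm (?A N ** ?B N - suminf a ** suminf b)) (mat_norm (?A N ** ?B N - ?C N))) \<longlonglongrightarrow> max 0 0"
      by (intro tendsto_max l1 l2)
    have le: "mat_norm (?A N ** ?B N - (?A N ** ?B N - ?C N) - suminf a ** suminf b) \<le>
       max (mat_norm (?A N ** ?B N - suminf a ** suminf b)) (mat_norm (?A N ** ?B N - ?C N))" for N
      using mat_norm_add[of "?A N ** ?B N - suminf a ** suminf b" "- (?A N ** ?B N - ?C N)"]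
      by (simp only: mat_norm_minus) (simp add: algebra_simps)
    show ?thesis unfolding tendsto_mat_norm_iff
      by (rule mat_norm_tendsto_0I[OF le]) (use lim in simp)
  qed
  then show ?thesis by (simp add: sums_def)
qed

section \<open>The exponential along a line and near zero\<close>

lemma mat_exp_term_scale:
  fixes A :: "'l::prime_card padic ^'n ^'n"
  shows "mat_exp_term (c *m A) k = (c ^ k / fact k) *m mat_pow A k"
  by (simp add: mat_exp_term_def mat_pow_scale scale_scale)

text \<open>Multiples of one matrix commute, so the n-th term of the Cauchy product is the binomial
  expansion of (x + y)^n / n!.\<close>

lemma mat_exp_add_scale:
  fixes A :: "'l::prime_card padic ^'n ^'n"
  assumes "summable (mat_exp_term (x *m A))" "summable (mat_exp_term (y *m A))"
  shows "mat_exp ((x + y) *m A) = mat_exp (x *m A) ** mat_exp (y *m A)"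
proof -
  have "(\<Sum>i\<le>n. mat_exp_term (x *m A) i ** mat_exp_term (y *m A) (n - i)) = mat_exp_term ((x + y) *m A) n" for n
  proof -
    have "(\<Sum>i\<le>n. mat_exp_term (x *m A) i ** mat_exp_term (y *m A) (n - i)) =
        (\<Sum>i\<le>n. ((x ^ i / fact i) * (y ^ (n - i) / fact (n - i))) *m mat_pow A n)"
      by (intro sum.cong refl) (simp add: mat_exp_term_scale scale_mult_left scale_mult_right scale_scale mat_pow_add[symmetric] mult.commute)
    also have "\<dots> = (\<Sum>i\<le>n. (x ^ i / fact i) * (y ^ (n - i) / fact (n - i))) *m mat_pow A n"
      by (simp only: scale_sum_left)
    also have "(\<Sum>i\<le>n. (x ^ i / fact i) * (y ^ (n - i) / fact (n - i))) = (x + y) ^ n / fact n"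
      by (simp add: binomial_ring sum_divide_distrib binomial_fact field_simps)
    finally show ?thesis by (simp only: mat_exp_term_scale)
  qed
  then show ?thesis
    using ultrametric_Cauchy_product[OF assms] by (simp add: mat_exp_def sums_iff)
qed

lemma mat_exp_0 [simp]: "mat_exp (0 :: 'l::prime_card padic ^'n ^'n) = mat 1"
proof -
  let ?O = "0 :: 'l padic ^'n ^'n"
  have "mat_exp_term ?O k = (if k = 0 then mat 1 else 0)" for k
    by (cases k) (auto simp: mat_exp_term_def mat_pow_Suc)
  then have "mat_exp_term ?O = (\<lambda>k. if k = 0 then mat 1 else 0)" by auto
  then show ?thesis unfolding mat_exp_def using sums_single[of 0 "\<lambda>_. mat 1 :: 'l padic ^'n ^'n"] by (simp add: sums_iff)
qed

lemma mat_exp_of_nat_scale: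
  fixes A :: "'l::prime_card padic ^'n ^'n"
  assumes "\<And>n. summable (mat_exp_term (of_nat n *m A))"
  shows "mat_exp (of_nat n *m A) = mat_pow (mat_exp A) n"
proof (induction n)
  case (Suc n)
  show ?case using mat_exp_add_scale[OF assms[of 1] assms[of n]] by (simp add: Suc mat_pow_Suc)
qed simp

text \<open>The n-th term is at most (l |u|)^n by \<open>padic_abs_fact_ge\<close>. As l |u| \<le>
  1, all terms with n \<ge> 2 are bounded by the square, and so is their ultrametric sum.\<close>

lemma mat_exp_first_order:
  fixes u :: "'l::prime_card padic ^'n ^'n"
  assumes "summable (mat_exp_term u)" "mat_norm u \<le> 1 / real CARD('l)"
  shows "mat_norm (mat_exp u - mat 1 - u) \<le> (real CARD('l) * mat_norm u)\<^sup>2"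
proof -
  let ?p = "real CARD('l)"
  have pu: "?p * mat_norm u \<le> 1" using assms(2) CARD_pos[where 'l='l] by (simp add: field_simps)
  have trm: "mat_norm (mat_exp_term u n) \<le> (?p * mat_norm u)\<^sup>2" if "n \<ge> 2" for n
  proof -
    have f: "padic_abs (1 / fact n :: 'l padic) \<le> ?p ^ n"
    proof -
      have "padic_abs (fact n :: 'l padic) > 0"
        using padic_abs_nonneg[of "fact n :: 'l padic"] by (metis fact_nonzero less_eq_real_def padic_abs_eq_0)
      then show ?thesis using padic_abs_fact_ge[where 'l='l, of n] CARD_pos[where 'l='l]
        by (simp add: padic_abs_divide field_simps)
    qed
    have "mat_norm (mat_exp_term u n) \<le> ?p ^ n * mat_norm u ^ n"
      unfolding mat_exp_term_def mat_norm_scale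
      by (intro mult_mono f mat_norm_pow) auto
    also have "\<dots> = (?p * mat_norm u) ^ n" by (simp add: power_mult_distrib)
    also have "\<dots> \<le> (?p * mat_norm u)\<^sup>2" by (intro power_decreasing that pu) simp
    finally show ?thesis .
  qed
  have lim: "(\<lambda>N. \<Sum>n<N+2. mat_exp_term u n) \<longlonglongrightarrow> mat_exp u"
    unfolding mat_exp_def by (intro LIMSEQ_ignore_initial_segment summable_LIMSEQ assms)
  have "mat_norm ((\<Sum>n<N+2. mat_exp_term u n) - (mat 1 + u)) \<le> (?p * mat_norm u)\<^sup>2" for N
  proof -
    have "(\<Sum>n<N+2. mat_exp_term u n) = mat_exp_term u 0 + mat_exp_term u 1 + (\<Sum>n<N. mat_exp_term u (n + 2))"
      by (simp add: sum.lessThan_Suc_shift del: sum.lessThan_Suc)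
    then have "(\<Sum>n<N+2. mat_exp_term u n) - (mat 1 + u) = (\<Sum>n<N. mat_exp_term u (n + 2))"
      by (simp add: mat_exp_term_def mat_pow_Suc)
    then show ?thesis using trm by (simp only:) (intro mat_norm_sum_le, auto)
  qed
  from mat_norm_lim_le[OF lim this] show ?thesis by (simp add: algebra_simps)
qed

text \<open>Below l^-2 the quadratic error (l |u|)^2 is strictly smaller than |u|, and in an
  ultrametric a strictly smaller perturbation does not change the norm.\<close>

lemma mat_norm_exp_minus_one:
  fixes u :: "'l::prime_card padic ^'n ^'n"
  assumes "summable (mat_exp_term u)" "mat_norm u < 1 / (real CARD('l))\<^sup>2"
  shows "mat_norm (mat_exp u - mat 1) = mat_norm u"
proof (cases "u = 0")
  case False
  let ?p = "real CARD('l)"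
  have p1: "?p > 1" by (rule CARD_gt_1)
  have u0: "mat_norm u > 0" using False mat_norm_nonneg[of u] by (metis less_eq_real_def mat_norm_eq_0)
  have "1 / ?p\<^sup>2 \<le> 1 / ?p" using p1 by (simp add: field_simps power2_eq_square)
  then have "mat_norm (mat_exp u - mat 1 - u) \<le> (?p * mat_norm u)\<^sup>2"
    using assms by (intro mat_exp_first_order) auto
  also have "\<dots> = (?p\<^sup>2 * mat_norm u) * mat_norm u" by (simp add: power2_eq_square)
  also have "\<dots> < 1 * mat_norm u"
    using assms(2) p1 u0 by (intro mult_strict_right_mono) (auto simp: field_simps)
  finally have lt: "mat_norm (mat_exp u - mat 1 - u) < mat_norm u" by simp
  show ?thesis
  proof (rule antisym)
    show "mat_norm (mat_exp u - mat 1) \<le> mat_norm u"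
      using mat_norm_add[of "mat_exp u - mat 1 - u" u] lt by simp
    show "mat_norm u \<le> mat_norm (mat_exp u - mat 1)"
      using mat_norm_add[of "mat_exp u - mat 1" "- (mat_exp u - mat 1 - u)"] lt
      by (simp only: mat_norm_minus) (simp add: max_def split: if_splits)
  qed
qed simp

section \<open>Congruence subgroups\<close>

locale padic_matrix_group =
  fixes G :: "('l::prime_card padic ^'m::finite ^'m) set"
  assumes subgroup_GL: "subgroup G GL_padic_ints"
begin

lemma G_integral: "x \<in> G \<Longrightarrow> mat_norm x \<le> 1"
  using subgroup.subset[OF subgroup_GL] by (auto simp: GL_padic_ints_def padic_ints_def mat_norm_le_iff)

lemma G_one: "mat 1 \<in> G"
  using subgroup.one_closed[OF subgroup_GL] by (simp add: GL_padic_ints_def)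

lemma G_mult: "x \<in> G \<Longrightarrow> y \<in> G \<Longrightarrow> x ** y \<in> G"
  using subgroup.m_closed[OF subgroup_GL] by (simp add: GL_padic_ints_def)

text \<open>Two inverses have to be identified: closure of a subgroup is about the inverse in the
  monoid \<open>GL_padic_ints\<close>, while \<open>D1_op\<close> is written with
  \<open>matrix_inv\<close>. Both equal the two-sided inverse that the carrier provides.\<close>

lemma G_inv:
  assumes "x \<in> G"
  shows "matrix_inv x \<in> G" "x ** matrix_inv x = mat 1" "matrix_inv x ** x = mat 1"
proof -
  have "x \<in> carrier GL_padic_ints" using subgroup.subset[OF subgroup_GL] assms by blast
  then obtain B where B: "\<forall>i j. B $ i $ j \<in> padic_ints" "x ** B = mat 1" "B ** x = mat 1"
    and x: "\<forall>i j. x $ i $ j \<in> padic_ints" by (auto simp: GL_padic_ints_def)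
  have uniq: "C = B" if "x ** C = mat 1" for C
    using that B(3) by (metis matrix_mul_assoc matrix_mul_lid matrix_mul_rid)
  have "x ** matrix_inv x = mat 1 \<and> matrix_inv x ** x = mat 1"
    unfolding matrix_inv_def by (rule someI[of _ B]) (use B in auto)
  then show "x ** matrix_inv x = mat 1" "matrix_inv x ** x = mat 1" by auto
  then have "matrix_inv x = B" using uniq by blast
  moreover have "inv\<^bsub>GL_padic_ints\<^esub> x = B"
    unfolding m_inv_def
  proof (rule the_equality)
    show "B \<in> carrier GL_padic_ints \<and> x \<otimes>\<^bsub>GL_padic_ints\<^esub> B = \<one>\<^bsub>GL_padic_ints\<^esub> \<and> B \<otimes>\<^bsub>GL_padic_ints\<^esub> x = \<one>\<^bsub>GL_padic_ints\<^esub>"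
      using B x by (auto simp: GL_padic_ints_def)
    fix C assume "C \<in> carrier GL_padic_ints \<and> x \<otimes>\<^bsub>GL_padic_ints\<^esub> C = \<one>\<^bsub>GL_padic_ints\<^esub> \<and> C \<otimes>\<^bsub>GL_padic_ints\<^esub> x = \<one>\<^bsub>GL_padic_ints\<^esub>"
    then have "x ** C = mat 1" by (simp add: GL_padic_ints_def)
    then show "C = B" by (rule uniq)
  qed
  ultimately show "matrix_inv x \<in> G" using subgroup.m_inv_closed[OF subgroup_GL assms] by simp
qed

lemma matrix_inv_eqI:
  assumes "x \<in> G" "x ** y = mat 1"
  shows "matrix_inv x = y"
  using G_inv[OF assms(1)] assms(2) by (metis matrix_mul_assoc matrix_mul_lid matrix_mul_rid)

lemma matrix_inv_inv: "x \<in> G \<Longrightarrow> matrix_inv (matrix_inv x) = x"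
  by (rule matrix_inv_eqI) (use G_inv in auto)

lemma inv_mult_cancel: "x \<in> G \<Longrightarrow> matrix_inv x ** (x ** y) = y"
  and mult_inv_cancel: "x \<in> G \<Longrightarrow> x ** (matrix_inv x ** y) = y"
  and mult_cancel_inv: "x \<in> G \<Longrightarrow> (z ** x) ** matrix_inv x = z"
  and mult_inv_cancel_right: "x \<in> G \<Longrightarrow> (z ** matrix_inv x) ** x = z"
     apply (simp_all add: matrix_mul_assoc G_inv)
   apply (simp_all add: matrix_mul_assoc[symmetric] G_inv)
  done

text \<open>An element of G and its inverse both have norm at most 1, so neither multiplication can
  increase the norm.\<close>

lemma mat_norm_G_mult_left: "x \<in> G \<Longrightarrow> mat_norm (x ** A) = mat_norm A"
proof (rule antisym)
  assume x: "x \<in> G"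
  show "mat_norm (x ** A) \<le> mat_norm A"
    using mat_norm_mult_le[OF G_integral[OF x] order_refl, of A] by simp
  show "mat_norm A \<le> mat_norm (x ** A)"
    using mat_norm_mult_le[OF G_integral[OF G_inv(1)[OF x]] order_refl, of "x ** A"]
    by (simp add: inv_mult_cancel[OF x])
qed

lemma mat_norm_G_mult_right: "x \<in> G \<Longrightarrow> mat_norm (A ** x) = mat_norm A"
proof (rule antisym)
  assume x: "x \<in> G"
  show "mat_norm (A ** x) \<le> mat_norm A"
    using mat_norm_mult_le[OF order_refl G_integral[OF x], of A] by simp
  show "mat_norm A \<le> mat_norm (A ** x)"
    using mat_norm_mult_le[OF order_refl G_integral[OF G_inv(1)[OF x]], of "A ** x"]
    by (simp add: mult_cancel_inv[OF x])
qed

lemma G_pow: "x \<in> G \<Longrightarrow> mat_pow x n \<in> G"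
  by (induction n) (auto simp: mat_pow_Suc G_one G_mult)

text \<open>Lets the distance of an element from 1 be bounded below by that of a high power of it,
  where the exponential is isometric.\<close>

lemma mat_norm_pow_minus_one:
  assumes "x \<in> G"
  shows "mat_norm (mat_pow x n - mat 1) \<le> mat_norm (x - mat 1)"
proof (induction n)
  case (Suc n)
  have eq: "mat_pow x (Suc n) - mat 1 = x ** (mat_pow x n - mat 1) + (x - mat 1)"
    by (simp add: mat_pow_Suc matrix_diff_ldistrib)
  show ?case unfolding eq
    by (rule mat_norm_add_le) (use Suc in \<open>simp_all add: mat_norm_G_mult_left[OF assms]\<close>)
qed simp

lemma conj_pow:
  assumes "z \<in> G"
  shows "z ** mat_pow x n ** matrix_inv z = mat_pow (z ** x ** matrix_inv z) n"
proof (induction n)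
  case (Suc n)
  have "z ** mat_pow x (Suc n) ** matrix_inv z = (z ** x ** matrix_inv z) ** (z ** mat_pow x n ** matrix_inv z)"
    using G_inv[OF assms] by (metis mat_pow_Suc matrix_mul_assoc matrix_mul_lid)
  then show ?case by (simp add: Suc mat_pow_Suc)
qed (simp add: G_inv assms)

lemma conj_closed: "z \<in> G \<Longrightarrow> x \<in> G \<Longrightarrow> z ** x ** matrix_inv z \<in> G"
  by (intro G_mult G_inv)

definition congruence_subgroup :: "nat \<Rightarrow> ('l padic ^'m ^'m) set" where
  "congruence_subgroup j = {x \<in> G. mat_norm (x - mat 1) \<le> 1 / real CARD('l) ^ j}"

abbreviation "K \<equiv> congruence_subgroup"

lemma K_subset_G: "K j \<subseteq> G" by (auto simp: congruence_subgroup_def)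

lemma K_0: "K 0 = G"
  unfolding congruence_subgroup_def by (auto intro: mat_norm_diff_le G_integral)

lemma K_one: "mat 1 \<in> K j" by (simp add: congruence_subgroup_def G_one)

lemma K_antimono: "i \<le> j \<Longrightarrow> K j \<subseteq> K i"
proof -
  assume "i \<le> j"
  then have "1 / real CARD('l) ^ j \<le> 1 / real CARD('l) ^ i"
    using CARD_gt_1[where 'l='l] by (intro divide_left_mono power_increasing) auto
  then show ?thesis by (auto simp: congruence_subgroup_def)
qed

lemma mat_norm_inv_mult_minus_one:
  assumes "x \<in> G"
  shows "mat_norm (matrix_inv x ** y - mat 1) = mat_norm (y - x)"
proof -
  have "matrix_inv x ** y - mat 1 = matrix_inv x ** (y - x)"
    by (simp add: matrix_diff_ldistrib G_inv[OF assms])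
  then show ?thesis by (simp add: mat_norm_G_mult_left G_inv assms)
qed

lemma K_inv_mult_iff:
  "x \<in> G \<Longrightarrow> y \<in> G \<Longrightarrow> matrix_inv x ** y \<in> K j \<longleftrightarrow> mat_norm (y - x) \<le> 1 / real CARD('l) ^ j"
  by (simp add: congruence_subgroup_def G_mult G_inv mat_norm_inv_mult_minus_one)

lemma K_mult: "x \<in> K j \<Longrightarrow> y \<in> K j \<Longrightarrow> x ** y \<in> K j"
proof -
  assume a: "x \<in> K j" "y \<in> K j"
  have eq: "x ** y - mat 1 = x ** (y - mat 1) + (x - mat 1)" by (simp add: matrix_diff_ldistrib)
  have "mat_norm (x ** y - mat 1) \<le> 1 / real CARD('l) ^ j" unfolding eq
    by (rule mat_norm_add_le) (use a in \<open>simp_all add: congruence_subgroup_def mat_norm_G_mult_left\<close>)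
  then show ?thesis using a by (simp add: congruence_subgroup_def G_mult)
qed

lemma K_inv: "x \<in> K j \<Longrightarrow> matrix_inv x \<in> K j"
  using mat_norm_inv_mult_minus_one[of x "mat 1"]
  by (auto simp: congruence_subgroup_def G_inv mat_norm_diff_commute)

lemma K_conj_iff:
  assumes "z \<in> G" "x \<in> G"
  shows "z ** x ** matrix_inv z \<in> K j \<longleftrightarrow> x \<in> K j"
proof -
  have "z ** x ** matrix_inv z - mat 1 = z ** (x - mat 1) ** matrix_inv z"
    by (simp add: matrix_diff_ldistrib matrix_diff_rdistrib G_inv assms)
  then show ?thesis using assms
    by (simp add: congruence_subgroup_def conj_closed mat_norm_G_mult_left mat_norm_G_mult_right G_inv)
qed

text \<open>Splits G without the identity into the shells \<open>K j\<close> minus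
  \<open>K (Suc j)\<close>, on which the kernel of D^1 is estimated. The shell exists because level
  0 is all of G and a positive distance from 1 exceeds some l^-n.\<close>

lemma ex_not_K:
  assumes "x \<in> G" "x \<noteq> mat 1"
  obtains j where "x \<in> K j" "x \<notin> K (Suc j)"
proof -
  let ?p = "real CARD('l)"
  have "mat_norm (x - mat 1) > 0" using assms(2) by (metis mat_norm_eq_0 mat_norm_nonneg eq_iff_diff_eq_0 less_eq_real_def)
  moreover have "(\<lambda>n. 1 / ?p ^ n) \<longlonglongrightarrow> 0"
    using LIMSEQ_realpow_zero[of "1 / ?p"] CARD_gt_1[where 'l='l] by (simp add: power_divide)
  ultimately obtain n where "1 / ?p ^ n < mat_norm (x - mat 1)"
    using order_tendstoD(2) eventually_happens'[OF sequentially_bot] by blast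
  then have ex: "\<exists>n. x \<notin> K n" by (auto simp: congruence_subgroup_def intro!: exI[of _ n])
  define j where "j = (LEAST n. x \<notin> K n)"
  have j: "x \<notin> K j" unfolding j_def using ex by (rule LeastI_ex)
  then have "j \<noteq> 0" using assms(1) K_0 by metis
  then obtain i where i: "j = Suc i" using not0_implies_Suc by blast
  then have "x \<in> K i" using not_less_Least[of i "\<lambda>n. x \<notin> K n"] by (auto simp: j_def)
  then show ?thesis using that j i by blast
qed

end

section \<open>The norm of the Lie group\<close>

definition vec_norm :: "'l::prime_card padic ^'d \<Rightarrow> real" where
  "vec_norm x = (MAX j. padic_abs (x $ j))"

lemma vec_norm_le_iff: "vec_norm x \<le> r \<longleftrightarrow> (\<forall>j. padic_abs (x $ j) \<le> r)"
  unfolding vec_norm_def by (subst Max_le_iff) auto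

lemma vec_norm_entry: "padic_abs (x $ j) \<le> vec_norm x"
  using vec_norm_le_iff by blast

lemma vec_norm_nonneg [simp]: "vec_norm x \<ge> 0"
  using vec_norm_entry[of x] padic_abs_nonneg by (meson order_trans)

lemma vec_norm_minus [simp]: "vec_norm (- x) = vec_norm x"
  unfolding vec_norm_def by simp

lemma vec_norm_add_le: "vec_norm x \<le> r \<Longrightarrow> vec_norm y \<le> r \<Longrightarrow> vec_norm (x + y) \<le> r"
  unfolding vec_norm_le_iff by (auto intro: order_trans[OF padic_abs_add])

lemma vec_norm_diff_le: "vec_norm x \<le> r \<Longrightarrow> vec_norm y \<le> r \<Longrightarrow> vec_norm (x - y) \<le> r"
  using vec_norm_add_le[of x r "- y"] by simp

lemma vec_norm_eq_0 [simp]: "vec_norm x = 0 \<longleftrightarrow> x = 0"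
proof -
  have "vec_norm x = 0 \<longleftrightarrow> vec_norm x \<le> 0" using vec_norm_nonneg[of x] by linarith
  also have "\<dots> \<longleftrightarrow> (\<forall>i. x $ i = 0)"
    unfolding vec_norm_le_iff by (metis padic_abs_eq_0 padic_abs_nonneg order_antisym order_refl)
  finally show ?thesis by (simp add: Finite_Cartesian_Product.vec_eq_iff)
qed

lemma vec_norm_0 [simp]: "vec_norm 0 = 0" by simp

lemma vec_norm_attained: "\<exists>j. vec_norm x = padic_abs (x $ j)"
proof -
  have "vec_norm x \<in> range (\<lambda>j. padic_abs (x $ j))"
    unfolding vec_norm_def by (rule Max_in) auto
  then show ?thesis by blast
qed

lemma vec_norm_scale: "vec_norm (c *s x) = padic_abs c * vec_norm x"
proof (rule antisym)
  show "vec_norm (c *s x) \<le> padic_abs c * vec_norm x"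
    unfolding vec_norm_le_iff by (auto simp: padic_abs_mult vec_norm_entry intro!: mult_left_mono)
  obtain j where "vec_norm x = padic_abs (x $ j)" using vec_norm_attained by blast
  then show "padic_abs c * vec_norm x \<le> vec_norm (c *s x)"
    using vec_norm_entry[of "c *s x" j] by (simp add: padic_abs_mult)
qed

lemma padic_int_vecs_iff: "x \<in> padic_int_vecs \<longleftrightarrow> vec_norm x \<le> 1"
  by (simp add: padic_int_vecs_def padic_ints_def vec_norm_le_iff)

lemma vec_norm_value:
  fixes x :: "'l::prime_card padic ^'d"
  assumes "vec_norm x \<le> 1" "x \<noteq> 0"
  obtains k :: nat where "vec_norm x = 1 / real CARD('l) ^ k"
proof -
  let ?p = "real CARD('l)"
  obtain j where j: "vec_norm x = padic_abs (x $ j)" using vec_norm_attained by blast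
  then have "x $ j \<noteq> 0" using assms(2) by (metis padic_abs_eq_0 vec_norm_eq_0)
  then obtain e where e: "padic_abs (x $ j) = ?p powi e" using padic_abs_value by blast
  have "e \<le> 0"
  proof (rule ccontr)
    assume "\<not> e \<le> 0"
    then have "?p powi e > 1" using CARD_gt_1[where 'l='l] by (simp add: power_int_def)
    then show False using assms(1) j e by simp
  qed
  then have "?p powi e = 1 / ?p ^ nat (- e)"
    by (auto simp: power_int_def field_simps)
  then show ?thesis using that j e by simp
qed

lemma lie_comb_add: "lie_comb X (x + y) = lie_comb X x + lie_comb X y"
  by (simp add: lie_comb_def scale_add_left sum.distrib)

lemma lie_comb_scale: "lie_comb X (c *s x) = c *m lie_comb X x"
  by (simp add: lie_comb_def scale_sum_right scale_scale)

lemma lie_comb_0 [simp]: "lie_comb X 0 = 0"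
  by (simp add: lie_comb_def)

lemma lie_comb_minus: "lie_comb X (- x) = - lie_comb X x"
  using lie_comb_add[of X x "- x"] by (simp add: eq_neg_iff_add_eq_0 add.commute)

lemma lie_comb_diff: "lie_comb X (x - y) = lie_comb X x - lie_comb X y"
  using lie_comb_add[of X x "- y"] by (simp add: lie_comb_minus)

lemma mat_norm_lie_comb_bound:
  fixes X :: "'d::finite \<Rightarrow> 'l::prime_card padic ^'m::finite ^'m"
  obtains C where "C \<ge> 1" "\<And>x. mat_norm (lie_comb X x) \<le> C * vec_norm x"
proof
  let ?C = "1 + (\<Sum>j\<in>UNIV. mat_norm (X j))"
  have s: "(\<Sum>j\<in>UNIV. mat_norm (X j)) \<ge> 0" by (simp add: sum_nonneg)
  then show "?C \<ge> 1" by simp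
  have m: "mat_norm (X j) \<le> ?C" for j
    using member_le_sum[of j UNIV "\<lambda>j. mat_norm (X j)"] by simp
  fix x
  show "mat_norm (lie_comb X x) \<le> ?C * vec_norm x"
    unfolding lie_comb_def
  proof (rule mat_norm_sum_le)
    show "?C * vec_norm x \<ge> 0" using s by simp
    fix j
    have "mat_norm (x $ j *m X j) \<le> vec_norm x * ?C"
      unfolding mat_norm_scale by (intro mult_mono vec_norm_entry m) auto
    then show "mat_norm (x $ j *m X j) \<le> ?C * vec_norm x" by (simp add: mult.commute)
  qed
qed

lemma padic_scale_to_int:
  fixes x :: "'l::prime_card padic ^'d"
  obtains n where "vec_norm (of_nat (CARD('l) ^ n) *s x) \<le> 1"
proof -
  let ?p = "real CARD('l)"
  obtain n where n: "vec_norm x < ?p ^ n" using real_arch_pow[OF CARD_gt_1[where 'l='l]] by blast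
  have "vec_norm (of_nat (CARD('l) ^ n) *s x) = vec_norm x / ?p ^ n"
    by (simp add: vec_norm_scale padic_abs_power padic_abs_prime power_divide)
  then show ?thesis using n that[of n] by (simp add: divide_le_eq)
qed

text \<open>A vector in the kernel becomes integral after multiplication by a power of l, so
  injectivity on integral vectors extends to the whole space over the l-adic field. The map then has
  a linear left inverse, and the entries of its matrix give the constant.\<close>

lemma vec_norm_lie_comb_bound:
  fixes X :: "'d::finite \<Rightarrow> 'l::prime_card padic ^'m::finite ^'m"
  assumes "inj_on (lie_comb X) padic_int_vecs"
  obtains C where "C \<ge> 1" "\<And>x. vec_norm x \<le> C * mat_norm (lie_comb X x)"
proof -
  \<comment> \<open>The matrix entries are listed as a vector indexed by pairs, so that the left
    inverse is given by a matrix.\<close>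
  define \<phi> :: "'l padic ^'d \<Rightarrow> 'l padic ^('m \<times> 'm)" where
    "\<phi> = (\<lambda>x. \<chi> i. lie_comb X x $ fst i $ snd i)"
  have ker: "x = 0" if "lie_comb X x = 0" for x
  proof -
    obtain n where n: "vec_norm (of_nat (CARD('l) ^ n) *s x) \<le> 1" using padic_scale_to_int by blast
    have "lie_comb X (of_nat (CARD('l) ^ n) *s x) = lie_comb X 0" by (simp add: lie_comb_scale that)
    then have "of_nat (CARD('l) ^ n) *s x = 0"
      by (rule inj_onD[OF assms]) (use n in \<open>simp_all add: padic_int_vecs_iff del: of_nat_power\<close>)
    then have "vec_norm (of_nat (CARD('l) ^ n) *s x) = 0" by (simp only: vec_norm_eq_0)
    then show ?thesis by (simp add: vec_norm_scale padic_abs_power padic_abs_prime)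
  qed
  have lin: "Vector_Spaces.linear (*s) (*s) \<phi>"
    by unfold_locales (simp_all add: \<phi>_def lie_comb_add lie_comb_scale Finite_Cartesian_Product.vec_eq_iff)
  have "inj \<phi>"
  proof (rule injI)
    fix x y assume "\<phi> x = \<phi> y"
    then have "lie_comb X x = lie_comb X y" by (auto simp: \<phi>_def Finite_Cartesian_Product.vec_eq_iff)
    then show "x = y" using ker[of "x - y"] by (simp add: lie_comb_diff)
  qed
  then obtain \<psi> where \<psi>: "Vector_Spaces.linear (*s) (*s) \<psi>" "\<psi> \<circ> \<phi> = id"
    using vec.linear_injective_left_inverse[OF lin] by blast
  define M where "M = matrix \<psi>"
  have M: "M *v \<phi> x = x" for x
    using matrix_works[OF \<psi>(1), of "\<phi> x"] \<psi>(2) by (simp add: M_def o_def fun_eq_iff)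
  show ?thesis
  proof (rule that[of "mat_norm M + 1"])
    fix x
    have "vec_norm (M *v \<phi> x) \<le> (mat_norm M + 1) * mat_norm (lie_comb X x)"
      unfolding vec_norm_le_iff matrix_vector_mult_def
      by (auto intro!: padic_abs_sum_le mult_mono order_trans[OF mat_norm_entry] mat_norm_entry simp: padic_abs_mult \<phi>_def)
    then show "vec_norm x \<le> (mat_norm M + 1) * mat_norm (lie_comb X x)" by (simp add: M)
  qed simp
qed

section \<open>Exponential coordinates on the group\<close>

sublocale compact_nilpotent_padic_Lie_group \<subseteq> padic_matrix_group G
  by (rule padic_matrix_group.intro) (rule subgroup)

context compact_nilpotent_padic_Lie_group
begin

lemma exp_coord_in_G: "vec_norm x \<le> 1 \<Longrightarrow> exp_coord X x \<in> G"
  using exp_bij by (auto simp: bij_betw_def padic_int_vecs_iff)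

lemma group_norm_exp_coord: "vec_norm x \<le> 1 \<Longrightarrow> group_norm X (exp_coord X x) = vec_norm x"
  using exp_bij by (simp add: group_norm_def vec_norm_def[symmetric] bij_betw_def padic_int_vecs_iff inv_into_f_f)

lemma G_exp_cases:
  assumes "h \<in> G"
  obtains x where "vec_norm x \<le> 1" "h = exp_coord X x"
  using assms exp_bij by (auto simp: bij_betw_def padic_int_vecs_iff)

lemma exp_coord_inj: "vec_norm x \<le> 1 \<Longrightarrow> vec_norm y \<le> 1 \<Longrightarrow> exp_coord X x = exp_coord X y \<longleftrightarrow> x = y"
  using exp_bij by (auto simp: bij_betw_def padic_int_vecs_iff inj_on_def)

lemma summable_exp: "vec_norm x \<le> 1 \<Longrightarrow> summable (mat_exp_term (lie_comb X x))"
  by (rule exp_converges) (auto simp: lie_lattice_def padic_int_vecs_iff)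

lemma vec_norm_of_nat_scale:
  fixes x :: "'l padic ^'d"
  shows "vec_norm x \<le> r \<Longrightarrow> vec_norm (of_nat n *s x) \<le> r"
  using mult_right_mono[OF padic_abs_of_nat_le_1[where 'l='l, of n], of "vec_norm x"] by (simp add: vec_norm_scale)

lemma exp_coord_of_nat_scale:
  assumes "vec_norm x \<le> 1"
  shows "exp_coord X (of_nat n *s x) = mat_pow (exp_coord X x) n"
  unfolding exp_coord_def lie_comb_scale
  by (rule mat_exp_of_nat_scale)
     (use summable_exp[OF vec_norm_of_nat_scale[OF assms]] in \<open>simp add: lie_comb_scale\<close>)

lemma exp_coord_0 [simp]: "exp_coord X 0 = mat 1"
  by (simp add: exp_coord_def)

lemma exp_coord_minus:
  assumes "vec_norm x \<le> 1"
  shows "exp_coord X (- x) = matrix_inv (exp_coord X x)"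
proof -
  have m: "lie_comb X (- x) = (-1) *m lie_comb X x"
    by (simp add: lie_comb_minus Finite_Cartesian_Product.vec_eq_iff)
  have "summable (mat_exp_term ((-1) *m lie_comb X x))"
    using summable_exp[of "- x"] assms by (simp add: m)
  then have "mat_exp ((1 + -1) *m lie_comb X x) = mat_exp (1 *m lie_comb X x) ** mat_exp ((-1) *m lie_comb X x)"
    using summable_exp[OF assms] by (intro mat_exp_add_scale) simp_all
  then have "exp_coord X x ** exp_coord X (- x) = mat 1"
    unfolding exp_coord_def m by simp
  then show ?thesis using matrix_inv_eqI exp_coord_in_G[OF assms] by metis
qed

lemma group_norm_nonneg: "h \<in> G \<Longrightarrow> group_norm X h \<ge> 0"
  and group_norm_le_1: "h \<in> G \<Longrightarrow> group_norm X h \<le> 1"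
  by (metis G_exp_cases group_norm_exp_coord vec_norm_nonneg)+

lemma group_norm_eq_0_iff: "h \<in> G \<Longrightarrow> group_norm X h = 0 \<longleftrightarrow> h = mat 1"
  using exp_coord_inj[of _ 0] by (elim G_exp_cases) (auto simp: group_norm_exp_coord)

lemma group_norm_inv: "h \<in> G \<Longrightarrow> group_norm X (matrix_inv h) = group_norm X h"
  by (elim G_exp_cases) (simp add: group_norm_exp_coord exp_coord_minus[symmetric])

lemma group_norm_value:
  assumes "h \<in> G" "h \<noteq> mat 1"
  obtains k :: nat where "group_norm X h = 1 / real CARD('l) ^ k"
proof -
  obtain x where x: "vec_norm x \<le> 1" "h = exp_coord X x" using assms(1) by (rule G_exp_cases)
  then have "x \<noteq> 0" using assms(2) by auto
  then show ?thesis using vec_norm_value[OF x(1)] that x by (metis group_norm_exp_coord)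
qed

text \<open>A vector of norm at most l^-k is l^k times an integral vector, and multiplying the
  coordinates by l^k is the same as raising the group element to the power l^k.\<close>

lemma group_norm_le_iff_power:
  assumes "h \<in> G"
  shows "group_norm X h \<le> 1 / real CARD('l) ^ k \<longleftrightarrow> (\<exists>g\<in>G. h = mat_pow g (CARD('l) ^ k))"
proof
  have p0: "(of_nat (CARD('l) ^ k) :: 'l padic) \<noteq> 0"
    using prime_gt_0_nat[OF prime_card[where 'a='l]] by simp
  have pa: "padic_abs (of_nat (CARD('l) ^ k) :: 'l padic) = 1 / real CARD('l) ^ k"
    by (simp add: padic_abs_power padic_abs_prime power_divide)
  {
    assume le: "group_norm X h \<le> 1 / real CARD('l) ^ k"
    obtain x where x: "vec_norm x \<le> 1" "h = exp_coord X x" using assms(1) by (rule G_exp_cases)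
    define y where "y = inverse (of_nat (CARD('l) ^ k)) *s x"
    have y: "vec_norm y \<le> 1"
      unfolding y_def vec_norm_scale padic_abs_inverse pa
      using le x by (simp add: group_norm_exp_coord field_simps)
    have "of_nat (CARD('l) ^ k) *s y = x"
      unfolding y_def using p0 by (simp add: vector_smult_assoc del: of_nat_power)
    then have "h = mat_pow (exp_coord X y) (CARD('l) ^ k)"
      using exp_coord_of_nat_scale[OF y, of "CARD('l) ^ k"] x by simp
    then show "\<exists>g\<in>G. h = mat_pow g (CARD('l) ^ k)" using exp_coord_in_G[OF y] by blast
  }
  assume "\<exists>g\<in>G. h = mat_pow g (CARD('l) ^ k)"
  then obtain g where g: "g \<in> G" "h = mat_pow g (CARD('l) ^ k)" by blast
  obtain x where "vec_norm x \<le> 1" "g = exp_coord X x" using g(1) by (rule G_exp_cases)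
  with g have x: "vec_norm x \<le> 1" "h = mat_pow (exp_coord X x) (CARD('l) ^ k)" by simp_all
  then have "h = exp_coord X (of_nat (CARD('l) ^ k) *s x)" by (simp only: exp_coord_of_nat_scale)
  then have "group_norm X h = vec_norm (of_nat (CARD('l) ^ k) *s x)"
    using group_norm_exp_coord[OF vec_norm_of_nat_scale[OF x(1)], of "CARD('l) ^ k"] by (simp only:)
  also have "\<dots> \<le> 1 / real CARD('l) ^ k"
    unfolding vec_norm_scale pa using x(1) by (simp add: divide_right_mono)
  finally show "group_norm X h \<le> 1 / real CARD('l) ^ k" .
qed

text \<open>Conjugation commutes with the power map, so it cannot increase the norm; applied to the
  inverse conjugation this gives equality.\<close>

lemma group_norm_conj:
  assumes "z \<in> G" "h \<in> G"
  shows "group_norm X (z ** h ** matrix_inv z) = group_norm X h"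
proof -
  have le: "group_norm X (z ** h ** matrix_inv z) \<le> group_norm X h" if zG: "z \<in> G" and hG: "h \<in> G" for z h
  proof (cases "h = mat 1")
    case True
    then show ?thesis using zG by (simp add: G_inv)
  next
    case False
    then obtain k where k: "group_norm X h = 1 / real CARD('l) ^ k" using group_norm_value[OF hG] by blast
    then obtain g where g: "g \<in> G" "h = mat_pow g (CARD('l) ^ k)"
      using group_norm_le_iff_power[OF hG, of k] by auto
    then have "z ** h ** matrix_inv z = mat_pow (z ** g ** matrix_inv z) (CARD('l) ^ k)"
      by (simp add: conj_pow zG)
    moreover have c: "z ** g ** matrix_inv z \<in> G" using zG g(1) by (rule conj_closed)
    ultimately show ?thesis unfolding k using group_norm_le_iff_power[OF G_pow[OF c]] by auto
  qed
  have "group_norm X (matrix_inv z ** (z ** h ** matrix_inv z) ** matrix_inv (matrix_inv z)) \<le> group_norm X (z ** h ** matrix_inv z)"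
    by (rule le) (use assms G_inv conj_closed in auto)
  moreover have "matrix_inv z ** (z ** h ** matrix_inv z) ** matrix_inv (matrix_inv z) = h"
    using assms by (simp add: matrix_inv_inv matrix_mul_assoc G_inv) (simp add: matrix_mul_assoc[symmetric] G_inv)
  ultimately show ?thesis using le[OF assms] by simp
qed

text \<open>The second estimate is proved at the l^N-th power: its logarithm has norm below l^-2,
  where \<open>mat_norm_exp_minus_one\<close> applies, and passing to a power does not increase the
  distance from 1. The factor l^N in the conclusion undoes the scaling.\<close>

lemma small_multiple:
  obtains N :: nat and C where "C \<ge> 1" "\<And>x. mat_norm (lie_comb X x) \<le> C * vec_norm x"
    "\<And>x. vec_norm x \<le> 1 \<Longrightarrow> mat_norm (lie_comb X x) \<le> real CARD('l) ^ N * mat_norm (exp_coord X x - mat 1)"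
proof -
  let ?p = "real CARD('l)"
  have p0: "?p > 0" by simp
  obtain C where C: "C \<ge> 1" "\<And>x. mat_norm (lie_comb X x) \<le> C * vec_norm x"
    by (rule mat_norm_lie_comb_bound[of X], rule that)
  \<comment> \<open>All integral coordinate vectors have logarithms of norm at most C, so this
    single N works for the whole group.\<close>
  obtain N where N: "?p\<^sup>2 * C < ?p ^ N" using real_arch_pow[OF CARD_gt_1[where 'l='l]] by blast
  have "mat_norm (lie_comb X x) \<le> ?p ^ N * mat_norm (exp_coord X x - mat 1)" if x: "vec_norm x \<le> 1" for x
  proof -
    let ?u = "lie_comb X (of_nat (CARD('l) ^ N) *s x)"
    have pa: "padic_abs (of_nat (CARD('l) ^ N) :: 'l padic) = 1 / ?p ^ N"
      by (simp add: padic_abs_power padic_abs_prime power_divide)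
    have u: "mat_norm ?u = mat_norm (lie_comb X x) / ?p ^ N"
      unfolding lie_comb_scale mat_norm_scale pa by simp
    have "mat_norm (lie_comb X x) \<le> C * 1"
      using C(2)[of x] mult_left_mono[OF x, of C] C(1) by linarith
    then have "mat_norm ?u \<le> C / ?p ^ N" unfolding u by (simp add: divide_right_mono)
    also have "\<dots> < 1 / ?p\<^sup>2" using N p0 by (simp add: field_simps)
    finally have "mat_norm (mat_exp ?u - mat 1) = mat_norm ?u"
      using summable_exp[OF vec_norm_of_nat_scale[OF x]] by (intro mat_norm_exp_minus_one)
    moreover have "mat_exp ?u = mat_pow (exp_coord X x) (CARD('l) ^ N)"
      using exp_coord_of_nat_scale[OF x, of "CARD('l) ^ N"] by (simp only: exp_coord_def)
    ultimately have "mat_norm ?u \<le> mat_norm (exp_coord X x - mat 1)"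
      using mat_norm_pow_minus_one[OF exp_coord_in_G[OF x], of "CARD('l) ^ N"] by simp
    then show ?thesis unfolding u using p0 by (simp add: field_simps)
  qed
  then show ?thesis using that[OF C] by blast
qed

lemma group_norm_bounds:
  obtains a b where "a > 0" "b > 0"
    "\<And>h. h \<in> G \<Longrightarrow> mat_norm (h - mat 1) \<le> a * group_norm X h"
    "\<And>h. h \<in> G \<Longrightarrow> group_norm X h \<le> b * mat_norm (h - mat 1)"
proof -
  let ?p = "real CARD('l)"
  have p1: "?p > 1" by (rule CARD_gt_1)
  obtain N C where C: "C \<ge> 1" "\<And>x. mat_norm (lie_comb X x) \<le> C * vec_norm x"
    "\<And>x. vec_norm x \<le> 1 \<Longrightarrow> mat_norm (lie_comb X x) \<le> ?p ^ N * mat_norm (exp_coord X x - mat 1)"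
    by (rule small_multiple, rule that)
  obtain D where D: "D \<ge> 1" "\<And>x. vec_norm x \<le> D * mat_norm (lie_comb X x)"
    by (rule vec_norm_lie_comb_bound[OF lie_basis], rule that)
  show ?thesis
  proof (rule that[of "?p\<^sup>2 * C" "D * ?p ^ N"])
    show "?p\<^sup>2 * C > 0" "D * ?p ^ N > 0" using C(1) D(1) p1 by simp_all
    fix h assume h: "h \<in> G"
    obtain x where x: "vec_norm x \<le> 1" "h = exp_coord X x" using h by (rule G_exp_cases)
    have gn: "group_norm X h = vec_norm x" using x by (simp add: group_norm_exp_coord)
    have "vec_norm x \<le> D * (?p ^ N * mat_norm (h - mat 1))"
      using D(2)[of x] mult_left_mono[OF C(3)[OF x(1)], of D] D(1) unfolding x(2) by linarith
    then show "group_norm X h \<le> D * ?p ^ N * mat_norm (h - mat 1)" by (simp add: gn mult.assoc)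
    have CC: "C * vec_norm x \<le> ?p\<^sup>2 * C * vec_norm x"
      using C(1) p1 by (intro mult_right_mono) auto
    show "mat_norm (h - mat 1) \<le> ?p\<^sup>2 * C * group_norm X h"
    proof (cases "mat_norm (lie_comb X x) < 1 / ?p\<^sup>2")
      case True
      then have "mat_norm (h - mat 1) = mat_norm (lie_comb X x)"
        using mat_norm_exp_minus_one[OF summable_exp[OF x(1)]] x(2) by (simp add: exp_coord_def)
      then show ?thesis using C(2)[of x] CC by (simp add: gn)
    next
      \<comment> \<open>Where the exponential is not known to be isometric,
        \<open>vec_norm x\<close> is at least 1 / (l^2 C), while h - 1 has norm at most 1 because h
        and 1 are integral. The factor l^2 in the constant comes from here.\<close>
      case False
      then have "1 / ?p\<^sup>2 \<le> C * vec_norm x" using C(2)[of x] by linarith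
      then have "1 \<le> ?p\<^sup>2 * C * vec_norm x" using p1 by (simp add: field_simps)
      moreover have "mat_norm (h - mat 1) \<le> 1" using h by (intro mat_norm_diff_le G_integral G_one)
      ultimately show ?thesis by (simp add: gn)
    qed
  qed
qed

text \<open>Let A, B, W be the logarithms of the two factors and of their product. All of them have
  norm of order l^-k, and W - A - B consists of quadratic errors, of order l^-2k. Once k is large
  enough to absorb the constants, this is below l^-(k+1).\<close>

lemma exp_coord_mult_close:
  obtains n0 :: nat where
    "\<And>k a b. k \<ge> n0 \<Longrightarrow> vec_norm a \<le> 1 / real CARD('l) ^ k \<Longrightarrow> vec_norm b \<le> 1 / real CARD('l) ^ k \<Longrightarrow>
      \<exists>w. vec_norm w \<le> 1 \<and> exp_coord X a ** exp_coord X b = exp_coord X w \<and>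
        vec_norm (w - a - b) \<le> 1 / real CARD('l) ^ Suc k"
proof -
  let ?p = "real CARD('l)"
  have p1: "?p > 1" by (rule CARD_gt_1)
  have p0: "?p > 0" by simp
  obtain N C where C: "C \<ge> 1" "\<And>x. mat_norm (lie_comb X x) \<le> C * vec_norm x"
    "\<And>x. vec_norm x \<le> 1 \<Longrightarrow> mat_norm (lie_comb X x) \<le> ?p ^ N * mat_norm (exp_coord X x - mat 1)"
    by (rule small_multiple, rule that)
  obtain D where D: "D \<ge> 1" "\<And>x. vec_norm x \<le> D * mat_norm (lie_comb X x)"
    by (rule vec_norm_lie_comb_bound[OF lie_basis], rule that)
  have pN: "?p ^ N \<ge> 1" using p1 by (intro one_le_power) simp
  \<comment> \<open>Exactly what D (l s)^2 \<le> l^-(k+1) requires for s = l^N C / l^k; it also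
    keeps s below l^-2.\<close>
  obtain n0 where n0: "?p ^ 3 * D * (?p ^ N * C)\<^sup>2 < ?p ^ n0" using real_arch_pow[OF p1] by blast
  show ?thesis
  proof (rule that[of n0])
    fix k :: nat and a b :: "'l padic ^'d"
    assume k: "k \<ge> n0" and a: "vec_norm a \<le> 1 / ?p ^ k" and b: "vec_norm b \<le> 1 / ?p ^ k"
    define t where "t = C / ?p ^ k"
    \<comment> \<open>The bound t holds for A and B. The logarithm of the product is estimated only
      through its exponential, at a loss of l^N, so the common bound is s.\<close>
    define s where "s = ?p ^ N * t"
    have pk: "?p ^ n0 \<le> ?p ^ k" using k p1 by (intro power_increasing) auto
    have t0: "t > 0" using C(1) p0 by (simp add: t_def)
    have ts: "t \<le> s" unfolding s_def using mult_right_mono[OF pN, of t] t0 by simp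
    have M1: "1 \<le> ?p ^ N * C" using mult_mono[OF pN C(1)] by simp
    have big: "?p ^ 3 * D * (?p ^ N * C)\<^sup>2 < ?p ^ k" using n0 pk by linarith
    have spk: "s = ?p ^ N * C / ?p ^ k" by (simp add: s_def t_def)
    have "?p\<^sup>2 * (?p ^ N * C) \<le> ?p ^ 3 * D * (?p ^ N * C)\<^sup>2"
    proof -
      have "?p\<^sup>2 * (?p ^ N * C) \<le> (?p\<^sup>2 * (?p ^ N * C)) * (?p * D * (?p ^ N * C))"
      proof -
        have "1 \<le> ?p * D * (?p ^ N * C)"
          using mult_mono[OF mult_mono[OF less_imp_le[OF p1] D(1)] M1] p0 D(1) by simp
        then show ?thesis using mult_left_mono[of 1 _ "?p\<^sup>2 * (?p ^ N * C)"] M1 p0 by simp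
      qed
      then show ?thesis by (simp add: power2_eq_square power3_eq_cube mult_ac)
    qed
    then have "?p\<^sup>2 * (?p ^ N * C) < ?p ^ k" using big by linarith
    then have s_small: "s < 1 / ?p\<^sup>2" unfolding spk using p0 by (simp add: field_simps)
    have s0: "s > 0" using t0 ts by linarith
    have s_p: "s \<le> 1 / ?p" using s_small p1 
    proof -
      have "1 / ?p\<^sup>2 \<le> 1 / ?p" using p1 by (simp add: field_simps power2_eq_square)
      then show ?thesis using s_small by linarith
    qed
    have pk1: "1 / ?p ^ k \<le> 1" using p1 by (simp add: one_le_power)
    have a1: "vec_norm a \<le> 1" and b1: "vec_norm b \<le> 1" using a b pk1 by linarith+
    have small: "mat_norm (lie_comb X c) \<le> t" if "vec_norm c \<le> 1 / ?p ^ k" for c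
      using C(2)[of c] mult_left_mono[OF that, of C] C(1) by (simp add: t_def)
    let ?A = "lie_comb X a" and ?B = "lie_comb X b"
    let ?e = "(?p * s)\<^sup>2"
    have step: "mat_norm (mat_exp U - mat 1 - U) \<le> ?e" if "mat_norm U \<le> s" "summable (mat_exp_term U)" for U :: "'l padic^'m^'m"
    proof -
      have "mat_norm (mat_exp U - mat 1 - U) \<le> (?p * mat_norm U)\<^sup>2"
        using that s_p by (intro mat_exp_first_order) auto
      also have "\<dots> \<le> ?e" using that p0 by (intro power_mono mult_left_mono) auto
      finally show ?thesis .
    qed
    have A: "mat_norm ?A \<le> t" "mat_norm ?B \<le> t" using small a b by auto
    have eA: "mat_norm (mat_exp ?A - mat 1) \<le> t" "mat_norm (mat_exp ?B - mat 1) \<le> t"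
      using mat_norm_exp_minus_one[OF summable_exp[OF a1]] mat_norm_exp_minus_one[OF summable_exp[OF b1]] A ts s_small by auto
    define h where "h = exp_coord X a ** exp_coord X b"
    have hG: "h \<in> G" unfolding h_def by (intro G_mult exp_coord_in_G a1 b1)
    obtain w where w: "vec_norm w \<le> 1" "h = exp_coord X w" using hG by (rule G_exp_cases)
    let ?W = "lie_comb X w"
    have h1: "h - mat 1 = (mat_exp ?A - mat 1) ** (mat_exp ?B - mat 1) + (mat_exp ?A - mat 1) + (mat_exp ?B - mat 1)"
      by (simp add: h_def exp_coord_def matrix_diff_ldistrib matrix_diff_rdistrib)
    have "1 / ?p \<le> 1" using p1 by simp
    then have t1: "t \<le> 1" using ts s_p by linarith
    have AB: "mat_norm ((mat_exp ?A - mat 1) ** (mat_exp ?B - mat 1)) \<le> t * t"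
      by (rule mat_norm_mult_le[OF eA])
    have tt: "t * t \<le> t" using t0 t1 by (simp add: mult_left_le)
    have "mat_norm (h - mat 1) \<le> t" unfolding h1
      using AB tt eA by (intro mat_norm_add_le) auto
    then have "?p ^ N * mat_norm (h - mat 1) \<le> s"
      unfolding s_def by (intro mult_left_mono) auto
    then have W: "mat_norm ?W \<le> s"
      using C(3)[OF w(1)] unfolding w(2) by linarith
    \<comment> \<open>Writing each exponential as 1 plus its argument plus a remainder, the equation
      exp W = exp A exp B leaves one product and three remainders, each at most (l s)^2.\<close>
    have W_eq: "?W - ?A - ?B = (mat_exp ?A - mat 1) ** (mat_exp ?B - mat 1) + (mat_exp ?A - mat 1 - ?A)
        + (mat_exp ?B - mat 1 - ?B) - (mat_exp ?W - mat 1 - ?W)"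
      using h1 unfolding w(2) exp_coord_def by (simp add: algebra_simps)
    have tte: "t * t \<le> ?e"
    proof -
      have "t \<le> ?p * s" using ts mult_right_mono[of 1 ?p s] p1 s0 by linarith
      then show ?thesis using t0 by (simp add: power2_eq_square mult_mono)
    qed
    have "mat_norm ?A \<le> s" "mat_norm ?B \<le> s" using A ts by linarith+
    then have AB': "mat_norm (mat_exp ?A - mat 1 - ?A) \<le> ?e" "mat_norm (mat_exp ?B - mat 1 - ?B) \<le> ?e"
      using step summable_exp a1 b1 by blast+
    have "mat_norm (?W - ?A - ?B) \<le> ?e"
      unfolding W_eq by (intro mat_norm_diff_le mat_norm_add_le AB' order_trans[OF AB tte] step[OF W summable_exp[OF w(1)]])
    then have "mat_norm (lie_comb X (w - a - b)) \<le> ?e" by (simp add: lie_comb_diff)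
    then have "vec_norm (w - a - b) \<le> D * ?e"
      using D(2)[of "w - a - b"] mult_left_mono[of "mat_norm (lie_comb X (w - a - b))" ?e D] D(1) by linarith
    also have "D * ?e \<le> 1 / ?p ^ Suc k"
    proof -
      have "?p ^ Suc k * (D * ?e) = (?p ^ 3 * D * (?p ^ N * C)\<^sup>2) / ?p ^ k"
        using p0 unfolding spk by (simp add: power2_eq_square power3_eq_cube field_simps)
      also have "\<dots> \<le> 1" using big p0 by (simp add: divide_le_eq)
      finally show ?thesis using p0 by (simp add: field_simps)
    qed
    finally show "\<exists>w. vec_norm w \<le> 1 \<and> exp_coord X a ** exp_coord X b = exp_coord X w \<and>
        vec_norm (w - a - b) \<le> 1 / ?p ^ Suc k"
      using w h_def by auto
  qed
qed

end

section \<open>Haar measure\<close>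

lemma open_mat_norm_ball: "open {y :: 'l::prime_card padic ^'m ^'m. mat_norm (y - x) \<le> 1 / real CARD('l) ^ j}"
proof -
  let ?r = "1 / real CARD('l) ^ j"
  let ?S = "{y :: 'l padic ^'m ^'m. mat_norm (y - x) \<le> ?r}"
  have r: "?r > 0" by simp
  have *: "\<forall>y\<in>?S. ball y ?r \<subseteq> ?S"
  proof (intro ballI subsetI)
    fix y z assume y: "y \<in> ?S" and "z \<in> ball y ?r"
    then have "mat_norm (z - y) \<le> ?r" using mat_norm_le_dist[of z y] by (simp add: dist_commute)
    then have "mat_norm ((z - y) + (y - x)) \<le> ?r" using y by (intro mat_norm_add_le) auto
    then show "z \<in> ?S" by simp
  qed
  show ?thesis
    unfolding open_contains_ball
    using * r by blast
qed

locale haar_padic_group = padic_matrix_group G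
  for G :: "('l::prime_card padic ^'m::finite ^'m) set" +
  fixes \<mu> :: "('l padic ^'m ^'m) measure"
  assumes haar: "normalized_Haar_measure G \<mu>" and compact_G: "compact G"
begin

lemma sets_mu: "sets \<mu> = sets (restrict_space borel G)"
  using haar by (simp add: normalized_Haar_measure_def)

lemma space_mu: "space \<mu> = G"
  using sets_eq_imp_space_eq[OF sets_mu] by (simp add: space_restrict_space)

lemma emeasure_G: "emeasure \<mu> G = 1"
  using haar by (simp add: normalized_Haar_measure_def)

sublocale finite_measure \<mu>
  by (rule finite_measureI) (simp add: space_mu emeasure_G)

lemma measure_G: "measure \<mu> G = 1"
  by (simp add: measure_def emeasure_G)

lemma measure_left_translate: "h \<in> G \<Longrightarrow> A \<in> sets \<mu> \<Longrightarrow> measure \<mu> ((\<lambda>x. h ** x) ` A) = measure \<mu> A"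
  using haar by (simp add: normalized_Haar_measure_def measure_def)

lemma continuous_imp_measurable: "continuous_on G f \<Longrightarrow> f \<in> borel_measurable \<mu>"
  using borel_measurable_continuous_on_restrict measurable_cong_sets[OF sets_mu refl] by blast

text \<open>For x in G this ball of the max-norm is the coset x \<open>K j\<close>, and also
  \<open>K j\<close> x, because \<open>K j\<close> is normal in G. The metric form makes isometries
  of G permute these sets.\<close>

definition Coset :: "nat \<Rightarrow> 'l padic ^'m ^'m \<Rightarrow> ('l padic ^'m ^'m) set" where
  "Coset j x = {y \<in> G. mat_norm (y - x) \<le> 1 / real CARD('l) ^ j}"

lemma Coset_subset_G: "Coset j x \<subseteq> G" by (auto simp: Coset_def)

lemma Coset_self: "x \<in> G \<Longrightarrow> x \<in> Coset j x" by (simp add: Coset_def)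

lemma Coset_0: "x \<in> G \<Longrightarrow> Coset 0 x = G"
  by (auto simp: Coset_def intro: mat_norm_diff_le G_integral)

lemma Coset_one: "Coset j (mat 1) = K j" by (simp add: Coset_def congruence_subgroup_def)

lemma Coset_iff_K: "x \<in> G \<Longrightarrow> y \<in> Coset j x \<longleftrightarrow> y \<in> G \<and> matrix_inv x ** y \<in> K j"
  by (auto simp: Coset_def K_inv_mult_iff)

lemma Coset_eq_image:
  assumes "x \<in> G"
  shows "Coset j x = (\<lambda>k. x ** k) ` K j"
proof
  show "Coset j x \<subseteq> (\<lambda>k. x ** k) ` K j"
  proof
    fix y assume "y \<in> Coset j x"
    then have "matrix_inv x ** y \<in> K j" using assms by (simp add: Coset_iff_K)
    moreover have "y = x ** (matrix_inv x ** y)" using assms by (simp add: mult_inv_cancel)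
    ultimately show "y \<in> (\<lambda>k. x ** k) ` K j" by blast
  qed
  show "(\<lambda>k. x ** k) ` K j \<subseteq> Coset j x"
    using assms K_subset_G[THEN subsetD] by (auto simp: Coset_iff_K inv_mult_cancel intro!: G_mult)
qed

lemma Coset_eqI:
  assumes "y \<in> Coset i x" "i \<le> j"
  shows "Coset j y \<subseteq> Coset i x"
proof
  fix z assume z: "z \<in> Coset j y"
  have "1 / real CARD('l) ^ j \<le> 1 / real CARD('l) ^ i"
    using CARD_gt_1[where 'l='l] assms(2) by (intro divide_left_mono power_increasing) auto
  then have "mat_norm ((z - y) + (y - x)) \<le> 1 / real CARD('l) ^ i"
    using z assms(1) by (intro mat_norm_add_le) (auto simp: Coset_def)
  then show "z \<in> Coset i x" using z by (simp add: Coset_def)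
qed

lemma Coset_sym: "x \<in> G \<Longrightarrow> y \<in> Coset j x \<Longrightarrow> x \<in> Coset j y"
  by (simp add: Coset_def mat_norm_diff_commute)

lemma Coset_eq: "x \<in> G \<Longrightarrow> y \<in> Coset j x \<Longrightarrow> Coset j y = Coset j x"
  using Coset_eqI[of y j x j] Coset_eqI[of x j y j] Coset_sym by blast

lemma Coset_sets [measurable]: "Coset j x \<in> sets \<mu>"
proof -
  have "Coset j x = G \<inter> {y. mat_norm (y - x) \<le> 1 / real CARD('l) ^ j}" by (auto simp: Coset_def)
  then show ?thesis unfolding sets_mu sets_restrict_space
    by (rule image_eqI) (rule borel_open[OF open_mat_norm_ball])
qed

lemma K_sets [measurable]: "K j \<in> sets \<mu>"
  using Coset_sets[of j "mat 1"] by (simp add: Coset_one)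

lemma measure_Coset: "x \<in> G \<Longrightarrow> measure \<mu> (Coset j x) = measure \<mu> (K j)"
  by (simp add: Coset_eq_image measure_left_translate K_sets)

lemma emeasure_Coset: "x \<in> G \<Longrightarrow> emeasure \<mu> (Coset j x) = emeasure \<mu> (K j)"
  by (simp add: emeasure_eq_measure measure_Coset)

lemma finite_Cosets: "finite (Coset j ` G)"
proof -
  let ?O = "\<lambda>x. {y :: 'l padic ^'m ^'m. mat_norm (y - x) \<le> 1 / real CARD('l) ^ j}"
  obtain R where R: "R \<subseteq> G" "finite R" "G \<subseteq> (\<Union>x\<in>R. ?O x)"
  proof (rule compactE_image[OF compact_G])
    show "open (?O x)" for x by (rule open_mat_norm_ball)
    show "G \<subseteq> (\<Union>x\<in>G. ?O x)" by auto
  qed blast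
  have "Coset j ` G \<subseteq> Coset j ` R"
  proof
    fix C assume "C \<in> Coset j ` G"
    then obtain x where x: "x \<in> G" "C = Coset j x" by blast
    then obtain r where r: "r \<in> R" "mat_norm (x - r) \<le> 1 / real CARD('l) ^ j" using R(3) by auto
    then have "x \<in> Coset j r" using x by (simp add: Coset_def)
    then have "C = Coset j r" using x r R(1) by (auto dest: Coset_eq)
    then show "C \<in> Coset j ` R" using r by blast
  qed
  then show ?thesis using R(2) finite_subset by blast
qed

lemma Cosets_cover: "\<Union>(Coset j ` G) = G"
  using Coset_self Coset_subset_G by blast

lemma disjoint_Cosets: "disjoint_family_on id (Coset j ` G)"
proof -
  have "Coset j x = Coset j y" if "x \<in> G" "y \<in> G" "Coset j x \<inter> Coset j y \<noteq> {}" for x y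
    using that Coset_eq by blast
  then show ?thesis unfolding disjoint_family_on_def by auto
qed

text \<open>Finitely many disjoint translates of \<open>K j\<close>, all of the same measure, fill
  G. The point is that \<open>K j\<close> has positive measure.\<close>

lemma measure_K: "real (card (Coset j ` G)) * measure \<mu> (K j) = 1"
proof -
  have "measure \<mu> (\<Union>C\<in>Coset j ` G. id C) = (\<Sum>C\<in>Coset j ` G. measure \<mu> (id C))"
    by (rule finite_measure_finite_Union[OF finite_Cosets _ disjoint_Cosets]) auto
  also have "\<dots> = (\<Sum>C\<in>Coset j ` G. measure \<mu> (K j))"
    by (rule sum.cong) (auto simp: measure_Coset)
  finally show ?thesis using Cosets_cover[of j] measure_G by simp
qed

lemma measure_K_pos: "measure \<mu> (K j) > 0"
proof (rule ccontr)
  assume "\<not> measure \<mu> (K j) > 0"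
  then have "measure \<mu> (K j) = 0" using measure_nonneg[of \<mu> "K j"] by linarith
  then show False using measure_K[of j] by simp
qed

section \<open>The cosets as generators of the measurable sets\<close>

definition "Cosets = insert {} (\<Union>j. Coset j ` G)"

lemma Cosets_subset: "Cosets \<subseteq> Pow G"
  using Coset_subset_G by (auto simp: Cosets_def)

lemma countable_Cosets: "countable Cosets"
proof -
  have "countable (\<Union>j. Coset j ` G)"
    by (rule countable_UN) (simp_all only: countable_finite[OF finite_Cosets] uncountable_def countableI_type)
  then show ?thesis by (simp add: Cosets_def)
qed

text \<open>Two balls of an ultrametric are nested or disjoint; the empty set belongs to the family
  for the second case.\<close>

lemma Int_stable_Cosets: "Int_stable Cosets"
proof (rule Int_stableI)
  fix A B assume "A \<in> Cosets" "B \<in> Cosets"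
  have *: "Coset i x \<inter> Coset j y \<in> Cosets" if "x \<in> G" "y \<in> G" "i \<le> j" for i j x y
  proof (cases "Coset i x \<inter> Coset j y = {}")
    case False
    then obtain z where z: "z \<in> Coset i x" "z \<in> Coset j y" by blast
    then have "Coset j y = Coset j z" using that Coset_eq by blast
    also have "\<dots> \<subseteq> Coset i x" using z that by (intro Coset_eqI)
    finally have "Coset i x \<inter> Coset j y = Coset j y" by blast
    then show ?thesis using that by (auto simp: Cosets_def)
  qed (simp add: Cosets_def)
  show "A \<inter> B \<in> Cosets"
  proof (cases "A = {} \<or> B = {}")
    case False
    then obtain i x j y where "A = Coset i x" "B = Coset j y" "x \<in> G" "y \<in> G"
      using \<open>A \<in> Cosets\<close> \<open>B \<in> Cosets\<close> by (auto simp: Cosets_def)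
    then show ?thesis using *[of x y i j] *[of y x j i] by (cases "i \<le> j") (auto simp: Int_commute)
  qed (auto simp: Cosets_def)
qed

lemma open_Int_G_Union_Cosets:
  assumes "open U"
  shows "G \<inter> U = \<Union>{C \<in> Cosets. C \<subseteq> U}"
proof
  show "\<Union>{C \<in> Cosets. C \<subseteq> U} \<subseteq> G \<inter> U" using Cosets_subset by blast
  show "G \<inter> U \<subseteq> \<Union>{C \<in> Cosets. C \<subseteq> U}"
  proof
    fix x assume x: "x \<in> G \<inter> U"
    then obtain e where e: "e > 0" "\<And>y. dist y x < e \<Longrightarrow> y \<in> U" using assms unfolding open_dist by blast
    let ?p = "real CARD('l)" and ?c = "real (CARD('m) * CARD('m))"
    have c0: "?c > 0" by simp
    obtain j where j: "?c / e < ?p ^ j" using real_arch_pow[OF CARD_gt_1[where 'l='l]] by blast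
    have "Coset j x \<subseteq> U"
    proof
      fix y assume "y \<in> Coset j x"
      then have "mat_norm (y - x) \<le> 1 / ?p ^ j" by (simp add: Coset_def)
      then have "?c * mat_norm (y - x) \<le> ?c * (1 / ?p ^ j)" using c0 by (intro mult_left_mono) auto
      then have "dist y x \<le> ?c * (1 / ?p ^ j)" using dist_le_mat_norm[of y x] by linarith
      also have "\<dots> < e" using j e by (simp add: field_simps)
      finally show "y \<in> U" by (rule e)
    qed
    moreover have "Coset j x \<in> Cosets" using x unfolding Cosets_def by blast
    moreover have "x \<in> Coset j x" using x by (simp add: Coset_self)
    ultimately show "x \<in> \<Union>{C \<in> Cosets. C \<subseteq> U}" by blast
  qed
qed

text \<open>There are finitely many cosets of each level, hence countably many in all, so every
  relatively open set is a countable union of cosets.\<close>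

lemma sets_mu_Cosets: "sets \<mu> = sigma_sets G Cosets"
proof
  have m: "(\<lambda>x. x) \<in> borel_measurable (sigma G Cosets)"
  proof (rule borel_measurableI)
    fix S :: "('l padic ^'m ^'m) set" assume "open S"
    then have "G \<inter> S = \<Union>{C \<in> Cosets. C \<subseteq> S}" by (rule open_Int_G_Union_Cosets)
    also have "\<dots> \<in> sigma_sets G Cosets"
      by (intro sigma_sets_UNION countable_subset[OF _ countable_Cosets]) auto
    finally show "(\<lambda>x. x) -` S \<inter> space (sigma G Cosets) \<in> sets (sigma G Cosets)"
      using Cosets_subset by (simp add: Int_commute space_measure_of_conv)
  qed
  have "G \<inter> A \<in> sigma_sets G Cosets" if "A \<in> sets borel" for A
    using measurable_sets[OF m that] Cosets_subset
    by (simp add: space_measure_of sets_measure_of Int_commute)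
  then show "sets \<mu> \<subseteq> sigma_sets G Cosets"
    unfolding sets_mu sets_restrict_space by blast
  show "sigma_sets G Cosets \<subseteq> sets \<mu>"
  proof -
    have "Cosets \<subseteq> sets \<mu>" using Coset_sets by (auto simp: Cosets_def)
    from sets.sigma_sets_subset[OF this] show ?thesis by (simp only: space_mu)
  qed
qed

lemma measure_eq_mu:
  assumes "sets N = sets \<mu>" "\<And>j x. x \<in> G \<Longrightarrow> emeasure N (Coset j x) = emeasure \<mu> (Coset j x)"
  shows "N = \<mu>"
proof (rule measure_eqI_generator_eq[OF Int_stable_Cosets Cosets_subset])
  show "emeasure N C = emeasure \<mu> C" if "C \<in> Cosets" for C
    using that assms(2) by (auto simp: Cosets_def)
  show "sets N = sigma_sets G Cosets" "sets \<mu> = sigma_sets G Cosets"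
    using assms(1) sets_mu_Cosets by simp_all
  have "Coset 0 (mat 1) \<in> Cosets" using G_one unfolding Cosets_def by blast
  then show "range (\<lambda>i::nat. G) \<subseteq> Cosets" using Coset_0[OF G_one] by auto
  show "emeasure N G \<noteq> \<infinity>"
    using assms(2)[OF G_one, of 0] by (simp add: Coset_0 G_one emeasure_G)
qed auto

text \<open>The preimage of a ball under a surjective isometry is a ball of the same radius, hence
  of the same measure, and the measure is determined by its values on balls. Right translations and
  inversion are covered although Haar measure is only assumed to be left invariant.\<close>

lemma isometry_invariant:
  assumes \<phi>: "\<And>y. y \<in> G \<Longrightarrow> \<phi> y \<in> G" "G \<subseteq> \<phi> ` G"
    and iso: "\<And>y z. y \<in> G \<Longrightarrow> z \<in> G \<Longrightarrow> mat_norm (\<phi> y - \<phi> z) = mat_norm (y - z)"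
  shows "\<phi> \<in> measurable \<mu> \<mu>" "distr \<mu> \<mu> \<phi> = \<mu>"
proof -
  have pre: "\<exists>x'\<in>G. \<phi> -` Coset j x \<inter> G = Coset j x'" if xG: "x \<in> G" for j x
  proof -
    obtain x' where x': "x' \<in> G" "x = \<phi> x'" using \<phi>(2) xG by blast
    then have "\<phi> -` Coset j x \<inter> G = Coset j x'" using \<phi>(1) iso by (auto simp: Coset_def)
    then show ?thesis using x' by blast
  qed
  show m: "\<phi> \<in> measurable \<mu> \<mu>"
  proof (rule measurable_sigma_sets[OF sets_mu_Cosets Cosets_subset])
    show "\<phi> \<in> space \<mu> \<rightarrow> G" unfolding space_mu by (rule Pi_I) (rule \<phi>(1))
    fix C assume "C \<in> Cosets"
    then consider "C = {}" | j x where "x \<in> G" "C = Coset j x" unfolding Cosets_def by blast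
    then show "\<phi> -` C \<inter> space \<mu> \<in> sets \<mu>"
    proof cases
      case 2
      then obtain x' where "\<phi> -` Coset j x \<inter> G = Coset j x'" using pre[of x j] by blast
      then show ?thesis using 2 by (simp only: space_mu Coset_sets)
    qed simp
  qed
  show "distr \<mu> \<mu> \<phi> = \<mu>"
  proof (rule measure_eq_mu)
    fix j x assume x: "x \<in> G"
    obtain x' where "x' \<in> G" "\<phi> -` Coset j x \<inter> G = Coset j x'" using pre[OF x] by blast
    then show "emeasure (distr \<mu> \<mu> \<phi>) (Coset j x) = emeasure \<mu> (Coset j x)"
      using x m by (simp add: emeasure_distr space_mu emeasure_Coset)
  qed simp
qed

lemma left_translation_isometry:
  assumes "h \<in> G"
  shows "(\<lambda>x. h ** x) \<in> measurable \<mu> \<mu>" "distr \<mu> \<mu> (\<lambda>x. h ** x) = \<mu>"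
proof -
  have 1: "G \<subseteq> (\<lambda>x. h ** x) ` G"
  proof
    fix y assume "y \<in> G"
    then show "y \<in> (\<lambda>x. h ** x) ` G"
      using assms by (intro image_eqI[of _ _ "matrix_inv h ** y"]) (auto simp: mult_inv_cancel G_mult G_inv)
  qed
  have 2: "mat_norm (h ** y - h ** z) = mat_norm (y - z)" for y z
    using assms by (simp add: matrix_diff_ldistrib[symmetric] mat_norm_G_mult_left)
  show "(\<lambda>x. h ** x) \<in> measurable \<mu> \<mu>" "distr \<mu> \<mu> (\<lambda>x. h ** x) = \<mu>"
    by (rule isometry_invariant[OF _ 1 2]; use assms G_mult in blast)+
qed

lemma right_translation_isometry:
  assumes "h \<in> G"
  shows "(\<lambda>x. x ** h) \<in> measurable \<mu> \<mu>" "distr \<mu> \<mu> (\<lambda>x. x ** h) = \<mu>"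
proof -
  have 1: "G \<subseteq> (\<lambda>x. x ** h) ` G"
  proof
    fix y assume "y \<in> G"
    then show "y \<in> (\<lambda>x. x ** h) ` G"
      using assms by (intro image_eqI[of _ _ "y ** matrix_inv h"]) (auto simp: mult_inv_cancel_right G_mult G_inv)
  qed
  have 2: "mat_norm (y ** h - z ** h) = mat_norm (y - z)" for y z
    using assms by (simp add: matrix_diff_rdistrib[symmetric] mat_norm_G_mult_right)
  show "(\<lambda>x. x ** h) \<in> measurable \<mu> \<mu>" "distr \<mu> \<mu> (\<lambda>x. x ** h) = \<mu>"
    by (rule isometry_invariant[OF _ 1 2]; use assms G_mult in blast)+
qed

lemma inverse_isometry:
  shows "matrix_inv \<in> measurable \<mu> \<mu>" "distr \<mu> \<mu> matrix_inv = \<mu>"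
proof -
  have 1: "G \<subseteq> matrix_inv ` G"
  proof
    fix y assume "y \<in> G"
    then show "y \<in> matrix_inv ` G"
      by (intro image_eqI[of _ _ "matrix_inv y"]) (auto simp: matrix_inv_inv G_inv)
  qed
  have 2: "mat_norm (matrix_inv y - matrix_inv z) = mat_norm (y - z)" if "y \<in> G" "z \<in> G" for y z
  proof -
    have "matrix_inv y - matrix_inv z = matrix_inv y ** (z - y) ** matrix_inv z"
      using that by (simp add: matrix_diff_ldistrib matrix_diff_rdistrib G_inv mult_cancel_inv)
    then show ?thesis using that
      by (simp add: mat_norm_G_mult_left mat_norm_G_mult_right G_inv mat_norm_diff_commute)
  qed
  show "matrix_inv \<in> measurable \<mu> \<mu>" "distr \<mu> \<mu> matrix_inv = \<mu>"
    by (rule isometry_invariant[OF _ 1 2]; use G_inv in blast)+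
qed

lemma integral_invariant:
  fixes f :: "'l padic ^'m ^'m \<Rightarrow> 'b::{banach, second_countable_topology}"
  assumes "\<phi> \<in> measurable \<mu> \<mu>" "distr \<mu> \<mu> \<phi> = \<mu>" "f \<in> borel_measurable \<mu>"
  shows "(\<integral>x. f (\<phi> x) \<partial>\<mu>) = (\<integral>x. f x \<partial>\<mu>)"
  using integral_distr[OF assms(1,3)] assms(2) by simp

lemma integrable_invariant:
  fixes f :: "'l padic ^'m ^'m \<Rightarrow> 'b::{banach, second_countable_topology}"
  assumes "\<phi> \<in> measurable \<mu> \<mu>" "distr \<mu> \<mu> \<phi> = \<mu>" "integrable \<mu> f"
  shows "integrable \<mu> (\<lambda>x. f (\<phi> x))"
  using integrable_distr[OF assms(1)] assms(2,3) by simp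

end

section \<open>Approximation in the space of square-integrable functions\<close>

lemma norm_add_sq_le: "(cmod (a + b))\<^sup>2 \<le> 2 * (cmod a)\<^sup>2 + 2 * (cmod b)\<^sup>2"
proof -
  have "(cmod (a + b))\<^sup>2 \<le> (cmod a + cmod b)\<^sup>2" by (intro power_mono norm_triangle_ineq) simp
  also have "\<dots> \<le> 2 * (cmod a)\<^sup>2 + 2 * (cmod b)\<^sup>2"
    using sum_squares_bound[of "cmod a" "cmod b"] by (simp add: power2_sum)
  finally show ?thesis .
qed

lemma norm_diff_sq_le: "(cmod (a - b))\<^sup>2 \<le> 2 * (cmod a)\<^sup>2 + 2 * (cmod b)\<^sup>2"
  using norm_add_sq_le[of a "- b"] by simp

lemma square_integrable_add:
  assumes "square_integrable M f" "square_integrable M g"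
  shows "square_integrable M (\<lambda>x. f x + g x)"
proof -
  have m: "f \<in> borel_measurable M" "g \<in> borel_measurable M"
    and i: "integrable M (\<lambda>x. (cmod (f x))\<^sup>2)" "integrable M (\<lambda>x. (cmod (g x))\<^sup>2)"
    using assms by (auto simp: square_integrable_def)
  have "integrable M (\<lambda>x. 2 * (cmod (f x))\<^sup>2 + 2 * (cmod (g x))\<^sup>2)" using i by auto
  then have "integrable M (\<lambda>x. (cmod (f x + g x))\<^sup>2)"
    by (rule Bochner_Integration.integrable_bound) (use m norm_add_sq_le in auto)
  then show ?thesis using m by (simp add: square_integrable_def)
qed

lemma square_integrable_scale:
  "square_integrable M f \<Longrightarrow> square_integrable M (\<lambda>x. c * f x)"
  by (auto simp: square_integrable_def norm_mult power_mult_distrib)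

lemma square_integrable_diff:
  "square_integrable M f \<Longrightarrow> square_integrable M g \<Longrightarrow> square_integrable M (\<lambda>x. f x - g x)"
  using square_integrable_add[of M f "\<lambda>x. (-1) * g x"] square_integrable_scale[of M g "-1"] by simp

lemma integrable_norm_diff_sq:
  "square_integrable M f \<Longrightarrow> square_integrable M g \<Longrightarrow> integrable M (\<lambda>x. (cmod (f x - g x))\<^sup>2)"
  using square_integrable_diff[of M f g] by (simp add: square_integrable_def)

lemma integrable_mult_square_integrable:
  assumes "square_integrable M f" "square_integrable M g"
  shows "integrable M (\<lambda>x. f x * g x)"
proof -
  have m: "f \<in> borel_measurable M" "g \<in> borel_measurable M"
    and i: "integrable M (\<lambda>x. (cmod (f x))\<^sup>2)" "integrable M (\<lambda>x. (cmod (g x))\<^sup>2)"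
    using assms by (auto simp: square_integrable_def)
  have "integrable M (\<lambda>x. (cmod (f x))\<^sup>2 + (cmod (g x))\<^sup>2)" using i by auto
  then show ?thesis
  proof (rule Bochner_Integration.integrable_bound)
    have "cmod (f x * g x) \<le> (cmod (f x))\<^sup>2 + (cmod (g x))\<^sup>2" for x
      unfolding norm_mult using sum_squares_bound[of "cmod (f x)" "cmod (g x)"]
        mult_nonneg_nonneg[OF norm_ge_zero[of "f x"] norm_ge_zero[of "g x"]]
      by linarith
    then show "AE x in M. norm (f x * g x) \<le> norm ((cmod (f x))\<^sup>2 + (cmod (g x))\<^sup>2)" by simp
  qed (use m in measurable)
qed

lemma square_integrable_cnj: "square_integrable M f \<Longrightarrow> square_integrable M (\<lambda>x. cnj (f x))"
  using measurable_compose[OF _ borel_measurable_continuous_onI[OF continuous_on_cnj[OF continuous_on_id]], of f M]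
  by (auto simp: square_integrable_def)

context haar_padic_group
begin

lemma square_integrable_bounded:
  assumes "f \<in> borel_measurable \<mu>" "\<And>x. x \<in> G \<Longrightarrow> cmod (f x) \<le> B"
  shows "square_integrable \<mu> f"
proof -
  have "(cmod (f x))\<^sup>2 \<le> B\<^sup>2" if "x \<in> G" for x
    using assms(2)[OF that] by (intro power_mono) auto
  then have "integrable \<mu> (\<lambda>x. (cmod (f x))\<^sup>2)"
    by (intro integrable_const_bound[where B="B\<^sup>2"]) (use assms(1) in \<open>auto simp: space_mu\<close>)
  then show ?thesis using assms(1) by (simp add: square_integrable_def)
qed

text \<open>Such functions live on the finite set G / K j, so they are simple functions and
  continuous; values outside G are ignored.\<close>

definition coset_const :: "nat \<Rightarrow> ('l padic ^'m ^'m \<Rightarrow> 'b) \<Rightarrow> bool" where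
  "coset_const j F \<longleftrightarrow> (\<forall>x\<in>G. \<forall>y\<in>Coset j x. F y = F x)"

lemma coset_const_mono: "coset_const i F \<Longrightarrow> i \<le> j \<Longrightarrow> coset_const j F"
  using Coset_eqI[OF Coset_self] by (fastforce simp: coset_const_def)

lemma coset_const_vimage:
  assumes "coset_const j F"
  shows "F -` A \<inter> G = \<Union>{C \<in> Coset j ` G. C \<subseteq> F -` A}"
proof
  show "F -` A \<inter> G \<subseteq> \<Union>{C \<in> Coset j ` G. C \<subseteq> F -` A}"
  proof
    fix x assume x: "x \<in> F -` A \<inter> G"
    then have "Coset j x \<subseteq> F -` A" using assms by (auto simp: coset_const_def)
    then show "x \<in> \<Union>{C \<in> Coset j ` G. C \<subseteq> F -` A}" using x Coset_self[of x j] by blast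
  qed
qed (use Coset_subset_G in blast)

lemma coset_const_measurable:
  fixes F :: "'l padic ^'m ^'m \<Rightarrow> 'b::topological_space"
  assumes "coset_const j F"
  shows "F \<in> borel_measurable \<mu>"
proof (rule measurableI)
  fix A assume "A \<in> sets (borel :: 'b measure)"
  have "\<Union>{C \<in> Coset j ` G. C \<subseteq> F -` A} \<in> sets \<mu>"
    by (rule sets.finite_Union) (use finite_Cosets[of j] Coset_sets in auto)
  then show "F -` A \<inter> space \<mu> \<in> sets \<mu>" unfolding space_mu coset_const_vimage[OF assms] .
qed simp

lemma coset_const_finite_range:
  assumes "coset_const j F"
  shows "finite (F ` G)"
proof -
  have "F ` G \<subseteq> (\<lambda>C. F (SOME x. x \<in> C)) ` (Coset j ` G)"
  proof
    fix y assume "y \<in> F ` G"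
    then obtain x where x: "x \<in> G" "y = F x" by blast
    then have "(SOME z. z \<in> Coset j x) \<in> Coset j x" using Coset_self by (intro someI)
    then have "F (SOME z. z \<in> Coset j x) = y" using assms x unfolding coset_const_def by blast
    then show "y \<in> (\<lambda>C. F (SOME x. x \<in> C)) ` (Coset j ` G)" using x by blast
  qed
  then show ?thesis using finite_Cosets finite_surj by (meson finite_imageI finite_subset)
qed

lemma coset_const_bounded:
  fixes F :: "'l padic ^'m ^'m \<Rightarrow> 'b::real_normed_vector"
  assumes "coset_const j F"
  obtains B where "\<And>x. x \<in> G \<Longrightarrow> norm (F x) \<le> B"
proof (rule that)
  fix x assume "x \<in> G"
  then show "norm (F x) \<le> (\<Sum>y\<in>F ` G. norm y)"
    using coset_const_finite_range[OF assms] by (intro member_le_sum) auto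
qed

lemma coset_const_square_integrable:
  assumes "coset_const j F"
  shows "square_integrable \<mu> F"
proof -
  obtain B where "\<And>x. x \<in> G \<Longrightarrow> cmod (F x) \<le> B" by (rule coset_const_bounded[OF assms], rule that)
  then show ?thesis by (rule square_integrable_bounded[OF coset_const_measurable[OF assms]])
qed

definition L2_dist2 :: "('l padic ^'m ^'m \<Rightarrow> complex) \<Rightarrow> ('l padic ^'m ^'m \<Rightarrow> complex) \<Rightarrow> real" where
  "L2_dist2 f g = (\<integral>x. (cmod (f x - g x))\<^sup>2 \<partial>\<mu>)"

lemma L2_dist2_nonneg: "L2_dist2 f g \<ge> 0"
  unfolding L2_dist2_def by (intro integral_nonneg_AE) auto

text \<open>Working with squared distances costs a factor 2, which the approximation arguments
  absorb in their choice of epsilon.\<close>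

lemma L2_dist2_triangle:
  assumes "square_integrable \<mu> f" "square_integrable \<mu> g" "square_integrable \<mu> h"
  shows "L2_dist2 f h \<le> 2 * L2_dist2 f g + 2 * L2_dist2 g h"
proof -
  have i: "integrable \<mu> (\<lambda>x. (cmod (f x - g x))\<^sup>2)" "integrable \<mu> (\<lambda>x. (cmod (g x - h x))\<^sup>2)"
    "integrable \<mu> (\<lambda>x. (cmod (f x - h x))\<^sup>2)"
    by (intro integrable_norm_diff_sq assms)+
  have "L2_dist2 f h \<le> (\<integral>x. 2 * (cmod (f x - g x))\<^sup>2 + 2 * (cmod (g x - h x))\<^sup>2 \<partial>\<mu>)"
    unfolding L2_dist2_def
  proof (rule integral_mono)
    show "(cmod (f x - h x))\<^sup>2 \<le> 2 * (cmod (f x - g x))\<^sup>2 + 2 * (cmod (g x - h x))\<^sup>2" for x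
      using norm_add_sq_le[of "f x - g x" "g x - h x"] by simp
  qed (use i in auto)
  then show ?thesis using i by (simp add: L2_dist2_def)
qed

definition L2_approx :: "('l padic ^'m ^'m \<Rightarrow> complex) \<Rightarrow> bool" where
  "L2_approx f \<longleftrightarrow> square_integrable \<mu> f \<and> (\<forall>e>0. \<exists>j F. coset_const j F \<and> L2_dist2 f F < e)"

lemma L2_approx_limit:
  assumes f: "square_integrable \<mu> f" and lim: "\<And>e. e > 0 \<Longrightarrow> \<exists>g. L2_approx g \<and> L2_dist2 f g < e"
  shows "L2_approx f"
  unfolding L2_approx_def
proof (intro conjI allI impI f)
  fix e :: real assume e: "e > 0"
  obtain g where g: "L2_approx g" "L2_dist2 f g < e / 4" using lim[of "e / 4"] e by auto
  have "e / 4 > 0" using e by simp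
  then obtain j F where F: "coset_const j F" "L2_dist2 g F < e / 4"
    using g(1) unfolding L2_approx_def by blast
  have "L2_dist2 f F < e"
    using L2_dist2_triangle[of f g F] f g F coset_const_square_integrable by (auto simp: L2_approx_def)
  then show "\<exists>j F. coset_const j F \<and> L2_dist2 f F < e" using F(1) by blast
qed

lemma L2_approx_coset_const: "coset_const j F \<Longrightarrow> L2_approx F"
  unfolding L2_approx_def L2_dist2_def
  by (auto intro!: coset_const_square_integrable exI[of _ j] exI[of _ F])

lemma L2_approx_add:
  assumes "L2_approx f" "L2_approx g"
  shows "L2_approx (\<lambda>x. f x + g x)"
  unfolding L2_approx_def
proof (intro conjI allI impI)
  have sq: "square_integrable \<mu> f" "square_integrable \<mu> g" using assms by (auto simp: L2_approx_def)
  then show "square_integrable \<mu> (\<lambda>x. f x + g x)" by (rule square_integrable_add)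
  fix e :: real assume "e > 0"
  then have e4: "e / 4 > 0" by simp
  obtain i F where F: "coset_const i F" "L2_dist2 f F < e / 4"
    using assms(1) e4 unfolding L2_approx_def by blast
  obtain j H where H: "coset_const j H" "L2_dist2 g H < e / 4"
    using assms(2) e4 unfolding L2_approx_def by blast
  have "coset_const (max i j) F" "coset_const (max i j) H"
    by (rule coset_const_mono[OF F(1) max.cobounded1], rule coset_const_mono[OF H(1) max.cobounded2])
  then have c: "coset_const (max i j) (\<lambda>x. F x + H x)" by (auto simp: coset_const_def)
  have i: "integrable \<mu> (\<lambda>x. (cmod (f x - F x))\<^sup>2)" "integrable \<mu> (\<lambda>x. (cmod (g x - H x))\<^sup>2)"
    "integrable \<mu> (\<lambda>x. (cmod (f x + g x - (F x + H x)))\<^sup>2)"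
    by (intro integrable_norm_diff_sq square_integrable_add sq coset_const_square_integrable[OF F(1)]
        coset_const_square_integrable[OF H(1)] coset_const_square_integrable[OF c])+
  have "L2_dist2 (\<lambda>x. f x + g x) (\<lambda>x. F x + H x) \<le> (\<integral>x. 2 * (cmod (f x - F x))\<^sup>2 + 2 * (cmod (g x - H x))\<^sup>2 \<partial>\<mu>)"
    unfolding L2_dist2_def
  proof (rule integral_mono)
    show "(cmod (f x + g x - (F x + H x)))\<^sup>2 \<le> 2 * (cmod (f x - F x))\<^sup>2 + 2 * (cmod (g x - H x))\<^sup>2" for x
      using norm_add_sq_le[of "f x - F x" "g x - H x"] by (simp add: algebra_simps)
  qed (use i in auto)
  also have "\<dots> = 2 * L2_dist2 f F + 2 * L2_dist2 g H" using i by (simp add: L2_dist2_def)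
  also have "\<dots> < e" using F(2) H(2) by linarith
  finally show "\<exists>j F. coset_const j F \<and> L2_dist2 (\<lambda>x. f x + g x) F < e"
    by (intro exI[of _ "max i j"] exI[of _ "\<lambda>x. F x + H x"] conjI c)
qed

lemma L2_approx_scale:
  assumes "L2_approx f"
  shows "L2_approx (\<lambda>x. c * f x)"
  unfolding L2_approx_def
proof (intro conjI allI impI)
  show "square_integrable \<mu> (\<lambda>x. c * f x)" using assms by (auto simp: L2_approx_def intro: square_integrable_scale)
  fix e :: real assume e: "e > 0"
  \<comment> \<open>The summand 1 in the denominator covers c = 0.\<close>
  define d where "d = e / ((cmod c)\<^sup>2 + 1)"
  have den: "(cmod c)\<^sup>2 + 1 > 0" by (simp add: add_nonneg_pos)
  then have d: "d > 0" using e by (simp add: d_def)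
  then obtain i F where F: "coset_const i F" "L2_dist2 f F < d"
    using assms unfolding L2_approx_def by blast
  have "L2_dist2 (\<lambda>x. c * f x) (\<lambda>x. c * F x) = (cmod c)\<^sup>2 * L2_dist2 f F"
    unfolding L2_dist2_def by (simp add: right_diff_distrib[symmetric] norm_mult power_mult_distrib)
  also have "\<dots> \<le> (cmod c)\<^sup>2 * d" using F(2) by (intro mult_left_mono) auto
  also have "\<dots> < ((cmod c)\<^sup>2 + 1) * d" using d by simp
  also have "\<dots> = e" using den by (simp add: d_def)
  finally show "\<exists>j F. coset_const j F \<and> L2_dist2 (\<lambda>x. c * f x) F < e"
    using F(1) by (intro exI[of _ i] exI[of _ "\<lambda>x. c * F x"]) (auto simp: coset_const_def)
qed

lemma L2_approx_sum:
  "finite I \<Longrightarrow> (\<And>i. i \<in> I \<Longrightarrow> L2_approx (f i)) \<Longrightarrow> L2_approx (\<lambda>x. \<Sum>i\<in>I. f i x)"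
proof (induction I rule: finite_induct)
  case empty
  show ?case by (rule L2_approx_coset_const[of 0]) (simp add: coset_const_def)
qed (auto intro: L2_approx_add)

lemma square_integrable_indicator: "A \<in> sets \<mu> \<Longrightarrow> square_integrable \<mu> (indicator A)"
  by (rule square_integrable_bounded[where B=1]) (auto simp: indicator_def)

text \<open>The sets whose indicator can be approximated contain the cosets and are closed under
  complements and countable disjoint unions. As cosets are stable under intersection, all measurable
  sets are reached.\<close>

lemma L2_approx_indicator:
  assumes "A \<in> sets \<mu>"
  shows "L2_approx (indicator A)"
proof -
  have "A \<in> sigma_sets G Cosets" using assms by (simp add: sets_mu_Cosets)
  then show ?thesis
  proof (induction rule: sigma_sets_induct_disjoint[OF Int_stable_Cosets Cosets_subset, consumes 1])
    case (1 A)
    then consider "A = {}" | j x where "x \<in> G" "A = Coset j x" by (auto simp: Cosets_def)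
    then show ?case
    proof cases
      case 2
      have "indicator A y = (indicator A z :: complex)" if "z \<in> G" "y \<in> Coset j z" for y z
      proof -
        have "y \<in> Coset j x \<longleftrightarrow> z \<in> Coset j x" using that 2(1) Coset_eq Coset_sym Coset_subset_G by blast
        then show ?thesis by (simp add: indicator_def 2(2))
      qed
      then show ?thesis by (intro L2_approx_coset_const[of j]) (auto simp: coset_const_def)
    qed (auto intro: L2_approx_coset_const[of 0] simp: coset_const_def)
  next
    case 2
    show ?case by (rule L2_approx_coset_const[of 0]) (simp add: coset_const_def)
  next
    case (3 A)
    have "A \<subseteq> G" using 3(1) sets.sets_into_space[of A \<mu>] by (simp add: sets_mu_Cosets space_mu)
    then have eq: "(\<lambda>x. indicator G x + (-1) * indicator A x) = (indicator (G - A) :: _ \<Rightarrow> complex)"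
      by (intro ext) (auto simp: indicator_def)
    have "L2_approx (indicator G)"
      by (rule L2_approx_coset_const[of 0]) (use Coset_subset_G in \<open>auto simp: coset_const_def indicator_def\<close>)
    then have "L2_approx (\<lambda>x. indicator G x + (-1) * indicator A x)"
      by (intro L2_approx_add L2_approx_scale 3)
    then show ?case unfolding eq .
  next
    case (4 A)
    have As: "A i \<in> sets \<mu>" for i using 4(2) by (auto simp: sets_mu_Cosets)
    show ?case
    proof (rule L2_approx_limit)
      show "square_integrable \<mu> (indicator (\<Union>i. A i))" using As by (intro square_integrable_indicator) auto
      fix e :: real assume e: "e > 0"
      have "(\<lambda>n. \<Sum>i<n. measure \<mu> (A i)) \<longlonglongrightarrow> measure \<mu> (\<Union>i. A i)"
        using finite_measure_UNION[of A] As 4(1) by (auto simp: sums_def)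
      then have "(\<lambda>n. measure \<mu> (\<Union>i. A i) - (\<Sum>i<n. measure \<mu> (A i))) \<longlonglongrightarrow> measure \<mu> (\<Union>i. A i) - measure \<mu> (\<Union>i. A i)"
        by (intro tendsto_intros)
      then have "eventually (\<lambda>n. measure \<mu> (\<Union>i. A i) - (\<Sum>i<n. measure \<mu> (A i)) < e) sequentially"
        using e by (intro order_tendstoD(2)) auto
      then obtain n where n: "measure \<mu> (\<Union>i. A i) - (\<Sum>i<n. measure \<mu> (A i)) < e"
        using eventually_happens'[OF sequentially_bot] by blast
      have disj: "disjoint_family_on A {..<n}" using 4(1) by (auto simp: disjoint_family_on_def)
      have mu: "measure \<mu> (\<Union>i<n. A i) = (\<Sum>i<n. measure \<mu> (A i))"
        using As disj by (intro finite_measure_finite_Union) auto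
      have ind: "(\<Sum>i<n. indicator (A i) x) = (indicator (\<Union>i<n. A i) x :: complex)" for x
        using disj by (simp add: indicator_UN_disjoint)
      have "L2_dist2 (indicator (\<Union>i. A i)) (\<lambda>x. \<Sum>i<n. indicator (A i) x)
          = (\<integral>x. indicator ((\<Union>i. A i) - (\<Union>i<n. A i)) x \<partial>\<mu>)"
        unfolding L2_dist2_def ind
        by (intro Bochner_Integration.integral_cong refl) (auto simp: indicator_def)
      also have "\<dots> = measure \<mu> ((\<Union>i. A i) - (\<Union>i<n. A i))"
        using As by simp
      also have "\<dots> = measure \<mu> (\<Union>i. A i) - measure \<mu> (\<Union>i<n. A i)"
        using As by (intro finite_measure_Diff) auto
      also have "\<dots> < e" using n mu by simp
      finally have "L2_dist2 (indicator (\<Union>i. A i)) (\<lambda>x. \<Sum>i<n. indicator (A i) x) < e" .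
      moreover have "L2_approx (\<lambda>x. \<Sum>i<n. indicator (A i) x)" by (intro L2_approx_sum 4) auto
      ultimately show "\<exists>g. L2_approx g \<and> L2_dist2 (indicator (\<Union>i. A i)) g < e" by blast
    qed
  qed
qed

lemma L2_approx_simple:
  assumes "simple_function \<mu> (s :: _ \<Rightarrow> complex)"
  shows "L2_approx s"
proof -
  have fin: "finite (s ` G)" using assms by (simp add: simple_function_def space_mu)
  have "L2_approx (\<lambda>x. \<Sum>y\<in>s ` G. y * indicator (s -` {y} \<inter> G) x)"
    using assms by (intro L2_approx_sum[OF fin] L2_approx_scale L2_approx_indicator)
      (auto simp: simple_function_def space_mu)
  moreover have eq: "(\<Sum>y\<in>s ` G. y * indicator (s -` {y} \<inter> G) x) = s x" if "x \<in> G" for x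
  proof -
    have "(\<Sum>y\<in>s ` G. y * indicator (s -` {y} \<inter> G) x) = (\<Sum>y\<in>s ` G. if y = s x then y else 0)"
      using that by (intro sum.cong) (auto simp: indicator_def)
    then show ?thesis using fin that by simp
  qed
  moreover have sq: "square_integrable \<mu> s"
  proof (rule square_integrable_bounded)
    show "s \<in> borel_measurable \<mu>" using assms by (rule borel_measurable_simple_function)
    show "cmod (s x) \<le> (\<Sum>y\<in>s ` G. cmod y)" if "x \<in> G" for x
      using fin that by (intro member_le_sum) auto
  qed
  ultimately show ?thesis
  proof -
    assume a: "L2_approx (\<lambda>x. \<Sum>y\<in>s ` G. y * indicator (s -` {y} \<inter> G) x)"
    have "L2_dist2 s (\<lambda>x. \<Sum>y\<in>s ` G. y * indicator (s -` {y} \<inter> G) x) = (\<integral>x. 0 \<partial>\<mu>)"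
      unfolding L2_dist2_def by (intro Bochner_Integration.integral_cong refl) (simp add: eq space_mu)
    then show ?thesis using a by (intro L2_approx_limit sq) auto
  qed
qed

lemma square_integrable_imp_L2_approx:
  assumes f: "square_integrable \<mu> f"
  shows "L2_approx f"
proof (rule L2_approx_limit[OF f])
  fix e :: real assume e: "e > 0"
  have fm: "f \<in> borel_measurable \<mu>" and fi: "integrable \<mu> (\<lambda>x. (cmod (f x))\<^sup>2)"
    using f by (auto simp: square_integrable_def)
  obtain s where s: "\<And>i. simple_function \<mu> (s i)" "\<And>x. x \<in> space \<mu> \<Longrightarrow> (\<lambda>i. s i x) \<longlonglongrightarrow> f x"
    "\<And>i x. x \<in> space \<mu> \<Longrightarrow> dist (s i x) 0 \<le> 2 * dist (f x) 0"
    using borel_measurable_implies_sequence_metric[OF fm, of 0] by blast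
  have sm: "s i \<in> borel_measurable \<mu>" for i using s(1) by (rule borel_measurable_simple_function)
  have "(\<lambda>i. \<integral>x. (cmod (f x - s i x))\<^sup>2 \<partial>\<mu>) \<longlonglongrightarrow> (\<integral>x. 0 \<partial>\<mu>)"
  proof (rule integral_dominated_convergence)
    \<comment> \<open>The simple functions satisfy |s| \<le> 2 |f|, so the squared difference is at
      most 2 |f|^2 + 2 (2 |f|)^2.\<close>
    show "integrable \<mu> (\<lambda>x. 10 * (cmod (f x))\<^sup>2)" using fi by simp
    show "AE x in \<mu>. (\<lambda>i. (cmod (f x - s i x))\<^sup>2) \<longlonglongrightarrow> 0"
    proof (rule AE_I2)
      fix x assume "x \<in> space \<mu>"
      then have "(\<lambda>i. (cmod (f x - s i x))\<^sup>2) \<longlonglongrightarrow> (cmod (f x - f x))\<^sup>2"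
        by (intro tendsto_intros s)
      then show "(\<lambda>i. (cmod (f x - s i x))\<^sup>2) \<longlonglongrightarrow> 0" by simp
    qed
    show "AE x in \<mu>. norm ((cmod (f x - s i x))\<^sup>2) \<le> 10 * (cmod (f x))\<^sup>2" for i
    proof (rule AE_I2)
      fix x assume "x \<in> space \<mu>"
      then have "cmod (s i x) \<le> 2 * cmod (f x)" using s(3)[of x i] by simp
      then have "(cmod (s i x))\<^sup>2 \<le> (2 * cmod (f x))\<^sup>2" by (intro power_mono) auto
      then show "norm ((cmod (f x - s i x))\<^sup>2) \<le> 10 * (cmod (f x))\<^sup>2"
        using norm_diff_sq_le[of "f x" "s i x"] by (simp add: power_mult_distrib)
    qed
  qed (use fm sm in measurable)
  then have "eventually (\<lambda>i. L2_dist2 f (s i) < e) sequentially"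
    using e unfolding L2_dist2_def by (intro order_tendstoD(2)) auto
  then obtain i where "L2_dist2 f (s i) < e"
    using eventually_happens'[OF sequentially_bot] by blast
  then show "\<exists>g. L2_approx g \<and> L2_dist2 f g < e" using L2_approx_simple[OF s(1)] by blast
qed

end

section \<open>Unitary representations\<close>

text \<open>Matrices of varying, possibly rectangular format are functions of two indices that
  vanish outside the format (\<open>fm_supp\<close>), and the product is told its inner dimension.
  Associativity then holds without side conditions, which suits long computations with
  intertwiners.\<close>

definition fm_mult :: "nat \<Rightarrow> (nat \<Rightarrow> nat \<Rightarrow> complex) \<Rightarrow> (nat \<Rightarrow> nat \<Rightarrow> complex) \<Rightarrow> nat \<Rightarrow> nat \<Rightarrow> complex" where
  "fm_mult n A B = (\<lambda>i j. \<Sum>k<n. A i k * B k j)"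

definition fm_adj :: "(nat \<Rightarrow> nat \<Rightarrow> complex) \<Rightarrow> nat \<Rightarrow> nat \<Rightarrow> complex" where
  "fm_adj A = (\<lambda>i j. cnj (A j i))"

definition fm_one :: "nat \<Rightarrow> nat \<Rightarrow> nat \<Rightarrow> complex" where
  "fm_one n = (\<lambda>i j. if i = j \<and> i < n then 1 else 0)"

definition fm_supp :: "nat \<Rightarrow> nat \<Rightarrow> (nat \<Rightarrow> nat \<Rightarrow> complex) \<Rightarrow> bool" where
  "fm_supp n m A \<longleftrightarrow> (\<forall>i j. i \<ge> n \<or> j \<ge> m \<longrightarrow> A i j = 0)"

lemma fm_assoc: "fm_mult n (fm_mult p A B) C = fm_mult p A (fm_mult n B C)"
proof (intro ext)
  fix i j
  have "fm_mult n (fm_mult p A B) C i j = (\<Sum>k<n. \<Sum>m<p. A i m * B m k * C k j)"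
    by (simp add: fm_mult_def sum_distrib_right)
  also have "\<dots> = (\<Sum>m<p. \<Sum>k<n. A i m * B m k * C k j)" by (rule sum.swap)
  also have "\<dots> = fm_mult p A (fm_mult n B C) i j"
    by (simp add: fm_mult_def sum_distrib_left mult.assoc)
  finally show "fm_mult n (fm_mult p A B) C i j = fm_mult p A (fm_mult n B C) i j" .
qed

lemma fm_adj_mult: "fm_adj (fm_mult n A B) = fm_mult n (fm_adj B) (fm_adj A)"
  by (simp add: fm_adj_def fm_mult_def mult.commute)

lemma fm_adj_adj [simp]: "fm_adj (fm_adj A) = A"
  by (simp add: fm_adj_def)

lemma fm_adj_one [simp]: "fm_adj (fm_one n) = fm_one n"
  by (auto simp: fm_adj_def fm_one_def fun_eq_iff)

lemma fm_supp_mult: "fm_supp n k A \<Longrightarrow> fm_supp k' m B \<Longrightarrow> fm_supp n m (fm_mult p A B)"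
  by (auto simp: fm_supp_def fm_mult_def)

lemma fm_supp_adj: "fm_supp n m A \<Longrightarrow> fm_supp m n (fm_adj A)"
  by (auto simp: fm_supp_def fm_adj_def)

lemma fm_one_mult: "fm_supp n m A \<Longrightarrow> fm_mult n (fm_one n) A = A"
proof (intro ext)
  fix i j assume A: "fm_supp n m A"
  have "fm_mult n (fm_one n) A i j = (\<Sum>k<n. if k = i then A i j else 0)"
    unfolding fm_mult_def fm_one_def by (intro sum.cong) auto
  also have "\<dots> = A i j" using A by (auto simp: fm_supp_def)
  finally show "fm_mult n (fm_one n) A i j = A i j" .
qed

lemma fm_mult_one: "fm_supp n m A \<Longrightarrow> fm_mult m A (fm_one m) = A"
proof (intro ext)
  fix i j assume A: "fm_supp n m A"
  have "fm_mult m A (fm_one m) i j = (\<Sum>k<m. if k = j then A i j else 0)"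
    unfolding fm_mult_def fm_one_def by (intro sum.cong) auto
  also have "\<dots> = A i j" using A by (auto simp: fm_supp_def)
  finally show "fm_mult m A (fm_one m) i j = A i j" .
qed

lemma fm_mult_scale_left: "fm_mult n (\<lambda>i j. c * A i j) B = (\<lambda>i j. c * fm_mult n A B i j)"
  and fm_mult_scale_right: "fm_mult n A (\<lambda>i j. c * B i j) = (\<lambda>i j. c * fm_mult n A B i j)"
  by (simp_all add: fm_mult_def sum_distrib_left mult_ac)

text \<open>Matrix entries, extended by zero, so that identities of matrices become identities of functions.\<close>

definition rep_coeff :: "('l::prime_card padic ^'m ^'m \<Rightarrow> complex Matrix.mat) \<Rightarrow> 'l padic ^'m ^'m \<Rightarrow> nat \<Rightarrow> nat \<Rightarrow> complex" where
  "rep_coeff \<xi> x = (\<lambda>i j. if i < rep_dim \<xi> \<and> j < rep_dim \<xi> then \<xi> x $$ (i, j) else 0)"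

lemma fm_supp_rep_coeff: "fm_supp (rep_dim \<xi>) (rep_dim \<xi>) (rep_coeff \<xi> x)"
  by (auto simp: fm_supp_def rep_coeff_def)

lemma mat_adjoint_dim: "A \<in> carrier_mat n m \<Longrightarrow> mat_adjoint A \<in> carrier_mat m n"
  by (auto simp: mat_adjoint_def)

lemma mat_adjoint_index:
  "A \<in> carrier_mat n m \<Longrightarrow> i < m \<Longrightarrow> j < n \<Longrightarrow> mat_adjoint A $$ (i, j) = cnj (A $$ (j, i :: nat))"
  by (auto simp: mat_adjoint_def mat_of_rows_index conjugate_complex_def)

lemma mult_mat_entry:
  "A \<in> carrier_mat n k \<Longrightarrow> B \<in> carrier_mat k m \<Longrightarrow> i < n \<Longrightarrow> j < m \<Longrightarrow>
    (A * B) $$ (i, j) = (\<Sum>l<k. A $$ (i, l) * (B $$ (l, j) :: complex))"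
  by (auto simp: scalar_prod_def atLeast0LessThan)

lemma unitary_mat_iff:
  assumes "U \<in> carrier_mat n n"
  shows "unitary_mat n U \<longleftrightarrow> (\<forall>i<n. \<forall>j<n. (\<Sum>k<n. U $$ (i, k) * cnj (U $$ (j, k))) = (if i = j then 1 else 0))"
proof -
  have a: "mat_adjoint U \<in> carrier_mat n n" using assms by (rule mat_adjoint_dim)
  have e: "(U * mat_adjoint U) $$ (i, j) = (\<Sum>k<n. U $$ (i, k) * cnj (U $$ (j, k)))" if "i < n" "j < n" for i j
    unfolding mult_mat_entry[OF assms a that]
    by (intro sum.cong refl) (use that in \<open>simp add: mat_adjoint_index[OF assms]\<close>)
  have "unitary_mat n U \<longleftrightarrow> U * mat_adjoint U = 1\<^sub>m n" using assms by (simp add: unitary_mat_def)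
  also have "\<dots> \<longleftrightarrow> (\<forall>i<n. \<forall>j<n. (U * mat_adjoint U) $$ (i, j) = (1\<^sub>m n :: complex Matrix.mat) $$ (i, j))"
    using assms a by (auto simp: mat_eq_iff)
  also have "\<dots> \<longleftrightarrow> (\<forall>i<n. \<forall>j<n. (\<Sum>k<n. U $$ (i, k) * cnj (U $$ (j, k))) = (if i = j then 1 else 0))"
    by (auto simp: e)
  finally show ?thesis .
qed

lemma unitary_mat_adjoint_left:
  assumes "unitary_mat n U"
  shows "mat_adjoint U * U = 1\<^sub>m n"
  using assms mat_mult_left_right_inverse[of U n "mat_adjoint U"] mat_adjoint_dim[of U n n]
  by (auto simp: unitary_mat_def)

context padic_matrix_group
begin

lemma unitary_rep_carrier: "unitary_rep G \<xi> \<Longrightarrow> x \<in> G \<Longrightarrow> \<xi> x \<in> carrier_mat (rep_dim \<xi>) (rep_dim \<xi>)"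
  by (simp add: unitary_rep_def unitary_mat_def)

lemma rep_coeff_mult:
  assumes "unitary_rep G \<xi>" "x \<in> G" "y \<in> G"
  shows "rep_coeff \<xi> (x ** y) = fm_mult (rep_dim \<xi>) (rep_coeff \<xi> x) (rep_coeff \<xi> y)"
proof (intro ext)
  fix i j
  have "\<xi> (x ** y) = \<xi> x * \<xi> y" using assms by (simp add: unitary_rep_def)
  then show "rep_coeff \<xi> (x ** y) i j = fm_mult (rep_dim \<xi>) (rep_coeff \<xi> x) (rep_coeff \<xi> y) i j"
    using mult_mat_entry[OF unitary_rep_carrier[OF assms(1,2)] unitary_rep_carrier[OF assms(1,3)], of i j]
    by (auto simp: rep_coeff_def fm_mult_def)
qed

lemma rep_coeff_unitary:
  assumes "unitary_rep G \<xi>" "x \<in> G"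
  shows "fm_mult (rep_dim \<xi>) (rep_coeff \<xi> x) (fm_adj (rep_coeff \<xi> x)) = fm_one (rep_dim \<xi>)"
proof (intro ext)
  fix i j
  have "unitary_mat (rep_dim \<xi>) (\<xi> x)" using assms by (simp add: unitary_rep_def)
  then have "\<forall>i<rep_dim \<xi>. \<forall>j<rep_dim \<xi>. (\<Sum>k<rep_dim \<xi>. \<xi> x $$ (i, k) * cnj (\<xi> x $$ (j, k))) = (if i = j then 1 else 0)"
    using unitary_mat_iff[OF unitary_rep_carrier[OF assms]] by simp
  then show "fm_mult (rep_dim \<xi>) (rep_coeff \<xi> x) (fm_adj (rep_coeff \<xi> x)) i j = fm_one (rep_dim \<xi>) i j"
    by (cases "i < rep_dim \<xi>"; cases "j < rep_dim \<xi>") (auto simp: rep_coeff_def fm_mult_def fm_adj_def fm_one_def)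
qed

text \<open>A \<open>unitary_rep\<close> is only required to be multiplicative, so its value at the
  identity is idempotent; being unitary as well, it is the identity matrix.\<close>

lemma rep_coeff_one:
  assumes "unitary_rep G \<xi>"
  shows "rep_coeff \<xi> (mat 1) = fm_one (rep_dim \<xi>)"
proof -
  let ?d = "rep_dim \<xi>" and ?R = "rep_coeff \<xi> (mat 1)"
  have "?R = fm_mult ?d ?R (fm_mult ?d ?R (fm_adj ?R))"
    unfolding rep_coeff_unitary[OF assms G_one] by (simp add: fm_mult_one[OF fm_supp_rep_coeff])
  also have "\<dots> = fm_mult ?d (fm_mult ?d ?R ?R) (fm_adj ?R)" by (simp only: fm_assoc)
  also have "fm_mult ?d ?R ?R = ?R" using rep_coeff_mult[OF assms G_one G_one] by simp
  also have "fm_mult ?d ?R (fm_adj ?R) = fm_one ?d" by (rule rep_coeff_unitary[OF assms G_one])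
  finally show ?thesis .
qed

lemma rep_coeff_inv:
  assumes "unitary_rep G \<xi>" "x \<in> G"
  shows "rep_coeff \<xi> (matrix_inv x) = fm_adj (rep_coeff \<xi> x)"
proof -
  let ?d = "rep_dim \<xi>" and ?R = "rep_coeff \<xi>"
  have "?R (matrix_inv x) = fm_mult ?d (?R (matrix_inv x)) (fm_mult ?d (?R x) (fm_adj (?R x)))"
    unfolding rep_coeff_unitary[OF assms] by (simp add: fm_mult_one[OF fm_supp_rep_coeff])
  also have "\<dots> = fm_mult ?d (fm_mult ?d (?R (matrix_inv x)) (?R x)) (fm_adj (?R x))" by (simp only: fm_assoc)
  also have "fm_mult ?d (?R (matrix_inv x)) (?R x) = fm_one ?d"
    using rep_coeff_mult[OF assms(1) G_inv(1)[OF assms(2)] assms(2)] rep_coeff_one[OF assms(1)]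
    by (simp add: G_inv assms)
  also have "fm_mult ?d (fm_one ?d) (fm_adj (?R x)) = fm_adj (?R x)"
    by (rule fm_one_mult[OF fm_supp_adj[OF fm_supp_rep_coeff]])
  finally show ?thesis .
qed

lemma rep_coeff_le_1:
  assumes "unitary_rep G \<xi>" "x \<in> G"
  shows "cmod (rep_coeff \<xi> x i j) \<le> 1"
proof (cases "i < rep_dim \<xi> \<and> j < rep_dim \<xi>")
  case True
  let ?d = "rep_dim \<xi>" and ?R = "rep_coeff \<xi> x"
  have "(\<Sum>k<?d. ?R i k * cnj (?R i k)) = 1"
    using fun_cong[OF fun_cong[OF rep_coeff_unitary[OF assms]], of i i] True
    by (simp add: fm_mult_def fm_adj_def fm_one_def)
  then have "complex_of_real (\<Sum>k<?d. (cmod (?R i k))\<^sup>2) = 1"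
    by (simp only: of_real_sum complex_norm_square)
  then have "(\<Sum>k<?d. (cmod (?R i k))\<^sup>2) = 1" by (simp only: of_real_eq_1_iff)
  moreover have "(cmod (?R i j))\<^sup>2 \<le> (\<Sum>k<?d. (cmod (?R i k))\<^sup>2)"
    using True by (intro member_le_sum) auto
  ultimately show ?thesis using abs_square_le_1[of "cmod (?R i j)"] by simp
qed (auto simp: rep_coeff_def)

section \<open>Schur's lemma for one representation\<close>

lemma vec_subspaceI:
  fixes W :: "complex Matrix.vec set"
  assumes "W \<subseteq> carrier_vec n" "0\<^sub>v n \<in> W" "\<And>v w. v \<in> W \<Longrightarrow> w \<in> W \<Longrightarrow> v + w \<in> W"
    "\<And>c v. v \<in> W \<Longrightarrow> c \<cdot>\<^sub>v v \<in> W"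
  shows "VectorSpace.subspace class_ring W (module_vec TYPE(complex) n)"
  unfolding subspace_def submodule_def
  using assms vec_vs[of n, where 'a=complex] vec_module[of n, where 'a=complex]
  by (auto simp: module_vec_simps)

lemma vec_subspaceD:
  fixes W :: "complex Matrix.vec set"
  assumes "VectorSpace.subspace class_ring W (module_vec TYPE(complex) n)"
  shows "W \<subseteq> carrier_vec n" "0\<^sub>v n \<in> W" "\<And>v w. v \<in> W \<Longrightarrow> w \<in> W \<Longrightarrow> v + w \<in> W"
    "\<And>c v. v \<in> W \<Longrightarrow> c \<cdot>\<^sub>v v \<in> W"
  using assms unfolding subspace_def submodule_def by (auto simp: module_vec_simps)

lemma irreps_unitary: "\<xi> \<in> irreps G \<Longrightarrow> unitary_rep G \<xi>"
  by (simp add: irreps_def)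

lemma irreps_dim_pos: "\<xi> \<in> irreps G \<Longrightarrow> rep_dim \<xi> > 0"
  by (simp add: irreps_def irreducible_rep_def)

text \<open>Over the complex numbers M has an eigenvalue, and since M commutes with the
  representation, the eigenspace is invariant. It is not zero, so by irreducibility it is the whole
  space.\<close>

lemma Schur_scalar:
  assumes irr: "\<xi> \<in> irreps G" and supp: "fm_supp (rep_dim \<xi>) (rep_dim \<xi>) M"
    and comm: "\<And>z. z \<in> G \<Longrightarrow> fm_mult (rep_dim \<xi>) (rep_coeff \<xi> z) M = fm_mult (rep_dim \<xi>) M (rep_coeff \<xi> z)"
  obtains m where "M = (\<lambda>i j. m * fm_one (rep_dim \<xi>) i j)"
proof -
  let ?d = "rep_dim \<xi>"
  define A where "A = Matrix.mat ?d ?d (\<lambda>(i, j). M i j)"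
  have A: "A \<in> carrier_mat ?d ?d" by (simp add: A_def)
  note ur = irreps_unitary[OF irr]
  have "degree (char_poly A) > 0"
    using degree_monic_char_poly[OF A] irreps_dim_pos[OF irr] by simp
  then have "\<not> constant (poly (char_poly A))" by (simp add: constant_degree)
  then obtain m where "poly (char_poly A) m = 0" using fundamental_theorem_of_algebra by blast
  then have "eigenvalue A m" by (simp add: eigenvalue_root_char_poly[OF A])
  then obtain v where v: "v \<in> carrier_vec ?d" "v \<noteq> 0\<^sub>v ?d" "A *\<^sub>v v = m \<cdot>\<^sub>v v"
    using A by (auto simp: eigenvalue_def eigenvector_def)
  define W where "W = {w \<in> carrier_vec ?d. A *\<^sub>v w = m \<cdot>\<^sub>v w}"
  have sub: "VectorSpace.subspace class_ring W (module_vec TYPE(complex) ?d)"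
  proof (rule vec_subspaceI)
    show "v + w \<in> W" if "v \<in> W" "w \<in> W" for v w
      using that A by (auto simp: W_def mult_add_distrib_mat_vec[OF A] smult_add_distrib_vec)
    show "c \<cdot>\<^sub>v v \<in> W" if "v \<in> W" for c v
      using that A by (auto simp: W_def mult_mat_vec[OF A] smult_smult_assoc mult.commute)
  qed (use A in \<open>auto simp: W_def\<close>)
  have comm': "\<xi> z * A = A * \<xi> z" if z: "z \<in> G" for z
  proof (rule eq_matI)
    have c: "\<xi> z \<in> carrier_mat ?d ?d" by (rule unitary_rep_carrier[OF ur z])
    fix i j assume "i < dim_row (A * \<xi> z)" "j < dim_col (A * \<xi> z)"
    then have ij: "i < ?d" "j < ?d" using A c by auto
    have "(\<xi> z * A) $$ (i, j) = fm_mult ?d (rep_coeff \<xi> z) M i j"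
      unfolding mult_mat_entry[OF c A ij] fm_mult_def
      by (intro sum.cong) (use ij in \<open>auto simp: rep_coeff_def A_def\<close>)
    moreover have "(A * \<xi> z) $$ (i, j) = fm_mult ?d M (rep_coeff \<xi> z) i j"
      unfolding mult_mat_entry[OF A c ij] fm_mult_def
      by (intro sum.cong) (use ij in \<open>auto simp: rep_coeff_def A_def\<close>)
    ultimately show "(\<xi> z * A) $$ (i, j) = (A * \<xi> z) $$ (i, j)" by (simp add: comm[OF z])
  qed (use A unitary_rep_carrier[OF ur z] in auto)
  have "\<forall>x\<in>G. \<forall>w\<in>W. \<xi> x *\<^sub>v w \<in> W"
  proof (intro ballI)
    fix x w assume x: "x \<in> G" and w: "w \<in> W"
    have c: "\<xi> x \<in> carrier_mat ?d ?d" by (rule unitary_rep_carrier[OF ur x])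
    have wc: "w \<in> carrier_vec ?d" "A *\<^sub>v w = m \<cdot>\<^sub>v w" using w by (auto simp: W_def)
    have "A *\<^sub>v (\<xi> x *\<^sub>v w) = \<xi> x *\<^sub>v (A *\<^sub>v w)"
      using assoc_mult_mat_vec[OF A c wc(1)] assoc_mult_mat_vec[OF c A wc(1)] comm'[OF x] by simp
    also have "\<dots> = m \<cdot>\<^sub>v (\<xi> x *\<^sub>v w)" using c wc by (simp add: mult_mat_vec)
    finally show "\<xi> x *\<^sub>v w \<in> W" using c wc by (simp add: W_def)
  qed
  then have "W = {0\<^sub>v ?d} \<or> W = carrier_vec ?d"
    using irr sub by (auto simp: irreps_def irreducible_rep_def)
  moreover have "v \<in> W" using v by (simp add: W_def)
  ultimately have W: "W = carrier_vec ?d" using v(2) by auto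
  have "M i j = m * fm_one ?d i j" for i j
  proof (cases "i < ?d \<and> j < ?d")
    case True
    have "unit_vec ?d j \<in> W" using W by simp
    then have "A *\<^sub>v unit_vec ?d j = m \<cdot>\<^sub>v unit_vec ?d j" by (simp add: W_def)
    then have "vec_index (A *\<^sub>v unit_vec ?d j) i = vec_index (m \<cdot>\<^sub>v unit_vec ?d j) i" by simp
    then show ?thesis using True A by (auto simp: A_def fm_one_def)
  next
    case False
    then show ?thesis using supp by (auto simp: fm_supp_def fm_one_def)
  qed
  then show ?thesis using that[of m] by auto
qed

end

section \<open>Schur's lemma for two representations\<close>

lemma fm_mult_diag: "fm_mult n A (fm_adj A) i i = complex_of_real (\<Sum>k<n. (cmod (A i k))\<^sup>2)"
  unfolding fm_mult_def fm_adj_def of_real_sum by (simp add: complex_norm_square del: of_real_power)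

lemma unitary_mat_one: "unitary_mat n (1\<^sub>m n)"
  by (subst unitary_mat_iff) (auto simp: if_distrib cong: if_cong)

lemma unitary_mat_adjoint:
  assumes "unitary_mat n U"
  shows "unitary_mat n (mat_adjoint U)"
proof -
  have c: "U \<in> carrier_mat n n" using assms by (simp add: unitary_mat_def)
  have a: "mat_adjoint U \<in> carrier_mat n n" using c by (rule mat_adjoint_dim)
  have "mat_adjoint (mat_adjoint U) = U"
    by (rule eq_matI) (use c mat_adjoint_dim[OF a] in \<open>auto simp: mat_adjoint_index[OF a] mat_adjoint_index[OF c]\<close>)
  then show ?thesis using unitary_mat_adjoint_left[OF assms] a by (simp add: unitary_mat_def)
qed

context padic_matrix_group
begin

text \<open>If A is the adjoint of B, then A B and B A commute with one representation each, so both
  are scalar. The scalars agree because B (A B) = (B A) B, and for nonzero B they equal some r > 0.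
  Hence B / sqrt r is unitary, once the two dimensions are known to coincide.\<close>

lemma intertwiner_zero_or_equiv:
  assumes irr: "\<xi> \<in> irreps G" "\<eta> \<in> irreps G"
    and supp: "fm_supp (rep_dim \<eta>) (rep_dim \<xi>) B"
    and comm: "\<And>z. z \<in> G \<Longrightarrow> fm_mult (rep_dim \<eta>) (rep_coeff \<eta> z) B = fm_mult (rep_dim \<xi>) B (rep_coeff \<xi> z)"
    and nequiv: "(\<xi>, \<eta>) \<notin> rep_equiv G"
  shows "B = (\<lambda>i j. 0)"
proof (rule ccontr)
  assume B: "B \<noteq> (\<lambda>i j. 0)"
  let ?d = "rep_dim \<xi>" and ?e = "rep_dim \<eta>"
  note ur = irreps_unitary[OF irr(1)] irreps_unitary[OF irr(2)]
  have adj: "fm_mult ?e (fm_adj B) (rep_coeff \<eta> z) = fm_mult ?d (rep_coeff \<xi> z) (fm_adj B)" if z: "z \<in> G" for z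
  proof -
    have "fm_adj (fm_mult ?e (rep_coeff \<eta> (matrix_inv z)) B) = fm_adj (fm_mult ?d B (rep_coeff \<xi> (matrix_inv z)))"
      using comm[OF G_inv(1)[OF z]] by simp
    then show ?thesis by (simp add: fm_adj_mult rep_coeff_inv[OF ur(1) z] rep_coeff_inv[OF ur(2) z])
  qed
  define C where "C = fm_mult ?e (fm_adj B) B"
  define D where "D = fm_mult ?d B (fm_adj B)"
  have Cs: "fm_supp ?d ?d C" unfolding C_def by (rule fm_supp_mult[OF fm_supp_adj[OF supp] supp])
  have Ds: "fm_supp ?e ?e D" unfolding D_def by (rule fm_supp_mult[OF supp fm_supp_adj[OF supp]])
  have "fm_mult ?d (rep_coeff \<xi> z) C = fm_mult ?d C (rep_coeff \<xi> z)" if z: "z \<in> G" for z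
    unfolding C_def fm_assoc comm[OF z, symmetric]
    by (simp only: fm_assoc[symmetric] adj[OF z])
  then obtain c where c: "C = (\<lambda>i j. c * fm_one ?d i j)" using Schur_scalar[OF irr(1) Cs] by blast
  have "fm_mult ?e (rep_coeff \<eta> z) D = fm_mult ?e D (rep_coeff \<eta> z)" if z: "z \<in> G" for z
    unfolding D_def fm_assoc adj[OF z]
    by (simp only: fm_assoc[symmetric] comm[OF z])
  then obtain c' where c': "D = (\<lambda>i j. c' * fm_one ?e i j)" using Schur_scalar[OF irr(2) Ds] by blast
  define S where "S = (\<Sum>i<?e. \<Sum>j<?d. (cmod (B i j))\<^sup>2)"
  have D1: "complex_of_real (\<Sum>k<?d. (cmod (B i k))\<^sup>2) = c'" if "i < ?e" for i
    using fm_mult_diag[of ?d B i] that by (simp add: D_def[symmetric] c' fm_one_def)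
  have C1: "complex_of_real (\<Sum>k<?e. (cmod (B k j))\<^sup>2) = c" if "j < ?d" for j
    using fm_mult_diag[of ?e "fm_adj B" j] that by (simp add: C_def[symmetric] c fm_one_def) (simp add: fm_adj_def)
  have "fm_mult ?d B C = fm_mult ?e D B" by (simp add: C_def D_def fm_assoc)
  then have fe: "(\<lambda>i j. c * B i j) = (\<lambda>i j. c' * B i j)"
    unfolding c c' by (simp add: fm_mult_scale_left fm_mult_scale_right fm_mult_one[OF supp] fm_one_mult[OF supp])
  obtain i0 j0 where ij0: "B i0 j0 \<noteq> 0" using B by (auto simp: fun_eq_iff)
  have cc: "c' = c" using fun_cong[OF fun_cong[OF fe], of i0 j0] ij0 by simp
  have b0: "i0 < ?e" "j0 < ?d" using ij0 supp unfolding fm_supp_def by (meson not_le)+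
  define r where "r = (\<Sum>k<?d. (cmod (B i0 k))\<^sup>2)"
  have cr: "c = complex_of_real r" using D1[OF b0(1)] cc by (simp add: r_def)
  have "(cmod (B i0 j0))\<^sup>2 \<le> r" unfolding r_def using b0 by (intro member_le_sum) auto
  moreover have "(cmod (B i0 j0))\<^sup>2 > 0" using ij0 by simp
  ultimately have r: "r > 0" by linarith
  have D2: "(\<Sum>k<?d. (cmod (B i k))\<^sup>2) = r" if "i < ?e" for i
    using D1[OF that] cc cr by (simp only: of_real_eq_iff)
  have C2: "(\<Sum>k<?e. (cmod (B k j))\<^sup>2) = r" if "j < ?d" for j
    using C1[OF that] cr by (simp only: of_real_eq_iff)
  \<comment> \<open>Every row and every column of B has square norm r; adding up all entries in both
    orders compares the dimensions.\<close>
  have "real ?e * r = (\<Sum>i<?e. \<Sum>j<?d. (cmod (B i j))\<^sup>2)" using D2 by simp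
  also have "\<dots> = (\<Sum>j<?d. \<Sum>i<?e. (cmod (B i j))\<^sup>2)" by (rule sum.swap)
  also have "\<dots> = real ?d * r" using C2 by simp
  finally have dim: "?e = ?d" using r by simp
  define T where "T = Matrix.mat ?d ?d (\<lambda>(i, j). B i j / complex_of_real (sqrt r))"
  have T: "T \<in> carrier_mat ?d ?d" by (simp add: T_def)
  have "unitary_mat ?d T"
  proof (subst unitary_mat_iff[OF T], intro allI impI)
    fix i j assume ij: "i < ?d" "j < ?d"
    have "(\<Sum>k<?d. T $$ (i, k) * cnj (T $$ (j, k))) = (\<Sum>k<?d. B i k * cnj (B j k) / complex_of_real r)"
    proof (rule sum.cong)
      fix k assume "k \<in> {..<?d}"
      then have "T $$ (i, k) * cnj (T $$ (j, k)) = B i k * cnj (B j k) / (complex_of_real (sqrt r) * complex_of_real (sqrt r))"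
        using ij by (simp add: T_def)
      also have "complex_of_real (sqrt r) * complex_of_real (sqrt r) = complex_of_real r"
        using r by (simp flip: of_real_mult)
      finally show "T $$ (i, k) * cnj (T $$ (j, k)) = B i k * cnj (B j k) / complex_of_real r" .
    qed simp
    also have "\<dots> = D i j / complex_of_real r"
      by (simp add: D_def fm_mult_def fm_adj_def sum_divide_distrib)
    also have "\<dots> = (if i = j then 1 else 0)" using ij r dim by (simp add: c' cc cr fm_one_def)
    finally show "(\<Sum>k<?d. T $$ (i, k) * cnj (T $$ (j, k))) = (if i = j then 1 else 0)" .
  qed
  moreover have "T * \<xi> x = \<eta> x * T" if x: "x \<in> G" for x
  proof (rule eq_matI)
    have cx: "\<xi> x \<in> carrier_mat ?d ?d" and ce: "\<eta> x \<in> carrier_mat ?d ?d"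
      using unitary_rep_carrier[OF ur(1) x] unitary_rep_carrier[OF ur(2) x] dim by auto
    fix i j assume "i < dim_row (\<eta> x * T)" "j < dim_col (\<eta> x * T)"
    then have ij: "i < ?d" "j < ?d" using T ce by auto
    have "(T * \<xi> x) $$ (i, j) = fm_mult ?d B (rep_coeff \<xi> x) i j / complex_of_real (sqrt r)"
      unfolding mult_mat_entry[OF T cx ij] fm_mult_def sum_divide_distrib
      by (intro sum.cong) (use ij in \<open>auto simp: rep_coeff_def T_def\<close>)
    also have "\<dots> = fm_mult ?e (rep_coeff \<eta> x) B i j / complex_of_real (sqrt r)" by (simp add: comm[OF x])
    also have "\<dots> = (\<eta> x * T) $$ (i, j)"
      unfolding mult_mat_entry[OF ce T ij] fm_mult_def sum_divide_distrib dim
      by (intro sum.cong) (use ij dim in \<open>auto simp: rep_coeff_def T_def\<close>)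
    finally show "(T * \<xi> x) $$ (i, j) = (\<eta> x * T) $$ (i, j)" .
  qed (use T unitary_rep_carrier[OF ur(1) x] unitary_rep_carrier[OF ur(2) x] dim in auto)
  ultimately have "(\<xi>, \<eta>) \<in> rep_equiv G"
    using irr dim unfolding rep_equiv_def by blast
  then show False using nequiv by blast
qed

section \<open>Equivalence classes of irreducible representations\<close>

lemma rep_equivI:
  "\<xi> \<in> irreps G \<Longrightarrow> \<eta> \<in> irreps G \<Longrightarrow> rep_dim \<eta> = rep_dim \<xi> \<Longrightarrow> unitary_mat (rep_dim \<xi>) T \<Longrightarrow>
    (\<And>x. x \<in> G \<Longrightarrow> T * \<xi> x = \<eta> x * T) \<Longrightarrow> (\<xi>, \<eta>) \<in> rep_equiv G"
  unfolding rep_equiv_def by blast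

lemma rep_equivE:
  assumes "(\<xi>, \<eta>) \<in> rep_equiv G"
  obtains T where "\<xi> \<in> irreps G" "\<eta> \<in> irreps G" "rep_dim \<eta> = rep_dim \<xi>" "unitary_mat (rep_dim \<xi>) T"
    "\<And>x. x \<in> G \<Longrightarrow> T * \<xi> x = \<eta> x * T"
  using assms unfolding rep_equiv_def by blast

lemma equiv_rep_equiv: "equiv (irreps G) (rep_equiv G)"
proof (rule equivI)
  show "rep_equiv G \<subseteq> irreps G \<times> irreps G" by (auto simp: rep_equiv_def)
  show "refl_on (irreps G) (rep_equiv G)"
  proof (rule refl_onI)
    fix \<xi> assume x: "\<xi> \<in> irreps G"
    show "(\<xi>, \<xi>) \<in> rep_equiv G"
    proof (rule rep_equivI[OF x x refl unitary_mat_one])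
      fix y assume "y \<in> G"
      from unitary_rep_carrier[OF irreps_unitary[OF x] this]
      show "1\<^sub>m (rep_dim \<xi>) * \<xi> y = \<xi> y * 1\<^sub>m (rep_dim \<xi>)" by simp
    qed
  qed
  show "sym (rep_equiv G)"
  proof (rule symI)
    fix \<xi> \<eta> assume 1: "(\<xi>, \<eta>) \<in> rep_equiv G"
    obtain T where T: "\<xi> \<in> irreps G" "\<eta> \<in> irreps G" "rep_dim \<eta> = rep_dim \<xi>" "unitary_mat (rep_dim \<xi>) T"
      "\<And>x. x \<in> G \<Longrightarrow> T * \<xi> x = \<eta> x * T" by (rule rep_equivE[OF 1], rule that)
    let ?A = "mat_adjoint T"
    have c: "T \<in> carrier_mat (rep_dim \<xi>) (rep_dim \<xi>)" using T(4) by (simp add: unitary_mat_def)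
    have a: "?A \<in> carrier_mat (rep_dim \<xi>) (rep_dim \<xi>)" by (rule mat_adjoint_dim[OF c])
    have TA: "T * ?A = 1\<^sub>m (rep_dim \<xi>)" "?A * T = 1\<^sub>m (rep_dim \<xi>)"
      using T(4) unitary_mat_adjoint_left[OF T(4)] by (simp_all add: unitary_mat_def)
    show "(\<eta>, \<xi>) \<in> rep_equiv G"
    proof (rule rep_equivI[where T="?A"])
      show "unitary_mat (rep_dim \<eta>) ?A" using unitary_mat_adjoint[OF T(4)] T(3) by simp
      fix x assume x: "x \<in> G"
      have cx: "\<xi> x \<in> carrier_mat (rep_dim \<xi>) (rep_dim \<xi>)" and ce: "\<eta> x \<in> carrier_mat (rep_dim \<xi>) (rep_dim \<xi>)"
        using unitary_rep_carrier[OF irreps_unitary[OF T(1)] x] unitary_rep_carrier[OF irreps_unitary[OF T(2)] x] T(3) by auto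
      have "?A * \<eta> x = ?A * \<eta> x * (T * ?A)" using a ce by (simp add: TA)
      also have "\<dots> = ?A * (\<eta> x * T) * ?A" using a ce c by (simp add: assoc_mult_mat[of _ "rep_dim \<xi>" "rep_dim \<xi>" _ "rep_dim \<xi>" _ "rep_dim \<xi>"])
      also have "\<dots> = ?A * (T * \<xi> x) * ?A" by (simp add: T(5)[OF x])
      also have "\<dots> = (?A * T) * \<xi> x * ?A" using a cx c by (simp add: assoc_mult_mat[of _ "rep_dim \<xi>" "rep_dim \<xi>" _ "rep_dim \<xi>" _ "rep_dim \<xi>"])
      also have "\<dots> = \<xi> x * ?A" using a cx by (simp add: TA)
      finally show "?A * \<eta> x = \<xi> x * ?A" .
    qed (use T in auto)
  qed
  show "trans (rep_equiv G)"
  proof (rule transI)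
    fix \<xi> \<eta> \<zeta> assume 1: "(\<xi>, \<eta>) \<in> rep_equiv G" and 2: "(\<eta>, \<zeta>) \<in> rep_equiv G"
    obtain T where T: "\<xi> \<in> irreps G" "\<eta> \<in> irreps G" "rep_dim \<eta> = rep_dim \<xi>" "unitary_mat (rep_dim \<xi>) T"
      "\<And>x. x \<in> G \<Longrightarrow> T * \<xi> x = \<eta> x * T" by (rule rep_equivE[OF 1], rule that)
    obtain S where S: "\<zeta> \<in> irreps G" "rep_dim \<zeta> = rep_dim \<eta>" "unitary_mat (rep_dim \<eta>) S"
      "\<And>x. x \<in> G \<Longrightarrow> S * \<eta> x = \<zeta> x * S" by (rule rep_equivE[OF 2], rule that)
    let ?n = "rep_dim \<xi>"
    note assoc = assoc_mult_mat[of _ ?n ?n _ ?n _ ?n]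
    have c: "T \<in> carrier_mat ?n ?n" "S \<in> carrier_mat ?n ?n" using T(3,4) S(3) by (simp_all add: unitary_mat_def)
    have a: "mat_adjoint T \<in> carrier_mat ?n ?n" "mat_adjoint S \<in> carrier_mat ?n ?n" using c by (auto intro: mat_adjoint_dim)
    have st: "S * T \<in> carrier_mat ?n ?n" using c by simp
    have "mat_adjoint (S * T) = mat_adjoint T * mat_adjoint S"
    proof (rule eq_matI)
      fix i j assume "i < dim_row (mat_adjoint T * mat_adjoint S)" "j < dim_col (mat_adjoint T * mat_adjoint S)"
      then have ij: "i < ?n" "j < ?n" using a by auto
      show "mat_adjoint (S * T) $$ (i, j) = (mat_adjoint T * mat_adjoint S) $$ (i, j)"
        unfolding mat_adjoint_index[OF st ij] mult_mat_entry[OF c(2,1) ij(2,1)] mult_mat_entry[OF a ij] cnj_sum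
        by (intro sum.cong refl) (use ij in \<open>simp add: mat_adjoint_index[OF c(1)] mat_adjoint_index[OF c(2)] mult.commute\<close>)
    qed (use a mat_adjoint_dim[OF st] in auto)
    then have "(S * T) * mat_adjoint (S * T) = S * (T * mat_adjoint T) * mat_adjoint S"
      using a c by (simp add: assoc)
    also have "\<dots> = 1\<^sub>m ?n" using T(3,4) S(3) a c by (simp add: unitary_mat_def)
    finally have u: "unitary_mat ?n (S * T)" using st by (simp add: unitary_mat_def)
    show "(\<xi>, \<zeta>) \<in> rep_equiv G"
    proof (rule rep_equivI[OF T(1) S(1) _ u])
      fix x assume x: "x \<in> G"
      have cx: "\<xi> x \<in> carrier_mat ?n ?n" "\<eta> x \<in> carrier_mat ?n ?n" "\<zeta> x \<in> carrier_mat ?n ?n"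
        using unitary_rep_carrier[OF irreps_unitary[OF T(1)] x] unitary_rep_carrier[OF irreps_unitary[OF T(2)] x]
          unitary_rep_carrier[OF irreps_unitary[OF S(1)] x] T(3) S(2) by auto
      have "S * T * \<xi> x = S * (T * \<xi> x)" using c cx by (simp add: assoc)
      also have "\<dots> = (S * \<eta> x) * T" using c cx by (simp add: assoc T(5)[OF x])
      also have "\<dots> = \<zeta> x * (S * T)" using c cx by (simp add: assoc S(4)[OF x])
      finally show "S * T * \<xi> x = \<zeta> x * (S * T)" .
    qed (use T S in simp)
  qed
qed

lemma class_rep_in: "c \<in> unitary_dual G \<Longrightarrow> class_rep c \<in> c"
proof -
  assume "c \<in> unitary_dual G"
  then have "c \<noteq> {}" unfolding unitary_dual_def by (rule in_quotient_imp_non_empty[OF equiv_rep_equiv])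
  then show ?thesis unfolding class_rep_def by (simp add: some_in_eq)
qed

lemma class_rep_irreps: "c \<in> unitary_dual G \<Longrightarrow> class_rep c \<in> irreps G"
  using class_rep_in in_quotient_imp_subset[OF equiv_rep_equiv] unfolding unitary_dual_def by blast

lemma class_rep_not_equiv:
  assumes "c \<in> unitary_dual G" "c' \<in> unitary_dual G" "c \<noteq> c'"
  shows "(class_rep c, class_rep c') \<notin> rep_equiv G"
  using quotient_eqI[OF equiv_rep_equiv _ _ class_rep_in class_rep_in, of c c'] assms
  by (auto simp: unitary_dual_def)

lemma ex_class_rep:
  assumes "\<xi> \<in> irreps G"
  obtains c where "c \<in> unitary_dual G" "(\<xi>, class_rep c) \<in> rep_equiv G"
proof -
  let ?c = "rep_equiv G `` {\<xi>}"
  have c: "?c \<in> unitary_dual G" unfolding unitary_dual_def using assms by (rule quotientI)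
  then have "class_rep ?c \<in> ?c" by (rule class_rep_in)
  then show ?thesis using that[OF c] by blast
qed

definition trivial_on :: "nat \<Rightarrow> ('l padic ^'m ^'m \<Rightarrow> complex Matrix.mat) \<Rightarrow> bool" where
  "trivial_on j \<xi> \<longleftrightarrow> (\<forall>k\<in>K j. rep_coeff \<xi> k = fm_one (rep_dim \<xi>))"

lemma trivial_on_invariant:
  assumes "unitary_rep G \<xi>" "trivial_on j \<xi>" "x \<in> G" "k \<in> K j"
  shows "rep_coeff \<xi> (x ** k) = rep_coeff \<xi> x" "rep_coeff \<xi> (k ** x) = rep_coeff \<xi> x"
proof -
  have k: "k \<in> G" "rep_coeff \<xi> k = fm_one (rep_dim \<xi>)"
    using assms K_subset_G by (auto simp: trivial_on_def)
  show "rep_coeff \<xi> (x ** k) = rep_coeff \<xi> x"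
    using rep_coeff_mult[OF assms(1,3) k(1)] k(2) fm_mult_one[OF fm_supp_rep_coeff] by simp
  show "rep_coeff \<xi> (k ** x) = rep_coeff \<xi> x"
    using rep_coeff_mult[OF assms(1) k(1) assms(3)] k(2) fm_one_mult[OF fm_supp_rep_coeff] by simp
qed

end

context haar_padic_group
begin

section \<open>Schur orthogonality\<close>

definition ip :: "('l padic ^'m ^'m \<Rightarrow> complex) \<Rightarrow> ('l padic ^'m ^'m \<Rightarrow> complex) \<Rightarrow> complex" where
  "ip f g = (\<integral>x. f x * cnj (g x) \<partial>\<mu>)"

abbreviation "sqint \<equiv> square_integrable \<mu>"

lemma integrable_ip: "sqint f \<Longrightarrow> sqint g \<Longrightarrow> integrable \<mu> (\<lambda>x. f x * cnj (g x))"
  by (intro integrable_mult_square_integrable square_integrable_cnj)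

lemma ip_cnj: "sqint f \<Longrightarrow> sqint g \<Longrightarrow> cnj (ip f g) = ip g f"
  unfolding ip_def Bochner_Integration.integral_cnj[symmetric] by (simp add: mult.commute)

lemma ip_diff_left: "sqint f \<Longrightarrow> sqint g \<Longrightarrow> sqint h \<Longrightarrow> ip (\<lambda>x. f x - g x) h = ip f h - ip g h"
  unfolding ip_def
  by (subst Bochner_Integration.integral_diff[symmetric]) (auto simp: integrable_ip left_diff_distrib)

lemma square_integrable_sum:
  "finite I \<Longrightarrow> (\<And>i. i \<in> I \<Longrightarrow> sqint (f i)) \<Longrightarrow> sqint (\<lambda>x. \<Sum>i\<in>I. c i * f i x)"
proof (induction I rule: finite_induct)
  case empty
  show ?case by (rule square_integrable_bounded[where B=0]) auto
next
  case (insert i I)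
  then show ?case by (auto intro!: square_integrable_add square_integrable_scale)
qed

lemma ip_sum_left:
  assumes "finite I" "\<And>i. i \<in> I \<Longrightarrow> sqint (f i)" "sqint g"
  shows "ip (\<lambda>x. \<Sum>i\<in>I. c i * f i x) g = (\<Sum>i\<in>I. c i * ip (f i) g)"
proof -
  have "ip (\<lambda>x. \<Sum>i\<in>I. c i * f i x) g = (\<integral>x. (\<Sum>i\<in>I. c i * (f i x * cnj (g x))) \<partial>\<mu>)"
    unfolding ip_def by (simp add: sum_distrib_right mult.assoc)
  also have "\<dots> = (\<Sum>i\<in>I. (\<integral>x. c i * (f i x * cnj (g x)) \<partial>\<mu>))"
    using assms by (intro Bochner_Integration.integral_sum integrable_mult_right integrable_ip)
  also have "\<dots> = (\<Sum>i\<in>I. c i * ip (f i) g)" by (simp add: ip_def)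
  finally show ?thesis .
qed

lemma ip_self: "ip f f = complex_of_real (\<integral>x. (cmod (f x))\<^sup>2 \<partial>\<mu>)"
proof -
  have "ip f f = (\<integral>x. complex_of_real ((cmod (f x))\<^sup>2) \<partial>\<mu>)"
    unfolding ip_def by (simp only: complex_norm_square)
  then show ?thesis by (simp only: integral_complex_of_real)
qed

text \<open>Pythagoras for arbitrary coefficients b. With b the Fourier coefficients it yields
  Bessel's inequality; with b the coefficients of an approximating function it yields the converse
  estimate in \<open>Parseval_approx\<close>.\<close>

lemma L2_dist2_orthonormal_sum:
  assumes "finite I" "\<And>i. i \<in> I \<Longrightarrow> sqint (\<phi> i)" "sqint f"
    and on: "\<And>i j. i \<in> I \<Longrightarrow> j \<in> I \<Longrightarrow> ip (\<phi> i) (\<phi> j) = (if i = j then 1 else 0)"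
  shows "L2_dist2 f (\<lambda>x. \<Sum>i\<in>I. b i * \<phi> i x) =
    (\<integral>x. (cmod (f x))\<^sup>2 \<partial>\<mu>) - (\<Sum>i\<in>I. (cmod (ip f (\<phi> i)))\<^sup>2) + (\<Sum>i\<in>I. (cmod (ip f (\<phi> i) - b i))\<^sup>2)"
proof -
  let ?S = "\<lambda>x. \<Sum>i\<in>I. b i * \<phi> i x"
  let ?a = "\<lambda>i. ip f (\<phi> i)"
  have S: "sqint ?S" by (rule square_integrable_sum[OF assms(1,2)])
  have d: "sqint (\<lambda>x. f x - ?S x)" by (rule square_integrable_diff[OF assms(3) S])
  have Sf: "ip ?S f = (\<Sum>i\<in>I. b i * cnj (?a i))"
    by (subst ip_sum_left[OF assms(1,2,3)]) (auto intro!: sum.cong simp: ip_cnj assms)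
  have fS: "ip f ?S = (\<Sum>i\<in>I. cnj (b i) * ?a i)"
    using ip_cnj[OF S assms(3)] by (simp add: Sf)
  have SS: "ip ?S ?S = (\<Sum>i\<in>I. b i * cnj (b i))"
  proof -
    have "ip (\<phi> i) ?S = cnj (b i)" if i: "i \<in> I" for i
    proof -
      have "ip ?S (\<phi> i) = (\<Sum>j\<in>I. b j * ip (\<phi> j) (\<phi> i))"
        by (rule ip_sum_left[OF assms(1,2)]) (auto simp: assms(2) i)
      also have "\<dots> = (\<Sum>j\<in>I. if j = i then b j else 0)" by (intro sum.cong) (auto simp: on i)
      also have "\<dots> = b i" using assms(1) i by simp
      finally show ?thesis using ip_cnj[OF S assms(2)[OF i]] by simp
    qed
    then show ?thesis by (subst ip_sum_left[OF assms(1,2) S]) (auto intro!: sum.cong)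
  qed
  have "complex_of_real (L2_dist2 f ?S) = ip (\<lambda>x. f x - ?S x) (\<lambda>x. f x - ?S x)"
    by (simp only: ip_self L2_dist2_def)
  also have "\<dots> = ip f (\<lambda>x. f x - ?S x) - ip ?S (\<lambda>x. f x - ?S x)" by (rule ip_diff_left[OF assms(3) S d])
  also have "ip f (\<lambda>x. f x - ?S x) = cnj (ip f f - ip ?S f)"
    using ip_cnj[OF d assms(3)] ip_diff_left[OF assms(3) S assms(3)] by simp
  also have "ip ?S (\<lambda>x. f x - ?S x) = cnj (ip f ?S - ip ?S ?S)"
    using ip_cnj[OF d S] ip_diff_left[OF assms(3) S S] by simp
  also have "cnj (ip f f - ip ?S f) - cnj (ip f ?S - ip ?S ?S) =
      ip f f - (\<Sum>i\<in>I. ?a i * cnj (?a i)) + (\<Sum>i\<in>I. (?a i - b i) * cnj (?a i - b i))"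
    unfolding Sf fS SS by (simp add: ip_cnj assms(3) sum.distrib sum_subtractf algebra_simps)
  also have "\<dots> = complex_of_real ((\<integral>x. (cmod (f x))\<^sup>2 \<partial>\<mu>) - (\<Sum>i\<in>I. (cmod (?a i))\<^sup>2) + (\<Sum>i\<in>I. (cmod (?a i - b i))\<^sup>2))"
    by (simp only: ip_self complex_norm_square of_real_add of_real_diff of_real_sum)
  finally show ?thesis by (simp only: of_real_eq_iff)
qed

lemma Bessel_inequality:
  assumes "finite I" "\<And>i. i \<in> I \<Longrightarrow> sqint (\<phi> i)" "sqint f"
    and "\<And>i j. i \<in> I \<Longrightarrow> j \<in> I \<Longrightarrow> ip (\<phi> i) (\<phi> j) = (if i = j then 1 else 0)"
  shows "(\<Sum>i\<in>I. (cmod (ip f (\<phi> i)))\<^sup>2) \<le> (\<integral>x. (cmod (f x))\<^sup>2 \<partial>\<mu>)"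
  using L2_dist2_orthonormal_sum[OF assms, of "\<lambda>i. ip f (\<phi> i)"]
    L2_dist2_nonneg[of f "\<lambda>x. \<Sum>i\<in>I. ip f (\<phi> i) * \<phi> i x"] by simp

lemma Coset_small:
  assumes "e > 0"
  obtains j where "\<And>x y. y \<in> Coset j x \<Longrightarrow> dist y x < e"
proof -
  let ?p = "real CARD('l)" and ?c = "real (CARD('m) * CARD('m))"
  have c0: "?c > 0" by simp
  obtain j where j: "?c / e < ?p ^ j" using real_arch_pow[OF CARD_gt_1[where 'l='l]] by blast
  have "dist y x < e" if "y \<in> Coset j x" for x y
  proof -
    have "mat_norm (y - x) \<le> 1 / ?p ^ j" using that by (simp add: Coset_def)
    then have "?c * mat_norm (y - x) \<le> ?c * (1 / ?p ^ j)" using c0 by (intro mult_left_mono) auto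
    then have "dist y x \<le> ?c * (1 / ?p ^ j)" using dist_le_mat_norm[of y x] by linarith
    also have "\<dots> < e" using j assms by (simp add: field_simps)
    finally show ?thesis .
  qed
  then show ?thesis using that by blast
qed

lemma coset_const_continuous_on:
  fixes F :: "'l padic ^'m ^'m \<Rightarrow> 'b::metric_space"
  assumes "coset_const j F"
  shows "continuous_on G F"
  unfolding continuous_on_iff
proof (intro ballI allI impI)
  fix x and e :: real assume x: "x \<in> G" and e: "e > 0"
  have "dist (F y) (F x) < e" if y: "y \<in> G" "dist y x < 1 / real CARD('l) ^ j" for y
  proof -
    have "y \<in> Coset j x" using y mat_norm_le_dist[of y x] by (simp add: Coset_def)
    then have "F y = F x" using assms x unfolding coset_const_def by blast
    then show ?thesis using e by simp
  qed
  moreover have "1 / real CARD('l) ^ j > 0" by simp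
  ultimately show "\<exists>d>0. \<forall>x'\<in>G. dist x' x < d \<longrightarrow> dist (F x') (F x) < e" by blast
qed

lemma continuous_on_rep_coeff:
  assumes "unitary_rep G \<xi>"
  shows "continuous_on G (\<lambda>x. rep_coeff \<xi> x i j)"
proof (cases "i < rep_dim \<xi> \<and> j < rep_dim \<xi>")
  case True
  then have "continuous_on G (\<lambda>x. \<xi> x $$ (i, j))" using assms by (simp add: unitary_rep_def)
  then show ?thesis using True by (simp add: rep_coeff_def)
next
  case False
  then have eq: "rep_coeff \<xi> x i j = 0" for x by (auto simp: rep_coeff_def)
  show ?thesis unfolding eq by (rule continuous_on_const)
qed

lemma measurable_rep_coeff: "unitary_rep G \<xi> \<Longrightarrow> (\<lambda>x. rep_coeff \<xi> x i j) \<in> borel_measurable \<mu>"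
  by (rule continuous_imp_measurable[OF continuous_on_rep_coeff])

lemma square_integrable_rep_coeff: "unitary_rep G \<xi> \<Longrightarrow> sqint (\<lambda>x. rep_coeff \<xi> x i j)"
  by (rule square_integrable_bounded[OF measurable_rep_coeff]) (auto intro: rep_coeff_le_1)

section \<open>Averages of representations against class functions\<close>

lemma integrable_bounded:
  fixes f :: "'l padic ^'m ^'m \<Rightarrow> 'b::{banach, second_countable_topology}"
  assumes "f \<in> borel_measurable \<mu>" "\<And>x. x \<in> G \<Longrightarrow> norm (f x) \<le> B"
  shows "integrable \<mu> f"
  by (rule integrable_const_bound[where B=B]) (use assms in \<open>auto simp: space_mu\<close>)

lemma integrable_weight_rep_coeff:
  assumes "unitary_rep G \<xi>" "w \<in> borel_measurable \<mu>" "\<And>x. x \<in> G \<Longrightarrow> cmod (w x) \<le> B"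
  shows "integrable \<mu> (\<lambda>x. w x * rep_coeff \<xi> x i j)"
proof (rule integrable_bounded)
  show "(\<lambda>x. w x * rep_coeff \<xi> x i j) \<in> borel_measurable \<mu>"
    using assms(2) measurable_rep_coeff[OF assms(1)] by measurable
  fix x assume x: "x \<in> G"
  have "cmod (w x) * cmod (rep_coeff \<xi> x i j) \<le> B * 1"
    using assms(3)[OF x] rep_coeff_le_1[OF assms(1) x] order_trans[OF norm_ge_zero assms(3)[OF x]]
    by (intro mult_mono) auto
  then show "cmod (w x * rep_coeff \<xi> x i j) \<le> B" by (simp add: norm_mult)
qed

text \<open>The matrix of integrals commutes with the representation, because w is invariant under
  conjugation and \<open>\<mu>\<close> under translations; Schur's lemma makes it scalar. It is
  applied to the indicator of \<open>K n\<close> and to the truncated kernel of D^1.\<close>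

lemma class_function_average:
  assumes irr: "\<xi> \<in> irreps G" and w: "w \<in> borel_measurable \<mu>" "\<And>x. x \<in> G \<Longrightarrow> cmod (w x) \<le> B"
    and cls: "\<And>z x. z \<in> G \<Longrightarrow> x \<in> G \<Longrightarrow> w (z ** x ** matrix_inv z) = w x"
  obtains \<nu> where "\<And>i j. (\<integral>x. w x * rep_coeff \<xi> x i j \<partial>\<mu>) = \<nu> * fm_one (rep_dim \<xi>) i j"
proof -
  let ?d = "rep_dim \<xi>" and ?R = "rep_coeff \<xi>"
  note ur = irreps_unitary[OF irr]
  define N where "N = (\<lambda>i j. \<integral>x. w x * ?R x i j \<partial>\<mu>)"
  note int = integrable_weight_rep_coeff[OF ur w]
  have meas: "(\<lambda>x. w x * ?R x i j) \<in> borel_measurable \<mu>" for i j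
    using int by (rule borel_measurable_integrable)
  have supp: "fm_supp ?d ?d N"
    unfolding fm_supp_def N_def by (auto simp: rep_coeff_def)
  have "fm_mult ?d (?R z) N = fm_mult ?d N (?R z)" if z: "z \<in> G" for z
  proof (intro ext)
    fix i j
    have 1: "fm_mult ?d (?R z) N i j = (\<integral>x. w x * ?R (z ** x) i j \<partial>\<mu>)"
    proof -
      have "fm_mult ?d (?R z) N i j = (\<integral>x. (\<Sum>k<?d. ?R z i k * (w x * ?R x k j)) \<partial>\<mu>)"
        unfolding fm_mult_def N_def
        by (subst Bochner_Integration.integral_sum) (auto intro: int)
      also have "\<dots> = (\<integral>x. w x * ?R (z ** x) i j \<partial>\<mu>)"
        by (intro Bochner_Integration.integral_cong refl)
           (simp add: space_mu rep_coeff_mult[OF ur z] fm_mult_def sum_distrib_left mult_ac)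
      finally show ?thesis .
    qed
    have 2: "fm_mult ?d N (?R z) i j = (\<integral>x. w x * ?R (x ** z) i j \<partial>\<mu>)"
    proof -
      have "fm_mult ?d N (?R z) i j = (\<integral>x. (\<Sum>k<?d. (w x * ?R x i k) * ?R z k j) \<partial>\<mu>)"
        unfolding fm_mult_def N_def
        by (subst Bochner_Integration.integral_sum) (auto intro: int)
      also have "\<dots> = (\<integral>x. w x * ?R (x ** z) i j \<partial>\<mu>)"
        by (intro Bochner_Integration.integral_cong refl)
           (simp add: space_mu rep_coeff_mult[OF ur _ z] fm_mult_def sum_distrib_left mult_ac)
      finally show ?thesis .
    qed
    \<comment> \<open>A right translation by z is undone and a left translation by z is put in its
      place, which turns the argument of w from x into its conjugate by z.\<close>
    have "(\<integral>x. w x * ?R (x ** z) i j \<partial>\<mu>) = (\<integral>x. w (z ** (x ** matrix_inv z)) * ?R (z ** x) i j \<partial>\<mu>)"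
    proof -
      let ?g = "\<lambda>y. w (y ** matrix_inv z) * ?R y i j"
      have m1: "?g \<in> borel_measurable \<mu>"
      proof -
        have "(\<lambda>y. w (y ** matrix_inv z)) \<in> borel_measurable \<mu>"
          using measurable_compose[OF right_translation_isometry(1)[OF G_inv(1)[OF z]] w(1)] .
        then show ?thesis using measurable_rep_coeff[OF ur] by measurable
      qed
      have "(\<integral>x. w x * ?R (x ** z) i j \<partial>\<mu>) = (\<integral>x. ?g (x ** z) \<partial>\<mu>)"
        by (intro Bochner_Integration.integral_cong refl) (simp add: mult_cancel_inv[OF z])
      also have "\<dots> = (\<integral>x. ?g x \<partial>\<mu>)"
        by (rule integral_invariant[OF right_translation_isometry[OF z] m1])
      also have "\<dots> = (\<integral>x. ?g (z ** x) \<partial>\<mu>)"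
        by (rule integral_invariant[OF left_translation_isometry[OF z] m1, symmetric])
      finally show ?thesis by (simp add: matrix_mul_assoc)
    qed
    also have "\<dots> = (\<integral>x. w x * ?R (z ** x) i j \<partial>\<mu>)"
      by (intro Bochner_Integration.integral_cong refl) (use cls[OF z] in \<open>simp add: space_mu matrix_mul_assoc\<close>)
    finally show "fm_mult ?d (?R z) N i j = fm_mult ?d N (?R z) i j" unfolding 1 2 by simp
  qed
  then obtain m where m: "N = (\<lambda>i j. m * fm_one ?d i j)" using Schur_scalar[OF irr supp] by blast
  show ?thesis
    by (rule that[of m]) (use fun_cong[OF fun_cong[OF m]] in \<open>simp add: N_def\<close>)
qed

text \<open>The average over \<open>K n\<close> is a scalar matrix, and multiplying it by the matrix
  of an element of \<open>K n\<close> does not change it. If the scalar is not zero, every such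
  matrix is therefore the identity.\<close>

lemma K_average:
  assumes irr: "\<xi> \<in> irreps G"
  obtains \<nu> where "\<And>i j. (\<integral>x. indicator (K n) x * rep_coeff \<xi> x i j \<partial>\<mu>) = \<nu> * fm_one (rep_dim \<xi>) i j"
    "trivial_on n \<xi> \<or> \<nu> = 0"
proof -
  let ?d = "rep_dim \<xi>" and ?R = "rep_coeff \<xi>" and ?w = "indicator (K n) :: _ \<Rightarrow> complex"
  note ur = irreps_unitary[OF irr]
  have w: "?w \<in> borel_measurable \<mu>" "\<And>x. x \<in> G \<Longrightarrow> cmod (?w x) \<le> 1" by (auto simp: indicator_def)
  have cls: "?w (z ** x ** matrix_inv z) = ?w x" if "z \<in> G" "x \<in> G" for z x
    using K_conj_iff[OF that] by (simp add: indicator_def)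
  obtain \<nu> where nu: "\<And>i j. (\<integral>x. ?w x * ?R x i j \<partial>\<mu>) = \<nu> * fm_one ?d i j"
    by (rule class_function_average[OF irr w cls], assumption+, rule that)
  have "trivial_on n \<xi>" if "\<nu> \<noteq> 0"
    unfolding trivial_on_def
  proof (intro ballI ext)
    fix k i j assume k: "k \<in> K n"
    then have kG: "k \<in> G" using K_subset_G by blast
    let ?g = "\<lambda>y. ?w y * ?R y i j"
    have m: "?g \<in> borel_measurable \<mu>" using w measurable_rep_coeff[OF ur] by measurable
    have "\<nu> * fm_one ?d i j = (\<integral>x. ?g x \<partial>\<mu>)" by (simp add: nu)
    also have "\<dots> = (\<integral>x. ?g (x ** k) \<partial>\<mu>)"
      by (rule integral_invariant[OF right_translation_isometry[OF kG] m, symmetric])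
    also have "\<dots> = (\<integral>x. (\<Sum>l<?d. (?w x * ?R x i l) * ?R k l j) \<partial>\<mu>)"
    proof (intro Bochner_Integration.integral_cong refl)
      fix x assume "x \<in> space \<mu>"
      then have x: "x \<in> G" by (simp add: space_mu)
      have "x ** k \<in> K n \<longleftrightarrow> x \<in> K n"
        using K_mult[OF _ k] K_mult[OF _ K_inv[OF k], of "x ** k"] mult_cancel_inv[OF kG, of x] by auto
      then show "?g (x ** k) = (\<Sum>l<?d. (?w x * ?R x i l) * ?R k l j)"
        by (simp add: indicator_def rep_coeff_mult[OF ur x kG] fm_mult_def)
    qed
    also have "\<dots> = (\<Sum>l<?d. \<nu> * fm_one ?d i l * ?R k l j)"
      by (subst Bochner_Integration.integral_sum) (auto simp: nu intro!: integrable_weight_rep_coeff[OF ur w])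
    also have "\<dots> = \<nu> * fm_mult ?d (fm_one ?d) (?R k) i j"
      by (simp add: fm_mult_def sum_distrib_left mult.assoc)
    also have "fm_mult ?d (fm_one ?d) (?R k) = ?R k" by (rule fm_one_mult[OF fm_supp_rep_coeff])
    finally show "?R k i j = fm_one ?d i j" using that by simp
  qed
  then show ?thesis using that[OF nu] by blast
qed

lemma integral_K_nontrivial:
  assumes "\<xi> \<in> irreps G" "\<not> trivial_on n \<xi>"
  shows "(\<integral>x. indicator (K n) x * rep_coeff \<xi> x i j \<partial>\<mu>) = 0"
proof -
  obtain \<nu> where nu: "\<And>i j. (\<integral>x. indicator (K n) x * rep_coeff \<xi> x i j \<partial>\<mu>) = \<nu> * fm_one (rep_dim \<xi>) i j"
    "trivial_on n \<xi> \<or> \<nu> = 0" by (rule K_average[OF assms(1), of n], rule that)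
  then show ?thesis using assms(2) by simp
qed

text \<open>By continuity the diagonal entry 0, 0 has real part at least 1/2 on some
  \<open>K j\<close>. Its integral over \<open>K j\<close> is then not zero, which by
  \<open>integral_K_nontrivial\<close> forces triviality.\<close>

lemma ex_trivial_on:
  assumes irr: "\<xi> \<in> irreps G"
  obtains j where "trivial_on j \<xi>"
proof -
  let ?d = "rep_dim \<xi>" and ?R = "rep_coeff \<xi>"
  note ur = irreps_unitary[OF irr]
  have one: "?R (mat 1) 0 0 = 1" using rep_coeff_one[OF ur] irreps_dim_pos[OF irr] by (simp add: fm_one_def)
  have "\<exists>e>0. \<forall>y\<in>G. dist y (mat 1) < e \<longrightarrow> dist (?R y 0 0) (?R (mat 1) 0 0) < 1/2"
    using continuous_on_rep_coeff[OF ur, of 0 0, unfolded continuous_on_iff, THEN bspec, OF G_one, THEN spec, of "1/2"]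
    by simp
  then obtain e where e: "e > 0" "\<And>y. y \<in> G \<Longrightarrow> dist y (mat 1) < e \<Longrightarrow> dist (?R y 0 0) (?R (mat 1) 0 0) < 1/2"
    by blast
  obtain j where j: "\<And>x y. y \<in> Coset j x \<Longrightarrow> dist y x < e" by (rule Coset_small[OF e(1)], rule that)
  have near: "cmod (?R y 0 0 - 1) < 1/2" if y: "y \<in> K j" for y
    using e(2)[of y] y K_subset_G[of j] j[of y "mat 1"] one by (auto simp: Coset_one dist_norm)
  have re: "Re (?R y 0 0) \<ge> 1/2" if "y \<in> K j" for y
    using abs_Re_le_cmod[of "?R y 0 0 - 1"] near[OF that] by simp
  have "trivial_on j \<xi>"
  proof (rule ccontr)
    assume "\<not> trivial_on j \<xi>"
    then have "(\<integral>x. indicator (K j) x * ?R x 0 0 \<partial>\<mu>) = 0" by (rule integral_K_nontrivial[OF irr])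
    moreover have int: "integrable \<mu> (\<lambda>x. indicator (K j) x * ?R x 0 0)"
      by (rule integrable_weight_rep_coeff[OF ur, where B=1]) (auto simp: indicator_def)
    ultimately have "(\<integral>x. Re (indicator (K j) x * ?R x 0 0) \<partial>\<mu>) = 0" by (subst integral_Re) auto
    moreover have "(\<integral>x. indicator (K j) x * (1/2) \<partial>\<mu>) \<le> (\<integral>x. Re (indicator (K j) x * ?R x 0 0) \<partial>\<mu>)"
    proof (rule integral_mono)
      show "integrable \<mu> (\<lambda>x. indicator (K j) x * (1/2 :: real))"
        by (rule integrable_bounded[where B=1]) (auto simp: indicator_def)
      show "integrable \<mu> (\<lambda>x. Re (indicator (K j) x * ?R x 0 0))" using int by (rule integrable_Re)
      show "indicator (K j) x * (1/2) \<le> Re (indicator (K j) x * ?R x 0 0)" for x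
        using re[of x] by (auto simp: indicator_def)
    qed
    moreover have "(\<integral>x. indicator (K j) x * (1/2 :: real) \<partial>\<mu>) = measure \<mu> (K j) / 2"
      using K_subset_G[of j] by (simp add: space_mu Int_absorb2)
    ultimately show False using measure_K_pos[of j] by simp
  qed
  then show ?thesis by (rule that)
qed

text \<open>For fixed column indices b and e, the inner products form the integral of \<eta>(x) E
  \<xi>(x^-1), where E is the matrix unit at b, e. This intertwines the two representations for any
  pair, so the same lemma serves equal and inequivalent ones.\<close>

lemma ip_rep_coeff_not_equiv:
  assumes irr: "\<xi> \<in> irreps G" "\<eta> \<in> irreps G"
  defines "B b e \<equiv> (\<lambda>a c. ip (\<lambda>x. rep_coeff \<eta> x a b) (\<lambda>x. rep_coeff \<xi> x c e))"
  shows "fm_supp (rep_dim \<eta>) (rep_dim \<xi>) (B b e)"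
    "z \<in> G \<Longrightarrow> fm_mult (rep_dim \<eta>) (rep_coeff \<eta> z) (B b e) = fm_mult (rep_dim \<xi>) (B b e) (rep_coeff \<xi> z)"
proof -
  note ur = irreps_unitary[OF irr(1)] irreps_unitary[OF irr(2)]
  show "fm_supp (rep_dim \<eta>) (rep_dim \<xi>) (B b e)"
    unfolding fm_supp_def B_def ip_def by (auto simp: rep_coeff_def)
  assume z: "z \<in> G"
  let ?R = "rep_coeff \<xi>" and ?S = "rep_coeff \<eta>" and ?d = "rep_dim \<xi>" and ?e = "rep_dim \<eta>"
  note sq = square_integrable_rep_coeff[OF ur(1)] square_integrable_rep_coeff[OF ur(2)]
  show "fm_mult ?e (?S z) (B b e) = fm_mult ?d (B b e) (?R z)"
  proof (intro ext)
    fix a c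
    let ?g = "\<lambda>y. ?S y a b * cnj (?R (matrix_inv z ** y) c e)"
    have expand: "?R (matrix_inv z ** x) c e = (\<Sum>t<?d. cnj (?R z t c) * ?R x t e)" if "x \<in> G" for x
      using that by (simp add: rep_coeff_mult[OF ur(1) G_inv(1)[OF z]] rep_coeff_inv[OF ur(1) z] fm_mult_def fm_adj_def)
    have m: "?g \<in> borel_measurable \<mu>"
    proof -
      have "(\<lambda>y. ?S y a b * cnj (\<Sum>t<?d. cnj (?R z t c) * ?R y t e)) \<in> borel_measurable \<mu>"
        using borel_measurable_integrable[OF integrable_ip[OF sq(2) square_integrable_sum[OF finite_lessThan sq(1)]]] .
      then show ?thesis
        by (rule measurable_cong[THEN iffD1, rotated]) (simp only: space_mu expand)
    qed
    have "fm_mult ?e (?S z) (B b e) a c = ip (\<lambda>x. \<Sum>k<?e. ?S z a k * ?S x k b) (\<lambda>x. ?R x c e)"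
      unfolding fm_mult_def B_def by (rule ip_sum_left[symmetric]) (auto intro: sq)
    also have "\<dots> = (\<integral>x. ?g (z ** x) \<partial>\<mu>)"
      unfolding ip_def
      by (intro Bochner_Integration.integral_cong refl)
         (simp add: space_mu rep_coeff_mult[OF ur(2) z] fm_mult_def inv_mult_cancel[OF z])
    also have "\<dots> = (\<integral>x. ?g x \<partial>\<mu>)"
      by (rule integral_invariant[OF left_translation_isometry[OF z] m])
    also have "\<dots> = ip (\<lambda>x. ?S x a b) (\<lambda>x. \<Sum>t<?d. cnj (?R z t c) * ?R x t e)"
      unfolding ip_def by (intro Bochner_Integration.integral_cong refl) (simp only: space_mu expand)
    also have "\<dots> = cnj (ip (\<lambda>x. \<Sum>t<?d. cnj (?R z t c) * ?R x t e) (\<lambda>x. ?S x a b))"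
      by (rule ip_cnj[symmetric]) (auto intro!: square_integrable_sum sq)
    also have "\<dots> = (\<Sum>t<?d. ?R z t c * cnj (ip (\<lambda>x. ?R x t e) (\<lambda>x. ?S x a b)))"
      by (subst ip_sum_left) (auto intro: sq)
    also have "\<dots> = fm_mult ?d (B b e) (?R z) a c"
      unfolding fm_mult_def B_def by (intro sum.cong refl) (simp add: ip_cnj sq mult.commute)
    finally show "fm_mult ?e (?S z) (B b e) a c = fm_mult ?d (B b e) (?R z) a c" .
  qed
qed

lemma Schur_orthogonality_inequiv:
  assumes "\<xi> \<in> irreps G" "\<eta> \<in> irreps G" "(\<xi>, \<eta>) \<notin> rep_equiv G"
  shows "ip (\<lambda>x. rep_coeff \<eta> x a b) (\<lambda>x. rep_coeff \<xi> x c e) = 0"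
proof -
  have "(\<lambda>a c. ip (\<lambda>x. rep_coeff \<eta> x a b) (\<lambda>x. rep_coeff \<xi> x c e)) = (\<lambda>i j. 0)"
    by (rule intertwiner_zero_or_equiv[OF assms(1,2) ip_rep_coeff_not_equiv(1)[OF assms(1,2)] _ assms(3)])
       (rule ip_rep_coeff_not_equiv(2)[OF assms(1,2)])
  then show ?thesis by (simp add: fun_eq_iff)
qed

text \<open>The intertwiner is scalar, and its trace is the integral of the entry e, b of the
  adjoint of the matrix times the matrix, that is, of the identity matrix. This fixes the scalar as
  1 / d or 0.\<close>

lemma Schur_orthogonality:
  assumes irr: "\<xi> \<in> irreps G" and lt: "a < rep_dim \<xi>" "b < rep_dim \<xi>" "c < rep_dim \<xi>" "e < rep_dim \<xi>"
  shows "ip (\<lambda>x. rep_coeff \<xi> x a b) (\<lambda>x. rep_coeff \<xi> x c e) = (if a = c \<and> b = e then 1 / of_nat (rep_dim \<xi>) else 0)"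
proof -
  let ?d = "rep_dim \<xi>" and ?R = "rep_coeff \<xi>"
  note ur = irreps_unitary[OF irr]
  define B where "B = (\<lambda>a c. ip (\<lambda>x. ?R x a b) (\<lambda>x. ?R x c e))"
  have supp: "fm_supp ?d ?d B" unfolding B_def by (rule ip_rep_coeff_not_equiv(1)[OF irr irr])
  have comm: "fm_mult ?d (?R z) B = fm_mult ?d B (?R z)" if "z \<in> G" for z
    unfolding B_def by (rule ip_rep_coeff_not_equiv(2)[OF irr irr that])
  obtain m where m: "B = (\<lambda>i j. m * fm_one ?d i j)" using Schur_scalar[OF irr supp comm] by blast
  have "(\<Sum>i<?d. B i i) = (\<integral>x. (\<Sum>i<?d. ?R x i b * cnj (?R x i e)) \<partial>\<mu>)"
    unfolding B_def ip_def
    by (subst Bochner_Integration.integral_sum) (auto intro!: integrable_ip square_integrable_rep_coeff ur)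
  also have "\<dots> = (\<integral>x. (if b = e then 1 else 0) \<partial>\<mu>)"
  proof (intro Bochner_Integration.integral_cong refl)
    fix x assume "x \<in> space \<mu>"
    then have x: "x \<in> G" by (simp add: space_mu)
    have "(\<Sum>i<?d. ?R x i b * cnj (?R x i e)) = fm_mult ?d (fm_adj (?R x)) (?R x) e b"
      by (simp add: fm_mult_def fm_adj_def mult.commute)
    also have "fm_mult ?d (fm_adj (?R x)) (?R x) = fm_one ?d"
      using rep_coeff_mult[OF ur G_inv(1)[OF x] x] rep_coeff_one[OF ur]
      by (simp add: rep_coeff_inv[OF ur x] G_inv[OF x])
    finally show "(\<Sum>i<?d. ?R x i b * cnj (?R x i e)) = (if b = e then 1 else 0)" using lt by (auto simp: fm_one_def)
  qed
  also have "\<dots> = (if b = e then 1 else 0)" by (simp add: space_mu measure_G)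
  finally have "of_nat ?d * m = (if b = e then 1 else 0)" by (simp add: m fm_one_def)
  moreover have "ip (\<lambda>x. ?R x a b) (\<lambda>x. ?R x c e) = m * fm_one ?d a c"
    using fun_cong[OF fun_cong[OF m], of a c] by (simp add: B_def)
  ultimately show ?thesis using lt by (auto simp: fm_one_def field_simps)
qed

end

section \<open>Completeness of the matrix entries\<close>

text \<open>Such a U embeds r-dimensional space isometrically, and U times its adjoint is the
  orthogonal projection onto the span of the columns.\<close>

definition fm_orthonormal :: "nat \<Rightarrow> nat \<Rightarrow> (nat \<Rightarrow> complex) set \<Rightarrow> (nat \<Rightarrow> nat \<Rightarrow> complex) \<Rightarrow> bool" where
  "fm_orthonormal n r W U \<longleftrightarrow> fm_supp n r U \<and> fm_mult n (fm_adj U) U = fm_one r \<and> (\<forall>a<r. (\<lambda>i. U i a) \<in> W)"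

lemma fm_orthonormal_trace:
  assumes "fm_orthonormal n r W U"
  shows "(\<Sum>i<n. fm_mult r U (fm_adj U) i i) = of_nat r"
proof -
  have "(\<Sum>i<n. fm_mult r U (fm_adj U) i i) = (\<Sum>a<r. \<Sum>i<n. U i a * cnj (U i a))"
    unfolding fm_mult_def fm_adj_def by (rule sum.swap)
  also have "\<dots> = (\<Sum>a<r. fm_mult n (fm_adj U) U a a)"
    by (simp add: fm_mult_def fm_adj_def mult.commute)
  also have "\<dots> = of_nat r" using assms by (simp add: fm_orthonormal_def fm_one_def)
  finally show ?thesis .
qed

text \<open>The projection P onto the span equals P times its adjoint, so each diagonal entry q
  satisfies q^2 \<le> q and is at most 1; the n diagonal entries add up to r. This bound is what
  allows a maximal orthonormal family to be chosen.\<close>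

lemma fm_orthonormal_le:
  assumes "fm_orthonormal n r W U"
  shows "r \<le> n"
proof -
  let ?P = "fm_mult r U (fm_adj U)"
  have supp: "fm_supp n r U" and one: "fm_mult n (fm_adj U) U = fm_one r"
    using assms by (auto simp: fm_orthonormal_def)
  have "fm_mult n ?P ?P = fm_mult r U (fm_mult r (fm_mult n (fm_adj U) U) (fm_adj U))"
    by (simp only: fm_assoc)
  also have "\<dots> = ?P" by (simp add: one fm_one_mult[OF fm_supp_adj[OF supp]])
  finally have PP: "fm_mult n ?P (fm_adj ?P) = ?P" by (simp add: fm_adj_mult)
  define q where "q = (\<lambda>i. \<Sum>a<r. (cmod (U i a))\<^sup>2)"
  have q: "?P i i = complex_of_real (q i)" for i unfolding q_def by (rule fm_mult_diag)
  have q1: "q i \<le> 1" if "i < n" for i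
  proof -
    have "complex_of_real (q i) = complex_of_real (\<Sum>k<n. (cmod (?P i k))\<^sup>2)"
      using fm_mult_diag[of n ?P i] by (simp only: PP q)
    then have "q i = (\<Sum>k<n. (cmod (?P i k))\<^sup>2)" by (simp only: of_real_eq_iff)
    moreover have "(cmod (?P i i))\<^sup>2 \<le> (\<Sum>k<n. (cmod (?P i k))\<^sup>2)"
      using that by (intro member_le_sum) auto
    moreover have "(cmod (?P i i))\<^sup>2 = q i * q i" unfolding q norm_of_real by (simp add: power2_eq_square)
    ultimately have le: "q i * q i \<le> q i" by linarith
    show ?thesis
    proof (rule ccontr)
      assume "\<not> q i \<le> 1"
      then have "q i * 1 < q i * q i" by (intro mult_strict_left_mono) auto
      then show False using le by simp
    qed
  qed
  have "complex_of_real (real r) = complex_of_real (\<Sum>i<n. q i)"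
    using fm_orthonormal_trace[OF assms] by (simp add: q)
  then have "real r = (\<Sum>i<n. q i)" by (simp only: of_real_eq_iff)
  also have "\<dots> \<le> (\<Sum>i<n. 1)" using q1 by (intro sum_mono) auto
  finally show ?thesis by simp
qed

text \<open>A maximal orthonormal family spans W: the part of a vector orthogonal to the family lies
  in W, and if it were not zero, its normalisation would enlarge the family.\<close>

lemma ex_orthonormal_basis:
  fixes W :: "(nat \<Rightarrow> complex) set"
  assumes supp: "\<And>w i. w \<in> W \<Longrightarrow> i \<ge> n \<Longrightarrow> w i = 0"
    and lin: "\<And>v w c. v \<in> W \<Longrightarrow> w \<in> W \<Longrightarrow> (\<lambda>i. v i + c * w i) \<in> W"
  obtains r U where "fm_orthonormal n r W U"
    "\<And>w i. w \<in> W \<Longrightarrow> w i = (\<Sum>a<r. U i a * (\<Sum>k<n. cnj (U k a) * w k))"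
proof -
  define P where "P = (\<lambda>r. \<exists>U. fm_orthonormal n r W U)"
  have "fm_orthonormal n 0 W (\<lambda>i j. 0)"
    by (auto simp: fm_orthonormal_def fm_supp_def fm_mult_def fm_one_def fun_eq_iff)
  then have ex: "\<exists>r. P r" unfolding P_def by blast
  have bd: "\<And>r. P r \<Longrightarrow> r \<le> n" unfolding P_def using fm_orthonormal_le by blast
  define r where "r = Greatest P"
  have "P r" unfolding r_def by (rule GreatestI_ex_nat[OF ex bd])
  then obtain U where U: "fm_orthonormal n r W U" unfolding P_def by blast
  have "\<not> P (Suc r)"
  proof
    assume "P (Suc r)"
    then have "Suc r \<le> r" unfolding r_def by (rule Greatest_le_nat) (rule bd)
    then show False by simp
  qed
  then have max: "\<not> fm_orthonormal n (Suc r) W V" for V unfolding P_def by blast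
  have Us: "fm_supp n r U" and U1: "fm_mult n (fm_adj U) U = fm_one r" and UW: "\<And>a. a < r \<Longrightarrow> (\<lambda>i. U i a) \<in> W"
    using U by (auto simp: fm_orthonormal_def)
  show ?thesis
  proof (rule that[OF U])
    fix w i assume w: "w \<in> W"
    define co where "co = (\<lambda>a. \<Sum>k<n. cnj (U k a) * w k)"
    define w' where "w' = (\<lambda>i. w i - (\<Sum>a<r. U i a * co a))"
    have part: "(\<lambda>i. w i - (\<Sum>a<s. U i a * co a)) \<in> W" if "s \<le> r" for s
      using that
    proof (induction s)
      case (Suc s)
      then have "(\<lambda>i. (w i - (\<Sum>a<s. U i a * co a)) + (- co s) * U i s) \<in> W"
        by (intro lin UW) auto
      then show ?case by (simp add: algebra_simps)
    qed (use w in simp)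
    have w'W: "w' \<in> W" unfolding w'_def by (rule part) simp
    have orth: "(\<Sum>k<n. cnj (U k b) * w' k) = 0" if b: "b < r" for b
    proof -
      have "(\<Sum>k<n. cnj (U k b) * w' k) = co b - (\<Sum>k<n. \<Sum>a<r. cnj (U k b) * U k a * co a)"
        by (simp add: w'_def co_def algebra_simps sum_subtractf sum_distrib_left)
      also have "(\<Sum>k<n. \<Sum>a<r. cnj (U k b) * U k a * co a) = (\<Sum>a<r. fm_mult n (fm_adj U) U b a * co a)"
        by (subst sum.swap) (simp add: fm_mult_def fm_adj_def sum_distrib_right)
      also have "\<dots> = (\<Sum>a<r. if a = b then co b else 0)"
        unfolding U1 by (intro sum.cong) (auto simp: fm_one_def)
      finally show ?thesis using b by simp
    qed
    have "w' = (\<lambda>i. 0)"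
    proof (rule ccontr)
      assume "w' \<noteq> (\<lambda>i. 0)"
      then obtain i0 where i0: "w' i0 \<noteq> 0" by auto
      then have "i0 < n" using supp[OF w'W, of i0] by (meson not_le)
      define s where "s = (\<Sum>k<n. (cmod (w' k))\<^sup>2)"
      have "(cmod (w' i0))\<^sup>2 \<le> s" unfolding s_def using \<open>i0 < n\<close> by (intro member_le_sum) auto
      moreover have "(cmod (w' i0))\<^sup>2 > 0" using i0 by simp
      ultimately have s: "s > 0" by linarith
      define c where "c = 1 / sqrt s"
      have sc: "s * (c * c) = 1" using s by (simp add: c_def field_simps)
      define u where "u = (\<lambda>i. w' i * complex_of_real c)"
      \<comment> \<open>The closure hypothesis only offers sums of the form v + c w, so the multiple
        c w' is obtained as w' + (c - 1) w'.\<close>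
      have uW: "u \<in> W"
        using lin[OF w'W w'W, of "complex_of_real c - 1"] by (simp add: u_def algebra_simps)
      have uu: "(\<Sum>k<n. cnj (u k) * u k) = 1"
      proof -
        have "(\<Sum>k<n. cnj (u k) * u k) = (\<Sum>k<n. (w' k * cnj (w' k)) * complex_of_real (c * c))"
          by (intro sum.cong refl) (simp add: u_def mult_ac)
        also have "\<dots> = complex_of_real (s * (c * c))"
          by (simp only: s_def of_real_mult of_real_sum sum_distrib_right complex_norm_square)
        finally show ?thesis by (simp only: sc of_real_1)
      qed
      have Uu: "(\<Sum>k<n. cnj (U k b) * u k) = 0" if "b < r" for b
        using orth[OF that] by (simp add: u_def mult.assoc[symmetric] sum_distrib_right[symmetric])
      have uU: "(\<Sum>k<n. cnj (u k) * U k b) = 0" if "b < r" for b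
      proof -
        have "cnj (\<Sum>k<n. cnj (U k b) * u k) = (\<Sum>k<n. cnj (u k) * U k b)" by (simp add: mult.commute)
        then show ?thesis using Uu[OF that] by simp
      qed
      define V where "V = (\<lambda>i a. if a = r then u i else U i a)"
      have "fm_orthonormal n (Suc r) W V"
        unfolding fm_orthonormal_def
      proof (intro conjI allI impI)
        show "fm_supp n (Suc r) V" using Us supp[OF uW] by (auto simp: fm_supp_def V_def)
        show "(\<lambda>i. V i a) \<in> W" if "a < Suc r" for a
          using that UW[of a] uW by (cases "a = r") (auto simp: V_def)
        show "fm_mult n (fm_adj V) V = fm_one (Suc r)"
        proof (intro ext)
          fix a b
          have UU: "(\<Sum>k<n. cnj (U k a) * U k b) = fm_one r a b"
            using fun_cong[OF fun_cong[OF U1], of a b] by (simp add: fm_mult_def fm_adj_def)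
          have z: "U k c = 0" if "c > r" for k c using Us that by (auto simp: fm_supp_def)
          show "fm_mult n (fm_adj V) V a b = fm_one (Suc r) a b"
            using UU uu Uu[of a] uU[of b] z[of a] z[of b]
            by (cases "a = r"; cases "b = r"; cases "a < r"; cases "b < r")
               (auto simp: V_def fm_mult_def fm_adj_def fm_one_def)
        qed
      qed
      then show False using max by blast
    qed
    then have "w' i = 0" by simp
    then show "w i = (\<Sum>a<r. U i a * (\<Sum>k<n. cnj (U k a) * w k))" by (simp add: w'_def co_def)
  qed
qed

text \<open>With P the projection onto W, each column of 1 - P is orthogonal to W, so it lies in W'
  and is reproduced by V. Since the adjoint of V annihilates P, the result is the corresponding
  column of the projection onto W'.\<close>

lemma fm_orthonormal_decomposition:
  fixes W :: "(nat \<Rightarrow> complex) set"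
  assumes supp: "\<And>w i. w \<in> W \<Longrightarrow> i \<ge> n \<Longrightarrow> w i = 0"
    and lin: "\<And>v w c. v \<in> W \<Longrightarrow> w \<in> W \<Longrightarrow> (\<lambda>i. v i + c * w i) \<in> W"
    and W'_def: "W' = {v. (\<forall>i\<ge>n. v i = 0) \<and> (\<forall>w\<in>W. (\<Sum>k<n. cnj (w k) * v k) = 0)}"
  obtains r U s V where "fm_orthonormal n r W U" "fm_orthonormal n s W' V" "r + s = n"
    "(\<lambda>i j. fm_mult r U (fm_adj U) i j + fm_mult s V (fm_adj V) i j) = fm_one n"
    "\<forall>w\<in>W. \<forall>i. w i = (\<Sum>a<r. U i a * (\<Sum>k<n. cnj (U k a) * w k))"
    "\<forall>w\<in>W'. \<forall>i. w i = (\<Sum>a<s. V i a * (\<Sum>k<n. cnj (V k a) * w k))"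
proof -
  obtain r U where U: "fm_orthonormal n r W U"
    "\<And>w i. w \<in> W \<Longrightarrow> w i = (\<Sum>a<r. U i a * (\<Sum>k<n. cnj (U k a) * w k))"
  proof (rule ex_orthonormal_basis[of W n])
    show "w i = 0" if h: "w \<in> W" "n \<le> i" for w i using h by (rule supp)
    show "(\<lambda>i. v i + c * w i) \<in> W" if h: "v \<in> W" "w \<in> W" for v w c using h by (rule lin)
  qed (rule that)
  have supp': "w i = 0" if "w \<in> W'" "i \<ge> n" for w i using that by (simp add: W'_def)
  have lin': "(\<lambda>i. v i + c * w i) \<in> W'" if "v \<in> W'" "w \<in> W'" for v w c
  proof -
    have "(\<Sum>k<n. cnj (u k) * (v k + c * w k)) = (\<Sum>k<n. cnj (u k) * v k) + c * (\<Sum>k<n. cnj (u k) * w k)" for u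
      by (simp add: sum.distrib sum_distrib_left algebra_simps)
    then show ?thesis using that by (simp add: W'_def)
  qed
  obtain s V where V: "fm_orthonormal n s W' V"
    "\<And>w i. w \<in> W' \<Longrightarrow> w i = (\<Sum>a<s. V i a * (\<Sum>k<n. cnj (V k a) * w k))"
  proof (rule ex_orthonormal_basis[of W' n])
    show "w i = 0" if h: "w \<in> W'" "n \<le> i" for w i using h by (rule supp')
    show "(\<lambda>i. v i + c * w i) \<in> W'" if h: "v \<in> W'" "w \<in> W'" for v w c using h by (rule lin')
  qed (rule that)
  have Us: "fm_supp n r U" and U1: "fm_mult n (fm_adj U) U = fm_one r"
    and UW: "\<And>a. a < r \<Longrightarrow> (\<lambda>i. U i a) \<in> W"
    using U by (auto simp: fm_orthonormal_def)
  have Vs: "fm_supp n s V" and VW: "\<And>a. a < s \<Longrightarrow> (\<lambda>i. V i a) \<in> W'"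
    using V by (auto simp: fm_orthonormal_def)
  let ?P = "fm_mult r U (fm_adj U)" and ?Q = "fm_mult s V (fm_adj V)"
  have VU: "fm_mult n (fm_adj V) U = (\<lambda>i j. 0)"
  proof (intro ext)
    fix a b
    show "fm_mult n (fm_adj V) U a b = 0"
    proof (cases "a < s \<and> b < r")
      case True
      then have "(\<Sum>k<n. cnj (U k b) * V k a) = 0" using VW UW by (auto simp: W'_def)
      moreover have "cnj (\<Sum>k<n. cnj (U k b) * V k a) = fm_mult n (fm_adj V) U a b"
        by (simp add: fm_mult_def fm_adj_def mult.commute)
      ultimately show ?thesis by simp
    next
      case False
      then show ?thesis using Us Vs by (auto simp: fm_supp_def fm_mult_def fm_adj_def not_less)
    qed
  qed
  have UP: "fm_mult n (fm_adj U) ?P = fm_adj U"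
    by (simp only: fm_assoc[symmetric] U1 fm_one_mult[OF fm_supp_adj[OF Us]])
  have VP: "fm_mult n (fm_adj V) ?P = (\<lambda>i j. 0)"
    by (simp only: fm_assoc[symmetric] VU) (simp add: fm_mult_def)
  have sum1: "?P i j + ?Q i j = fm_one n i j" for i j
  proof -
    define v where "v = (\<lambda>i. fm_one n i j - ?P i j)"
    have Ps: "fm_supp n n ?P" by (rule fm_supp_mult[OF Us fm_supp_adj[OF Us]])
    have Ave: "(\<Sum>k<n. A k * v k) = (\<Sum>k<n. A k * fm_one n k j) - (\<Sum>k<n. A k * ?P k j)" for A
      by (simp add: v_def algebra_simps sum_subtractf)
    have e: "(\<Sum>k<n. cnj (A k a) * fm_one n k j) = fm_mult n (fm_adj A) (fm_one n) a j" for A a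
      by (simp add: fm_mult_def fm_adj_def)
    have Uv: "(\<Sum>k<n. cnj (U k a) * v k) = 0" for a
      unfolding Ave e using fun_cong[OF fun_cong[OF UP], of a j] fm_mult_one[OF fm_supp_adj[OF Us]]
      by (simp add: fm_mult_def fm_adj_def)
    have Vv: "(\<Sum>k<n. cnj (V k a) * v k) = cnj (V j a)" for a
      unfolding Ave e using fun_cong[OF fun_cong[OF VP], of a j] fm_mult_one[OF fm_supp_adj[OF Vs]]
      by (simp add: fm_mult_def fm_adj_def)
    have "v \<in> W'"
      unfolding W'_def mem_Collect_eq
    proof (intro conjI allI impI ballI)
      show "v i = 0" if "i \<ge> n" for i using that Ps by (simp add: v_def fm_one_def fm_supp_def)
      fix w assume w: "w \<in> W"
      have "(\<Sum>k<n. cnj (w k) * v k) = (\<Sum>k<n. \<Sum>a<r. cnj (\<Sum>l<n. cnj (U l a) * w l) * (cnj (U k a) * v k))"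
      proof (rule sum.cong)
        fix k
        have wk: "cnj (w k) = (\<Sum>a<r. cnj (U k a) * cnj (\<Sum>l<n. cnj (U l a) * w l))"
          by (subst U(2)[OF w, of k]) simp
        show "cnj (w k) * v k = (\<Sum>a<r. cnj (\<Sum>l<n. cnj (U l a) * w l) * (cnj (U k a) * v k))"
          unfolding wk sum_distrib_right by (intro sum.cong refl) (simp only: mult_ac)
      qed simp
      also have "\<dots> = (\<Sum>a<r. cnj (\<Sum>l<n. cnj (U l a) * w l) * (\<Sum>k<n. cnj (U k a) * v k))"
        by (subst sum.swap) (simp only: sum_distrib_left)
      also have "\<dots> = 0" by (simp add: Uv)
      finally show "(\<Sum>k<n. cnj (w k) * v k) = 0" .
    qed
    then have "v i = (\<Sum>a<s. V i a * cnj (V j a))" using V(2)[of v i] by (simp only: Vv)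
    then show ?thesis by (simp add: v_def fm_mult_def fm_adj_def algebra_simps)
  qed
  have "of_nat (r + s) = (\<Sum>i<n. ?P i i + ?Q i i)"
    by (simp add: sum.distrib fm_orthonormal_trace[OF U(1)] fm_orthonormal_trace[OF V(1)])
  also have "\<dots> = (of_nat n :: complex)" by (simp add: sum1 fm_one_def)
  finally have rs: "r + s = n" by (simp only: of_nat_eq_iff)
  have "\<forall>w\<in>W. \<forall>i. w i = (\<Sum>a<r. U i a * (\<Sum>k<n. cnj (U k a) * w k))" using U(2) by (intro ballI allI)
  moreover have "\<forall>w\<in>W'. \<forall>i. w i = (\<Sum>a<s. V i a * (\<Sum>k<n. cnj (V k a) * w k))" using V(2) by (intro ballI allI)
  moreover have "(\<lambda>i j. ?P i j + ?Q i j) = fm_one n" by (simp add: sum1)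
  ultimately show ?thesis using that[OF U(1) V(1) rs] by blast
qed

context padic_matrix_group
begin

text \<open>Hypothesis \<open>inv\<close> says that the range of U is invariant. On this range U
  times its adjoint acts as the identity, which makes the compression of the representation
  multiplicative; it is the restriction of \<rho> written in an orthonormal basis.\<close>

lemma compressed_rep:
  assumes ur: "unitary_rep G \<rho>" and n: "n = rep_dim \<rho>"
    and supp: "fm_supp n r U" and one: "fm_mult n (fm_adj U) U = fm_one r"
    and inv: "\<And>x. x \<in> G \<Longrightarrow> fm_mult r U (fm_mult n (fm_adj U) (fm_mult n (rep_coeff \<rho> x) U)) = fm_mult n (rep_coeff \<rho> x) U"
    and cont: "\<And>i j. continuous_on G (\<lambda>x. rep_coeff \<rho> x i j)"
  obtains \<sigma> where "unitary_rep G \<sigma>" "rep_dim \<sigma> = r"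
    "\<And>x. x \<in> G \<Longrightarrow> fm_mult n (rep_coeff \<rho> x) U = fm_mult r U (rep_coeff \<sigma> x)"
    "\<And>m. trivial_on m \<rho> \<Longrightarrow> trivial_on m \<sigma>"
proof -
  let ?R = "rep_coeff \<rho>"
  define S where "S = (\<lambda>x. fm_mult n (fm_adj U) (fm_mult n (?R x) U))"
  define \<sigma> where "\<sigma> = (\<lambda>x. Matrix.mat r r (\<lambda>(i, j). S x i j))"
  have dim: "rep_dim \<sigma> = r" by (simp add: rep_dim_def \<sigma>_def)
  have US: "fm_mult r U (S x) = fm_mult n (?R x) U" if "x \<in> G" for x
    using inv[OF that] by (simp add: S_def)
  have Ss: "fm_supp r r (S x)" for x
    unfolding S_def n
    by (rule fm_supp_mult[OF fm_supp_adj[OF supp]], rule fm_supp_mult[OF fm_supp_rep_coeff supp])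
  have SR: "rep_coeff \<sigma> x = S x" for x
    unfolding rep_coeff_def dim using Ss[of x] by (auto simp: \<sigma>_def fm_supp_def fun_eq_iff not_less)
  have S_mult: "S (x ** y) = fm_mult r (S x) (S y)" if "x \<in> G" "y \<in> G" for x y
  proof -
    have "fm_mult r (S x) (S y) = fm_mult n (fm_adj U) (fm_mult n (?R x) (fm_mult r U (S y)))"
      unfolding fun_cong[OF S_def, of x] by (simp only: fm_assoc)
    also have "\<dots> = fm_mult n (fm_adj U) (fm_mult n (fm_mult n (?R x) (?R y)) U)"
      unfolding US[OF that(2)] by (simp only: fm_assoc)
    also have "\<dots> = S (x ** y)" unfolding S_def rep_coeff_mult[OF ur that] n ..
    finally show ?thesis ..
  qed
  have Rtriv: "S x = fm_one r" if "?R x = fm_one n" for x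
    unfolding S_def that using one by (simp only: fm_one_mult[OF supp])
  have S_adj: "fm_adj (S x) = S (matrix_inv x)" if "x \<in> G" for x
    unfolding S_def rep_coeff_inv[OF ur that] by (simp add: fm_adj_mult fm_assoc)
  have S_unit: "fm_mult r (S x) (fm_adj (S x)) = fm_one r" if x: "x \<in> G" for x
  proof -
    have "fm_mult r (S x) (fm_adj (S x)) = S (mat 1)"
      using S_mult[OF x G_inv(1)[OF x]] by (simp add: S_adj[OF x] G_inv[OF x])
    then show ?thesis using Rtriv[of "mat 1"] rep_coeff_one[OF ur] by (simp add: n)
  qed
  have c: "\<sigma> x \<in> carrier_mat r r" for x by (simp add: \<sigma>_def)
  have "unitary_rep G \<sigma>"
    unfolding unitary_rep_def dim
  proof (intro conjI ballI allI impI)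
    fix x assume x: "x \<in> G"
    show "unitary_mat r (\<sigma> x)"
    proof (subst unitary_mat_iff[OF c], intro allI impI)
      fix i j assume ij: "i < r" "j < r"
      have "(\<Sum>k<r. \<sigma> x $$ (i, k) * cnj (\<sigma> x $$ (j, k))) = fm_mult r (S x) (fm_adj (S x)) i j"
        unfolding fm_mult_def fm_adj_def by (intro sum.cong) (use ij in \<open>auto simp: \<sigma>_def\<close>)
      then show "(\<Sum>k<r. \<sigma> x $$ (i, k) * cnj (\<sigma> x $$ (j, k))) = (if i = j then 1 else 0)"
        using ij by (simp add: S_unit[OF x] fm_one_def)
    qed
    fix y assume y: "y \<in> G"
    show "\<sigma> (x ** y) = \<sigma> x * \<sigma> y"
    proof (rule eq_matI)
      fix i j assume "i < dim_row (\<sigma> x * \<sigma> y)" "j < dim_col (\<sigma> x * \<sigma> y)"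
      then have ij: "i < r" "j < r" by (simp_all add: \<sigma>_def)
      have "\<sigma> (x ** y) $$ (i, j) = fm_mult r (S x) (S y) i j" using ij S_mult[OF x y] by (simp add: \<sigma>_def)
      also have "\<dots> = (\<sigma> x * \<sigma> y) $$ (i, j)"
        unfolding mult_mat_entry[OF c c ij] fm_mult_def by (intro sum.cong) (use ij in \<open>auto simp: \<sigma>_def\<close>)
      finally show "\<sigma> (x ** y) $$ (i, j) = (\<sigma> x * \<sigma> y) $$ (i, j)" .
    qed (simp_all add: \<sigma>_def)
  next
    fix i j assume ij: "i < r" "j < r"
    have "continuous_on G (\<lambda>x. S x i j)"
      unfolding S_def fm_mult_def by (intro continuous_intros cont)
    then show "continuous_on G (\<lambda>x. \<sigma> x $$ (i, j))" using ij by (simp add: \<sigma>_def)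
  qed
  moreover have "trivial_on m \<sigma>" if "trivial_on m \<rho>" for m
    using that Rtriv by (simp add: trivial_on_def SR dim n)
  ultimately show ?thesis using that[of \<sigma>] dim US SR by simp
qed

end

context haar_padic_group
begin

section \<open>The orthonormal system of matrix entries and the Fourier terms\<close>

definition dual_level :: "nat \<Rightarrow> ('l padic ^'m ^'m \<Rightarrow> complex Matrix.mat) set set" where
  "dual_level m = {c \<in> unitary_dual G. trivial_on m (class_rep c)}"

definition coeff_index :: "('l padic ^'m ^'m \<Rightarrow> complex Matrix.mat) set set \<Rightarrow>
    (('l padic ^'m ^'m \<Rightarrow> complex Matrix.mat) set \<times> nat \<times> nat) set" where
  "coeff_index A = (SIGMA c:A. {..<rep_dim (class_rep c)} \<times> {..<rep_dim (class_rep c)})"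

text \<open>The square root of the dimension turns Schur orthogonality into orthonormality.\<close>

definition coeff_fun :: "('l padic ^'m ^'m \<Rightarrow> complex Matrix.mat) set \<times> nat \<times> nat \<Rightarrow> 'l padic ^'m ^'m \<Rightarrow> complex" where
  "coeff_fun = (\<lambda>(c, i, j) x. complex_of_real (sqrt (rep_dim (class_rep c))) * rep_coeff (class_rep c) x i j)"

lemma square_integrable_coeff_fun:
  "e \<in> coeff_index (unitary_dual G) \<Longrightarrow> sqint (coeff_fun e)"
  by (auto simp: coeff_index_def coeff_fun_def
      intro!: square_integrable_scale square_integrable_rep_coeff irreps_unitary class_rep_irreps)

lemma ip_scale: "ip (\<lambda>x. a * f x) (\<lambda>x. b * g x) = a * cnj b * ip f g"
proof -
  have "ip (\<lambda>x. a * f x) (\<lambda>x. b * g x) = (\<integral>x. (a * cnj b) * (f x * cnj (g x)) \<partial>\<mu>)"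
    unfolding ip_def by (simp add: mult_ac)
  then show ?thesis by (simp add: ip_def)
qed

lemma coeff_fun_orthonormal:
  assumes "e \<in> coeff_index (unitary_dual G)" "e' \<in> coeff_index (unitary_dual G)"
  shows "ip (coeff_fun e) (coeff_fun e') = (if e = e' then 1 else 0)"
proof -
  obtain c i j where e: "e = (c, i, j)" "c \<in> unitary_dual G" "i < rep_dim (class_rep c)" "j < rep_dim (class_rep c)"
    using assms(1) by (auto simp: coeff_index_def)
  obtain c' i' j' where e': "e' = (c', i', j')" "c' \<in> unitary_dual G" "i' < rep_dim (class_rep c')" "j' < rep_dim (class_rep c')"
    using assms(2) by (auto simp: coeff_index_def)
  note ir = class_rep_irreps[OF e(2)] class_rep_irreps[OF e'(2)]
  show ?thesis
  proof (cases "c = c'")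
    case False
    then have "(class_rep c', class_rep c) \<notin> rep_equiv G"
      using class_rep_not_equiv[OF e'(2) e(2)] by simp
    then show ?thesis
      unfolding coeff_fun_def e e' prod.case ip_scale
      using Schur_orthogonality_inequiv[OF ir(2,1)] False by simp
  next
    case True
    have "complex_of_real (sqrt (rep_dim (class_rep c))) * cnj (complex_of_real (sqrt (rep_dim (class_rep c)))) = of_nat (rep_dim (class_rep c))"
      by (simp flip: of_real_mult)
    then show ?thesis
      unfolding coeff_fun_def e e' prod.case ip_scale
      using Schur_orthogonality[OF ir(1) e(3,4), of i' j'] e' True irreps_dim_pos[OF ir(1)] by auto
  qed
qed

definition fourier_term :: "('l padic ^'m ^'m \<Rightarrow> complex) \<Rightarrow> ('l padic ^'m ^'m \<Rightarrow> complex Matrix.mat) set \<Rightarrow> real" where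
  "fourier_term f c = real (rep_dim (class_rep c)) * (HS_norm (fourier_coeff \<mu> f (class_rep c)))\<^sup>2"

lemma fourier_term_nonneg: "fourier_term f c \<ge> 0"
  by (simp add: fourier_term_def)

text \<open>The adjoint in the Fourier coefficient makes its entry i, j the inner product with the
  matrix entry j, i; the Hilbert-Schmidt norm does not see the exchange, and the dimension factor is
  absorbed by the normalisation.\<close>

lemma fourier_term_eq:
  assumes "c \<in> unitary_dual G"
  shows "fourier_term f c = (\<Sum>(i, j)\<in>{..<rep_dim (class_rep c)} \<times> {..<rep_dim (class_rep c)}. (cmod (ip f (coeff_fun (c, i, j))))\<^sup>2)"
proof -
  let ?x = "class_rep c" and ?d = "rep_dim (class_rep c)"
  note ur = irreps_unitary[OF class_rep_irreps[OF assms]]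
  let ?F = "fourier_coeff \<mu> f ?x"
  have F: "?F $$ (i, j) = ip f (\<lambda>x. rep_coeff ?x x j i)" if "i < ?d" "j < ?d" for i j
  proof -
    have "?F $$ (i, j) = (\<integral>x. f x * mat_adjoint (?x x) $$ (i, j) \<partial>\<mu>)"
      using that by (simp add: fourier_coeff_def)
    also have "\<dots> = ip f (\<lambda>x. rep_coeff ?x x j i)"
      unfolding ip_def
      by (intro Bochner_Integration.integral_cong refl)
         (use that in \<open>simp add: space_mu mat_adjoint_index[OF unitary_rep_carrier[OF ur]] rep_coeff_def\<close>)
    finally show ?thesis .
  qed
  have "(HS_norm ?F)\<^sup>2 = (\<Sum>i<dim_row ?F. \<Sum>j<dim_col ?F. (cmod (?F $$ (i, j)))\<^sup>2)"
    unfolding HS_norm_def by (simp add: sum_nonneg)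
  also have "\<dots> = (\<Sum>i<?d. \<Sum>j<?d. (cmod (ip f (\<lambda>x. rep_coeff ?x x j i)))\<^sup>2)"
    by (intro sum.cong) (auto simp: F fourier_coeff_def[of \<mu> f ?x, THEN arg_cong[of _ _ dim_row]] fourier_coeff_def[of \<mu> f ?x, THEN arg_cong[of _ _ dim_col]])
  also have "\<dots> = (\<Sum>j<?d. \<Sum>i<?d. (cmod (ip f (\<lambda>x. rep_coeff ?x x j i)))\<^sup>2)" by (rule sum.swap)
  finally have "fourier_term f c = (\<Sum>j<?d. \<Sum>i<?d. real ?d * (cmod (ip f (\<lambda>x. rep_coeff ?x x j i)))\<^sup>2)"
    unfolding fourier_term_def by (simp add: sum_distrib_left)
  also have "\<dots> = (\<Sum>j<?d. \<Sum>i<?d. (cmod (ip f (coeff_fun (c, j, i))))\<^sup>2)"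
  proof (intro sum.cong refl)
    fix i j
    have "ip f (coeff_fun (c, j, i)) = complex_of_real (sqrt ?d) * ip f (\<lambda>x. rep_coeff ?x x j i)"
      using ip_scale[of 1 f "complex_of_real (sqrt ?d)"] by (simp add: coeff_fun_def)
    then show "real ?d * (cmod (ip f (\<lambda>x. rep_coeff ?x x j i)))\<^sup>2 = (cmod (ip f (coeff_fun (c, j, i))))\<^sup>2"
      by (simp add: norm_mult power_mult_distrib)
  qed
  finally show ?thesis by (simp add: sum.cartesian_product)
qed

lemma sum_fourier_term:
  assumes "finite A" "A \<subseteq> unitary_dual G"
  shows "(\<Sum>c\<in>A. fourier_term f c) = (\<Sum>e\<in>coeff_index A. (cmod (ip f (coeff_fun e)))\<^sup>2)"
proof -
  have "(\<Sum>c\<in>A. fourier_term f c) = (\<Sum>c\<in>A. \<Sum>p\<in>{..<rep_dim (class_rep c)} \<times> {..<rep_dim (class_rep c)}. (cmod (ip f (coeff_fun (c, p))))\<^sup>2)"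
    using assms(2) by (intro sum.cong refl) (auto simp: fourier_term_eq case_prod_beta)
  also have "\<dots> = (\<Sum>e\<in>coeff_index A. (cmod (ip f (coeff_fun e)))\<^sup>2)"
    unfolding coeff_index_def by (subst sum.Sigma) (auto simp: assms(1))
  finally show ?thesis .
qed

lemma finite_coeff_index: "finite A \<Longrightarrow> finite (coeff_index A)"
  by (auto simp: coeff_index_def)

lemma coeff_index_mono: "A \<subseteq> B \<Longrightarrow> coeff_index A \<subseteq> coeff_index B"
  by (auto simp: coeff_index_def)

lemma Bessel_fourier:
  assumes "finite A" "A \<subseteq> unitary_dual G" "sqint f"
  shows "(\<Sum>c\<in>A. fourier_term f c) \<le> (\<integral>x. (cmod (f x))\<^sup>2 \<partial>\<mu>)"
  unfolding sum_fourier_term[OF assms(1,2)]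
proof (rule Bessel_inequality[OF finite_coeff_index[OF assms(1)] _ assms(3)])
  note sub = coeff_index_mono[OF assms(2), THEN subsetD]
  show "sqint (coeff_fun e)" if "e \<in> coeff_index A" for e
    by (rule square_integrable_coeff_fun[OF sub[OF that]])
  show "ip (coeff_fun e) (coeff_fun e') = (if e = e' then 1 else 0)" if "e \<in> coeff_index A" "e' \<in> coeff_index A" for e e'
    by (rule coeff_fun_orthonormal[OF sub[OF that(1)] sub[OF that(2)]])
qed

text \<open>Bessel's inequality for the indicator of \<open>K m\<close>: a class trivial on
  \<open>K m\<close> contributes at least the square of its measure, while the total is at most this
  measure. So there are at most as many classes as the reciprocal of the measure.\<close>

lemma finite_dual_level: "finite (dual_level m)"
proof -
  let ?f = "indicator (K m) :: _ \<Rightarrow> complex" and ?k = "measure \<mu> (K m)"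
  have sq: "sqint ?f" by (rule square_integrable_indicator) simp
  have norm: "(\<integral>x. (cmod (?f x))\<^sup>2 \<partial>\<mu>) = ?k"
  proof -
    have "(\<integral>x. (cmod (?f x))\<^sup>2 \<partial>\<mu>) = (\<integral>x. indicator (K m) x \<partial>\<mu>)"
      by (intro Bochner_Integration.integral_cong refl) (auto simp: indicator_def)
    then show ?thesis using K_subset_G[of m] by (simp add: space_mu Int_absorb2)
  qed
  have low: "fourier_term ?f c \<ge> ?k\<^sup>2" if c: "c \<in> dual_level m" for c
  proof -
    let ?x = "class_rep c" and ?d = "rep_dim (class_rep c)"
    have cu: "c \<in> unitary_dual G" and tr: "trivial_on m ?x" using c by (auto simp: dual_level_def)
    note ir = class_rep_irreps[OF cu]
    have d: "?d > 0" by (rule irreps_dim_pos[OF ir])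
    have "ip ?f (coeff_fun (c, 0, 0)) = (\<integral>x. complex_of_real (sqrt ?d * indicator (K m) x) \<partial>\<mu>)"
      unfolding ip_def
      by (intro Bochner_Integration.integral_cong refl)
         (use tr d in \<open>auto simp: coeff_fun_def indicator_def trivial_on_def fm_one_def\<close>)
    also have "\<dots> = complex_of_real (sqrt ?d * ?k)"
      unfolding integral_complex_of_real using K_subset_G[of m] by (simp add: space_mu Int_absorb2)
    finally have "(cmod (ip ?f (coeff_fun (c, 0, 0))))\<^sup>2 = real ?d * ?k\<^sup>2"
      by (simp only: norm_of_real) (simp add: power_mult_distrib)
    moreover have "(cmod (ip ?f (coeff_fun (c, 0, 0))))\<^sup>2 \<le> fourier_term ?f c"
      unfolding fourier_term_eq[OF cu] using d
        member_le_sum[of "(0, 0)" "{..<?d} \<times> {..<?d}" "\<lambda>(i, j). (cmod (ip ?f (coeff_fun (c, i, j))))\<^sup>2"] by auto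
    moreover have "?k\<^sup>2 \<le> real ?d * ?k\<^sup>2" using d mult_right_mono[of 1 "real ?d" "?k\<^sup>2"] by simp
    ultimately show ?thesis by linarith
  qed
  have "card A \<le> nat \<lfloor>1 / ?k\<rfloor>" if A: "A \<subseteq> dual_level m" "finite A" for A :: "('l padic ^'m ^'m \<Rightarrow> complex Matrix.mat) set set"
  proof -
    have "real (card A) * ?k\<^sup>2 = (\<Sum>c\<in>A. ?k\<^sup>2)" by simp
    also have "\<dots> \<le> (\<Sum>c\<in>A. fourier_term ?f c)" using A low by (intro sum_mono) auto
    also have "\<dots> \<le> ?k" using Bessel_fourier[OF A(2) _ sq] A norm by (auto simp: dual_level_def)
    finally have "real (card A) \<le> 1 / ?k" using measure_K_pos[of m] by (simp add: field_simps power2_eq_square)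
    then show ?thesis by (simp add: le_nat_floor)
  qed
  then show ?thesis using finite_if_finite_subsets_card_bdd by blast
qed

section \<open>The span of the matrix entries of a given level\<close>

definition in_coeff_span :: "nat \<Rightarrow> ('l padic ^'m ^'m \<Rightarrow> complex) \<Rightarrow> bool" where
  "in_coeff_span m F \<longleftrightarrow> (\<exists>a. \<forall>x\<in>G. F x = (\<Sum>e\<in>coeff_index (dual_level m). a e * coeff_fun e x))"

lemma finite_coeff_index_level: "finite (coeff_index (dual_level m))"
  by (rule finite_coeff_index[OF finite_dual_level])

lemma in_coeff_span_cong: "(\<And>x. x \<in> G \<Longrightarrow> F x = H x) \<Longrightarrow> in_coeff_span m F \<longleftrightarrow> in_coeff_span m H"
  unfolding in_coeff_span_def by simp

lemma in_coeff_span_add: "in_coeff_span m F \<Longrightarrow> in_coeff_span m H \<Longrightarrow> in_coeff_span m (\<lambda>x. F x + H x)"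
proof -
  assume "in_coeff_span m F" "in_coeff_span m H"
  then obtain a b where ab: "\<And>x. x \<in> G \<Longrightarrow> F x = (\<Sum>e\<in>coeff_index (dual_level m). a e * coeff_fun e x)"
    "\<And>x. x \<in> G \<Longrightarrow> H x = (\<Sum>e\<in>coeff_index (dual_level m). b e * coeff_fun e x)"
    unfolding in_coeff_span_def by blast
  show ?thesis
    unfolding in_coeff_span_def
    by (rule exI[of _ "\<lambda>e. a e + b e"]) (simp add: ab distrib_right sum.distrib)
qed

lemma in_coeff_span_scale: "in_coeff_span m F \<Longrightarrow> in_coeff_span m (\<lambda>x. c * F x)"
proof -
  assume "in_coeff_span m F"
  then obtain a where a: "\<And>x. x \<in> G \<Longrightarrow> F x = (\<Sum>e\<in>coeff_index (dual_level m). a e * coeff_fun e x)"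
    unfolding in_coeff_span_def by blast
  show ?thesis
    unfolding in_coeff_span_def
    by (rule exI[of _ "\<lambda>e. c * a e"]) (simp add: a sum_distrib_left mult.assoc)
qed

lemma in_coeff_span_sum:
  "(\<And>i. i \<in> I \<Longrightarrow> in_coeff_span m (F i)) \<Longrightarrow> in_coeff_span m (\<lambda>x. \<Sum>i\<in>I. F i x)"
proof (induction I rule: infinite_finite_induct)
  case (insert i I)
  then show ?case by (auto intro: in_coeff_span_add)
qed (auto simp: in_coeff_span_def intro!: exI[of _ "\<lambda>_. 0"])

lemma in_coeff_span_class_rep:
  assumes "c \<in> dual_level m"
  shows "in_coeff_span m (\<lambda>x. rep_coeff (class_rep c) x i j)"
proof (cases "i < rep_dim (class_rep c) \<and> j < rep_dim (class_rep c)")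
  case True
  let ?d = "rep_dim (class_rep c)"
  have e: "(c, i, j) \<in> coeff_index (dual_level m)" using assms True by (simp add: coeff_index_def)
  have "in_coeff_span m (coeff_fun (c, i, j))"
    unfolding in_coeff_span_def
  proof (intro exI[of _ "\<lambda>e. if e = (c, i, j) then 1 else 0"] ballI)
    fix x
    have "(\<Sum>e\<in>coeff_index (dual_level m). (if e = (c, i, j) then 1 else 0) * coeff_fun e x) =
      (\<Sum>e\<in>coeff_index (dual_level m). if e = (c, i, j) then coeff_fun e x else 0)"
      by (intro sum.cong) auto
    then show "coeff_fun (c, i, j) x = (\<Sum>e\<in>coeff_index (dual_level m). (if e = (c, i, j) then 1 else 0) * coeff_fun e x)"
      using e finite_coeff_index_level by simp
  qed
  then have "in_coeff_span m (\<lambda>x. (1 / complex_of_real (sqrt ?d)) * coeff_fun (c, i, j) x)" by (rule in_coeff_span_scale)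
  then show ?thesis using True by (simp add: coeff_fun_def)
next
  case False
  then have eq: "rep_coeff (class_rep c) x i j = 0" for x by (auto simp: rep_coeff_def)
  show ?thesis unfolding eq in_coeff_span_def by (intro exI[of _ "\<lambda>_. 0"]) simp
qed

lemma in_coeff_span_fm:
  assumes "\<And>i j. in_coeff_span m (\<lambda>x. R x i j)"
  shows "in_coeff_span m (\<lambda>x. fm_mult n A (fm_mult p (R x) B) i j)"
proof -
  have eq: "fm_mult n A (fm_mult p (R x) B) i j = (\<Sum>k<n. \<Sum>l<p. (A i k * B l j) * R x k l)" for x
    by (simp add: fm_mult_def sum_distrib_left mult_ac)
  show ?thesis unfolding eq by (intro in_coeff_span_sum in_coeff_span_scale assms)
qed

text \<open>A unitary change of basis relates \<rho> to the chosen representative of its class, so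
  the entries of one are combinations of those of the other, and triviality on \<open>K m\<close>
  carries over.\<close>

lemma in_coeff_span_irreducible:
  assumes irr: "\<rho> \<in> irreps G" and tr: "trivial_on m \<rho>"
  shows "in_coeff_span m (\<lambda>x. rep_coeff \<rho> x i j)"
proof -
  obtain c where c: "c \<in> unitary_dual G" "(\<rho>, class_rep c) \<in> rep_equiv G" using ex_class_rep[OF irr] by blast
  let ?e = "class_rep c" and ?d = "rep_dim \<rho>"
  obtain T where T: "rep_dim ?e = ?d" "unitary_mat ?d T" "\<And>x. x \<in> G \<Longrightarrow> T * \<rho> x = ?e x * T"
    using c(2) unfolding rep_equiv_def by blast
  note ur = irreps_unitary[OF irr] irreps_unitary[OF class_rep_irreps[OF c(1)]]
  have Tc: "T \<in> carrier_mat ?d ?d" using T(2) by (simp add: unitary_mat_def)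
  define S where "S = (\<lambda>i j. if i < ?d \<and> j < ?d then T $$ (i, j) else 0)"
  have Ss: "fm_supp ?d ?d S" by (auto simp: S_def fm_supp_def)
  have SS: "fm_mult ?d S (fm_adj S) = fm_one ?d"
  proof (intro ext)
    fix i j
    show "fm_mult ?d S (fm_adj S) i j = fm_one ?d i j"
      using T(2) unfolding unitary_mat_iff[OF Tc]
      by (cases "i < ?d"; cases "j < ?d") (auto simp: S_def fm_mult_def fm_adj_def fm_one_def)
  qed
  have SS': "fm_mult ?d (fm_adj S) S = fm_one ?d"
  proof (intro ext)
    fix i j
    show "fm_mult ?d (fm_adj S) S i j = fm_one ?d i j"
    proof (cases "i < ?d \<and> j < ?d")
      case True
      have "(mat_adjoint T * T) $$ (i, j) = fm_mult ?d (fm_adj S) S i j"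
        unfolding mult_mat_entry[OF mat_adjoint_dim[OF Tc] Tc True[THEN conjunct1] True[THEN conjunct2]] fm_mult_def
        by (intro sum.cong) (use True in \<open>auto simp: S_def fm_adj_def mat_adjoint_index[OF Tc]\<close>)
      then show ?thesis using unitary_mat_adjoint_left[OF T(2)] True by (simp add: fm_one_def)
    next
      case False
      then show ?thesis by (auto simp: S_def fm_mult_def fm_adj_def fm_one_def)
    qed
  qed
  have inter: "fm_mult ?d S (rep_coeff \<rho> x) = fm_mult ?d (rep_coeff ?e x) S" if x: "x \<in> G" for x
  proof (intro ext)
    fix i j
    have cc: "\<rho> x \<in> carrier_mat ?d ?d" "?e x \<in> carrier_mat ?d ?d"
      using unitary_rep_carrier[OF ur(1) x] unitary_rep_carrier[OF ur(2) x] T(1) by auto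
    show "fm_mult ?d S (rep_coeff \<rho> x) i j = fm_mult ?d (rep_coeff ?e x) S i j"
    proof (cases "i < ?d \<and> j < ?d")
      case True
      then have ij: "i < ?d" "j < ?d" by auto
      have "fm_mult ?d S (rep_coeff \<rho> x) i j = (T * \<rho> x) $$ (i, j)"
        unfolding mult_mat_entry[OF Tc cc(1) ij] fm_mult_def
        by (intro sum.cong) (use ij in \<open>auto simp: S_def rep_coeff_def\<close>)
      also have "\<dots> = (?e x * T) $$ (i, j)" by (simp only: T(3)[OF x])
      also have "\<dots> = fm_mult ?d (rep_coeff ?e x) S i j"
        unfolding mult_mat_entry[OF cc(2) Tc ij] fm_mult_def
        by (intro sum.cong) (use ij T(1) in \<open>auto simp: S_def rep_coeff_def\<close>)
      finally show ?thesis .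
    next
      case False
      then show ?thesis using T(1) by (auto simp: S_def rep_coeff_def fm_mult_def)
    qed
  qed
  have R: "rep_coeff \<rho> x = fm_mult ?d (fm_adj S) (fm_mult ?d (rep_coeff ?e x) S)" if "x \<in> G" for x
    using SS' by (simp only: inter[OF that, symmetric] fm_assoc[symmetric] fm_one_mult[OF fm_supp_rep_coeff])
  have E: "rep_coeff ?e x = fm_mult ?d S (fm_mult ?d (rep_coeff \<rho> x) (fm_adj S))" if "x \<in> G" for x
    using fm_mult_one[OF fm_supp_rep_coeff[of ?e x]] SS T(1)
    by (simp only: fm_assoc[symmetric] inter[OF that]) (simp only: fm_assoc)
  have "trivial_on m ?e"
    unfolding trivial_on_def
  proof
    fix k assume k: "k \<in> K m"
    then have kG: "k \<in> G" using K_subset_G by blast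
    have "rep_coeff \<rho> k = fm_one ?d" using tr k by (simp add: trivial_on_def)
    then show "rep_coeff ?e k = fm_one (rep_dim ?e)"
      unfolding E[OF kG] using SS T(1) by (simp add: fm_one_mult[OF fm_supp_adj[OF Ss]])
  qed
  then have "c \<in> dual_level m" using c(1) by (simp add: dual_level_def)
  then have "in_coeff_span m (\<lambda>x. fm_mult ?d (fm_adj S) (fm_mult ?d (rep_coeff ?e x) S) i j)"
    by (intro in_coeff_span_fm in_coeff_span_class_rep)
  then show ?thesis by (rule in_coeff_span_cong[THEN iffD1, rotated]) (simp only: R)
qed

end

section \<open>Complete reducibility of unitary representations\<close>

definition vec_fun :: "nat \<Rightarrow> complex Matrix.vec \<Rightarrow> nat \<Rightarrow> complex" where
  "vec_fun n v = (\<lambda>i. if i < n then vec_index v i else 0)"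

lemma vec_fun_lin:
  "v \<in> carrier_vec n \<Longrightarrow> w \<in> carrier_vec n \<Longrightarrow> vec_fun n (v + c \<cdot>\<^sub>v w) = (\<lambda>i. vec_fun n v i + c * vec_fun n w i)"
  by (auto simp: vec_fun_def)

lemma vec_fun_inj: "v \<in> carrier_vec n \<Longrightarrow> w \<in> carrier_vec n \<Longrightarrow> vec_fun n v = vec_fun n w \<Longrightarrow> v = w"
  by (rule eq_vecI) (auto simp: vec_fun_def fun_eq_iff split: if_splits)

context haar_padic_group
begin

text \<open>Induction on the dimension: a reducible representation splits into its restrictions to
  an invariant subspace and to the orthogonal complement, and triviality on \<open>K m\<close> is
  inherited by both.\<close>

lemma in_coeff_span_unitary_rep:
  assumes "unitary_rep G \<rho>" "trivial_on m \<rho>"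
  shows "in_coeff_span m (\<lambda>x. rep_coeff \<rho> x i j)"
  using assms
proof (induction "rep_dim \<rho>" arbitrary: \<rho> i j rule: less_induct)
  case less
  let ?n = "rep_dim \<rho>"
  note ur = less.prems(1) and tr = less.prems(2)
  consider "?n = 0" | "\<rho> \<in> irreps G" | "?n > 0" "\<rho> \<notin> irreps G" by blast
  then show ?case
  proof cases
    case 1
    then have eq: "rep_coeff \<rho> x i j = 0" for x by (simp add: rep_coeff_def)
    show ?thesis unfolding eq in_coeff_span_def by (intro exI[of _ "\<lambda>_. 0"]) simp
  next
    case 2
    then show ?thesis using tr by (rule in_coeff_span_irreducible)
  next
    case 3
    then obtain W0 where W0: "VectorSpace.subspace class_ring W0 (module_vec TYPE(complex) ?n)"
      "\<And>x w. x \<in> G \<Longrightarrow> w \<in> W0 \<Longrightarrow> \<rho> x *\<^sub>v w \<in> W0" "W0 \<noteq> {0\<^sub>v ?n}" "W0 \<noteq> carrier_vec ?n"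
      using ur unfolding irreps_def irreducible_rep_def by blast
    note W0s = vec_subspaceD[OF W0(1)]
    define W where "W = vec_fun ?n ` W0"
    have supp: "w i = 0" if "w \<in> W" "i \<ge> ?n" for w i using that by (auto simp: W_def vec_fun_def)
    have lin: "(\<lambda>i. v i + c * w i) \<in> W" if vw: "v \<in> W" "w \<in> W" for v w c
    proof -
      obtain v0 w0 where v0: "v0 \<in> W0" "w0 \<in> W0" "v = vec_fun ?n v0" "w = vec_fun ?n w0"
        using vw by (auto simp: W_def)
      then have "(\<lambda>i. v i + c * w i) = vec_fun ?n (v0 + c \<cdot>\<^sub>v w0)"
        using W0s(1) by (subst vec_fun_lin) auto
      moreover have "v0 + c \<cdot>\<^sub>v w0 \<in> W0" by (intro W0s v0)
      ultimately show ?thesis unfolding W_def by blast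
    qed
    have zero: "(\<lambda>i. 0) \<in> W"
    proof -
      have "(\<lambda>i. 0) = vec_fun ?n (0\<^sub>v ?n)" by (auto simp: vec_fun_def)
      then show ?thesis unfolding W_def using W0s(2) by blast
    qed
    have inv: "(\<lambda>i. \<Sum>k<?n. rep_coeff \<rho> x i k * w k) \<in> W" if x: "x \<in> G" and w: "w \<in> W" for x w
    proof -
      obtain w0 where w0: "w0 \<in> W0" "w = vec_fun ?n w0" using w by (auto simp: W_def)
      have c: "\<rho> x \<in> carrier_mat ?n ?n" by (rule unitary_rep_carrier[OF ur x])
      have wc: "w0 \<in> carrier_vec ?n" using w0 W0s(1) by auto
      have "(\<lambda>i. \<Sum>k<?n. rep_coeff \<rho> x i k * w k) = vec_fun ?n (\<rho> x *\<^sub>v w0)"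
      proof
        fix i
        show "(\<Sum>k<?n. rep_coeff \<rho> x i k * w k) = vec_fun ?n (\<rho> x *\<^sub>v w0) i"
          using c wc by (auto simp: vec_fun_def w0(2) rep_coeff_def scalar_prod_def atLeast0LessThan intro!: sum.cong)
      qed
      then show ?thesis using W0(2)[OF x w0(1)] unfolding W_def by blast
    qed
    \<comment> \<open>The complement is invariant because the adjoint of the matrix of x is the
      matrix of its inverse, and W is invariant under that.\<close>
    define W' where "W' = {v. (\<forall>i\<ge>?n. v i = 0) \<and> (\<forall>w\<in>W. (\<Sum>k<?n. cnj (w k) * v k) = 0)}"
    have inv': "(\<lambda>i. \<Sum>k<?n. rep_coeff \<rho> x i k * v k) \<in> W'" if x: "x \<in> G" and v: "v \<in> W'" for x v
      unfolding W'_def mem_Collect_eq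
    proof (intro conjI allI impI ballI)
      show "(\<Sum>k<?n. rep_coeff \<rho> x i k * v k) = 0" if "i \<ge> ?n" for i using that by (simp add: rep_coeff_def)
      fix w assume w: "w \<in> W"
      have "(\<Sum>i<?n. cnj (w i) * (\<Sum>k<?n. rep_coeff \<rho> x i k * v k)) = (\<Sum>i<?n. \<Sum>k<?n. cnj (w i) * rep_coeff \<rho> x i k * v k)"
        by (simp add: sum_distrib_left mult.assoc)
      also have "\<dots> = (\<Sum>k<?n. \<Sum>i<?n. cnj (w i) * rep_coeff \<rho> x i k * v k)" by (rule sum.swap)
      also have "\<dots> = (\<Sum>k<?n. cnj (\<Sum>i<?n. rep_coeff \<rho> (matrix_inv x) k i * w i) * v k)"
        unfolding rep_coeff_inv[OF ur x] fm_adj_def cnj_sum sum_distrib_right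
        by (intro sum.cong refl) (simp add: mult.commute)
      also have "\<dots> = 0"
      proof -
        have "\<forall>w\<in>W. (\<Sum>k<?n. cnj (w k) * v k) = 0" using v by (simp add: W'_def)
        from bspec[OF this inv[OF G_inv(1)[OF x] w]] show ?thesis .
      qed
      finally show "(\<Sum>i<?n. cnj (w i) * (\<Sum>k<?n. rep_coeff \<rho> x i k * v k)) = 0" .
    qed
    obtain r U s V where U: "fm_orthonormal ?n r W U" and V: "fm_orthonormal ?n s W' V" and rs: "r + s = ?n"
      and sum1: "(\<lambda>i j. fm_mult r U (fm_adj U) i j + fm_mult s V (fm_adj V) i j) = fm_one ?n"
      and Ux': "\<forall>w\<in>W. \<forall>i. w i = (\<Sum>a<r. U i a * (\<Sum>k<?n. cnj (U k a) * w k))"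
      and Vx': "\<forall>w\<in>W'. \<forall>i. w i = (\<Sum>a<s. V i a * (\<Sum>k<?n. cnj (V k a) * w k))"
    proof (rule fm_orthonormal_decomposition[of W ?n W'])
      show "W' = {v. (\<forall>i\<ge>?n. v i = 0) \<and> (\<forall>w\<in>W. (\<Sum>k<?n. cnj (w k) * v k) = 0)}" by (rule W'_def)
      show "w i = 0" if h: "w \<in> W" "?n \<le> i" for w i using h by (rule supp)
      show "(\<lambda>i. v i + c * w i) \<in> W" if h: "v \<in> W" "w \<in> W" for v w c using h by (rule lin)
    qed (rule that)
    note Ux = Ux'[THEN bspec, THEN spec] and Vx = Vx'[THEN bspec, THEN spec]
    \<comment> \<open>Both parts must be nonzero for each to have dimension below that of \<rho>. If
      r were 0, the given invariant subspace would be zero.\<close>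
    have "r > 0"
    proof (rule ccontr)
      assume "\<not> r > 0"
      then have r0: "r = 0" by simp
      have z0: "w i = 0" if "w \<in> W" for w i
        using Ux[OF that, of i] by (simp only: r0 lessThan_0 sum.empty)
      have z: "w = 0\<^sub>v ?n" if "w \<in> W0" for w
      proof (rule vec_fun_inj[of _ ?n])
        have "vec_fun ?n w \<in> W" using that by (simp add: W_def)
        from z0[OF this] show "vec_fun ?n w = vec_fun ?n (0\<^sub>v ?n)" by (intro ext) (simp add: vec_fun_def)
      qed (use that W0s(1) in auto)
      then have "W0 = {0\<^sub>v ?n}" using W0s(2) by blast
      then show False using W0(3) by simp
    qed
    \<comment> \<open>If s were 0, the projection onto W would be the identity and the given
      subspace would be everything.\<close>
    have "s > 0"
    proof (rule ccontr)
      assume "\<not> s > 0"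
      then have UU: "fm_mult r U (fm_adj U) = fm_one ?n" using sum1 by (simp add: fm_mult_def)
      have "carrier_vec ?n \<subseteq> W0"
      proof
        fix v :: "complex Matrix.vec" assume v: "v \<in> carrier_vec ?n"
        define co where "co = (\<lambda>a. \<Sum>j<?n. cnj (U j a) * vec_fun ?n v j)"
        have part: "(\<lambda>i. \<Sum>a<t. U i a * co a) \<in> W" if "t \<le> r" for t
          using that
        proof (induction t)
          case (Suc t)
          have "(\<lambda>i. U i t) \<in> W" using U Suc by (auto simp: fm_orthonormal_def)
          then have "(\<lambda>i. (\<Sum>a<t. U i a * co a) + co t * U i t) \<in> W" using Suc by (intro lin) auto
          then show ?case by (simp add: mult.commute)
        qed (use zero in simp)
        have "(\<Sum>a<r. U i a * co a) = vec_fun ?n v i" for i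
        proof -
          have "(\<Sum>a<r. U i a * co a) = (\<Sum>a<r. \<Sum>j<?n. U i a * cnj (U j a) * vec_fun ?n v j)"
            by (simp add: co_def sum_distrib_left mult.assoc)
          also have "\<dots> = (\<Sum>j<?n. fm_mult r U (fm_adj U) i j * vec_fun ?n v j)"
            by (subst sum.swap) (simp add: fm_mult_def fm_adj_def sum_distrib_right)
          also have "\<dots> = (\<Sum>j<?n. if j = i then vec_fun ?n v i else 0)"
            unfolding UU by (intro sum.cong) (auto simp: fm_one_def)
          also have "\<dots> = vec_fun ?n v i" by (simp add: vec_fun_def)
          finally show ?thesis .
        qed
        then have "vec_fun ?n v \<in> W" using part[of r] by simp
        then obtain w where "w \<in> W0" "vec_fun ?n v = vec_fun ?n w" by (auto simp: W_def)
        then show "v \<in> W0" using v W0s(1) vec_fun_inj by blast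
      qed
      then show False using W0(4) W0s(1) by blast
    qed
    note cont = continuous_on_rep_coeff[OF ur]
    have eqU: "fm_mult r U (fm_mult ?n (fm_adj U) (fm_mult ?n (rep_coeff \<rho> x) U)) = fm_mult ?n (rep_coeff \<rho> x) U" if x: "x \<in> G" for x
    proof (intro ext)
      fix i a
      show "fm_mult r U (fm_mult ?n (fm_adj U) (fm_mult ?n (rep_coeff \<rho> x) U)) i a = fm_mult ?n (rep_coeff \<rho> x) U i a"
      proof (cases "a < r")
        case True
        then have "(\<lambda>i. U i a) \<in> W" using U by (auto simp: fm_orthonormal_def)
        from Ux[OF inv[OF x this], of i] show ?thesis by (simp add: fm_mult_def fm_adj_def)
      next
        case False
        then have "U k a = 0" for k using U by (auto simp: fm_orthonormal_def fm_supp_def)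
        then show ?thesis by (simp add: fm_mult_def)
      qed
    qed
    have eqV: "fm_mult s V (fm_mult ?n (fm_adj V) (fm_mult ?n (rep_coeff \<rho> x) V)) = fm_mult ?n (rep_coeff \<rho> x) V" if x: "x \<in> G" for x
    proof (intro ext)
      fix i a
      show "fm_mult s V (fm_mult ?n (fm_adj V) (fm_mult ?n (rep_coeff \<rho> x) V)) i a = fm_mult ?n (rep_coeff \<rho> x) V i a"
      proof (cases "a < s")
        case True
        then have "(\<lambda>i. V i a) \<in> W'" using V by (auto simp: fm_orthonormal_def)
        from Vx[OF inv'[OF x this], of i] show ?thesis by (simp add: fm_mult_def fm_adj_def)
      next
        case False
        then have "V k a = 0" for k using V by (auto simp: fm_orthonormal_def fm_supp_def)
        then show ?thesis by (simp add: fm_mult_def)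
      qed
    qed
    have U2: "fm_supp ?n r U" "fm_mult ?n (fm_adj U) U = fm_one r" using U by (auto simp: fm_orthonormal_def)
    have V2: "fm_supp ?n s V" "fm_mult ?n (fm_adj V) V = fm_one s" using V by (auto simp: fm_orthonormal_def)
    obtain \<sigma> where \<sigma>: "unitary_rep G \<sigma>" "rep_dim \<sigma> = r"
      "\<And>x. x \<in> G \<Longrightarrow> fm_mult ?n (rep_coeff \<rho> x) U = fm_mult r U (rep_coeff \<sigma> x)"
      "\<And>m. trivial_on m \<rho> \<Longrightarrow> trivial_on m \<sigma>"
      by (rule compressed_rep[OF ur refl U2 eqU cont], assumption, rule that)
    obtain \<tau> where \<tau>: "unitary_rep G \<tau>" "rep_dim \<tau> = s"
      "\<And>x. x \<in> G \<Longrightarrow> fm_mult ?n (rep_coeff \<rho> x) V = fm_mult s V (rep_coeff \<tau> x)"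
      "\<And>m. trivial_on m \<rho> \<Longrightarrow> trivial_on m \<tau>"
      by (rule compressed_rep[OF ur refl V2 eqV cont], assumption, rule that)
    have split: "rep_coeff \<rho> x i j = fm_mult r U (fm_mult r (rep_coeff \<sigma> x) (fm_adj U)) i j
        + fm_mult s V (fm_mult s (rep_coeff \<tau> x) (fm_adj V)) i j" if x: "x \<in> G" for x
    proof -
      have "rep_coeff \<rho> x i j = fm_mult ?n (rep_coeff \<rho> x) (\<lambda>i j. fm_mult r U (fm_adj U) i j + fm_mult s V (fm_adj V) i j) i j"
        unfolding sum1 by (simp add: fm_mult_one[OF fm_supp_rep_coeff])
      also have "\<dots> = fm_mult ?n (rep_coeff \<rho> x) (fm_mult r U (fm_adj U)) i j + fm_mult ?n (rep_coeff \<rho> x) (fm_mult s V (fm_adj V)) i j"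
        unfolding fm_mult_def[of ?n] by (simp add: distrib_left sum.distrib)
      also have "fm_mult ?n (rep_coeff \<rho> x) (fm_mult r U (fm_adj U)) = fm_mult r U (fm_mult r (rep_coeff \<sigma> x) (fm_adj U))"
        by (simp only: fm_assoc[symmetric] \<sigma>(3)[OF x])
      also have "fm_mult ?n (rep_coeff \<rho> x) (fm_mult s V (fm_adj V)) = fm_mult s V (fm_mult s (rep_coeff \<tau> x) (fm_adj V))"
        by (simp only: fm_assoc[symmetric] \<tau>(3)[OF x])
      finally show ?thesis .
    qed
    have "in_coeff_span m (\<lambda>x. rep_coeff \<sigma> x a b)" "in_coeff_span m (\<lambda>x. rep_coeff \<tau> x a b)" for a b
      using less.hyps[OF _ \<sigma>(1) \<sigma>(4)[OF tr]] less.hyps[OF _ \<tau>(1) \<tau>(4)[OF tr]] \<sigma>(2) \<tau>(2) rs \<open>r > 0\<close> \<open>s > 0\<close> by simp_all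
    then have "in_coeff_span m (\<lambda>x. fm_mult r U (fm_mult r (rep_coeff \<sigma> x) (fm_adj U)) i j
        + fm_mult s V (fm_mult s (rep_coeff \<tau> x) (fm_adj V)) i j)"
      by (intro in_coeff_span_add in_coeff_span_fm)
    then show ?thesis by (rule in_coeff_span_cong[THEN iffD1, rotated]) (simp only: split)
  qed
qed

section \<open>Functions on the cosets as matrix entries\<close>

lemma image_Coset:
  assumes "x \<in> G" "y \<in> G"
  shows "(\<lambda>k. x ** k) ` Coset m y = Coset m (x ** y)"
  using assms by (simp add: Coset_eq_image G_mult image_image matrix_mul_assoc)

text \<open>G permutes the finitely many cosets of \<open>K m\<close> by left multiplication. The
  entry of the permutation matrix of x in the column of the base coset is 1 exactly in the row of x
  \<open>K m\<close>, so this column, weighted with the values of F, recovers F.\<close>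

lemma in_coeff_span_coset_const:
  assumes "coset_const m F"
  shows "in_coeff_span m F"
proof -
  let ?C = "Coset m ` G" and ?N = "card (Coset m ` G)"
  obtain g where g: "bij_betw g {..<?N} ?C"
    using ex_bij_betw_nat_finite[OF finite_Cosets[of m]] by (auto simp: atLeast0LessThan)
  define act where "act = (\<lambda>(x :: 'l padic ^'m ^'m) (C :: ('l padic ^'m ^'m) set). (\<lambda>k. x ** k) ` C)"
  have act_C: "act x C \<in> ?C" if "x \<in> G" "C \<in> ?C" for x C
    using that G_mult by (auto simp: act_def image_Coset)
  have act_mult: "act (x ** y) C = act x (act y C)" for x y C
    by (simp add: act_def image_image matrix_mul_assoc)
  have act_one: "act (mat 1) C = C" for C by (auto simp: act_def image_def)
  have act_inv: "act (matrix_inv x) (act x C) = C" "act x (act (matrix_inv x) C) = C" if "x \<in> G" for x C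
    using that by (simp_all add: act_mult[symmetric] act_one G_inv)
  define \<rho> where "\<rho> = (\<lambda>x. Matrix.mat ?N ?N (\<lambda>(i, j). if act x (g j) = g i then 1 else (0::complex)))"
  have dim: "rep_dim \<rho> = ?N" by (simp add: rep_dim_def \<rho>_def)
  have c: "\<rho> x \<in> carrier_mat ?N ?N" for x by (simp add: \<rho>_def)
  have gC: "g i \<in> ?C" if "i < ?N" for i using g that by (auto simp: bij_betw_def)
  have gsurj: "\<exists>k<?N. g k = C" if "C \<in> ?C" for C
  proof -
    have "C \<in> g ` {..<?N}" using that by (simp only: bij_betw_imp_surj_on[OF g])
    then show ?thesis by blast
  qed
  have ginj: "i = j" if "g i = g j" "i < ?N" "j < ?N" for i j using g that by (auto simp: bij_betw_def inj_on_def)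
  have R: "rep_coeff \<rho> x i j = (if i < ?N \<and> j < ?N \<and> act x (g j) = g i then 1 else 0)" for x i j
    unfolding rep_coeff_def dim by (simp add: \<rho>_def)
  \<comment> \<open>Normality of \<open>K m\<close> is used here: k y lies in y \<open>K m\<close>,
    so left multiplication by elements of \<open>K m\<close> fixes every coset.\<close>
  have inv_coset: "act (x ** k) C = act x C" if xk: "x \<in> G" "k \<in> K m" "C \<in> ?C" for x k C
  proof -
    obtain y where y: "y \<in> G" "C = Coset m y" using xk(3) by blast
    have kG: "k \<in> G" using xk(2) K_subset_G by blast
    have "matrix_inv y ** (k ** y) = matrix_inv y ** k ** matrix_inv (matrix_inv y)"
      using y by (simp add: matrix_inv_inv matrix_mul_assoc)
    also have "\<dots> \<in> K m" using K_conj_iff[OF G_inv(1)[OF y(1)] kG] xk(2) by simp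
    finally have "k ** y \<in> Coset m y" using y kG by (simp add: Coset_iff_K G_mult)
    then have "Coset m (k ** y) = Coset m y" by (rule Coset_eq[OF y(1)])
    then have "act k C = C" using y kG by (simp add: act_def image_Coset)
    then show ?thesis by (simp add: act_mult)
  qed
  have "unitary_rep G \<rho>"
    unfolding unitary_rep_def dim
  proof (intro conjI ballI allI impI)
    fix x assume x: "x \<in> G"
    show "unitary_mat ?N (\<rho> x)"
    proof (subst unitary_mat_iff[OF c], intro allI impI)
      fix i j assume ij: "i < ?N" "j < ?N"
      obtain k0 where k0: "k0 < ?N" "g k0 = act (matrix_inv x) (g i)"
        using gsurj[OF act_C[OF G_inv(1)[OF x] gC[OF ij(1)]]] by blast
      have iff: "act x (g k) = g i \<longleftrightarrow> k = k0" if "k < ?N" for k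
      proof
        assume "act x (g k) = g i"
        then have "g k = g k0" using act_inv[OF x] k0(2) by metis
        then show "k = k0" using ginj that k0(1) by blast
      qed (use k0 act_inv[OF x] in simp)
      have "(\<Sum>k<?N. \<rho> x $$ (i, k) * cnj (\<rho> x $$ (j, k))) = (\<Sum>k<?N. if k = k0 then (if act x (g k0) = g j then 1 else 0) else 0)"
        by (intro sum.cong refl) (use ij iff in \<open>auto simp: \<rho>_def\<close>)
      also have "\<dots> = (if act x (g k0) = g j then 1 else 0)" using k0 by simp
      also have "act x (g k0) = g i" using k0 act_inv[OF x] by simp
      finally show "(\<Sum>k<?N. \<rho> x $$ (i, k) * cnj (\<rho> x $$ (j, k))) = (if i = j then 1 else 0)"
        using ginj ij by auto
    qed
    fix y assume y: "y \<in> G"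
    show "\<rho> (x ** y) = \<rho> x * \<rho> y"
    proof (rule eq_matI)
      fix i j assume "i < dim_row (\<rho> x * \<rho> y)" "j < dim_col (\<rho> x * \<rho> y)"
      then have ij: "i < ?N" "j < ?N" by (simp_all add: \<rho>_def)
      obtain k0 where k0: "k0 < ?N" "g k0 = act y (g j)"
        using gsurj[OF act_C[OF y gC[OF ij(2)]]] by blast
      have "(\<rho> x * \<rho> y) $$ (i, j) = (\<Sum>k<?N. if k = k0 then (if act x (g k0) = g i then 1 else 0) else 0)"
        unfolding mult_mat_entry[OF c c ij]
        by (intro sum.cong refl) (use ij k0 ginj in \<open>auto simp: \<rho>_def\<close>)
      also have "\<dots> = \<rho> (x ** y) $$ (i, j)" using k0 ij by (simp add: \<rho>_def act_mult)
      finally show "\<rho> (x ** y) $$ (i, j) = (\<rho> x * \<rho> y) $$ (i, j)" by simp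
    qed (simp_all add: \<rho>_def)
  next
    fix i j assume ij: "i < ?N" "j < ?N"
    have "coset_const m (\<lambda>x. \<rho> x $$ (i, j))"
      unfolding coset_const_def
    proof (intro ballI)
      fix x y assume x: "x \<in> G" and "y \<in> Coset m x"
      then obtain k where k: "k \<in> K m" "y = x ** k" by (auto simp: Coset_eq_image)
      show "\<rho> y $$ (i, j) = \<rho> x $$ (i, j)" using ij inv_coset[OF x k(1) gC[OF ij(2)]] by (simp add: \<rho>_def k(2))
    qed
    then show "continuous_on G (\<lambda>x. \<rho> x $$ (i, j))" by (rule coset_const_continuous_on)
  qed
  moreover have "trivial_on m \<rho>"
    unfolding trivial_on_def dim
  proof (intro ballI ext)
    fix k i j assume k: "k \<in> K m"
    have "act k (g j) = g j" if "j < ?N" using inv_coset[OF G_one k gC[OF that]] by (simp add: act_one)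
    then show "rep_coeff \<rho> k i j = fm_one ?N i j" using ginj by (auto simp: R fm_one_def)
  qed
  ultimately have sp: "in_coeff_span m (\<lambda>x. rep_coeff \<rho> x i j)" for i j
    by (rule in_coeff_span_unitary_rep)
  obtain j0 where j0: "j0 < ?N" "g j0 = Coset m (mat 1)" using gsurj[of "Coset m (mat 1)"] G_one by blast
  \<comment> \<open>The common value of F on the i-th coset, read off at an arbitrary point of
    it.\<close>
  define v where "v = (\<lambda>i. F (SOME y. y \<in> g i))"
  have F: "F x = (\<Sum>i<?N. v i * rep_coeff \<rho> x i j0)" if x: "x \<in> G" for x
  proof -
    obtain i0 where i0: "i0 < ?N" "g i0 = Coset m x" using gsurj[of "Coset m x"] x by blast
    have a: "act x (g j0) = Coset m x" using j0 x G_one by (simp add: act_def image_Coset)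
    have "(\<Sum>i<?N. v i * rep_coeff \<rho> x i j0) = (\<Sum>i<?N. if i = i0 then v i0 else 0)"
    proof (intro sum.cong refl)
      fix i assume i: "i \<in> {..<?N}"
      have "Coset m x = g i \<longleftrightarrow> i = i0" using ginj[of i i0] i i0 by auto
      then show "v i * rep_coeff \<rho> x i j0 = (if i = i0 then v i0 else 0)" using i j0(1) by (simp add: R a)
    qed
    also have "\<dots> = v i0" using i0 by simp
    also have "\<dots> = F x"
    proof -
      have "(SOME y. y \<in> Coset m x) \<in> Coset m x" using Coset_self[OF x] by (rule someI)
      then show ?thesis using assms x unfolding v_def i0(2) coset_const_def by blast
    qed
    finally show ?thesis ..
  qed
  have "in_coeff_span m (\<lambda>x. \<Sum>i<?N. v i * rep_coeff \<rho> x i j0)"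
    by (intro in_coeff_span_sum in_coeff_span_scale sp)
  then show ?thesis by (rule in_coeff_span_cong[THEN iffD1, rotated]) (simp only: F)
qed

text \<open>A function constant on cosets of level m that is close to f is a combination of the
  entries of level m. Replacing its coefficients by the Fourier coefficients of f can only bring it
  closer.\<close>

lemma Parseval_approx:
  assumes f: "sqint f" and e: "e > 0"
  obtains m where "(\<integral>x. (cmod (f x))\<^sup>2 \<partial>\<mu>) < (\<Sum>c\<in>dual_level m. fourier_term f c) + e"
proof -
  obtain m F where F: "coset_const m F" "L2_dist2 f F < e"
    using square_integrable_imp_L2_approx[OF f] e unfolding L2_approx_def by blast
  obtain a where a: "\<And>x. x \<in> G \<Longrightarrow> F x = (\<Sum>e\<in>coeff_index (dual_level m). a e * coeff_fun e x)"
    using in_coeff_span_coset_const[OF F(1)] unfolding in_coeff_span_def by blast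
  let ?I = "coeff_index (dual_level m)"
  have sub: "?I \<subseteq> coeff_index (unitary_dual G)" by (rule coeff_index_mono) (auto simp: dual_level_def)
  have "L2_dist2 f F = L2_dist2 f (\<lambda>x. \<Sum>e\<in>?I. a e * coeff_fun e x)"
    unfolding L2_dist2_def by (intro Bochner_Integration.integral_cong refl) (simp add: space_mu a)
  also have "\<dots> = (\<integral>x. (cmod (f x))\<^sup>2 \<partial>\<mu>) - (\<Sum>e\<in>?I. (cmod (ip f (coeff_fun e)))\<^sup>2)
      + (\<Sum>e\<in>?I. (cmod (ip f (coeff_fun e) - a e))\<^sup>2)"
  proof (rule L2_dist2_orthonormal_sum[OF finite_coeff_index_level _ f])
    show "sqint (coeff_fun e)" if "e \<in> ?I" for e using sub that square_integrable_coeff_fun by blast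
    show "ip (coeff_fun e) (coeff_fun e') = (if e = e' then 1 else 0)" if "e \<in> ?I" "e' \<in> ?I" for e e'
      by (rule coeff_fun_orthonormal) (use sub that in auto)
  qed
  also have "(\<Sum>e\<in>?I. (cmod (ip f (coeff_fun e)))\<^sup>2) = (\<Sum>c\<in>dual_level m. fourier_term f c)"
    by (rule sum_fourier_term[symmetric, OF finite_dual_level]) (auto simp: dual_level_def)
  finally have "(\<integral>x. (cmod (f x))\<^sup>2 \<partial>\<mu>) - (\<Sum>c\<in>dual_level m. fourier_term f c) + (\<Sum>e\<in>?I. (cmod (ip f (coeff_fun e) - a e))\<^sup>2) < e"
    using F(2) by simp
  moreover have "(\<Sum>e\<in>?I. (cmod (ip f (coeff_fun e) - a e))\<^sup>2) \<ge> 0" by (intro sum_nonneg) auto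
  ultimately have "(\<integral>x. (cmod (f x))\<^sup>2 \<partial>\<mu>) < (\<Sum>c\<in>dual_level m. fourier_term f c) + e" by linarith
  then show ?thesis by (rule that)
qed

end

section \<open>Growth of the eigenvalues\<close>

locale padic_Lie_haar_group =
  compact_nilpotent_padic_Lie_group X G + haar_padic_group G \<mu>
  for X :: "'d::finite \<Rightarrow> 'l::prime_card padic ^'m::finite ^'m" and G and \<mu>
begin

definition norm_ball :: "nat \<Rightarrow> ('l padic ^'m ^'m) set" where
  "norm_ball k = {h \<in> G. group_norm X h \<le> 1 / real CARD('l) ^ k}"

lemma norm_ball_subset: "norm_ball k \<subseteq> G" by (auto simp: norm_ball_def)

lemma continuous_on_mat_pow: "continuous_on G (\<lambda>g. mat_pow g n)"
  by (induction n) (auto simp: mat_pow_Suc intro: continuous_on_matrix_mult)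

lemma norm_ball_sets: "norm_ball k \<in> sets \<mu>"
proof -
  have eq: "norm_ball k = (\<lambda>g. mat_pow g (CARD('l) ^ k)) ` G"
    using group_norm_le_iff_power[of _ k] G_pow by (auto simp: norm_ball_def)
  have "compact (norm_ball k)"
    unfolding eq by (rule compact_continuous_image[OF continuous_on_mat_pow compact_G])
  then have "norm_ball k \<in> sets borel" by (intro borel_closed compact_imp_closed)
  moreover have "norm_ball k = G \<inter> norm_ball k" using norm_ball_subset by blast
  ultimately show ?thesis unfolding sets_mu sets_restrict_space by (rule rev_image_eqI)
qed

text \<open>The norm takes only the values 0 and l^-k. For a \<ge> 0 it is thus at most a exactly
  when, for every k with a < l^-k, it is at most l^-(k+1), and the balls are measurable.\<close>

lemma measurable_group_norm: "group_norm X \<in> borel_measurable \<mu>"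
  unfolding borel_measurable_iff_le
proof
  fix a :: real
  let ?p = "real CARD('l)"
  show "{h \<in> space \<mu>. group_norm X h \<le> a} \<in> sets \<mu>"
  proof (cases "a < 0")
    case True
    have n: "\<not> group_norm X h \<le> a" if "h \<in> space \<mu>" for h
      using group_norm_nonneg[OF that[unfolded space_mu]] True by linarith
    have eq: "{h \<in> space \<mu>. group_norm X h \<le> a} = {}" using n by blast
    show ?thesis unfolding eq by (rule sets.empty_sets)
  next
    case False
    have "{h \<in> space \<mu>. group_norm X h \<le> a} = G \<inter> (\<Inter>k. if a < 1 / ?p ^ k then norm_ball (Suc k) else G)"
    proof (intro equalityI subsetI)
      fix h assume "h \<in> {h \<in> space \<mu>. group_norm X h \<le> a}"
      then have h: "h \<in> G" "group_norm X h \<le> a" by (auto simp: space_mu)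
      have "h \<in> norm_ball (Suc k)" if k: "a < 1 / ?p ^ k" for k
      proof (cases "h = mat 1")
        case True
        have "group_norm X h = 0" using True h(1) group_norm_eq_0_iff by blast
        then show ?thesis using h(1) by (simp add: norm_ball_def)
      next
        case False
        then obtain i where i: "group_norm X h = 1 / ?p ^ i" using group_norm_value[OF h(1)] by blast
        then have "1 / ?p ^ i < 1 / ?p ^ k" using h k by linarith
        then have "?p ^ k < ?p ^ i" by (simp add: field_simps)
        then have "Suc k \<le> i" using power_less_imp_less_exp[OF CARD_gt_1[where 'l='l]] by (simp add: Suc_le_eq)
        then have "1 / ?p ^ i \<le> 1 / ?p ^ Suc k"
          using CARD_gt_1[where 'l='l] by (intro divide_left_mono power_increasing) auto
        then show ?thesis using h(1) i by (simp add: norm_ball_def)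
      qed
      then show "h \<in> G \<inter> (\<Inter>k. if a < 1 / ?p ^ k then norm_ball (Suc k) else G)" using h(1) by auto
    next
      fix h assume h: "h \<in> G \<inter> (\<Inter>k. if a < 1 / ?p ^ k then norm_ball (Suc k) else G)"
      then have hG: "h \<in> G" by blast
      have "group_norm X h \<le> a"
      proof (rule ccontr)
        assume n: "\<not> group_norm X h \<le> a"
        then have "h \<noteq> mat 1" using group_norm_eq_0_iff[OF hG] False by auto
        then obtain i where i: "group_norm X h = 1 / ?p ^ i" using group_norm_value[OF hG] by blast
        then have lt: "a < 1 / ?p ^ i" using n by simp
        have "h \<in> (if a < 1 / ?p ^ i then norm_ball (Suc i) else G)" using h by blast
        then have "1 / ?p ^ i \<le> 1 / ?p ^ Suc i" using lt i by (simp add: norm_ball_def)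
        moreover have "1 / ?p ^ Suc i < 1 / ?p ^ i"
          using CARD_gt_1[where 'l='l] by (intro divide_strict_left_mono power_strict_increasing) auto
        ultimately show False by linarith
      qed
      then show "h \<in> {h \<in> space \<mu>. group_norm X h \<le> a}" using hG by (simp add: space_mu)
    qed
    also have "\<dots> \<in> sets \<mu>"
    proof -
      have G: "G \<in> sets \<mu>" using sets.top[of \<mu>] by (simp add: space_mu)
      have "(\<Inter>k. if a < 1 / ?p ^ k then norm_ball (Suc k) else G) \<in> sets \<mu>"
        by (rule sets.countable_INT) (use G norm_ball_sets in auto)
      then show ?thesis using G by blast
    qed
    finally show ?thesis .
  qed
qed

text \<open>A ball is cut into left translates of the next smaller one by exp v, with one v for each
  vector of leading digits. By \<open>exp_coord_mult_close\<close>, multiplication by exp v shifts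
  the coordinates by v up to l^-(k+1), so the translates are told apart by their digits, just as in
  the additive group.\<close>

lemma measure_norm_ball_step:
  obtains n0 where "\<And>k. k \<ge> n0 \<Longrightarrow>
    measure \<mu> (norm_ball k) = real CARD('l) ^ CARD('d) * measure \<mu> (norm_ball (Suc k))"
proof -
  let ?p = "real CARD('l)"
  obtain n0 where n0: "\<forall>k a b. k \<ge> n0 \<longrightarrow> vec_norm a \<le> 1 / ?p ^ k \<longrightarrow> vec_norm b \<le> 1 / ?p ^ k \<longrightarrow>
      (\<exists>w. vec_norm w \<le> 1 \<and> exp_coord X a ** exp_coord X b = exp_coord X w \<and>
        vec_norm (w - a - b) \<le> 1 / ?p ^ Suc k)"
    using exp_coord_mult_close by blast
  have "measure \<mu> (norm_ball k) = ?p ^ CARD('d) * measure \<mu> (norm_ball (Suc k))" if k: "k \<ge> n0" for k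
  proof -
    define P where "P = (of_nat (CARD('l) ^ k) :: 'l padic)"
    have P: "padic_abs P = 1 / ?p ^ k" by (simp add: P_def padic_abs_power padic_abs_prime power_divide)
    have P0: "P \<noteq> 0" using P by (metis padic_abs_0 CARD_pos divide_eq_0_iff less_irrefl power_not_zero zero_neq_one)
    have pk1: "1 / ?p ^ k \<le> 1" using CARD_gt_1[where 'l='l] by (simp add: one_le_power)
    have pSk: "1 / ?p ^ Suc k \<le> 1 / ?p ^ k"
      using CARD_gt_1[where 'l='l] by (intro divide_left_mono power_increasing) auto
    \<comment> \<open>The l^d vectors of digits; below, v attaches to each of them the vector with
      these digits in place k and zeros elsewhere.\<close>
    define R where "R = ((UNIV :: 'd set) \<rightarrow>\<^sub>E {..<CARD('l)})"
    define v where "v = (\<lambda>r :: 'd \<Rightarrow> nat. P *s (\<chi> j :: 'd. (of_nat (r j) :: 'l padic)))"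
    have v: "vec_norm (v r) \<le> 1 / ?p ^ k" for r
    proof -
      have "vec_norm (\<chi> j :: 'd. (of_nat (r j) :: 'l padic)) \<le> 1" by (simp add: vec_norm_le_iff padic_abs_of_nat_le_1)
      then show ?thesis unfolding v_def vec_norm_scale P
        using mult_left_mono[of "vec_norm (\<chi> j :: 'd. (of_nat (r j) :: 'l padic))" 1 "1 / ?p ^ k"] by simp
    qed
    have mem: "exp_coord X x \<in> norm_ball i \<longleftrightarrow> vec_norm x \<le> 1 / ?p ^ i" if "vec_norm x \<le> 1" for x i
      using that by (simp add: norm_ball_def exp_coord_in_G group_norm_exp_coord)
    have exG: "exp_coord X (v r) \<in> G" for r using v[of r] pk1 by (intro exp_coord_in_G) linarith
    have coord: "\<exists>y. vec_norm y \<le> 1 / ?p ^ i \<and> h = exp_coord X y" if hi: "h \<in> norm_ball i" for h i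
    proof -
      obtain y where y: "vec_norm y \<le> 1" "h = exp_coord X y" by (rule G_exp_cases[OF subsetD[OF norm_ball_subset hi]])
      then have "vec_norm y \<le> 1 / ?p ^ i" using mem[OF y(1)] hi by simp
      then show ?thesis using y(2) by blast
    qed
    let ?T = "\<lambda>r. (\<lambda>x. exp_coord X (v r) ** x) ` norm_ball (Suc k)"
    have sub: "?T r \<subseteq> norm_ball k" for r
    proof
      fix h assume "h \<in> ?T r"
      then obtain x where x: "x \<in> norm_ball (Suc k)" "h = exp_coord X (v r) ** x" by blast
      obtain y where y: "vec_norm y \<le> 1 / ?p ^ Suc k" "x = exp_coord X y" using coord[OF x(1)] by blast
      have yk: "vec_norm y \<le> 1 / ?p ^ k" using y(1) pSk by linarith
      obtain w where w: "vec_norm w \<le> 1" "exp_coord X (v r) ** exp_coord X y = exp_coord X w"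
        "vec_norm (w - v r - y) \<le> 1 / ?p ^ Suc k" using n0[rule_format, OF k v[of r] yk] by blast
      have "vec_norm (w - v r - y + (v r + y)) \<le> 1 / ?p ^ k"
        using w(3) pSk v[of r] yk by (intro vec_norm_add_le) linarith+
      then have "vec_norm w \<le> 1 / ?p ^ k" by simp
      then show "h \<in> norm_ball k" using mem[OF w(1)] w(2) x y by simp
    qed
    have cover: "norm_ball k \<subseteq> (\<Union>r\<in>R. ?T r)"
    proof
      fix h assume h: "h \<in> norm_ball k"
      obtain x where x: "vec_norm x \<le> 1 / ?p ^ k" "h = exp_coord X x" using coord[OF h] by blast
      have xj: "padic_abs (x $ j / P) \<le> 1" for j
        using order_trans[OF vec_norm_entry x(1), of j] CARD_pos[where 'l='l] by (simp add: padic_abs_divide P field_simps)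
      have "\<forall>j. \<exists>r. r < CARD('l) \<and> padic_abs (x $ j / P - of_nat r) \<le> 1 / ?p"
      proof
        fix j
        obtain r where "r < CARD('l)" "padic_abs (x $ j / P - of_nat r) \<le> 1 / ?p"
          using xj by (rule padic_residue_ex)
        then show "\<exists>r. r < CARD('l) \<and> padic_abs (x $ j / P - of_nat r) \<le> 1 / ?p" by blast
      qed
      from choice[OF this] obtain r where r': "\<forall>j. r j < CARD('l) \<and> padic_abs (x $ j / P - of_nat (r j)) \<le> 1 / ?p" ..
      then have r: "\<And>j. r j < CARD('l)" "\<And>j. padic_abs (x $ j / P - of_nat (r j)) \<le> 1 / ?p" by blast+
      have rR: "r \<in> R" using r(1) by (simp add: R_def PiE_UNIV_domain)
      have xv: "vec_norm (x - v r) \<le> 1 / ?p ^ Suc k"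
        unfolding vec_norm_le_iff
      proof
        fix j
        have "(x - v r) $ j = P * (x $ j / P - of_nat (r j))" using P0 by (simp add: v_def field_simps)
        then have "padic_abs ((x - v r) $ j) = 1 / ?p ^ k * padic_abs (x $ j / P - of_nat (r j))"
          by (simp only: padic_abs_mult P)
        also have "\<dots> \<le> 1 / ?p ^ k * (1 / ?p)" by (intro mult_left_mono r) simp
        finally show "padic_abs ((x - v r) $ j) \<le> 1 / ?p ^ Suc k" by (simp add: mult.commute)
      qed
      \<comment> \<open>Covering: if v carries the leading digits of x, the product of exp (-v) and
        exp x has coordinates x - v up to l^-(k+1), so it lies in the smaller ball.\<close>
      have mv: "vec_norm (- v r) \<le> 1 / ?p ^ k" using v[of r] by simp
      obtain w where w: "vec_norm w \<le> 1" "exp_coord X (- v r) ** exp_coord X x = exp_coord X w"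
        "vec_norm (w - (- v r) - x) \<le> 1 / ?p ^ Suc k" using n0[rule_format, OF k mv x(1)] by blast
      have "vec_norm (w - (- v r) - x + (x - v r)) \<le> 1 / ?p ^ Suc k" by (intro vec_norm_add_le w xv)
      then have "exp_coord X w \<in> norm_ball (Suc k)" using mem[OF w(1), of "Suc k"] by simp
      moreover have "h = exp_coord X (v r) ** exp_coord X w"
      proof -
        have "vec_norm (v r) \<le> 1" using v[of r] pk1 by linarith
        then have "exp_coord X (- v r) = matrix_inv (exp_coord X (v r))" by (rule exp_coord_minus)
        then show ?thesis using w(2) x(2) mult_inv_cancel[OF exG[of r]] by metis
      qed
      ultimately show "h \<in> (\<Union>r\<in>R. ?T r)" using rR by blast
    qed
    have disj: "disjoint_family_on ?T R"
      unfolding disjoint_family_on_def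
    proof (intro ballI impI)
      fix r s assume rs: "r \<in> R" "s \<in> R" "r \<noteq> s"
      show "?T r \<inter> ?T s = {}"
      proof (rule ccontr)
        assume "?T r \<inter> ?T s \<noteq> {}"
        then obtain h where h: "h \<in> ?T r" "h \<in> ?T s" by blast
        have *: "\<exists>w. vec_norm w \<le> 1 \<and> h = exp_coord X w \<and> vec_norm (w - v t) \<le> 1 / ?p ^ Suc k" if ht: "h \<in> ?T t" for t
        proof -
          obtain x where x: "x \<in> norm_ball (Suc k)" "h = exp_coord X (v t) ** x" using ht by blast
          obtain y where y: "vec_norm y \<le> 1 / ?p ^ Suc k" "x = exp_coord X y" using coord[OF x(1)] by blast
          have yk: "vec_norm y \<le> 1 / ?p ^ k" using y(1) pSk by linarith
          obtain w where w: "vec_norm w \<le> 1" "exp_coord X (v t) ** exp_coord X y = exp_coord X w"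
            "vec_norm (w - v t - y) \<le> 1 / ?p ^ Suc k" using n0[rule_format, OF k v[of t] yk] by blast
          have "vec_norm (w - v t - y + y) \<le> 1 / ?p ^ Suc k" by (intro vec_norm_add_le w y)
          then show ?thesis using w x y by auto
        qed
        obtain w where w: "vec_norm w \<le> 1" "h = exp_coord X w" "vec_norm (w - v r) \<le> 1 / ?p ^ Suc k" using *[OF h(1)] by blast
        obtain u where u: "vec_norm u \<le> 1" "h = exp_coord X u" "vec_norm (u - v s) \<le> 1 / ?p ^ Suc k" using *[OF h(2)] by blast
        have "w = u" using exp_coord_inj[OF w(1) u(1)] w(2) u(2) by simp
        then have vv: "vec_norm ((u - v s) - (w - v r)) \<le> 1 / ?p ^ Suc k" "(u - v s) - (w - v r) = v r - v s"
          using vec_norm_diff_le[OF u(3) w(3)] by simp_all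
        have "r j = s j" for j
        proof (rule padic_residue_unique[where 'l='l])
          show "r j < CARD('l)" "s j < CARD('l)" using rs by (auto simp: R_def PiE_UNIV_domain)
          have "(v r - v s) $ j = P * (of_nat (r j) - of_nat (s j))" by (simp add: v_def right_diff_distrib)
          then have "1 / ?p ^ k * padic_abs (of_nat (r j) - of_nat (s j) :: 'l padic) = padic_abs ((v r - v s) $ j)"
            by (simp only: padic_abs_mult P)
          also have "\<dots> \<le> 1 / ?p ^ Suc k" using order_trans[OF vec_norm_entry vv(1)[unfolded vv(2)]] .
          finally have "padic_abs (of_nat (r j) - of_nat (s j) :: 'l padic) \<le> 1 / ?p"
            using CARD_pos[where 'l='l] by (simp add: field_simps)
          also have "\<dots> < 1" using CARD_gt_1[where 'l='l] by simp
          finally show "padic_abs (of_nat (r j) - of_nat (s j) :: 'l padic) < 1" .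
        qed
        then show False using rs(3) by auto
      qed
    qed
    have finR: "finite R" by (simp add: R_def finite_PiE)
    have Ts: "?T r \<in> sets \<mu>" for r
    proof -
      have "?T r = (\<lambda>x. matrix_inv (exp_coord X (v r)) ** x) -` norm_ball (Suc k) \<inter> space \<mu>"
      proof (intro equalityI subsetI)
        fix h assume "h \<in> ?T r"
        then show "h \<in> (\<lambda>x. matrix_inv (exp_coord X (v r)) ** x) -` norm_ball (Suc k) \<inter> space \<mu>"
          using norm_ball_subset[of "Suc k"] exG[of r] by (auto simp: space_mu inv_mult_cancel G_mult)
      next
        fix h assume h: "h \<in> (\<lambda>x. matrix_inv (exp_coord X (v r)) ** x) -` norm_ball (Suc k) \<inter> space \<mu>"
        then show "h \<in> ?T r"
          by (intro image_eqI[of _ _ "matrix_inv (exp_coord X (v r)) ** h"]) (auto simp: mult_inv_cancel[OF exG])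
      qed
      then show ?thesis
        using measurable_sets[OF left_translation_isometry(1)[OF G_inv(1)[OF exG[of r]]] norm_ball_sets] by simp
    qed
    have "norm_ball k = (\<Union>r\<in>R. ?T r)" using cover sub by blast
    then have "measure \<mu> (norm_ball k) = measure \<mu> (\<Union>r\<in>R. ?T r)" by simp
    also have "\<dots> = (\<Sum>r\<in>R. measure \<mu> (?T r))"
      by (rule finite_measure_finite_Union[OF finR _ disj]) (use Ts in blast)
    also have "\<dots> = (\<Sum>r\<in>R. measure \<mu> (norm_ball (Suc k)))"
      by (intro sum.cong refl measure_left_translate exG norm_ball_sets)
    also have "\<dots> = real (card R) * measure \<mu> (norm_ball (Suc k))" by simp
    also have "card R = CARD('l) ^ CARD('d)" by (simp add: R_def card_PiE)
    finally show ?thesis by simp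
  qed
  then show ?thesis by (rule that)
qed

text \<open>From level n0 on the rescaled measure is constant by
  \<open>measure_norm_ball_step\<close>; the finitely many lower levels are handled by monotonicity
  in k.\<close>

lemma measure_norm_ball_bounds:
  obtains c C where "c > 0" "C > 0"
    "\<And>k. c \<le> real CARD('l) ^ (k * CARD('d)) * measure \<mu> (norm_ball k)"
    "\<And>k. real CARD('l) ^ (k * CARD('d)) * measure \<mu> (norm_ball k) \<le> C"
proof -
  let ?p = "real CARD('l)" and ?d = "CARD('d)" and ?M = "\<lambda>k. measure \<mu> (norm_ball k)"
  have p1: "?p \<ge> 1" using CARD_gt_1[where 'l='l] by simp
  obtain n0 where n0: "\<And>k. k \<ge> n0 \<Longrightarrow> ?M k = ?p ^ ?d * ?M (Suc k)"
    by (rule measure_norm_ball_step, rule that)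
  define L where "L = ?p ^ (n0 * ?d) * ?M n0"
  have L: "?p ^ ((n0 + i) * ?d) * ?M (n0 + i) = L" for i
  proof (induction i)
    case (Suc i)
    have "?p ^ ((n0 + Suc i) * ?d) * ?M (n0 + Suc i) = ?p ^ ((n0 + i) * ?d) * (?p ^ ?d * ?M (Suc (n0 + i)))"
      by (simp add: power_add algebra_simps)
    also have "?p ^ ?d * ?M (Suc (n0 + i)) = ?M (n0 + i)" using n0[of "n0 + i"] by simp
    finally show ?case using Suc by simp
  qed (simp add: L_def)
  have mono: "?M j \<le> ?M i" if "i \<le> j" for i j
  proof (rule finite_measure_mono[OF _ norm_ball_sets])
    have "1 / ?p ^ j \<le> 1 / ?p ^ i" using that p1 by (intro divide_left_mono power_increasing) auto
    then show "norm_ball j \<subseteq> norm_ball i" by (auto simp: norm_ball_def)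
  qed
  have le1: "?M k \<le> 1" for k
    using finite_measure_mono[OF norm_ball_subset, of k] sets.top[of \<mu>] by (simp add: space_mu measure_G)
  have pos: "?M n0 > 0"
  proof -
    obtain a b where ab: "a > 0" "b > 0" "\<And>h. h \<in> G \<Longrightarrow> mat_norm (h - mat 1) \<le> a * group_norm X h"
      "\<And>h. h \<in> G \<Longrightarrow> group_norm X h \<le> b * mat_norm (h - mat 1)"
      by (rule group_norm_bounds, rule that)
    obtain j where j: "b * ?p ^ n0 < ?p ^ j" using real_arch_pow[OF CARD_gt_1[where 'l='l]] by blast
    have "K j \<subseteq> norm_ball n0"
    proof
      fix h assume h: "h \<in> K j"
      then have hG: "h \<in> G" and hj: "mat_norm (h - mat 1) \<le> 1 / ?p ^ j" by (auto simp: congruence_subgroup_def)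
      have "group_norm X h \<le> b * mat_norm (h - mat 1)" by (rule ab(4)[OF hG])
      also have "\<dots> \<le> b * (1 / ?p ^ j)" using ab(2) hj by (intro mult_left_mono) auto
      also have "\<dots> \<le> 1 / ?p ^ n0" using j by (simp add: field_simps)
      finally show "h \<in> norm_ball n0" using hG by (simp add: norm_ball_def)
    qed
    then show ?thesis using finite_measure_mono[OF _ norm_ball_sets, of "K j" n0] measure_K_pos[of j] by linarith
  qed
  have pn0: "?p ^ (n0 * ?d) \<ge> 1" using p1 by (rule one_le_power)
  show ?thesis
  proof (rule that[of "?M n0" "?p ^ (n0 * ?d)"])
    show "?M n0 \<le> ?p ^ (k * ?d) * ?M k" for k
    proof (cases "k \<ge> n0")
      case True
      then have "?p ^ (k * ?d) * ?M k = L" using L[of "k - n0"] by simp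
      moreover have "1 * ?M n0 \<le> L" unfolding L_def using pn0 by (intro mult_right_mono) auto
      ultimately show ?thesis by simp
    next
      case False
      then have "?M n0 \<le> ?M k" by (intro mono) simp
      also have "1 * ?M k \<le> ?p ^ (k * ?d) * ?M k" using p1 by (intro mult_right_mono one_le_power) auto
      finally show ?thesis by simp
    qed
    show "?p ^ (k * ?d) * ?M k \<le> ?p ^ (n0 * ?d)" for k
    proof (cases "k \<ge> n0")
      case True
      then have "?p ^ (k * ?d) * ?M k = L" using L[of "k - n0"] by simp
      also have "L \<le> ?p ^ (n0 * ?d) * 1" unfolding L_def using le1 by (intro mult_left_mono) auto
      finally show ?thesis by simp
    next
      case False
      then have "?p ^ (k * ?d) \<le> ?p ^ (n0 * ?d)" using p1 by (intro power_increasing) auto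
      moreover have "?p ^ (k * ?d) * ?M k \<le> ?p ^ (k * ?d) * 1" using le1 by (intro mult_left_mono) auto
      ultimately show ?thesis by linarith
    qed
  qed (use pos in auto)
qed

text \<open>By \<open>group_norm_bounds\<close> the subgroup of level j lies between balls of level
  j + s and j - s. The shift costs the factor l^(s d) in either direction.\<close>

lemma measure_K_bounds:
  obtains c C where "c > 0" "C > 0"
    "\<And>j. c \<le> real CARD('l) ^ (j * CARD('d)) * measure \<mu> (K j)"
    "\<And>j. real CARD('l) ^ (j * CARD('d)) * measure \<mu> (K j) \<le> C"
proof -
  let ?p = "real CARD('l)" and ?d = "CARD('d)"
  have p1: "?p \<ge> 1" using CARD_gt_1[where 'l='l] by simp
  obtain c C where cC: "c > 0" "C > 0" "\<And>k. c \<le> ?p ^ (k * ?d) * measure \<mu> (norm_ball k)"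
    "\<And>k. ?p ^ (k * ?d) * measure \<mu> (norm_ball k) \<le> C"
    by (rule measure_norm_ball_bounds, rule that)
  obtain a b where ab: "a > 0" "b > 0" "\<And>h. h \<in> G \<Longrightarrow> mat_norm (h - mat 1) \<le> a * group_norm X h"
    "\<And>h. h \<in> G \<Longrightarrow> group_norm X h \<le> b * mat_norm (h - mat 1)"
    by (rule group_norm_bounds, rule that)
  obtain s where s: "max a b < ?p ^ s" using real_arch_pow[OF CARD_gt_1[where 'l='l]] by blast
  have up: "K (j + s) \<subseteq> norm_ball j" for j
  proof
    fix h assume h: "h \<in> K (j + s)"
    then have hG: "h \<in> G" and hj: "mat_norm (h - mat 1) \<le> 1 / ?p ^ (j + s)" by (auto simp: congruence_subgroup_def)
    have "group_norm X h \<le> b * mat_norm (h - mat 1)" by (rule ab(4)[OF hG])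
    also have "\<dots> \<le> b * (1 / ?p ^ (j + s))" using ab(2) hj by (intro mult_left_mono) auto
    also have "\<dots> \<le> 1 / ?p ^ j" using s by (simp add: field_simps power_add)
    finally show "h \<in> norm_ball j" using hG by (simp add: norm_ball_def)
  qed
  have lo: "norm_ball (j + s) \<subseteq> K j" for j
  proof
    fix h assume h: "h \<in> norm_ball (j + s)"
    then have hG: "h \<in> G" and hj: "group_norm X h \<le> 1 / ?p ^ (j + s)" by (auto simp: norm_ball_def)
    have "mat_norm (h - mat 1) \<le> a * group_norm X h" by (rule ab(3)[OF hG])
    also have "\<dots> \<le> a * (1 / ?p ^ (j + s))" using ab(1) hj by (intro mult_left_mono) auto
    also have "\<dots> \<le> 1 / ?p ^ j" using s by (simp add: field_simps power_add)
    finally show "h \<in> K j" using hG by (simp add: congruence_subgroup_def)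
  qed
  have mu1: "measure \<mu> (K j) \<le> 1" for j
    using finite_measure_mono[OF K_subset_G, of j] sets.top[of \<mu>] by (simp add: space_mu measure_G)
  have ps: "?p ^ (s * ?d) \<ge> 1" using p1 by (rule one_le_power)
  show ?thesis
  proof (rule that[of "c / ?p ^ (s * ?d)" "?p ^ (s * ?d) * max C 1"])
    show "c / ?p ^ (s * ?d) \<le> ?p ^ (j * ?d) * measure \<mu> (K j)" for j
    proof -
      have "c \<le> ?p ^ ((j + s) * ?d) * measure \<mu> (norm_ball (j + s))" by (rule cC(3))
      also have "\<dots> \<le> ?p ^ ((j + s) * ?d) * measure \<mu> (K j)"
        by (intro mult_left_mono finite_measure_mono lo K_sets) simp
      finally show ?thesis by (simp add: field_simps power_add)
    qed
    show "?p ^ (j * ?d) * measure \<mu> (K j) \<le> ?p ^ (s * ?d) * max C 1" for j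
    proof (cases "j \<ge> s")
      case True
      then obtain i where i: "j = i + s" using le_Suc_ex[of s j] by (metis add.commute)
      have "?p ^ (j * ?d) * measure \<mu> (K j) \<le> ?p ^ (j * ?d) * measure \<mu> (norm_ball i)"
        unfolding i by (intro mult_left_mono finite_measure_mono up norm_ball_sets) simp
      also have "\<dots> = ?p ^ (s * ?d) * (?p ^ (i * ?d) * measure \<mu> (norm_ball i))"
        unfolding i by (simp add: power_add algebra_simps)
      also have "\<dots> \<le> ?p ^ (s * ?d) * max C 1"
        using cC(4) by (intro mult_left_mono) (auto simp: le_max_iff_disj)
      finally show ?thesis .
    next
      \<comment> \<open>There is no ball of level j - s when j < s; the measure is bounded by 1
        instead, which explains \<open>max C 1\<close>.\<close>
      case False
      then have "?p ^ (j * ?d) \<le> ?p ^ (s * ?d)" using p1 by (intro power_increasing) auto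
      then have "?p ^ (j * ?d) * measure \<mu> (K j) \<le> ?p ^ (s * ?d) * 1"
        using mu1 by (intro mult_mono) auto
      also have "\<dots> \<le> ?p ^ (s * ?d) * max C 1" by (intro mult_left_mono) auto
      finally show ?thesis .
    qed
  qed (use cC ps in auto)
qed

end

section \<open>The eigenvalue as an integral over shells\<close>

lemma sum_power_le:
  fixes p :: real
  assumes "p \<ge> 2"
  shows "(\<Sum>i<j. p ^ i) \<le> p ^ j"
proof (induction j)
  case (Suc j)
  have "(\<Sum>i<Suc j. p ^ i) \<le> p ^ j + p ^ j" using Suc by simp
  also have "\<dots> = 2 * p ^ j" by simp
  also have "\<dots> \<le> p * p ^ j" using assms by (intro mult_right_mono) auto
  finally show ?case by simp
qed simp

context padic_Lie_haar_group
begin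

text \<open>The kernel of D^1, cut off on \<open>K j\<close>. A representation trivial on
  \<open>K j\<close> does not notice the cut, and the truncated kernel is bounded, so the two parts
  of the difference can be integrated separately.\<close>

definition weight :: "nat \<Rightarrow> 'l padic ^'m ^'m \<Rightarrow> real" where
  "weight j y = (if y \<in> K j then 0 else 1 / group_norm X y ^ (1 + CARD('d)))"

lemma weight_nonneg: "y \<in> G \<Longrightarrow> weight j y \<ge> 0"
  using group_norm_nonneg by (simp add: weight_def)

lemma measurable_weight: "weight j \<in> borel_measurable \<mu>"
proof -
  have "(\<lambda>y. if y \<in> K j then 0 else 1 / group_norm X y ^ (1 + CARD('d))) \<in> borel_measurable \<mu>"
    using measurable_group_norm K_sets[of j] by measurable
  then show ?thesis unfolding weight_def .
qed

lemma weight_conj: "z \<in> G \<Longrightarrow> y \<in> G \<Longrightarrow> weight j (z ** y ** matrix_inv z) = weight j y"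
  by (simp add: weight_def K_conj_iff group_norm_conj)

lemma weight_inv: "y \<in> G \<Longrightarrow> weight j (matrix_inv y) = weight j y"
  using K_inv[of y j] K_inv[of "matrix_inv y" j] by (auto simp: weight_def group_norm_inv matrix_inv_inv)

text \<open>Outside \<open>K (Suc i)\<close> the distance from 1 exceeds l^-(i+1), so the group norm
  exceeds l^-(i+1) / a with a from \<open>group_norm_bounds\<close>. The bound does not depend on
  the level j of the cut.\<close>

lemma weight_upper:
  obtains A where "A > 0" "\<And>i j y. y \<in> G \<Longrightarrow> y \<notin> K (Suc i) \<Longrightarrow> weight j y \<le> A * (real CARD('l) ^ i) ^ (1 + CARD('d))"
proof -
  let ?p = "real CARD('l)" and ?e = "1 + CARD('d)"
  obtain a b where ab: "a > 0" "b > 0" "\<And>h. h \<in> G \<Longrightarrow> mat_norm (h - mat 1) \<le> a * group_norm X h"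
    "\<And>h. h \<in> G \<Longrightarrow> group_norm X h \<le> b * mat_norm (h - mat 1)"
    by (rule group_norm_bounds, rule that)
  have "weight j y \<le> (a * ?p) ^ ?e * (?p ^ i) ^ ?e" if y: "y \<in> G" "y \<notin> K (Suc i)" for i j y
  proof -
    have "1 / ?p ^ Suc i < mat_norm (y - mat 1)" using y by (auto simp: congruence_subgroup_def)
    also have "\<dots> \<le> a * group_norm X y" by (rule ab(3)[OF y(1)])
    finally have lt: "1 < a * ?p * ?p ^ i * group_norm X y" by (simp add: field_simps)
    have g0: "group_norm X y > 0"
    proof (rule ccontr)
      assume "\<not> group_norm X y > 0"
      then have "group_norm X y = 0" using group_norm_nonneg[OF y(1)] by linarith
      then show False using lt by simp
    qed
    have "1 ^ ?e \<le> (a * ?p * ?p ^ i * group_norm X y) ^ ?e" using lt by (intro power_mono) auto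
    then have "1 \<le> (a * ?p) ^ ?e * (?p ^ i) ^ ?e * group_norm X y ^ ?e" by (simp only: power_one power_mult_distrib)
    then have "1 / group_norm X y ^ ?e \<le> (a * ?p) ^ ?e * (?p ^ i) ^ ?e"
      using g0 by (simp only: divide_le_eq zero_less_power if_True)
    moreover have "0 \<le> (a * ?p) ^ ?e * (?p ^ i) ^ ?e" using ab(1) by simp
    ultimately show ?thesis unfolding weight_def by (cases "y \<in> K j") simp_all
  qed
  moreover have "(a * ?p) ^ ?e > 0" using ab(1) by simp
  ultimately show ?thesis using that[of "(a * ?p) ^ ?e"] by blast
qed

lemma weight_lower:
  obtains B where "B > 0" "\<And>i j y. y \<in> K i \<Longrightarrow> y \<notin> K j \<Longrightarrow> B * (real CARD('l) ^ i) ^ (1 + CARD('d)) \<le> weight j y"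
proof -
  let ?p = "real CARD('l)" and ?e = "1 + CARD('d)"
  obtain a b where ab: "a > 0" "b > 0" "\<And>h. h \<in> G \<Longrightarrow> mat_norm (h - mat 1) \<le> a * group_norm X h"
    "\<And>h. h \<in> G \<Longrightarrow> group_norm X h \<le> b * mat_norm (h - mat 1)"
    by (rule group_norm_bounds, rule that)
  have "(1 / b) ^ ?e * (?p ^ i) ^ ?e \<le> weight j y" if y: "y \<in> K i" "y \<notin> K j" for i j y
  proof -
    have yG: "y \<in> G" and yi: "mat_norm (y - mat 1) \<le> 1 / ?p ^ i" using y(1) by (auto simp: congruence_subgroup_def)
    have "y \<noteq> mat 1" using y(2) K_one by blast
    then have g0: "group_norm X y > 0" using group_norm_nonneg[OF yG] group_norm_eq_0_iff[OF yG] by linarith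
    have "group_norm X y \<le> b * mat_norm (y - mat 1)" by (rule ab(4)[OF yG])
    also have "\<dots> \<le> b * (1 / ?p ^ i)" using ab(2) yi by (intro mult_left_mono) auto
    finally have "(1 / b) * ?p ^ i * group_norm X y \<le> 1" using ab(2) by (simp add: field_simps)
    then have "((1 / b) * ?p ^ i * group_norm X y) ^ ?e \<le> 1 ^ ?e" using ab(2) g0 by (intro power_mono) auto
    then have "(1 / b) ^ ?e * (?p ^ i) ^ ?e * group_norm X y ^ ?e \<le> 1" by (simp only: power_one power_mult_distrib)
    then have "(1 / b) ^ ?e * (?p ^ i) ^ ?e \<le> 1 / group_norm X y ^ ?e"
      using g0 by (simp only: le_divide_eq zero_less_power if_True)
    then show ?thesis using y(2) by (simp add: weight_def)
  qed
  moreover have "(1 / b) ^ ?e > 0" using ab(2) by simp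
  ultimately show ?thesis using that[of "(1 / b) ^ ?e"] by blast
qed

lemma weight_bounded: obtains B where "\<And>y. y \<in> G \<Longrightarrow> weight j y \<le> B"
proof -
  obtain A where A: "A > 0" "\<And>i j y. y \<in> G \<Longrightarrow> y \<notin> K (Suc i) \<Longrightarrow> weight j y \<le> A * (real CARD('l) ^ i) ^ (1 + CARD('d))"
    by (rule weight_upper, rule that)
  have "weight j y \<le> A * (real CARD('l) ^ j) ^ (1 + CARD('d))" if y: "y \<in> G" for y
  proof (cases "y \<in> K j")
    case True
    then show ?thesis using A(1) by (simp add: weight_def)
  next
    case False
    then have "y \<notin> K (Suc j)" using K_antimono[of j "Suc j"] by auto
    then show ?thesis by (rule A(2)[OF y])
  qed
  then show ?thesis by (rule that)
qed

definition eigen_const :: real where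
  "eigen_const = (1 - 1 / real CARD('l) ^ CARD('d)) / (1 - 1 / real CARD('l) ^ (1 + CARD('d)))"

text \<open>The factor in front of the integral in \<open>D1_op\<close>. It is negative, so the
  differences u(x y^-1) - u(x) contribute with the sign that makes the eigenvalue grow.\<close>

definition D1_const :: real where
  "D1_const = (1 - real CARD('l)) / (1 - 1 / real CARD('l) ^ (1 + CARD('d)))"

lemma eigen_const_bounds: "0 \<le> eigen_const" "eigen_const \<le> 1" and D1_const_neg: "D1_const < 0"
proof -
  let ?p = "real CARD('l)"
  have p1: "?p > 1" by (rule CARD_gt_1)
  have a: "1 / ?p ^ (1 + CARD('d)) \<le> 1 / ?p ^ CARD('d)" using p1 by (intro divide_left_mono power_increasing) auto
  have b: "1 / ?p ^ CARD('d) \<le> 1" using p1 by (simp add: one_le_power)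
  have "?p ^ (1 + CARD('d)) > 1" using p1 by (intro one_less_power) auto
  then have c: "1 / ?p ^ (1 + CARD('d)) < 1" by simp
  show "0 \<le> eigen_const" unfolding eigen_const_def using b c by (intro divide_nonneg_pos) auto
  show "eigen_const \<le> 1" unfolding eigen_const_def using a c by (subst divide_le_eq_1_pos) auto
  show "D1_const < 0" unfolding D1_const_def using c p1 by (intro divide_neg_pos) auto
qed

text \<open>D^1 multiplies the representation from the right by the integral of the kernel against
  \<xi>(y^-1) - 1. The norm is a class function, so this matrix is scalar, and invariance under
  inversion makes the scalar real. A unique real e therefore satisfies the defining condition, and
  the definite description is meaningful.\<close>

lemma rep_eigenvalue_eq:
  assumes irr: "\<xi> \<in> irreps G" and tr: "trivial_on j \<xi>"
  shows "rep_eigenvalue X G \<mu> \<xi> = eigen_const - D1_const * (\<integral>y. weight j y * (1 - Re (rep_coeff \<xi> y 0 0)) \<partial>\<mu>)"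
    "integrable \<mu> (\<lambda>y. weight j y * (1 - Re (rep_coeff \<xi> y 0 0)))"
proof -
  let ?R = "rep_coeff \<xi>" and ?d = "rep_dim \<xi>" and ?w = "\<lambda>y. complex_of_real (weight j y)"
  note ur = irreps_unitary[OF irr]
  have d0: "?d > 0" by (rule irreps_dim_pos[OF irr])
  obtain B where B: "\<And>y. y \<in> G \<Longrightarrow> weight j y \<le> B" by (rule weight_bounded[of j], rule that)
  have wB: "cmod (?w y) \<le> B" if "y \<in> G" for y
    unfolding norm_of_real using B[OF that] weight_nonneg[OF that, of j] by simp
  have wm: "?w \<in> borel_measurable \<mu>" using measurable_weight by measurable
  have cl: "?w (z ** x ** matrix_inv z) = ?w x" if "z \<in> G" "x \<in> G" for z x
    by (simp add: weight_conj that)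
  obtain \<nu> where nu: "\<And>i k. (\<integral>y. ?w y * ?R y i k \<partial>\<mu>) = \<nu> * fm_one ?d i k"
    by (rule class_function_average[OF irr wm wB cl], assumption+, rule that)
  define \<omega> where "\<omega> = (\<integral>y. weight j y \<partial>\<mu>)"
  have intw: "integrable \<mu> (weight j)"
    by (rule integrable_bounded[OF measurable_weight, where B=B]) (use wB in simp)
  have intR: "integrable \<mu> (\<lambda>y. ?w y * ?R y i k)" for i k by (rule integrable_weight_rep_coeff[OF ur wm wB])
  \<comment> \<open>The operator involves y^-1; the measure and the weight are invariant under
    inversion, so the same scalar appears.\<close>
  have inv: "(\<integral>y. ?w y * ?R (matrix_inv y) i k \<partial>\<mu>) = \<nu> * fm_one ?d i k" for i k
  proof -
    have "(\<integral>y. ?w y * ?R (matrix_inv y) i k \<partial>\<mu>) = (\<integral>y. ?w (matrix_inv y) * ?R (matrix_inv y) i k \<partial>\<mu>)"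
      by (intro Bochner_Integration.integral_cong refl) (simp add: space_mu weight_inv)
    also have "\<dots> = (\<integral>y. ?w y * ?R y i k \<partial>\<mu>)"
      by (rule integral_invariant[OF inverse_isometry, where f="\<lambda>y. ?w y * ?R y i k"]) (rule borel_measurable_integrable[OF intR])
    finally show ?thesis by (simp add: nu)
  qed
  have nu_real: "cnj \<nu> = \<nu>"
  proof -
    have "cnj \<nu> = (\<integral>y. cnj (?w y * ?R y 0 0) \<partial>\<mu>)"
      unfolding Bochner_Integration.integral_cnj nu using d0 by (simp add: fm_one_def)
    also have "\<dots> = (\<integral>y. ?w y * ?R (matrix_inv y) 0 0 \<partial>\<mu>)"
      by (intro Bochner_Integration.integral_cong refl) (simp add: space_mu rep_coeff_inv[OF ur] fm_adj_def)
    finally show ?thesis unfolding inv using d0 by (simp add: fm_one_def)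
  qed
  then have nuR: "\<nu> = complex_of_real (Re \<nu>)" by (simp add: complex_eq_iff)
  have Re_nu: "Re \<nu> = (\<integral>y. weight j y * Re (?R y 0 0) \<partial>\<mu>)"
  proof -
    have "\<nu> = (\<integral>y. ?w y * ?R y 0 0 \<partial>\<mu>)" using nu[of 0 0] d0 by (simp add: fm_one_def)
    then have "Re \<nu> = (\<integral>y. Re (?w y * ?R y 0 0) \<partial>\<mu>)" using integral_Re[OF intR[of 0 0]] by simp
    then show ?thesis by simp
  qed
  have intRe: "integrable \<mu> (\<lambda>y. weight j y * Re (?R y 0 0))" using integrable_Re[OF intR[of 0 0]] by simp
  show int: "integrable \<mu> (\<lambda>y. weight j y * (1 - Re (?R y 0 0)))"
    using Bochner_Integration.integrable_diff[OF intw intRe] by (simp add: algebra_simps)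
  have E: "(\<integral>y. weight j y * (1 - Re (?R y 0 0)) \<partial>\<mu>) = \<omega> - Re \<nu>"
    unfolding Re_nu \<omega>_def Bochner_Integration.integral_diff[OF intw intRe, symmetric]
    by (intro Bochner_Integration.integral_cong refl) (simp add: algebra_simps)
  have entry: "\<xi> y $$ (i, k) = ?R y i k" if "i < ?d" "k < ?d" for y i k using that by (simp add: rep_coeff_def)
  have D1: "D1_op X \<mu> (\<lambda>y. \<xi> y $$ (i, k)) x = complex_of_real (D1_const * (Re \<nu> - \<omega>)) * ?R x i k"
    if ik: "i < ?d" "k < ?d" and x: "x \<in> G" for i k x
  proof -
    have "(\<integral>y. (\<xi> (x ** matrix_inv y) $$ (i, k) - \<xi> x $$ (i, k)) / complex_of_real (group_norm X y ^ (1 + CARD('d))) \<partial>\<mu>)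
        = (\<integral>y. (\<Sum>s<?d. ?R x i s * (?w y * ?R (matrix_inv y) s k)) - ?R x i k * ?w y \<partial>\<mu>)"
    proof (intro Bochner_Integration.integral_cong refl)
      fix y assume "y \<in> space \<mu>"
      then have y: "y \<in> G" by (simp add: space_mu)
      have S: "(\<Sum>s<?d. ?R x i s * (?w y * ?R (matrix_inv y) s k)) = ?w y * ?R (x ** matrix_inv y) i k"
        unfolding rep_coeff_mult[OF ur x G_inv(1)[OF y]] fm_mult_def sum_distrib_left by (simp only: mult_ac)
      show "(\<xi> (x ** matrix_inv y) $$ (i, k) - \<xi> x $$ (i, k)) / complex_of_real (group_norm X y ^ (1 + CARD('d)))
          = (\<Sum>s<?d. ?R x i s * (?w y * ?R (matrix_inv y) s k)) - ?R x i k * ?w y"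
      proof (cases "y \<in> K j")
        \<comment> \<open>On \<open>K j\<close> the numerator vanishes, so the integrand is 0
          whatever the denominator; this includes y = 1, where the norm is 0.\<close>
        case True
        then have "?R (x ** matrix_inv y) = ?R x" by (intro trivial_on_invariant[OF ur tr x] K_inv)
        then show ?thesis unfolding S entry[OF ik] using True by (simp add: weight_def)
      next
        case False
        then have wF: "?w y = 1 / complex_of_real (group_norm X y ^ (1 + CARD('d)))" using False by (simp add: weight_def)
        show ?thesis unfolding S unfolding entry[OF ik] unfolding wF by (simp add: diff_divide_distrib)
      qed
    qed
    also have "\<dots> = (\<Sum>s<?d. ?R x i s * (\<nu> * fm_one ?d s k)) - ?R x i k * complex_of_real \<omega>"
    proof -
      have i1: "integrable \<mu> (\<lambda>y. ?w y * ?R (matrix_inv y) s k)" for s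
      proof -
        have "integrable \<mu> (\<lambda>y. ?w (matrix_inv y) * ?R (matrix_inv y) s k)"
          using integrable_invariant[OF inverse_isometry intR[of s k]] .
        then show ?thesis
          by (rule Bochner_Integration.integrable_cong[OF refl, THEN iffD1, rotated]) (simp add: space_mu weight_inv)
      qed
      have i2: "integrable \<mu> ?w" using intw by simp
      have "(\<integral>y. (\<Sum>s<?d. ?R x i s * (?w y * ?R (matrix_inv y) s k)) - ?R x i k * ?w y \<partial>\<mu>)
          = (\<integral>y. (\<Sum>s<?d. ?R x i s * (?w y * ?R (matrix_inv y) s k)) \<partial>\<mu>) - (\<integral>y. ?R x i k * ?w y \<partial>\<mu>)"
        by (rule Bochner_Integration.integral_diff) (intro Bochner_Integration.integrable_sum integrable_mult_right i1 i2)+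
      also have "(\<integral>y. (\<Sum>s<?d. ?R x i s * (?w y * ?R (matrix_inv y) s k)) \<partial>\<mu>) = (\<Sum>s<?d. (\<integral>y. ?R x i s * (?w y * ?R (matrix_inv y) s k) \<partial>\<mu>))"
        by (rule Bochner_Integration.integral_sum) (intro integrable_mult_right i1)
      finally show ?thesis by (simp add: inv \<omega>_def)
    qed
    also have "(\<Sum>s<?d. ?R x i s * (\<nu> * fm_one ?d s k)) = \<nu> * fm_mult ?d (?R x) (fm_one ?d) i k"
      by (simp add: fm_mult_def sum_distrib_left mult_ac)
    also have "fm_mult ?d (?R x) (fm_one ?d) = ?R x" by (rule fm_mult_one[OF fm_supp_rep_coeff])
    finally have I: "(\<integral>y. (\<xi> (x ** matrix_inv y) $$ (i, k) - \<xi> x $$ (i, k)) / complex_of_real (group_norm X y ^ (1 + CARD('d))) \<partial>\<mu>)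
        = \<nu> * ?R x i k - ?R x i k * complex_of_real \<omega>" .
    show ?thesis
      unfolding D1_op_def I D1_const_def[symmetric] by (subst nuR) (simp add: algebra_simps)
  qed
  let ?e = "eigen_const - D1_const * (\<omega> - Re \<nu>)"
  have "rep_eigenvalue X G \<mu> \<xi> = ?e"
    unfolding rep_eigenvalue_def eigen_const_def[symmetric]
  proof (rule the_equality, intro allI impI ballI)
    fix i k x assume ik: "i < ?d" "k < ?d" and x: "x \<in> G"
    show "complex_of_real eigen_const * \<xi> x $$ (i, k) + D1_op X \<mu> (\<lambda>y. \<xi> y $$ (i, k)) x = complex_of_real ?e * \<xi> x $$ (i, k)"
      unfolding D1[OF ik x] unfolding entry[OF ik] by (simp add: algebra_simps)
  next
    \<comment> \<open>Uniqueness is read off from the diagonal entry 0, 0 at the identity, where the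
      representation has the value 1.\<close>
    fix e assume "\<forall>i<?d. \<forall>k<?d. \<forall>x\<in>G. complex_of_real eigen_const * \<xi> x $$ (i, k) + D1_op X \<mu> (\<lambda>y. \<xi> y $$ (i, k)) x = complex_of_real e * \<xi> x $$ (i, k)"
    then have "complex_of_real eigen_const * \<xi> (mat 1) $$ (0, 0) + D1_op X \<mu> (\<lambda>y. \<xi> y $$ (0, 0)) (mat 1) = complex_of_real e * \<xi> (mat 1) $$ (0, 0)"
      using d0 G_one by blast
    then have "complex_of_real eigen_const + complex_of_real (D1_const * (Re \<nu> - \<omega>)) = complex_of_real e"
      unfolding D1[OF d0 d0 G_one] unfolding entry[OF d0 d0] unfolding rep_coeff_one[OF ur] using d0 by (simp add: fm_one_def)
    then have "eigen_const + D1_const * (Re \<nu> - \<omega>) = e" by (simp only: of_real_add[symmetric] of_real_eq_iff)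
    then show "e = ?e" by (simp add: algebra_simps)
  qed
  then show "rep_eigenvalue X G \<mu> \<xi> = eigen_const - D1_const * (\<integral>y. weight j y * (1 - Re (?R y 0 0)) \<partial>\<mu>)"
    by (simp only: E)
qed

lemma Re_rep_coeff_bounds:
  assumes "unitary_rep G \<xi>" "y \<in> G"
  shows "0 \<le> 1 - Re (rep_coeff \<xi> y i k)" "1 - Re (rep_coeff \<xi> y i k) \<le> 2"
  using rep_coeff_le_1[OF assms, of i k] abs_Re_le_cmod[of "rep_coeff \<xi> y i k"] by linarith+

text \<open>On the shell of level i < j the weight is of order l^(i (1 + d)) and the measure at most
  of order l^(-i d), so the shell contributes about l^i. The geometric sum over i < j is at most
  l^j, and \<open>eigen_const\<close> \<le> 1 accounts for the summand 1 in the constant.\<close>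

lemma rep_eigenvalue_upper:
  obtains \<beta> where "\<beta> > 0" "\<And>\<xi> j. \<xi> \<in> irreps G \<Longrightarrow> trivial_on j \<xi> \<Longrightarrow> rep_eigenvalue X G \<mu> \<xi> \<le> \<beta> * real CARD('l) ^ j"
proof -
  let ?p = "real CARD('l)" and ?e = "1 + CARD('d)"
  have p1: "?p > 1" by (rule CARD_gt_1)
  have p2: "?p \<ge> 2" using prime_ge_2_nat[OF prime_card[where 'a='l]] by simp
  obtain A where A: "A > 0" "\<And>i j y. y \<in> G \<Longrightarrow> y \<notin> K (Suc i) \<Longrightarrow> weight j y \<le> A * (?p ^ i) ^ ?e"
    by (rule weight_upper, rule that)
  obtain c C where C: "c > 0" "C > 0" "\<And>j. c \<le> ?p ^ (j * CARD('d)) * measure \<mu> (K j)"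
    "\<And>j. ?p ^ (j * CARD('d)) * measure \<mu> (K j) \<le> C"
    by (rule measure_K_bounds, rule that)
  have "rep_eigenvalue X G \<mu> \<xi> \<le> (1 + (- D1_const) * (2 * A * C)) * ?p ^ j" if irr: "\<xi> \<in> irreps G" and tr: "trivial_on j \<xi>" for \<xi> j
  proof -
    note ur = irreps_unitary[OF irr]
    let ?S = "\<lambda>y. \<Sum>i<j. 2 * A * (?p ^ i) ^ ?e * indicator (K i) y"
    have intS: "integrable \<mu> ?S"
      by (intro Bochner_Integration.integrable_sum integrable_mult_right integrable_bounded[where B=1]) (auto simp: indicator_def)
    have "(\<integral>y. weight j y * (1 - Re (rep_coeff \<xi> y 0 0)) \<partial>\<mu>) \<le> (\<integral>y. ?S y \<partial>\<mu>)"
    proof (rule integral_mono[OF rep_eigenvalue_eq(2)[OF irr tr] intS])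
      fix y assume "y \<in> space \<mu>"
      then have y: "y \<in> G" by (simp add: space_mu)
      have nn: "0 \<le> 2 * A * (?p ^ i) ^ ?e * indicator (K i) y" for i using A(1) by simp
      show "weight j y * (1 - Re (rep_coeff \<xi> y 0 0)) \<le> ?S y"
      proof (cases "y \<in> K j")
        case True
        have "0 \<le> ?S y" by (intro sum_nonneg nn)
        then show ?thesis using True by (simp only: weight_def if_True mult_zero_left)
      next
        case False
        then have "y \<noteq> mat 1" using K_one by blast
        then obtain i where i: "y \<in> K i" "y \<notin> K (Suc i)" using ex_not_K[OF y] by blast
        have ij: "i < j"
        proof (rule ccontr)
          assume "\<not> i < j"
          then show False using K_antimono[of j i] i(1) False by auto
        qed
        have "weight j y * (1 - Re (rep_coeff \<xi> y 0 0)) \<le> (A * (?p ^ i) ^ ?e) * 2"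
          using A(1) by (intro mult_mono A(2)[OF y i(2)] Re_rep_coeff_bounds[OF ur y]) auto
        also have "\<dots> = 2 * A * (?p ^ i) ^ ?e * indicator (K i) y" using i(1) by simp
        also have "\<dots> \<le> ?S y" using ij nn by (intro member_le_sum[where f="\<lambda>i. 2 * A * (?p ^ i) ^ ?e * indicator (K i) y"]) auto
        finally show ?thesis .
      qed
    qed
    also have "(\<integral>y. ?S y \<partial>\<mu>) = (\<Sum>i<j. 2 * A * (?p ^ i) ^ ?e * measure \<mu> (K i))"
    proof -
      have ii: "integrable \<mu> (indicator (K i) :: _ \<Rightarrow> real)" for i by (rule integrable_bounded[where B=1]) (auto simp: indicator_def)
      have im: "(\<integral>y. indicator (K i) y \<partial>\<mu>) = measure \<mu> (K i)" for i using K_subset_G[of i] by (simp add: space_mu Int_absorb2)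
      have "(\<integral>y. ?S y \<partial>\<mu>) = (\<Sum>i<j. (\<integral>y. 2 * A * (?p ^ i) ^ ?e * indicator (K i) y \<partial>\<mu>))"
        by (rule Bochner_Integration.integral_sum) (intro integrable_mult_right ii)
      then show ?thesis by (simp add: im)
    qed
    also have "\<dots> \<le> (\<Sum>i<j. 2 * A * C * ?p ^ i)"
    proof (rule sum_mono)
      fix i
      have "2 * A * (?p ^ i) ^ ?e * measure \<mu> (K i) = 2 * A * ?p ^ i * (?p ^ (i * CARD('d)) * measure \<mu> (K i))"
        by (simp add: power_mult power_add)
      also have "\<dots> \<le> 2 * A * ?p ^ i * C" using A(1) C(4)[of i] by (intro mult_left_mono) auto
      finally show "2 * A * (?p ^ i) ^ ?e * measure \<mu> (K i) \<le> 2 * A * C * ?p ^ i" by (simp add: mult_ac)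
    qed
    also have "\<dots> = 2 * A * C * (\<Sum>i<j. ?p ^ i)" by (simp add: sum_distrib_left)
    also have "\<dots> \<le> 2 * A * C * ?p ^ j" using A(1) C(2) by (intro mult_left_mono sum_power_le p2) auto
    finally have le: "(\<integral>y. weight j y * (1 - Re (rep_coeff \<xi> y 0 0)) \<partial>\<mu>) \<le> 2 * A * C * ?p ^ j" .
    have "(- D1_const) * (\<integral>y. weight j y * (1 - Re (rep_coeff \<xi> y 0 0)) \<partial>\<mu>) \<le> (- D1_const) * (2 * A * C * ?p ^ j)"
      using le D1_const_neg by (intro mult_left_mono) auto
    moreover have "eigen_const \<le> ?p ^ j" using eigen_const_bounds(2) one_le_power[of ?p j] p1 by linarith
    ultimately have "rep_eigenvalue X G \<mu> \<xi> \<le> ?p ^ j + (- D1_const) * (2 * A * C * ?p ^ j)"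
      unfolding rep_eigenvalue_eq(1)[OF irr tr] by linarith
    then show ?thesis by (simp add: algebra_simps)
  qed
  moreover have "1 + (- D1_const) * (2 * A * C) > 0"
    using D1_const_neg A(1) C(2) by (intro add_pos_nonneg mult_nonneg_nonneg) auto
  ultimately show ?thesis using that by blast
qed

text \<open>Only the contribution of \<open>K i\<close> is kept. There the kernel is at least of
  order l^(i (1 + d)), and 1 - Re \<xi> has the integral of the constant 1, since the entry of a
  representation nontrivial on \<open>K i\<close> has mean zero. The product with the measure is of
  order l^i.\<close>

lemma rep_eigenvalue_lower:
  obtains \<alpha> where "\<alpha> > 0" "\<And>\<xi> j. \<xi> \<in> irreps G \<Longrightarrow> \<not> trivial_on j \<xi> \<Longrightarrow> \<alpha> * real CARD('l) ^ j \<le> rep_eigenvalue X G \<mu> \<xi>"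
proof -
  let ?p = "real CARD('l)" and ?e = "1 + CARD('d)"
  obtain B where B: "B > 0" "\<And>i j y. y \<in> K i \<Longrightarrow> y \<notin> K j \<Longrightarrow> B * (?p ^ i) ^ ?e \<le> weight j y"
    by (rule weight_lower, rule that)
  obtain c C where C: "c > 0" "C > 0" "\<And>j. c \<le> ?p ^ (j * CARD('d)) * measure \<mu> (K j)"
    "\<And>j. ?p ^ (j * CARD('d)) * measure \<mu> (K j) \<le> C"
    by (rule measure_K_bounds, rule that)
  have "(- D1_const) * (B * c) * ?p ^ i \<le> rep_eigenvalue X G \<mu> \<xi>" if irr: "\<xi> \<in> irreps G" and nt: "\<not> trivial_on i \<xi>" for \<xi> i
  proof -
    note ur = irreps_unitary[OF irr]
    obtain j where tr: "trivial_on j \<xi>" by (rule ex_trivial_on[OF irr], rule that)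
    let ?f = "\<lambda>y. indicator (K i) y * Re (rep_coeff \<xi> y 0 0)"
    have iR: "integrable \<mu> (\<lambda>y. indicator (K i) y * rep_coeff \<xi> y 0 0)"
      by (rule integrable_weight_rep_coeff[OF ur, where B=1]) (auto simp: indicator_def)
    have ReI: "Re (indicator (K i) y * rep_coeff \<xi> y 0 0) = ?f y" for y by (simp add: indicator_def)
    have if': "integrable \<mu> ?f" using integrable_Re[OF iR] by (simp only: ReI)
    have f0: "(\<integral>y. ?f y \<partial>\<mu>) = 0" using integral_Re[OF iR] integral_K_nontrivial[OF irr nt, of 0 0] by (simp only: ReI) simp
    have ii: "integrable \<mu> (indicator (K i) :: _ \<Rightarrow> real)" by (rule integrable_bounded[where B=1]) (auto simp: indicator_def)
    have im: "(\<integral>y. indicator (K i) y \<partial>\<mu>) = measure \<mu> (K i)" using K_subset_G[of i] by (simp add: space_mu Int_absorb2)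
    let ?h = "\<lambda>y. B * (?p ^ i) ^ ?e * (indicator (K i) y - ?f y)"
    have "B * c * ?p ^ i \<le> B * ?p ^ i * (?p ^ (i * CARD('d)) * measure \<mu> (K i))"
      using mult_left_mono[OF C(3)[of i], of "B * ?p ^ i"] B(1) by (simp add: mult_ac)
    also have "\<dots> = B * (?p ^ i) ^ ?e * measure \<mu> (K i)" by (simp add: power_mult power_add)
    also have "\<dots> = (\<integral>y. ?h y \<partial>\<mu>)"
      using Bochner_Integration.integral_diff[OF ii if'] by (simp add: im f0)
    also have "\<dots> \<le> (\<integral>y. weight j y * (1 - Re (rep_coeff \<xi> y 0 0)) \<partial>\<mu>)"
    proof (rule integral_mono[OF _ rep_eigenvalue_eq(2)[OF irr tr]])
      show "integrable \<mu> ?h" by (intro integrable_mult_right Bochner_Integration.integrable_diff ii if')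
      fix y assume "y \<in> space \<mu>"
      then have y: "y \<in> G" by (simp add: space_mu)
      note bd = Re_rep_coeff_bounds(1)[OF ur y, of 0 0]
      show "?h y \<le> weight j y * (1 - Re (rep_coeff \<xi> y 0 0))"
      proof (cases "y \<in> K i")
        case False
        then show ?thesis using bd weight_nonneg[OF y, of j] by simp
      next
        case yi: True
        show ?thesis
        proof (cases "y \<in> K j")
          \<comment> \<open>The cut removes the weight here, but nothing is lost: \<xi> is trivial
            on \<open>K j\<close>, so the lower bound vanishes as well.\<close>
          case True
          then have "rep_coeff \<xi> y 0 0 = 1" using tr irreps_dim_pos[OF irr] by (simp add: trivial_on_def fm_one_def)
          then show ?thesis using yi by simp
        next
          case False
          then show ?thesis using mult_right_mono[OF B(2)[OF yi False] bd] yi by simp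
        qed
      qed
    qed
    finally have "(- D1_const) * (B * c * ?p ^ i) \<le> (- D1_const) * (\<integral>y. weight j y * (1 - Re (rep_coeff \<xi> y 0 0)) \<partial>\<mu>)"
      using D1_const_neg by (intro mult_left_mono) auto
    then have "(- D1_const) * (B * c * ?p ^ i) \<le> rep_eigenvalue X G \<mu> \<xi>"
      unfolding rep_eigenvalue_eq(1)[OF irr tr] using eigen_const_bounds(1) by linarith
    then show ?thesis by (simp only: mult.assoc)
  qed
  moreover have "(- D1_const) * (B * c) > 0" using D1_const_neg B(1) C(1) by (intro mult_pos_pos) auto
  ultimately show ?thesis using that by blast
qed

end

section \<open>Translates and Lipschitz functions\<close>

text \<open>The rows of R are orthonormal, so its transpose preserves the norm. The transpose is
  what occurs, because translating f acts on the row index of its coefficients.\<close>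

lemma unitary_transpose_norm:
  assumes "fm_mult n R (fm_adj R) = fm_one n"
  shows "(\<Sum>i<n. (cmod (\<Sum>k<n. R k i * v k))\<^sup>2) = (\<Sum>k<n. (cmod (v k))\<^sup>2)"
proof -
  have orth: "(\<Sum>i<n. R k i * cnj (R l i)) = fm_one n k l" for k l
    using fun_cong[OF fun_cong[OF assms, of k], of l] by (simp add: fm_mult_def fm_adj_def)
  have "complex_of_real (\<Sum>i<n. (cmod (\<Sum>k<n. R k i * v k))\<^sup>2)
      = (\<Sum>i<n. (\<Sum>k<n. R k i * v k) * cnj (\<Sum>l<n. R l i * v l))"
    unfolding of_real_sum by (simp add: complex_norm_square del: of_real_power)
  also have "\<dots> = (\<Sum>i<n. \<Sum>k<n. \<Sum>l<n. (v k * cnj (v l)) * (R k i * cnj (R l i)))"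
    unfolding cnj_sum sum_product by (intro sum.cong refl) (simp add: mult_ac)
  also have "\<dots> = (\<Sum>k<n. \<Sum>i<n. \<Sum>l<n. (v k * cnj (v l)) * (R k i * cnj (R l i)))"
    by (rule sum.swap)
  also have "\<dots> = (\<Sum>k<n. \<Sum>l<n. \<Sum>i<n. (v k * cnj (v l)) * (R k i * cnj (R l i)))"
    by (intro sum.cong refl sum.swap)
  also have "\<dots> = (\<Sum>k<n. \<Sum>l<n. (v k * cnj (v l)) * fm_one n k l)"
    unfolding sum_distrib_left[symmetric] orth ..
  also have "\<dots> = (\<Sum>k<n. v k * cnj (v k))"
  proof (intro sum.cong refl)
    fix k assume k: "k \<in> {..<n}"
    have "(\<Sum>l<n. (v k * cnj (v l)) * fm_one n k l) = (\<Sum>l<n. if k = l then v k * cnj (v l) else 0)"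
      using k by (intro sum.cong refl) (simp add: fm_one_def)
    then show "(\<Sum>l<n. (v k * cnj (v l)) * fm_one n k l) = v k * cnj (v k)" using k by simp
  qed
  also have "\<dots> = complex_of_real (\<Sum>k<n. (cmod (v k))\<^sup>2)"
    unfolding of_real_sum by (simp add: complex_norm_square del: of_real_power)
  finally show ?thesis by (simp only: of_real_eq_iff)
qed

context haar_padic_group begin

lemma square_integrable_translate:
  assumes "h \<in> G" "sqint f"
  shows "sqint (\<lambda>x. f (h ** x))"
  unfolding square_integrable_def
proof
  show "(\<lambda>x. f (h ** x)) \<in> borel_measurable \<mu>"
    using measurable_compose[OF left_translation_isometry(1)[OF assms(1)], of f borel] assms(2)
    by (simp add: square_integrable_def)
  show "integrable \<mu> (\<lambda>x. (cmod (f (h ** x)))\<^sup>2)"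
    using integrable_invariant[OF left_translation_isometry[OF assms(1)], of "\<lambda>x. (cmod (f x))\<^sup>2"] assms(2)
    by (simp add: square_integrable_def)
qed

definition translate_diff :: "('l padic ^'m ^'m \<Rightarrow> complex) \<Rightarrow> 'l padic ^'m ^'m \<Rightarrow> 'l padic ^'m ^'m \<Rightarrow> complex" where
  "translate_diff f h = (\<lambda>x. f (h ** x) - f x)"

lemma square_integrable_translate_diff: "h \<in> G \<Longrightarrow> sqint f \<Longrightarrow> sqint (translate_diff f h)"
  unfolding translate_diff_def by (intro square_integrable_diff square_integrable_translate)

lemma sqint_coeff:
  assumes "c \<in> unitary_dual G"
  shows "sqint (coeff_fun (c, i, j))"
proof -
  have "sqint (\<lambda>x. complex_of_real (sqrt (rep_dim (class_rep c))) * rep_coeff (class_rep c) x i j)"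
    by (intro square_integrable_scale square_integrable_rep_coeff irreps_unitary class_rep_irreps assms)
  then show ?thesis by (simp add: coeff_fun_def)
qed

text \<open>Invariance of \<open>\<mu>\<close> moves the translation from f to the matrix entry,
  where it becomes multiplication by the adjoint of \<xi>(h); conjugation in the inner product then
  leaves the entries of \<xi>(h) itself.\<close>

lemma ip_translate:
  assumes c: "c \<in> unitary_dual G" and h: "h \<in> G" and f: "sqint f"
  shows "ip (\<lambda>x. f (h ** x)) (coeff_fun (c, i, j))
    = (\<Sum>k<rep_dim (class_rep c). rep_coeff (class_rep c) h k i * ip f (coeff_fun (c, k, j)))"
proof -
  let ?\<xi> = "class_rep c"
  let ?s = "complex_of_real (sqrt (rep_dim ?\<xi>))"
  note ur = irreps_unitary[OF class_rep_irreps[OF c]]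
  note hi = G_inv(1)[OF h]
  have coeff: "coeff_fun (c, i, j) (matrix_inv h ** x) = (\<Sum>k<rep_dim ?\<xi>. cnj (rep_coeff ?\<xi> h k i) * coeff_fun (c, k, j) x)"
    if "x \<in> G" for x
    by (simp add: coeff_fun_def rep_coeff_mult[OF ur hi that] rep_coeff_inv[OF ur h] fm_mult_def fm_adj_def sum_distrib_left mult_ac)
  have "ip (\<lambda>x. f (h ** x)) (coeff_fun (c, i, j))
      = (\<integral>x. f (h ** x) * cnj (coeff_fun (c, i, j) (matrix_inv h ** (h ** x))) \<partial>\<mu>)"
    unfolding ip_def by (intro Bochner_Integration.integral_cong refl) (simp add: space_mu h inv_mult_cancel)
  also have "\<dots> = (\<integral>x. f x * cnj (coeff_fun (c, i, j) (matrix_inv h ** x)) \<partial>\<mu>)"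
    by (rule integral_invariant[OF left_translation_isometry[OF h], where f="\<lambda>x. f x * cnj (coeff_fun (c, i, j) (matrix_inv h ** x))"])
      (rule borel_measurable_integrable[OF integrable_ip[OF f square_integrable_translate[OF hi sqint_coeff[OF c]]]])
  also have "\<dots> = (\<integral>x. (\<Sum>k<rep_dim ?\<xi>. rep_coeff ?\<xi> h k i * (f x * cnj (coeff_fun (c, k, j) x))) \<partial>\<mu>)"
    by (intro Bochner_Integration.integral_cong refl) (simp add: space_mu coeff cnj_sum sum_distrib_left mult_ac)
  also have "\<dots> = (\<Sum>k<rep_dim ?\<xi>. (\<integral>x. rep_coeff ?\<xi> h k i * (f x * cnj (coeff_fun (c, k, j) x)) \<partial>\<mu>))"
    by (rule Bochner_Integration.integral_sum) (intro integrable_mult_right integrable_ip f sqint_coeff c)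
  finally show ?thesis by (simp add: ip_def)
qed

lemma ip_translate_diff:
  assumes c: "c \<in> unitary_dual G" and h: "h \<in> G" and f: "sqint f"
  shows "ip (translate_diff f h) (coeff_fun (c, i, j))
    = (\<Sum>k<rep_dim (class_rep c). rep_coeff (class_rep c) h k i * ip f (coeff_fun (c, k, j))) - ip f (coeff_fun (c, i, j))"
  unfolding translate_diff_def
  by (simp only: ip_diff_left[OF square_integrable_translate[OF h f] f sqint_coeff[OF c]] ip_translate[OF assms])

lemma fourier_term_translate:
  assumes c: "c \<in> unitary_dual G" and h: "h \<in> G"
  shows "(\<Sum>(i, j)\<in>{..<rep_dim (class_rep c)} \<times> {..<rep_dim (class_rep c)}.
    (cmod (\<Sum>k<rep_dim (class_rep c). rep_coeff (class_rep c) h k i * ip f (coeff_fun (c, k, j))))\<^sup>2) = fourier_term f c"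
proof -
  note u = rep_coeff_unitary[OF irreps_unitary[OF class_rep_irreps[OF c]] h]
  show ?thesis
    unfolding fourier_term_eq[OF c] sum.cartesian_product[symmetric]
    by (subst (1 2) sum.swap) (simp only: unitary_transpose_norm[OF u])
qed

text \<open>In the expansion of the squared difference both square terms equal the Fourier term of
  f, by unitarity. The cross term is linear in the entries of \<xi>(h), which is the form needed for
  averaging over h.\<close>

lemma fourier_term_translate_diff:
  assumes c: "c \<in> unitary_dual G" and h: "h \<in> G" and f: "sqint f"
  shows "fourier_term (translate_diff f h) c = 2 * fourier_term f c
    - 2 * Re (\<Sum>(i, j)\<in>{..<rep_dim (class_rep c)} \<times> {..<rep_dim (class_rep c)}. \<Sum>k<rep_dim (class_rep c).
        rep_coeff (class_rep c) h k i * (ip f (coeff_fun (c, k, j)) * cnj (ip f (coeff_fun (c, i, j)))))"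
proof -
  let ?d = "rep_dim (class_rep c)"
  define a where "a = (\<lambda>i j. ip f (coeff_fun (c, i, j)))"
  define w where "w = (\<lambda>i j. \<Sum>k<?d. rep_coeff (class_rep c) h k i * a k j)"
  have sq: "(cmod (z - y))\<^sup>2 = (cmod z)\<^sup>2 + (cmod y)\<^sup>2 - 2 * Re (z * cnj y)" for z y
    by (simp only: cmod_power2) (simp add: power2_eq_square algebra_simps)
  have "fourier_term (translate_diff f h) c = (\<Sum>(i, j)\<in>{..<?d} \<times> {..<?d}. (cmod (w i j - a i j))\<^sup>2)"
    unfolding fourier_term_eq[OF c] ip_translate_diff[OF assms] w_def a_def ..
  also have "\<dots> = (\<Sum>(i, j)\<in>{..<?d} \<times> {..<?d}. (cmod (w i j))\<^sup>2) + (\<Sum>(i, j)\<in>{..<?d} \<times> {..<?d}. (cmod (a i j))\<^sup>2)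
      - 2 * Re (\<Sum>(i, j)\<in>{..<?d} \<times> {..<?d}. w i j * cnj (a i j))"
    unfolding sq by (simp only: Re_sum case_prod_unfold sum.distrib sum_subtractf sum_distrib_left)
  also have "(\<Sum>(i, j)\<in>{..<?d} \<times> {..<?d}. (cmod (w i j))\<^sup>2) = fourier_term f c"
    unfolding w_def a_def by (rule fourier_term_translate[OF c h])
  also have "(\<Sum>(i, j)\<in>{..<?d} \<times> {..<?d}. (cmod (a i j))\<^sup>2) = fourier_term f c"
    unfolding fourier_term_eq[OF c] a_def ..
  finally show ?thesis unfolding w_def a_def by (simp add: sum_distrib_right mult.assoc)
qed

lemma fourier_term_translate_diff_le:
  assumes c: "c \<in> unitary_dual G" and h: "h \<in> G" and f: "sqint f"
  shows "fourier_term (translate_diff f h) c \<le> 4 * fourier_term f c"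
proof -
  let ?d = "rep_dim (class_rep c)"
  let ?w = "\<lambda>i j. \<Sum>k<?d. rep_coeff (class_rep c) h k i * ip f (coeff_fun (c, k, j))"
  have "fourier_term (translate_diff f h) c
      \<le> (\<Sum>(i, j)\<in>{..<?d} \<times> {..<?d}. 2 * (cmod (?w i j))\<^sup>2 + 2 * (cmod (ip f (coeff_fun (c, i, j))))\<^sup>2)"
    unfolding fourier_term_eq[OF c] ip_translate_diff[OF assms] case_prod_unfold
    by (intro sum_mono norm_diff_sq_le)
  also have "\<dots> = 2 * (\<Sum>(i, j)\<in>{..<?d} \<times> {..<?d}. (cmod (?w i j))\<^sup>2)
      + 2 * (\<Sum>(i, j)\<in>{..<?d} \<times> {..<?d}. (cmod (ip f (coeff_fun (c, i, j))))\<^sup>2)"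
    by (simp only: case_prod_unfold sum.distrib sum_distrib_left)
  also have "\<dots> = 4 * fourier_term f c"
    unfolding fourier_term_translate[OF c h] fourier_term_eq[OF c, symmetric] by simp
  finally show ?thesis .
qed

lemma fourier_term_translate_diff_eq_0:
  assumes c: "c \<in> dual_level n" and h: "h \<in> K n" and f: "sqint f"
  shows "fourier_term (translate_diff f h) c = 0"
proof -
  have cd: "c \<in> unitary_dual G" and R: "rep_coeff (class_rep c) h = fm_one (rep_dim (class_rep c))"
    using c h by (auto simp: dual_level_def trivial_on_def)
  have hG: "h \<in> G" using h K_subset_G by blast
  have "ip (translate_diff f h) (coeff_fun (c, i, j)) = 0" if i: "i < rep_dim (class_rep c)" for i j
  proof -
    have "(\<Sum>k<rep_dim (class_rep c). fm_one (rep_dim (class_rep c)) k i * ip f (coeff_fun (c, k, j)))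
        = (\<Sum>k<rep_dim (class_rep c). if k = i then ip f (coeff_fun (c, k, j)) else 0)"
      by (intro sum.cong refl) (auto simp: fm_one_def)
    then show ?thesis unfolding ip_translate_diff[OF cd hG f] R using i by simp
  qed
  then show ?thesis unfolding fourier_term_eq[OF cd] by (intro sum.neutral) auto
qed

section \<open>Tails of the Fourier series against translate differences\<close>

lemma summable_fourier_term:
  assumes "sqint f" "A \<subseteq> unitary_dual G"
  shows "fourier_term f summable_on A"
proof (rule nonneg_bdd_above_summable_on)
  show "0 \<le> fourier_term f c" for c by (rule fourier_term_nonneg)
  show "bdd_above (sum (fourier_term f) ` {F. F \<subseteq> A \<and> finite F})"
    by (rule bdd_aboveI2[where M="\<integral>x. (cmod (f x))\<^sup>2 \<partial>\<mu>"]) (use assms Bessel_fourier in auto)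
qed

text \<open>The averaging is done for a finite set of classes, where sum and integral may be
  exchanged and Bessel's inequality applies; the bound is uniform over these sets and passes to the
  infinite sum.\<close>

lemma tail_le_translate_diff:
  assumes f: "sqint f" and L: "\<And>h. h \<in> K n \<Longrightarrow> (\<integral>x. (cmod (translate_diff f h x))\<^sup>2 \<partial>\<mu>) \<le> L"
  shows "2 * infsum (fourier_term f) (unitary_dual G - dual_level n) \<le> L"
proof -
  have fin: "(\<Sum>c\<in>A. fourier_term f c) \<le> L / 2" if A: "finite A" "A \<subseteq> unitary_dual G - dual_level n" for A
  proof -
    \<comment> \<open>The indicator is placed inside the cross term, so that its integral over G is
      the integral over \<open>K n\<close> of a single matrix entry in each summand, which
      vanishes.\<close>
    define r where "r = (\<lambda>c h. Re (\<Sum>(i, j)\<in>{..<rep_dim (class_rep c)} \<times> {..<rep_dim (class_rep c)}. \<Sum>k<rep_dim (class_rep c).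
        (indicator (K n) h * rep_coeff (class_rep c) h k i) * (ip f (coeff_fun (c, k, j)) * cnj (ip f (coeff_fun (c, i, j))))))"
    have cA: "c \<in> unitary_dual G" "class_rep c \<in> irreps G" "\<not> trivial_on n (class_rep c)" if "c \<in> A" for c
      using A(2) that class_rep_irreps by (auto simp: dual_level_def)
    have int: "integrable \<mu> (\<lambda>h. indicator (K n) h * rep_coeff (class_rep c) h k i)" if "c \<in> A" for c k i
      by (rule integrable_weight_rep_coeff[OF irreps_unitary[OF cA(2)[OF that]], where B=1]) (auto simp: indicator_def)
    have intr: "integrable \<mu> (r c)" if "c \<in> A" for c
      unfolding r_def case_prod_unfold
      by (intro integrable_Re Bochner_Integration.integrable_sum integrable_mult_left int that)
    have r0: "(\<integral>h. r c h \<partial>\<mu>) = 0" if "c \<in> A" for c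
    proof -
      have "(\<integral>h. (\<Sum>z\<in>{..<rep_dim (class_rep c)} \<times> {..<rep_dim (class_rep c)}. \<Sum>k<rep_dim (class_rep c).
        (indicator (K n) h * rep_coeff (class_rep c) h k (fst z)) * (ip f (coeff_fun (c, k, snd z)) * cnj (ip f (coeff_fun (c, fst z, snd z))))) \<partial>\<mu>) = 0"
        by (simp add: Bochner_Integration.integral_sum Bochner_Integration.integrable_sum int[OF that] integral_K_nontrivial[OF cA(2,3)[OF that]])
      then show ?thesis
        unfolding r_def case_prod_unfold
        by (subst integral_Re) (intro Bochner_Integration.integrable_sum integrable_mult_left int that, simp)
    qed
    have ii: "integrable \<mu> (indicator (K n) :: _ \<Rightarrow> real)" by (rule integrable_bounded[where B=1]) (auto simp: indicator_def)
    have im: "(\<integral>y. indicator (K n) y \<partial>\<mu>) = measure \<mu> (K n)" using K_subset_G[of n] by (simp add: space_mu Int_absorb2)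
    let ?F = "\<lambda>h. \<Sum>c\<in>A. 2 * fourier_term f c * indicator (K n) h - 2 * r c h"
    have intF: "integrable \<mu> ?F"
      by (intro Bochner_Integration.integrable_sum Bochner_Integration.integrable_diff integrable_mult_right ii intr)
    have "(\<integral>h. ?F h \<partial>\<mu>) = (\<Sum>c\<in>A. (\<integral>h. 2 * fourier_term f c * indicator (K n) h - 2 * r c h \<partial>\<mu>))"
      by (rule Bochner_Integration.integral_sum)
        (intro Bochner_Integration.integrable_diff integrable_mult_right ii intr)
    also have "\<dots> = (\<Sum>c\<in>A. 2 * fourier_term f c * measure \<mu> (K n))"
    proof (intro sum.cong refl)
      fix c assume c: "c \<in> A"
      have "(\<integral>h. 2 * fourier_term f c * indicator (K n) h - 2 * r c h \<partial>\<mu>)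
          = (\<integral>h. 2 * fourier_term f c * indicator (K n) h \<partial>\<mu>) - (\<integral>h. 2 * r c h \<partial>\<mu>)"
        by (rule Bochner_Integration.integral_diff) (intro integrable_mult_right ii intr c)+
      then show "(\<integral>h. 2 * fourier_term f c * indicator (K n) h - 2 * r c h \<partial>\<mu>) = 2 * fourier_term f c * measure \<mu> (K n)"
        by (simp add: im r0[OF c])
    qed
    finally have I: "(\<integral>h. ?F h \<partial>\<mu>) = 2 * (\<Sum>c\<in>A. fourier_term f c) * measure \<mu> (K n)"
      by (simp add: sum_distrib_left sum_distrib_right)
    have "(\<integral>h. ?F h \<partial>\<mu>) \<le> (\<integral>h. L * indicator (K n) h \<partial>\<mu>)"
    proof (rule integral_mono[OF intF integrable_mult_right[OF ii]])
      fix h assume "h \<in> space \<mu>"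
      show "?F h \<le> L * indicator (K n) h"
      proof (cases "h \<in> K n")
        case False
        then show ?thesis by (simp add: r_def)
      next
        case True
        then have hG: "h \<in> G" using K_subset_G by blast
        have "?F h = (\<Sum>c\<in>A. fourier_term (translate_diff f h) c)"
          using True by (intro sum.cong refl) (simp add: fourier_term_translate_diff[OF cA(1) hG f] r_def)
        also have "\<dots> \<le> (\<integral>x. (cmod (translate_diff f h x))\<^sup>2 \<partial>\<mu>)"
          using A by (intro Bessel_fourier square_integrable_translate_diff hG f) auto
        also have "\<dots> \<le> L" by (rule L[OF True])
        finally show ?thesis using True by simp
      qed
    qed
    then have "2 * (\<Sum>c\<in>A. fourier_term f c) * measure \<mu> (K n) \<le> L * measure \<mu> (K n)"
      unfolding I by (simp add: im)
    then show ?thesis using measure_K_pos[of n] by simp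
  qed
  have "infsum (fourier_term f) (unitary_dual G - dual_level n) \<le> L / 2"
    by (rule infsum_le_finite_sums[OF summable_fourier_term[OF f]], blast, rule fin)
  then show ?thesis by linarith
qed

text \<open>Parseval's identity enters through finite levels: a level m that captures the norm of
  the translate difference up to e is chosen, and after removing level n its sum is bounded by the
  tail of f. Only m depends on e.\<close>

lemma translate_diff_le_tail:
  assumes f: "sqint f" and h: "h \<in> K n"
  shows "(\<integral>x. (cmod (translate_diff f h x))\<^sup>2 \<partial>\<mu>) \<le> 4 * infsum (fourier_term f) (unitary_dual G - dual_level n)"
proof (rule field_le_epsilon)
  fix e :: real assume e: "e > 0"
  have hG: "h \<in> G" using h K_subset_G by blast
  obtain m where m: "(\<integral>x. (cmod (translate_diff f h x))\<^sup>2 \<partial>\<mu>) < (\<Sum>c\<in>dual_level m. fourier_term (translate_diff f h) c) + e"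
    by (rule Parseval_approx[OF square_integrable_translate_diff[OF hG f] e], rule that)
  have "(\<Sum>c\<in>dual_level m. fourier_term (translate_diff f h) c) = (\<Sum>c\<in>dual_level m - dual_level n. fourier_term (translate_diff f h) c)"
    by (rule sum.mono_neutral_right) (use finite_dual_level fourier_term_translate_diff_eq_0[OF _ h f] in auto)
  also have "\<dots> \<le> (\<Sum>c\<in>dual_level m - dual_level n. 4 * fourier_term f c)"
    by (intro sum_mono fourier_term_translate_diff_le hG f) (simp add: dual_level_def)
  also have "\<dots> = 4 * (\<Sum>c\<in>dual_level m - dual_level n. fourier_term f c)" by (simp add: sum_distrib_left)
  also have "\<dots> \<le> 4 * infsum (fourier_term f) (unitary_dual G - dual_level n)"
    by (intro mult_left_mono finite_sum_le_infsum summable_fourier_term f)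
      (auto simp: finite_dual_level fourier_term_nonneg, auto simp: dual_level_def)
  finally show "(\<integral>x. (cmod (translate_diff f h x))\<^sup>2 \<partial>\<mu>) \<le> 4 * infsum (fourier_term f) (unitary_dual G - dual_level n) + e"
    using m by linarith
qed

end

context padic_Lie_haar_group begin

section \<open>From congruence levels to the Lipschitz condition\<close>

lemma powr_level:
  assumes "b \<ge> 0"
  shows "((b / real CARD('l) ^ n) powr \<alpha>)\<^sup>2 = b powr (2 * \<alpha>) * real CARD('l) powr (- 2 * real n * \<alpha>)"
proof -
  let ?p = "real CARD('l)"
  have p: "?p > 0" using CARD_gt_1[where 'l='l] by simp
  have "((b / ?p ^ n) powr \<alpha>)\<^sup>2 = (b / ?p ^ n) powr (2 * \<alpha>)"
    by (simp only: power2_eq_square powr_add[symmetric] mult_2)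
  also have "\<dots> = (b * ?p powr (- real n)) powr (2 * \<alpha>)"
    using p by (simp add: powr_minus powr_realpow divide_inverse)
  also have "\<dots> = b powr (2 * \<alpha>) * ?p powr (- 2 * real n * \<alpha>)"
    using assms by (simp add: powr_mult powr_powr mult_ac)
  finally show ?thesis .
qed

lemma L2_norm_translate: "(L2_norm \<mu> (\<lambda>x. f (h ** x) - f x))\<^sup>2 = (\<integral>x. (cmod (translate_diff f h x))\<^sup>2 \<partial>\<mu>)"
  by (simp add: L2_norm_def translate_diff_def)

lemma eventually_near_one:
  "eventually P (inf (filtercomap (group_norm X) (nhds 0)) (principal G))
    \<longleftrightarrow> (\<exists>e>0. \<forall>h\<in>G. group_norm X h < e \<longrightarrow> P h)" (is "?L \<longleftrightarrow> ?R")
proof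
  assume ?L
  then obtain Q where Q: "eventually Q (nhds (0::real))" "\<And>h. Q (group_norm X h) \<Longrightarrow> h \<in> G \<Longrightarrow> P h"
    unfolding eventually_inf_principal eventually_filtercomap by blast
  then obtain e where "e > 0" "\<And>x. dist x 0 < e \<Longrightarrow> Q x" unfolding eventually_nhds_metric by blast
  then show ?R using Q(2) group_norm_nonneg by (intro exI[of _ e]) (simp add: dist_real_def)
next
  assume ?R
  then obtain e where e: "e > 0" "\<And>h. h \<in> G \<Longrightarrow> group_norm X h < e \<Longrightarrow> P h" by blast
  have "eventually (\<lambda>x::real. x < e) (nhds 0)" by (intro order_tendstoD(2)[OF filterlim_ident] e(1))
  then show ?L unfolding eventually_inf_principal eventually_filtercomap using e(2) by blast
qed

text \<open>An element of exact level n has group norm comparable with l^-n, by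
  \<open>group_norm_bounds\<close>. So the continuous parameter can be replaced by n, and a bound on
  all of \<open>K n\<close> loses only a constant.\<close>

lemma Lipschitz_space_iff:
  assumes f: "sqint f" and \<alpha>: "\<alpha> > 0"
  shows "f \<in> Lipschitz_space X G \<mu> \<alpha> \<longleftrightarrow> (\<exists>N C. \<forall>n\<ge>N. \<forall>h\<in>K n.
    (\<integral>x. (cmod (translate_diff f h x))\<^sup>2 \<partial>\<mu>) \<le> C * real CARD('l) powr (- 2 * real n * \<alpha>))"
    (is "_ \<longleftrightarrow> ?R")
proof
  let ?p = "real CARD('l)" and ?N = "\<lambda>h. L2_norm \<mu> (\<lambda>x. f (h ** x) - f x)"
  have p1: "?p > 1" using CARD_gt_1[where 'l='l] by simp
  obtain a b where ab: "a > 0" "b > 0"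
    "\<And>h. h \<in> G \<Longrightarrow> mat_norm (h - mat 1) \<le> a * group_norm X h"
    "\<And>h. h \<in> G \<Longrightarrow> group_norm X h \<le> b * mat_norm (h - mat 1)"
    by (rule group_norm_bounds, rule that)
  have N0: "?N h \<ge> 0" for h by (simp add: L2_norm_def)
  {
    assume "f \<in> Lipschitz_space X G \<mu> \<alpha>"
    then obtain C where C: "C > 0" "eventually (\<lambda>h. norm (?N h) \<le> C * norm (group_norm X h powr \<alpha>))
        (inf (filtercomap (group_norm X) (nhds 0)) (principal G))"
      unfolding Lipschitz_space_def by (auto elim!: landau_o.bigE)
    then obtain e where e: "e > 0" "\<And>h. h \<in> G \<Longrightarrow> group_norm X h < e \<Longrightarrow> ?N h \<le> C * group_norm X h powr \<alpha>"
      unfolding eventually_near_one using N0 by auto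
    obtain N where N: "b / e < ?p ^ N" using real_arch_pow[OF p1] by blast
    show ?R
    proof (intro exI[of _ N] exI[of _ "C\<^sup>2 * b powr (2 * \<alpha>)"] allI impI ballI)
      fix n h assume n: "n \<ge> N" and h: "h \<in> K n"
      then have hG: "h \<in> G" using K_subset_G by blast
      have g: "group_norm X h \<le> b / ?p ^ n"
      proof -
        have "mat_norm (h - mat 1) \<le> 1 / ?p ^ n" using h by (simp add: congruence_subgroup_def)
        then show ?thesis using ab(4)[OF hG] mult_left_mono[of "mat_norm (h - mat 1)" "1 / ?p ^ n" b] ab(2) by simp
      qed
      also have "\<dots> < e"
      proof -
        have "?p ^ N \<le> ?p ^ n" using p1 n by (intro power_increasing) auto
        then have "b / e < ?p ^ n" using N by linarith
        then show ?thesis using e(1) p1 by (simp add: field_simps)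
      qed
      finally have "?N h \<le> C * group_norm X h powr \<alpha>" by (rule e(2)[OF hG])
      also have "\<dots> \<le> C * (b / ?p ^ n) powr \<alpha>"
        using g C(1) \<alpha> group_norm_nonneg[OF hG] by (intro mult_left_mono powr_mono2) auto
      finally have "(?N h)\<^sup>2 \<le> (C * (b / ?p ^ n) powr \<alpha>)\<^sup>2" by (intro power_mono N0)
      then show "(\<integral>x. (cmod (translate_diff f h x))\<^sup>2 \<partial>\<mu>) \<le> C\<^sup>2 * b powr (2 * \<alpha>) * ?p powr (- 2 * real n * \<alpha>)"
        unfolding L2_norm_translate power_mult_distrib powr_level[OF less_imp_le[OF ab(2)]] by (simp only: mult.assoc)
    qed
  }
  {
    assume ?R
    then obtain N C where C: "\<And>n h. n \<ge> N \<Longrightarrow> h \<in> K n \<Longrightarrow>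
        (\<integral>x. (cmod (translate_diff f h x))\<^sup>2 \<partial>\<mu>) \<le> C * ?p powr (- 2 * real n * \<alpha>)" by blast
    \<comment> \<open>The square root undoes the square in the hypothesis, with an absolute value
      because the sign of C is not known; (a l)^\<alpha> comes from l^-n \<le> a l
      \<open>group_norm X h\<close>.\<close>
    let ?D = "sqrt \<bar>C\<bar> * (a * ?p) powr \<alpha>"
    have "eventually (\<lambda>h. norm (?N h) \<le> ?D * norm (group_norm X h powr \<alpha>))
        (inf (filtercomap (group_norm X) (nhds 0)) (principal G))"
      unfolding eventually_near_one
    proof (intro exI[of _ "1 / (a * ?p ^ N)"] conjI ballI impI)
      show "1 / (a * ?p ^ N) > 0" using ab(1) p1 by simp
      fix h assume hG: "h \<in> G" and small: "group_norm X h < 1 / (a * ?p ^ N)"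
      have "?N h \<le> ?D * group_norm X h powr \<alpha>"
      proof (cases "h = mat 1")
        \<comment> \<open>The neighbourhood filter includes h = 1, which lies in no shell; both
          sides are 0 there.\<close>
        case True
        then have "?N h = 0" by (simp add: L2_norm_def)
        then show ?thesis by simp
      next
        case False
        \<comment> \<open>The exact level: membership in \<open>K n\<close> gives the estimate, and
          failure at \<open>Suc n\<close> bounds the group norm from below.\<close>
        obtain n where n: "h \<in> K n" "h \<notin> K (Suc n)" by (rule ex_not_K[OF hG False])
        have "1 / ?p ^ Suc n < mat_norm (h - mat 1)" using n(2) hG by (simp add: congruence_subgroup_def)
        then have low: "1 / ?p ^ Suc n < a * group_norm X h" using ab(3)[OF hG] by linarith
        have "a * group_norm X h < 1 / ?p ^ N"
          using mult_strict_left_mono[OF small ab(1)] ab(1) by simp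
        then have "1 / ?p ^ Suc n < 1 / ?p ^ N" using low by linarith
        then have "?p ^ N < ?p ^ Suc n" using p1 by (simp add: divide_less_cancel field_simps)
        then have nN: "N \<le> n" using p1 by (simp only: power_strict_increasing_iff less_Suc_eq_le)
        have le: "1 / ?p ^ n \<le> a * ?p * group_norm X h"
          using low p1 by (simp add: field_simps)
        have "(?N h)\<^sup>2 \<le> C * ?p powr (- 2 * real n * \<alpha>)" unfolding L2_norm_translate by (rule C[OF nN n(1)])
        also have "\<dots> \<le> \<bar>C\<bar> * ((1 / ?p ^ n) powr \<alpha>)\<^sup>2"
          unfolding powr_level[OF zero_le_one] by (simp add: mult_right_mono)
        also have "\<dots> \<le> \<bar>C\<bar> * ((a * ?p * group_norm X h) powr \<alpha>)\<^sup>2"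
          using le \<alpha> by (intro mult_left_mono power_mono powr_mono2) auto
        also have "\<dots> = (?D * group_norm X h powr \<alpha>)\<^sup>2"
          using ab(1) group_norm_nonneg[OF hG] by (simp add: powr_mult power_mult_distrib mult_ac)
        finally show ?thesis by (rule power2_le_imp_le) simp
      qed
      then show "norm (?N h) \<le> ?D * norm (group_norm X h powr \<alpha>)" using N0 by simp
    qed
    then show "f \<in> Lipschitz_space X G \<mu> \<alpha>" unfolding Lipschitz_space_def using f by (auto intro: landau_o.bigI landau_o.big_mono bigoI)
  }
qed

section \<open>From congruence levels to eigenvalues\<close>

definition eigen_tail :: "nat \<Rightarrow> ('l padic ^'m ^'m \<Rightarrow> complex Matrix.mat) set set" where
  "eigen_tail k = {c \<in> unitary_dual G. rep_eigenvalue X G \<mu> (class_rep c) > real CARD('l) ^ k}"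

text \<open>The two eigenvalue bounds differ from l^j by constant factors. A power l^s that exceeds
  \<beta> and 1 / \<gamma> absorbs them and becomes a shift of the level by s.\<close>

lemma eigen_tail_subsets:
  obtains s where "\<And>k. eigen_tail (k + s) \<subseteq> unitary_dual G - dual_level k"
    "\<And>k. unitary_dual G - dual_level (k + s) \<subseteq> eigen_tail k"
proof -
  let ?p = "real CARD('l)"
  have p1: "?p > 1" using CARD_gt_1[where 'l='l] by simp
  obtain \<beta> where \<beta>: "\<beta> > 0" "\<And>\<xi> j. \<xi> \<in> irreps G \<Longrightarrow> trivial_on j \<xi> \<Longrightarrow> rep_eigenvalue X G \<mu> \<xi> \<le> \<beta> * ?p ^ j"
    by (rule rep_eigenvalue_upper, rule that)
  obtain \<gamma> where \<gamma>: "\<gamma> > 0" "\<And>\<xi> j. \<xi> \<in> irreps G \<Longrightarrow> \<not> trivial_on j \<xi> \<Longrightarrow> \<gamma> * ?p ^ j \<le> rep_eigenvalue X G \<mu> \<xi>"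
    by (rule rep_eigenvalue_lower, rule that)
  obtain s where s: "max \<beta> (1 / \<gamma>) < ?p ^ s" using real_arch_pow[OF p1] by blast
  show ?thesis
  proof (rule that)
    fix k
    show "eigen_tail (k + s) \<subseteq> unitary_dual G - dual_level k"
    proof (intro subsetI DiffI notI)
      fix c assume c: "c \<in> eigen_tail (k + s)"
      then show "c \<in> unitary_dual G" by (simp add: eigen_tail_def)
      assume "c \<in> dual_level k"
      then have "rep_eigenvalue X G \<mu> (class_rep c) \<le> \<beta> * ?p ^ k"
        by (intro \<beta>(2) class_rep_irreps) (auto simp: dual_level_def)
      also have "\<dots> \<le> ?p ^ s * ?p ^ k" using s p1 by (intro mult_right_mono) auto
      finally show False using c by (simp add: eigen_tail_def power_add mult.commute)
    qed
    show "unitary_dual G - dual_level (k + s) \<subseteq> eigen_tail k"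
    proof
      fix c assume c: "c \<in> unitary_dual G - dual_level (k + s)"
      have "1 < \<gamma> * ?p ^ s" using s \<gamma>(1) by (simp add: field_simps)
      then have "1 * ?p ^ k < (\<gamma> * ?p ^ s) * ?p ^ k" using p1 by (intro mult_strict_right_mono) auto
      also have "\<dots> = \<gamma> * ?p ^ (k + s)" by (simp add: power_add mult_ac)
      also have "\<dots> \<le> rep_eigenvalue X G \<mu> (class_rep c)"
        using c by (intro \<gamma>(2) class_rep_irreps) (auto simp: dual_level_def)
      finally show "c \<in> eigen_tail k" using c by (simp add: eigen_tail_def)
    qed
  qed
qed

text \<open>The inclusions of \<open>eigen_tail_subsets\<close> compare the two kinds of tails,
  whose terms are nonnegative. Shifting k by s changes l^(-2 k \<alpha>) only by the constant factor
  l^(2 s \<alpha>).\<close>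

theorem Lipschitz_space_iff_tail:
  assumes f: "sqint f" and \<alpha>: "\<alpha> > 0"
  shows "f \<in> Lipschitz_space X G \<mu> \<alpha> \<longleftrightarrow>
    (\<lambda>k. infsum (fourier_term f) (eigen_tail k)) \<in> O(\<lambda>k. real CARD('l) powr (- 2 * real k * \<alpha>))"
proof -
  let ?p = "real CARD('l)" and ?T = "\<lambda>k. infsum (fourier_term f) (eigen_tail k)"
    and ?t = "\<lambda>n. infsum (fourier_term f) (unitary_dual G - dual_level n)"
  obtain s where s: "\<And>k. eigen_tail (k + s) \<subseteq> unitary_dual G - dual_level k"
    "\<And>k. unitary_dual G - dual_level (k + s) \<subseteq> eigen_tail k"
    by (rule eigen_tail_subsets, rule that)
  have sub: "eigen_tail k \<subseteq> unitary_dual G" for k by (auto simp: eigen_tail_def)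
  have T1: "?T (k + s) \<le> ?t k" for k
    by (rule infsum_mono2[OF summable_fourier_term[OF f sub] summable_fourier_term[OF f Diff_subset] s(1)])
      (rule fourier_term_nonneg)
  have T2: "?t (k + s) \<le> ?T k" for k
    by (rule infsum_mono2[OF summable_fourier_term[OF f Diff_subset] summable_fourier_term[OF f sub] s(2)])
      (rule fourier_term_nonneg)
  have T0: "?T k \<ge> 0" for k by (rule infsum_nonneg) (rule fourier_term_nonneg)
  have shift: "?p powr (- 2 * real k * \<alpha>) = ?p powr (2 * real s * \<alpha>) * ?p powr (- 2 * real (k + s) * \<alpha>)" for k
    unfolding powr_add[symmetric] by (simp add: algebra_simps)
  show ?thesis
    unfolding Lipschitz_space_iff[OF assms]
  proof
    assume "\<exists>N C. \<forall>n\<ge>N. \<forall>h\<in>K n. (\<integral>x. (cmod (translate_diff f h x))\<^sup>2 \<partial>\<mu>) \<le> C * ?p powr (- 2 * real n * \<alpha>)"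
    then obtain N C where C: "\<And>n h. n \<ge> N \<Longrightarrow> h \<in> K n \<Longrightarrow>
        (\<integral>x. (cmod (translate_diff f h x))\<^sup>2 \<partial>\<mu>) \<le> C * ?p powr (- 2 * real n * \<alpha>)" by blast
    have bound: "?T k \<le> (C / 2 * ?p powr (2 * real s * \<alpha>)) * ?p powr (- 2 * real k * \<alpha>)" if k: "k \<ge> N + s" for k
    proof -
      \<comment> \<open>The eigenvalue tail at k is compared with the congruence tail at k - s, so
        the bound is available only from N + s on.\<close>
      define n where "n = k - s"
      have kn: "k = n + s" and nN: "n \<ge> N" using k by (auto simp: n_def)
      have "2 * ?t n \<le> C * ?p powr (- 2 * real n * \<alpha>)" by (rule tail_le_translate_diff[OF f C[OF nN]])
      then have "2 * ?T k \<le> C * (?p powr (2 * real s * \<alpha>) * ?p powr (- 2 * real k * \<alpha>))"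
        using T1[of n] unfolding kn unfolding shift[of n] by linarith
      then show ?thesis by simp
    qed
    show "?T \<in> O(\<lambda>k. ?p powr (- 2 * real k * \<alpha>))"
      by (rule bigoI[where c="C / 2 * ?p powr (2 * real s * \<alpha>)"], rule eventually_sequentiallyI[of "N + s"])
        (use bound T0 in simp)
  next
    assume "?T \<in> O(\<lambda>k. ?p powr (- 2 * real k * \<alpha>))"
    then obtain C where C: "eventually (\<lambda>k. norm (?T k) \<le> C * norm (?p powr (- 2 * real k * \<alpha>))) sequentially"
      by (rule landau_o.bigE)
    then obtain N where N: "\<And>k. k \<ge> N \<Longrightarrow> ?T k \<le> C * ?p powr (- 2 * real k * \<alpha>)"
      unfolding eventually_sequentially using T0 by auto
    show "\<exists>N C. \<forall>n\<ge>N. \<forall>h\<in>K n. (\<integral>x. (cmod (translate_diff f h x))\<^sup>2 \<partial>\<mu>) \<le> C * ?p powr (- 2 * real n * \<alpha>)"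
    proof (intro exI[of _ "N + s"] exI[of _ "4 * C * ?p powr (2 * real s * \<alpha>)"] allI impI ballI)
      fix n h assume n: "n \<ge> N + s" and h: "h \<in> K n"
      define k where "k = n - s"
      have nk: "n = k + s" and kN: "k \<ge> N" using n by (auto simp: k_def)
      have "(\<integral>x. (cmod (translate_diff f h x))\<^sup>2 \<partial>\<mu>) \<le> 4 * ?t n" by (rule translate_diff_le_tail[OF f h])
      also have "\<dots> \<le> 4 * (C * (?p powr (2 * real s * \<alpha>) * ?p powr (- 2 * real n * \<alpha>)))"
        using T2[of k] N[OF kN] unfolding nk unfolding shift[of k] by linarith
      finally show "(\<integral>x. (cmod (translate_diff f h x))\<^sup>2 \<partial>\<mu>) \<le> 4 * C * ?p powr (2 * real s * \<alpha>) * ?p powr (- 2 * real n * \<alpha>)"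
        by (simp only: mult.assoc)
    qed
  qed
qed

end

theorem theorem1p10:
  fixes X :: "'d::finite \<Rightarrow> 'l::prime_card padic ^'m::finite ^'m"
    and G :: "('l padic ^'m ^'m) set"
    and \<mu> :: "('l padic ^'m ^'m) measure"
    and f :: "'l padic ^'m ^'m \<Rightarrow> complex"
    and \<alpha> :: real
  assumes "compact_nilpotent_padic_Lie_group X G"
    and "normalized_Haar_measure G \<mu>"
    and "0 < \<alpha>" and "\<alpha> \<le> 1"
    and "square_integrable \<mu> f"
  shows "f \<in> Lipschitz_space X G \<mu> \<alpha> \<longleftrightarrow>
    (\<lambda>k::nat. \<Sum>\<^sub>\<infinity>c\<in>{c \<in> unitary_dual G. rep_eigenvalue X G \<mu> (class_rep c) > real CARD('l) ^ k}.
       real (rep_dim (class_rep c)) * (HS_norm (fourier_coeff \<mu> f (class_rep c)))\<^sup>2)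
    \<in> O(\<lambda>k. real CARD('l) powr (- 2 * real k * \<alpha>))"
proof -
  interpret compact_nilpotent_padic_Lie_group X G by fact
  interpret padic_Lie_haar_group X G \<mu>
    by unfold_locales (use assms(2) compact in auto)
  show ?thesis
    using Lipschitz_space_iff_tail[OF assms(5,3)] unfolding eigen_tail_def fourier_term_def .
qed

end
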